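(* Let $K$ be an algebraically closed field of characteristic $2$, let $G=\mathrm{SL}_2$ be regarded as an algebraic group over $K$, and let $V$ be the $2$-dimensional natural representation of $G$. Let $\delta=\frac32-\frac{\log 3}{2\log 2}$. Then $b_{2k}^{G,V}=b_{2k-1}^{G,V}$ for all integers $k\ge 1$, and there exists a smooth function $\omega\colon(0,\infty)\to(0,\infty)$ such that $x\mapsto\omega(4^x)$ is periodic with period $1$ on $\mathbb{R}$ and $$b_{2k}^{G,V}=b_{2k-1}^{G,V}\sim \omega(k)\,k^{-\delta}\,4^k\qquad (k\to\infty),$$ i.e. the ratio of the two sides tends to $1$ as the integer $k$ tends to infinity.
   Context: For a finite-dimensional algebraic representation $W$ of $G$ and an integer $k\ge 0$, $b_k^{G,W}$ denotes the number of indecomposable direct summands, counted with multiplicity, in a decomposition of the $G$-representation $W^{\otimes k}$ as a direct sum of indecomposable representations (well defined by Krull--Schmidt). *)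

theory Defs
  imports "HOL-Analysis.Analysis" "HOL-Library.Function_Algebras" "HOL-Library.FuncSet"
begin

section \<open>Algebraic representations of matrix groups\<close>

text \<open>
  All representation spaces are finite-dimensional subspaces of a space of functions
  \<^typ>\<open>'b \<Rightarrow> 'a\<close> over the field \<^typ>\<open>'a\<close>, with pointwise operations.
\<close>

definition fscale :: "'a::field \<Rightarrow> ('b \<Rightarrow> 'a) \<Rightarrow> ('b \<Rightarrow> 'a)" where
  "fscale c f = (\<lambda>x. c * f x)"

global_interpretation fvs: vector_space "fscale :: 'a::field \<Rightarrow> ('b \<Rightarrow> 'a) \<Rightarrow> ('b \<Rightarrow> 'a)"
  by unfold_locales (auto simp: fscale_def algebra_simps fun_eq_iff)

text \<open>
  The elements of \<open>K[x\<^sub>i\<^sub>j, 1/det]\<close> as functions on matrices.  Over an algebraically closed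
  field, an affine algebraic group is identified with its group of points, a Zariski closed
  group \<^term>\<open>G\<close> of invertible matrices; its coordinate ring consists of the restrictions
  of these functions to \<^term>\<open>G\<close>.
\<close>

inductive_set gl_regular :: "('a::field ^ 'm ^ 'm \<Rightarrow> 'a) set" where
  const: "(\<lambda>A. c) \<in> gl_regular"
| entry: "(\<lambda>A. A $ i $ j) \<in> gl_regular"
| inv_det: "(\<lambda>A. inverse (det A)) \<in> gl_regular"
| add: "p \<in> gl_regular \<Longrightarrow> q \<in> gl_regular \<Longrightarrow> (\<lambda>A. p A + q A) \<in> gl_regular"
| mult: "p \<in> gl_regular \<Longrightarrow> q \<in> gl_regular \<Longrightarrow> (\<lambda>A. p A * q A) \<in> gl_regular"

definition regular_on :: "('a::field ^ 'm ^ 'm) set \<Rightarrow> ('a ^ 'm ^ 'm \<Rightarrow> 'a) \<Rightarrow> bool" where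
  "regular_on G f \<longleftrightarrow> (\<exists>p\<in>gl_regular. \<forall>A\<in>G. f A = p A)"

text \<open>
  \<^term>\<open>U\<close> is a finite-dimensional vector space on which \<^term>\<open>G\<close> acts linearly through
  \<^term>\<open>act\<close>, and all matrix coefficients of the action are regular functions on \<^term>\<open>G\<close>.
  (Every linear functional on \<^term>\<open>U\<close> is the restriction of one on the ambient space.)
\<close>

definition algebraic_representation ::
  "('a::field ^ 'm ^ 'm) set \<Rightarrow> ('a ^ 'm ^ 'm \<Rightarrow> ('b \<Rightarrow> 'a) \<Rightarrow> ('b \<Rightarrow> 'a)) \<Rightarrow> ('b \<Rightarrow> 'a) set \<Rightarrow> bool"
where
  "algebraic_representation G act U \<longleftrightarrow>
     fvs.subspace U \<and> (\<exists>B. finite B \<and> U = fvs.span B) \<and>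
     (\<forall>A\<in>G. \<forall>u\<in>U. act A u \<in> U) \<and>
     (\<forall>A\<in>G. \<forall>u\<in>U. \<forall>v\<in>U. act A (u + v) = act A u + act A v) \<and>
     (\<forall>A\<in>G. \<forall>c. \<forall>u\<in>U. act A (fscale c u) = fscale c (act A u)) \<and>
     (\<forall>u\<in>U. act (mat 1) u = u) \<and>
     (\<forall>A\<in>G. \<forall>B\<in>G. \<forall>u\<in>U. act (A ** B) u = act A (act B u)) \<and>
     (\<forall>u\<in>U. \<forall>\<phi>. Vector_Spaces.linear fscale (*) \<phi> \<longrightarrow> regular_on G (\<lambda>A. \<phi> (act A u)))"

text \<open>\<^term>\<open>U\<close> is the internal direct sum of \<open>S 0, \<dots>, S (n - 1)\<close>: the summation map from
  the external direct sum to \<^term>\<open>U\<close> is bijective.\<close>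

definition direct_sum :: "('b \<Rightarrow> 'a::field) set \<Rightarrow> nat \<Rightarrow> (nat \<Rightarrow> ('b \<Rightarrow> 'a) set) \<Rightarrow> bool" where
  "direct_sum U n S \<longleftrightarrow> bij_betw (\<lambda>x. \<Sum>i<n. x i) (\<Pi>\<^sub>E i\<in>{..<n}. S i) U"

definition indecomposable ::
  "('a::field ^ 'm ^ 'm) set \<Rightarrow> ('a ^ 'm ^ 'm \<Rightarrow> ('b \<Rightarrow> 'a) \<Rightarrow> ('b \<Rightarrow> 'a)) \<Rightarrow> ('b \<Rightarrow> 'a) set \<Rightarrow> bool"
where
  "indecomposable G act U \<longleftrightarrow>
     algebraic_representation G act U \<and> U \<noteq> {0} \<and>
     \<not> (\<exists>S. direct_sum U 2 S \<and> (\<forall>i<2. algebraic_representation G act (S i) \<and> S i \<noteq> {0}))"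

text \<open>The number is unique, and the description proper, by the Krull--Schmidt theorem.\<close>

definition num_indecomposable_summands ::
  "('a::field ^ 'm ^ 'm) set \<Rightarrow> ('a ^ 'm ^ 'm \<Rightarrow> ('b \<Rightarrow> 'a) \<Rightarrow> ('b \<Rightarrow> 'a)) \<Rightarrow> ('b \<Rightarrow> 'a) set \<Rightarrow> nat"
where
  "num_indecomposable_summands G act U =
     (THE n. \<exists>S. direct_sum U n S \<and> (\<forall>i<n. indecomposable G act (S i)))"


section \<open>Tensor powers\<close>

text \<open>
  The \<open>k\<close>-th tensor power of \<open>K\<^sup>n\<close> has as basis the tensors
  \<open>e\<^bsub>w\<^esub>\<close>, the products of the \<^term>\<open>k\<close> standard basis vectors listed by a
  word \<^term>\<open>w\<close> of length \<^term>\<open>k\<close>. A tensor is represented by its coefficient function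
  on words, extended by 0 to words of other lengths.
\<close>

definition tensor_power :: "nat \<Rightarrow> ('n list \<Rightarrow> 'a::field) set" where
  "tensor_power k = {t. \<forall>w. length w \<noteq> k \<longrightarrow> t w = 0}"

definition tensor_act :: "nat \<Rightarrow> 'a::field ^ 'n ^ 'n \<Rightarrow> ('n list \<Rightarrow> 'a) \<Rightarrow> ('n list \<Rightarrow> 'a)" where
  "tensor_act k A t = (\<lambda>w. if length w = k
     then \<Sum>v | length v = k. (\<Prod>i<k. A $ (w ! i) $ (v ! i)) * t v else 0)"

definition pure_tensor :: "nat \<Rightarrow> (nat \<Rightarrow> 'a::field ^ 'n) \<Rightarrow> ('n list \<Rightarrow> 'a)" where
  "pure_tensor k x = (\<lambda>w. if length w = k then \<Prod>i<k. x i $ (w ! i) else 0)"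

lemma prod_sum_words:
  fixes f :: "nat \<Rightarrow> 'n::finite \<Rightarrow> 'a::field"
  shows "(\<Prod>i<k. \<Sum>j\<in>UNIV. f i j) = (\<Sum>v | length v = k. \<Prod>i<k. f i (v ! i))"
proof (induction k arbitrary: f)
  case 0
  have "{v::'n list. v = []} = {[]}" by auto
  then show ?case by simp
next
  case (Suc k)
  have eq: "{v::'n list. length v = Suc k} = (\<lambda>(j, v). j # v) ` (UNIV \<times> {v. length v = k})"
    by (auto simp: image_iff length_Suc_conv)
  have inj: "inj_on (\<lambda>(j, v). j # v) (UNIV \<times> {v::'n list. length v = k})"
    by (auto simp: inj_on_def)
  have "(\<Sum>v | length v = Suc k. \<Prod>i<Suc k. f i (v ! i)) =
      (\<Sum>(j, v)\<in>UNIV \<times> {v. length v = k}. f 0 j * (\<Prod>i<k. f (Suc i) (v ! i)))"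
    unfolding eq
    by (subst sum.reindex[OF inj]) (auto simp: prod.lessThan_Suc_shift intro!: sum.cong simp del: prod.lessThan_Suc)
  also have "\<dots> = (\<Sum>j\<in>UNIV. f 0 j) * (\<Sum>v | length v = k. \<Prod>i<k. f (Suc i) (v ! i))"
    by (simp add: sum_product sum.cartesian_product)
  also have "\<dots> = (\<Prod>i<Suc k. \<Sum>j\<in>UNIV. f i j)"
    by (simp only: Suc.IH[of "\<lambda>i. f (Suc i)"] prod.lessThan_Suc_shift o_def)
  finally show ?case by simp
qed

text \<open>The action is the diagonal one.\<close>

lemma tensor_act_pure_tensor:
  fixes A :: "'a::field ^ 'n ^ 'n"
  shows "tensor_act k A (pure_tensor k x) = pure_tensor k (\<lambda>i. A *v x i)"
proof
  fix w :: "'n list"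
  have "(\<Sum>v | length v = k. (\<Prod>i<k. A $ (w ! i) $ (v ! i)) * pure_tensor k x v) =
        (\<Sum>v | length v = k. \<Prod>i<k. A $ (w ! i) $ (v ! i) * x i $ (v ! i))"
    by (intro sum.cong) (auto simp: pure_tensor_def prod.distrib)
  also have "\<dots> = (\<Prod>i<k. (A *v x i) $ (w ! i))"
    by (simp only: prod_sum_words[of "\<lambda>i j. A $ (w ! i) $ j * x i $ j", symmetric]
          matrix_vector_mult_def vec_lambda_beta)
  finally show "tensor_act k A (pure_tensor k x) w = pure_tensor k (\<lambda>i. A *v x i) w"
    by (simp add: tensor_act_def pure_tensor_def)
qed

text \<open>
  The number \<open>b\<^sub>k\<close> attached to the representation of \<^term>\<open>G\<close> on \<open>K\<^sup>n\<close> given by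
  \<^term>\<open>\<rho>\<close>.
\<close>

definition tensor_summands ::
  "('a::field ^ 'm ^ 'm) set \<Rightarrow> ('a ^ 'm ^ 'm \<Rightarrow> 'a ^ 'n ^ 'n) \<Rightarrow> nat \<Rightarrow> nat" where
  "tensor_summands G \<rho> k = num_indecomposable_summands G (\<lambda>A. tensor_act k (\<rho> A)) (tensor_power k)"

definition SL2 :: "('a::field ^ 2 ^ 2) set" where
  "SL2 = {A. det A = 1}"

definition natural_rep :: "'a::field ^ 2 ^ 2 \<Rightarrow> 'a ^ 2 ^ 2" where
  "natural_rep A = A"

lemma sum_tensor_apply: "(\<Sum>x\<in>X. f x) w = (\<Sum>x\<in>X. f x w)" for f :: "'c \<Rightarrow> 'b \<Rightarrow> 'a::field"
  by (induction X rule: infinite_finite_induct) auto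

definition word_tensor :: "'n list \<Rightarrow> ('n list \<Rightarrow> 'a::field)" where
  "word_tensor w = (\<lambda>v. if v = w then 1 else 0)"

lemma finite_words: "finite {v::'n::finite list. length v = k}"
  using finite_lists_length_eq[of "UNIV::'n set" k] by simp

lemma tensor_power_expand:
  fixes t :: "'n::finite list \<Rightarrow> 'a::field"
  assumes "t \<in> tensor_power k"
  shows "t = (\<Sum>w | length w = k. fscale (t w) (word_tensor w))"
proof
  fix v :: "'n list"
  show "t v = (\<Sum>w | length w = k. fscale (t w) (word_tensor w)) v"
    using assms finite_words[where 'n='n and k=k]
    by (auto simp: sum_tensor_apply fscale_def word_tensor_def tensor_power_def if_distrib sum.delta cong: if_cong)
qed

lemma tensor_power_span:
  "tensor_power k = fvs.span (word_tensor ` {w::'n::finite list. length w = k} :: ('n list \<Rightarrow> 'a::field) set)"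
    (is "?T = fvs.span ?B")
proof
  have sub: "fvs.subspace ?T"
    by (auto simp: fvs.subspace_def tensor_power_def fscale_def)
  have "?B \<subseteq> ?T" by (auto simp: word_tensor_def tensor_power_def)
  then show "fvs.span ?B \<subseteq> ?T" by (rule fvs.span_minimal[OF _ sub])
  show "?T \<subseteq> fvs.span ?B"
  proof
    fix t :: "'n list \<Rightarrow> 'a" assume "t \<in> ?T"
    then show "t \<in> fvs.span ?B"
      by (subst tensor_power_expand) (auto intro!: fvs.span_sum fvs.span_scale intro: fvs.span_base)
  qed
qed

lemma tensor_act_mult:
  fixes A B :: "'a::field ^ 'n ^ 'n"
  shows "tensor_act k (A ** B) t = tensor_act k A (tensor_act k B t)"
proof
  fix w :: "'n list"
  let ?W = "{v::'n list. length v = k}"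
  have "(\<Sum>u\<in>?W. (\<Prod>i<k. (A ** B) $ (w ! i) $ (u ! i)) * t u) =
        (\<Sum>u\<in>?W. (\<Sum>v\<in>?W. \<Prod>i<k. A $ (w ! i) $ (v ! i) * B $ (v ! i) $ (u ! i)) * t u)"
    by (simp only: matrix_matrix_mult_def vec_lambda_beta
          prod_sum_words[of "\<lambda>i j. A $ (w ! i) $ j * B $ j $ (_ ! i)"])
  also have "\<dots> = (\<Sum>u\<in>?W. \<Sum>v\<in>?W. (\<Prod>i<k. A $ (w ! i) $ (v ! i)) * ((\<Prod>i<k. B $ (v ! i) $ (u ! i)) * t u))"
    by (simp add: prod.distrib sum_distrib_right mult.assoc)
  also have "\<dots> = (\<Sum>v\<in>?W. (\<Prod>i<k. A $ (w ! i) $ (v ! i)) * (\<Sum>u\<in>?W. (\<Prod>i<k. B $ (v ! i) $ (u ! i)) * t u))"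
    by (subst sum.swap) (simp add: sum_distrib_left)
  also have "\<dots> = (\<Sum>v\<in>?W. (\<Prod>i<k. A $ (w ! i) $ (v ! i)) * tensor_act k B t v)"
    by (intro sum.cong) (auto simp: tensor_act_def)
  finally show "tensor_act k (A ** B) t w = tensor_act k A (tensor_act k B t) w"
    by (simp add: tensor_act_def[of k "A ** B"] tensor_act_def[of k A])
qed

lemma gl_regular_sum: "finite X \<Longrightarrow> (\<And>x. x \<in> X \<Longrightarrow> f x \<in> gl_regular) \<Longrightarrow> (\<lambda>A. \<Sum>x\<in>X. f x A) \<in> gl_regular"
  by (induction X rule: finite_induct) (auto intro: gl_regular.intros)

lemma gl_regular_prod: "finite X \<Longrightarrow> (\<And>x. x \<in> X \<Longrightarrow> f x \<in> gl_regular) \<Longrightarrow> (\<lambda>A. \<Prod>x\<in>X. f x A) \<in> gl_regular"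
  by (induction X rule: finite_induct) (auto intro: gl_regular.intros)

lemma algebraic_representation_tensor_power:
  "algebraic_representation G (tensor_act k) (tensor_power k :: ('n::finite list \<Rightarrow> 'a::field) set)"
proof -
  let ?T = "tensor_power k :: ('n list \<Rightarrow> 'a) set"
  let ?W = "{v::'n list. length v = k}"
  have closed: "tensor_act k A u \<in> ?T" for A u
    by (auto simp: tensor_act_def tensor_power_def)
  have one: "tensor_act k (mat 1) u = u" if "u \<in> ?T" for u
  proof
    fix w :: "'n list"
    show "tensor_act k (mat 1) u w = u w"
    proof (cases "length w = k")
      case True
      have "(\<Prod>i<k. mat 1 $ (w ! i) $ (v ! i)) = (if v = w then 1 else 0 :: 'a)" if len: "length v = k" for v
      proof (cases "v = w")
        case False
        then obtain i where "i < k" "w ! i \<noteq> v ! i"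
          using len True by (metis nth_equalityI)
        then have "(\<Prod>i<k. mat 1 $ (w ! i) $ (v ! i)) = (0 :: 'a)"
          by (intro prod_zero) (auto simp: mat_def)
        with False show ?thesis by simp
      qed (simp add: mat_def)
      then have "(\<Sum>v\<in>?W. (\<Prod>i<k. mat 1 $ (w ! i) $ (v ! i)) * u v) = (\<Sum>v\<in>?W. if v = w then u v else 0)"
        by (intro sum.cong) auto
      then show ?thesis using True finite_words[where 'n='n and k=k]
        by (simp add: tensor_act_def)
    next
      case False
      then show ?thesis using that by (simp add: tensor_act_def tensor_power_def)
    qed
  qed
  have reg: "regular_on G (\<lambda>A. \<phi> (tensor_act k A u))"
    if phi: "Vector_Spaces.linear fscale (*) \<phi>" for \<phi> :: "('n list \<Rightarrow> 'a) \<Rightarrow> 'a" and u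
  proof -
    interpret phi: Vector_Spaces.linear "fscale :: 'a \<Rightarrow> ('n list \<Rightarrow> 'a) \<Rightarrow> _" "(*)" \<phi> by (fact phi)
    have eq: "\<phi> (tensor_act k A u) = (\<Sum>w\<in>?W. (\<Sum>v\<in>?W. (\<Prod>i<k. A $ (w ! i) $ (v ! i)) * u v) * \<phi> (word_tensor w))" for A
      by (subst tensor_power_expand[OF closed]) (simp add: phi.sum phi.scale tensor_act_def)
    show ?thesis unfolding regular_on_def eq
      by (intro bexI[of _ "\<lambda>A. \<Sum>w\<in>?W. (\<Sum>v\<in>?W. (\<Prod>i<k. A $ (w ! i) $ (v ! i)) * u v) * \<phi> (word_tensor w)"])
        (auto intro!: gl_regular_sum gl_regular_prod gl_regular.mult gl_regular.const gl_regular.entry finite_words)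
  qed
  have add: "tensor_act k A (u + v) = tensor_act k A u + tensor_act k A v" for A and u v :: "'n list \<Rightarrow> 'a"
    by (auto simp: tensor_act_def fun_eq_iff algebra_simps sum.distrib)
  have scale: "tensor_act k A (fscale c u) = fscale c (tensor_act k A u)" for A c and u :: "'n list \<Rightarrow> 'a"
    by (auto simp: tensor_act_def fscale_def fun_eq_iff algebra_simps sum_distrib_left)
  have sub: "fvs.subspace ?T"
    by (auto simp: fvs.subspace_def tensor_power_def fscale_def)
  have fin: "\<exists>B. finite B \<and> ?T = fvs.span B"
    using tensor_power_span finite_imageI[OF finite_words] by metis
  show ?thesis
    unfolding algebraic_representation_def
    using closed one reg add scale sub fin tensor_act_mult by blast
qed

section \<open>The asymptotic statement\<close>

text \<open>Infinitely differentiable; only meaningful for open \<^term>\<open>X\<close>, on which iterated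
  derivatives depend only on the values of the function on \<^term>\<open>X\<close>.\<close>

definition smooth_on :: "real set \<Rightarrow> (real \<Rightarrow> real) \<Rightarrow> bool" where
  "smooth_on X f \<longleftrightarrow> (\<forall>n. \<forall>x\<in>X. (deriv ^^ n) f differentiable at x)"

definition delta_exponent :: real where
  "delta_exponent = 3 / 2 - ln 3 / (2 * ln 2)"

end

theory Submission
  imports Defs "HOL-Complex_Analysis.Complex_Analysis"
begin

text \<open>
  Let \<open>V\<^sup>F\<close> be the Frobenius twist of \<open>V\<close> and \<open>T\<close> the trivial representation. In characteristic 2,
  \<open>V \<otimes> V \<otimes> V\<close> is isomorphic to \<open>V \<otimes> (V\<^sup>F \<oplus> T \<oplus> T)\<close>, so \<open>V\<close> to the power \<open>2 n + 1\<close> is the sum over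
  \<open>j\<close> of \<open>(n choose j) 2\<^bsup>n - j\<^esup>\<close> copies of \<open>V \<otimes> (V\<^sup>F)\<^bsup>\<otimes>j\<^esup>\<close>. If \<open>S\<close> is an indecomposable
  summand of \<open>(V\<^sup>F)\<^bsup>\<otimes>j\<^esup>\<close>, then \<open>V \<otimes> S\<close> and \<open>V \<otimes> V \<otimes> S\<close> are indecomposable: an endomorphism commutes with
  the infinitesimal actions of the two root subgroups, which are trivial on \<open>S\<close>. Since twisting
  does not change the number of summands, \<open>b(2 n + 1) = b(2 n + 2)\<close> is the sum over \<open>j\<close> of
  \<open>(n choose j) 2\<^bsup>n - j\<^esup> b(j)\<close>.

  Iterating this recursion writes \<open>b(2 n + 1) / 4\<^sup>n\<close> as a sum of layers, each obtained from the previous one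
  by applying the same kernel. The kernel maps \<open>m \<mapsto> cos\<^bsup>2 m\<^esup>(x / 2)\<close> to a combination of the
  \<open>n\<close>-th powers of \<open>cos\<^sup>2(x / 4)\<close>, \<open>sin\<^sup>2(x / 4)\<close> and \<open>1 / 2\<close>, which makes layer \<open>r\<close> an explicit
  alternating trigonometric sum. After multiplication by \<open>(8 / 3)\<^sup>r\<close> it converges to a fixed profile
  \<open>h\<close> evaluated at \<open>n / 4\<^sup>r\<close>, and
  \<open>\<omega>(x) x\<^bsup>-\<delta>\<^esup>\<close> is one quarter of the sum of \<open>(3 / 8)\<^sup>i h(x / 4\<^sup>i)\<close> over all integers \<open>i\<close>.
  Smoothness holds because \<open>h\<close> extends holomorphically to the sector \<open>\<bar>Im z\<bar> < Re z\<close>, with bounds at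
  \<open>0\<close> and \<open>\<infinity>\<close> that make the sum converge locally uniformly there.
\<close>

section \<open>Krull--Schmidt for linear actions\<close>

text \<open>As a module for the first Frobenius kernel, V is the Steinberg module: simple and
  projective; V tensor V is the projective cover of the trivial module. Hence one or two copies of V
  keep a twisted indecomposable indecomposable, while a third copy splits. Origin of the exponent:
  after division by 4^n the binomial weights centre j at n/2, hence m at n/4 for j = 2m + 1 or 2m +
  2, and the kernel has total mass tending to 3/8. So b(2n + 1) / 4^n shrinks by about 3/8 when n
  grows fourfold, and 4^delta = 8/3. Iterating this heuristic accumulates errors; the exact formula
  for each layer permits termwise limits under a summable majorant instead. The obstacle to
  smoothness is h near 0. On the real axis h is at most 1, but holomorphy of the sum needs a bound
  |z|^-s in a sector with s below log_4(8/3) = 0.707..., and absolute values of the series only give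
  3/2. Two summations by parts exploit the alternating signs and allow every s > 1/2; s = 2/3 is
  used.\<close>

definition lin_on :: "('b \<Rightarrow> 'a::field) set \<Rightarrow> (('b \<Rightarrow> 'a) \<Rightarrow> ('c \<Rightarrow> 'a)) \<Rightarrow> bool" where
  "lin_on S f \<longleftrightarrow> (\<forall>x\<in>S. \<forall>y\<in>S. f (x + y) = f x + f y) \<and> (\<forall>c. \<forall>x\<in>S. f (fscale c x) = fscale c (f x))"

definition lin_act :: "'g set \<Rightarrow> ('g \<Rightarrow> ('b \<Rightarrow> 'a::field) \<Rightarrow> ('b \<Rightarrow> 'a)) \<Rightarrow> bool" where
  "lin_act G act \<longleftrightarrow> (\<forall>A\<in>G. lin_on UNIV (act A))"

definition stab where
  "stab G act S \<longleftrightarrow> fvs.subspace S \<and> (\<forall>A\<in>G. \<forall>x\<in>S. act A x \<in> S)"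

definition splits where
  "splits G act U P Q \<longleftrightarrow> stab G act P \<and> stab G act Q \<and> P \<inter> Q = {0} \<and> U = {x + y |x y. x \<in> P \<and> y \<in> Q}"

definition indec where
  "indec G act S \<longleftrightarrow> stab G act S \<and> S \<noteq> {0} \<and> (\<forall>P Q. splits G act S P Q \<longrightarrow> P = {0} \<or> Q = {0})"

text \<open>Peeling off one indecomposable summand at a time makes rule induction available;
  \<open>dec_iff_direct_sum\<close> translates to families indexed by numbers.\<close>

inductive dec for G act where
  zero: "dec G act {0} 0"
| step: "splits G act U S R \<Longrightarrow> indec G act S \<Longrightarrow> dec G act R n \<Longrightarrow> dec G act U (Suc n)"

definition rep_hom where
  "rep_hom G act S act' T f \<longleftrightarrow> lin_on S f \<and> (\<forall>x\<in>S. f x \<in> T) \<and> (\<forall>A\<in>G. \<forall>x\<in>S. f (act A x) = act' A (f x))"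

definition rep_iso where
  "rep_iso G act S act' T f \<longleftrightarrow> rep_hom G act S act' T f \<and> bij_betw f S T"

definition proj :: "('b \<Rightarrow> 'a::field) set \<Rightarrow> ('b \<Rightarrow> 'a) set \<Rightarrow> ('b \<Rightarrow> 'a) \<Rightarrow> ('b \<Rightarrow> 'a)" where
  "proj P Q u = (THE p. p \<in> P \<and> u - p \<in> Q)"

lemmas subsp = fvs.subspace_0 fvs.subspace_add fvs.subspace_diff fvs.subspace_scale fvs.subspace_neg

lemma lin_on_add: "lin_on S f \<Longrightarrow> x \<in> S \<Longrightarrow> y \<in> S \<Longrightarrow> f (x + y) = f x + f y"
  and lin_on_scale: "lin_on S f \<Longrightarrow> x \<in> S \<Longrightarrow> f (fscale c x) = fscale c (f x)"
  by (auto simp: lin_on_def)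

lemma lin_on_zero: "lin_on S f \<Longrightarrow> x \<in> S \<Longrightarrow> f 0 = 0"
  using lin_on_scale[of S f x 0] by (simp)

lemma lin_on_neg: "lin_on S f \<Longrightarrow> x \<in> S \<Longrightarrow> f (- x) = - f x"
  using lin_on_scale[of S f x "-1"] by (simp)

lemma lin_on_diff:
  assumes "lin_on S f" "fvs.subspace S" "x \<in> S" "y \<in> S" shows "f (x - y) = f x - f y"
  using lin_on_add[OF assms(1,3), of "- y"] lin_on_neg[OF assms(1,4)] fvs.subspace_neg[OF assms(2,4)] by simp

lemma stab_subspace: "stab G act S \<Longrightarrow> fvs.subspace S" by (simp add: stab_def)
lemma stab_act: "stab G act S \<Longrightarrow> A \<in> G \<Longrightarrow> x \<in> S \<Longrightarrow> act A x \<in> S" by (simp add: stab_def)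
lemma stab_0: "stab G act S \<Longrightarrow> 0 \<in> S" by (simp add: stab_def fvs.subspace_0)

lemma stab_image: "rep_hom G act S act' T f \<Longrightarrow> stab G act S \<Longrightarrow> stab G act' (f ` S)"
proof -
  assume h: "rep_hom G act S act' T f" and s: "stab G act S"
  have l: "lin_on S f" and e: "\<And>A x. A \<in> G \<Longrightarrow> x \<in> S \<Longrightarrow> act' A (f x) = f (act A x)"
    using h by (auto simp: rep_hom_def)
  note ss = stab_subspace[OF s]
  have "fvs.subspace (f ` S)"
  proof (rule fvs.subspaceI)
    show "0 \<in> f ` S" using lin_on_zero[OF l, of 0] subsp(1)[OF ss] by force
    show "x + y \<in> f ` S" if "x \<in> f ` S" "y \<in> f ` S" for x y
      using that lin_on_add[OF l] subsp(2)[OF ss] by (smt (verit) image_iff)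
    show "fscale c x \<in> f ` S" if "x \<in> f ` S" for c x
      using that lin_on_scale[OF l] subsp(4)[OF ss] by (smt (verit) image_iff)
  qed
  then show ?thesis using e stab_act[OF s] by (auto simp: stab_def)
qed

lemma rep_hom_subset: "rep_hom G act S act' T f \<Longrightarrow> S' \<subseteq> S \<Longrightarrow> f ` S' \<subseteq> T' \<Longrightarrow> rep_hom G act S' act' T' f"
  unfolding rep_hom_def lin_on_def by blast

lemma rep_hom_comp: "rep_hom G act S act' T f \<Longrightarrow> rep_hom G act' T act'' R g \<Longrightarrow> rep_hom G act S act'' R (\<lambda>x. g (f x))"
  by (auto simp: rep_hom_def lin_on_def)

lemma rep_hom_mono: "rep_hom G act S act' T f \<Longrightarrow> T \<subseteq> T' \<Longrightarrow> rep_hom G act S act' T' f"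
  by (auto simp: rep_hom_def)

lemma rep_iso_inv:
  assumes f: "rep_iso G act S act' T f" and s: "stab G act S"
  shows "rep_iso G act' T act S (inv_into S f)"
proof -
  have b: "bij_betw f S T" and h: "rep_hom G act S act' T f" using f by (auto simp: rep_iso_def)
  let ?g = "inv_into S f"
  have gf: "?g (f x) = x" if "x \<in> S" for x using b that by (simp add: bij_betw_inv_into_left)
  have ex: "\<exists>x\<in>S. y = f x" if "y \<in> T" for y using b that by (auto simp: bij_betw_def)
  note ss = stab_subspace[OF s]
  have l: "lin_on S f" and e: "\<And>A x. A \<in> G \<Longrightarrow> x \<in> S \<Longrightarrow> act' A (f x) = f (act A x)"
    using h by (auto simp: rep_hom_def)
  have 1: "?g (x + y) = ?g x + ?g y" if "x \<in> T" "y \<in> T" for x y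
    using ex[OF that(1)] ex[OF that(2)] lin_on_add[OF l, symmetric] subsp(2)[OF ss] gf by force
  have 2: "?g (fscale c x) = fscale c (?g x)" if "x \<in> T" for c x
    using ex[OF that(1)] lin_on_scale[OF l, symmetric] subsp(4)[OF ss] gf by force
  have 3: "?g (act' A x) = act A (?g x)" if "x \<in> T" "A \<in> G" for A x
    using ex[OF that(1)] e[OF that(2)] stab_act[OF s that(2)] gf by force
  show ?thesis unfolding rep_iso_def rep_hom_def lin_on_def
    using bij_betw_inv_into[OF b] 1 2 3 by (auto simp: bij_betw_def)
qed

lemma lin_act_lin: "lin_act G act \<Longrightarrow> A \<in> G \<Longrightarrow> lin_on UNIV (act A)"
  by (simp add: lin_act_def)

lemmas lin_act_add = lin_on_add[OF lin_act_lin UNIV_I UNIV_I]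
lemmas lin_act_zero = lin_on_zero[OF lin_act_lin UNIV_I]
lemmas lin_act_diff = lin_on_diff[OF lin_act_lin fvs.subspace_UNIV UNIV_I UNIV_I]

lemma stab_zero: "lin_act G act \<Longrightarrow> stab G act {0}"
  unfolding stab_def by (metis lin_act_zero fvs.subspace_single_0 singletonD singletonI)

lemma splits_stab:
  assumes la: "lin_act G act" and sp: "splits G act U P Q"
  shows "stab G act U"
proof -
  have st: "stab G act P" "stab G act Q" and U: "U = {x + y |x y. x \<in> P \<and> y \<in> Q}"
    using sp by (auto simp: splits_def)
  have "act A (x + y) \<in> U" if "A \<in> G" "x \<in> P" "y \<in> Q" for A x y
    using lin_act_add[OF la that(1), of x y] stab_act[OF st(1) that(1,2)] stab_act[OF st(2) that(1,3)] U by blast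
  then show ?thesis unfolding stab_def using fvs.subspace_sums[OF stab_subspace[OF st(1)] stab_subspace[OF st(2)]] U
    by blast
qed

lemma splits_Int: "splits G act U P Q \<Longrightarrow> x \<in> P \<Longrightarrow> x \<in> Q \<Longrightarrow> x = 0"
  unfolding splits_def by blast

lemma splits_subset: assumes "splits G act U P Q" shows "P \<subseteq> U" "Q \<subseteq> U"
proof -
  have "x \<in> U" if "x \<in> P" for x
  proof -
    have "x = x + 0" "0 \<in> Q" using assms by (auto simp: splits_def stab_0)
    then show ?thesis using that assms unfolding splits_def by blast
  qed
  moreover have "x \<in> U" if "x \<in> Q" for x
  proof -
    have "x = 0 + x" "0 \<in> P" using assms by (auto simp: splits_def stab_0)
    then show ?thesis using that assms unfolding splits_def by blast
  qed
  ultimately show "P \<subseteq> U" "Q \<subseteq> U" by auto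
qed

lemma splits_sym: "splits G act U P Q \<Longrightarrow> splits G act U Q P"
  unfolding splits_def by (auto simp: add.commute) (metis add.commute)+

lemma splits_image:
  assumes sp: "splits G act U P Q" and f: "rep_hom G act U act' T f" and inj: "inj_on f U"
  shows "splits G act' (f ` U) (f ` P) (f ` Q)"
proof -
  note sub = splits_subset[OF sp]
  have st: "stab G act P" "stab G act Q" and i: "P \<inter> Q = {0}" and U: "U = {x + y |x y. x \<in> P \<and> y \<in> Q}"
    using sp by (auto simp: splits_def)
  have l: "lin_on U f" using f by (simp add: rep_hom_def)
  have "f ` P \<inter> f ` Q = f ` (P \<inter> Q)" using inj sub by (simp add: inj_on_image_Int)
  also have "\<dots> = {0}" using i lin_on_zero[OF l] stab_0[OF st(1)] sub by auto
  finally have 1: "f ` P \<inter> f ` Q = {0}" .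
  have 2: "f ` U = {x + y |x y. x \<in> f ` P \<and> y \<in> f ` Q}"
  proof safe
    fix u assume "u \<in> U"
    then obtain x y where "u = x + y" "x \<in> P" "y \<in> Q" using U by blast
    then show "\<exists>x y. f u = x + y \<and> x \<in> f ` P \<and> y \<in> f ` Q" using lin_on_add[OF l, of x y] sub by blast
  next
    fix x y assume "x \<in> P" "y \<in> Q"
    then have "x \<in> U" "y \<in> U" "x + y \<in> U" using sub U by blast+
    then have "f x + f y = f (x + y)" "x + y \<in> U" using lin_on_add[OF l, of x y] by simp_all
    then show "f x + f y \<in> f ` U" by auto
  qed
  show ?thesis unfolding splits_def using 1 2
      stab_image[OF rep_hom_subset[OF f sub(1)] st(1), of "f ` P"]
      stab_image[OF rep_hom_subset[OF f sub(2)] st(2), of "f ` Q"] by auto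
qed

lemma indec_image:
  assumes ind: "indec G act S" and f: "rep_iso G act S act' T f"
  shows "indec G act' T"
proof -
  have st: "stab G act S" and h: "rep_hom G act S act' T f" and b: "bij_betw f S T"
    using ind f by (auto simp: indec_def rep_iso_def)
  have T: "T = f ` S" using b by (simp add: bij_betw_def)
  have sT: "stab G act' T" unfolding T by (rule stab_image[OF h st])
  let ?g = "inv_into S f"
  have g: "rep_iso G act' T act S ?g" by (rule rep_iso_inv[OF f st])
  have lg: "lin_on T ?g" using g by (auto simp: rep_iso_def rep_hom_def)
  have bg: "bij_betw ?g T S" using g by (auto simp: rep_iso_def)
  have z: "P = {0}" if "?g ` P = {0}" "P \<subseteq> T" "0 \<in> P" for P
  proof -
    have "inj_on ?g T" using bg by (simp add: bij_betw_def)
    moreover have "?g 0 = 0" using lin_on_zero[OF lg] that by auto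
    ultimately have "p = 0" if "p \<in> P" for p
      using \<open>?g ` P = {0}\<close> \<open>P \<subseteq> T\<close> \<open>0 \<in> P\<close> that by (metis image_eqI inj_onD singletonD subsetD)
    then show ?thesis using that by auto
  qed
  have "T \<noteq> {0}"
  proof
    assume "T = {0}"
    then have "?g ` T = {0}" using lin_on_zero[OF lg] by auto
    then show False using bg ind by (auto simp: bij_betw_def indec_def)
  qed
  moreover have "P = {0} \<or> Q = {0}" if sp: "splits G act' T P Q" for P Q
  proof -
    have "splits G act (?g ` T) (?g ` P) (?g ` Q)"
      using splits_image[OF sp, of act S ?g] g by (auto simp: rep_iso_def bij_betw_def)
    then have "?g ` P = {0} \<or> ?g ` Q = {0}" using ind bg by (auto simp: bij_betw_def indec_def)
    then show ?thesis using z splits_subset[OF sp] sp by (auto simp: splits_def stab_0)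
  qed
  ultimately show ?thesis using sT by (auto simp: indec_def)
qed

lemma dec_stab:
  assumes "dec G act U n" and la: "lin_act G act"
  shows "stab G act U"
  using assms(1)
proof cases
  case zero
  then show ?thesis using stab_zero[OF la] by metis
next
  case (step S R n)
  show ?thesis by (rule splits_stab[OF la step(2)])
qed

lemma dec_image:
  "dec G act U n \<Longrightarrow> rep_hom G act U act' T f \<Longrightarrow> inj_on f U \<Longrightarrow> dec G act' (f ` U) n"
proof (induction arbitrary: T rule: dec.induct)
  case zero
  then have "f 0 = 0" using lin_on_zero[of "{0}" f 0] by (auto simp: rep_hom_def)
  then have "f ` {0} = {0}" by (metis image_empty image_insert)
  then show ?case using dec.zero by metis
next
  case (step U S R n)
  note sub = splits_subset[OF step(1)]
  have 1: "splits G act' (f ` U) (f ` S) (f ` R)" by (rule splits_image[OF step(1,5,6)])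
  have "rep_iso G act S act' (f ` S) f" unfolding rep_iso_def
    using rep_hom_subset[OF step(5) sub(1)] inj_on_subset[OF step(6) sub(1)] by (auto simp: bij_betw_def)
  then have 2: "indec G act' (f ` S)" by (rule indec_image[OF step(2)])
  have 3: "dec G act' (f ` R) n"
    using step(4)[of "f ` R"] rep_hom_subset[OF step(5) sub(2)] inj_on_subset[OF step(6) sub(2)] by auto
  show ?case by (rule dec.step[OF 1 2 3])
qed

lemma dec_iso: "dec G act U n \<Longrightarrow> rep_iso G act U act' T f \<Longrightarrow> dec G act' T n"
  using dec_image[of G act U n act' T f] by (auto simp: rep_iso_def bij_betw_def)


lemma projI:
  assumes sp: "splits G act U P Q" and "u \<in> U"
  shows "proj P Q u \<in> P" "u - proj P Q u \<in> Q"
proof -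
  have st: "fvs.subspace P" "fvs.subspace Q" and i: "P \<inter> Q = {0}" and U: "U = {x + y |x y. x \<in> P \<and> y \<in> Q}"
    using sp by (auto simp: splits_def stab_def)
  obtain x y where xy: "u = x + y" "x \<in> P" "y \<in> Q" using assms U by blast
  have "\<exists>!p. p \<in> P \<and> u - p \<in> Q"
  proof (rule ex1I[of _ x])
    show "x \<in> P \<and> u - x \<in> Q" using xy by simp
    fix p assume p: "p \<in> P \<and> u - p \<in> Q"
    have "u - x \<in> Q" using xy by simp
    then have "(u - x) - (u - p) \<in> Q" using p subsp(3)[OF st(2)] by blast
    moreover have "(u - x) - (u - p) = p - x" by simp
    moreover have "p - x \<in> P" using p xy subsp(3)[OF st(1)] by blast
    ultimately have "p - x \<in> P \<inter> Q" by simp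
    then have "p - x = 0" using i by simp
    then show "p = x" by simp
  qed
  from theI'[OF this] show "proj P Q u \<in> P" "u - proj P Q u \<in> Q" by (auto simp: proj_def)
qed

lemma proj_eqI:
  assumes sp: "splits G act U P Q" and "p \<in> P" "u - p \<in> Q"
  shows "proj P Q u = p"
proof -
  have st: "fvs.subspace P" "fvs.subspace Q" and i: "P \<inter> Q = {0}" and U: "U = {x + y |x y. x \<in> P \<and> y \<in> Q}"
    using sp by (auto simp: splits_def stab_def)
  have "u = p + (u - p)" by simp
  then have "u \<in> U" using assms U by blast
  note pr = projI[OF sp this]
  have "(u - proj P Q u) - (u - p) \<in> Q" using assms pr subsp(3)[OF st(2)] by blast
  moreover have "(u - proj P Q u) - (u - p) = p - proj P Q u" by simp
  moreover have "p - proj P Q u \<in> P" using assms pr subsp(3)[OF st(1)] by blast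
  ultimately have "p - proj P Q u \<in> P \<inter> Q" by simp
  then show ?thesis using i by simp
qed

lemma splits_0: "splits G act U P Q \<Longrightarrow> 0 \<in> P" "splits G act U P Q \<Longrightarrow> 0 \<in> Q"
  by (meson splits_def stab_0)+

lemma proj_left: "splits G act U P Q \<Longrightarrow> p \<in> P \<Longrightarrow> proj P Q p = p"
  by (metis proj_eqI diff_self splits_0(2))

lemma proj_right: "splits G act U P Q \<Longrightarrow> q \<in> Q \<Longrightarrow> proj P Q q = 0"
  by (metis proj_eqI diff_0_right splits_0(1))

lemma proj_zero_iff: "splits G act U P Q \<Longrightarrow> u \<in> U \<Longrightarrow> proj P Q u = 0 \<longleftrightarrow> u \<in> Q"
  using projI(2)[of G act U P Q u] proj_right[of G act U P Q u] by (metis diff_0_right)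

lemma proj_hom:
  assumes la: "lin_act G act" and sp: "splits G act U P Q"
  shows "rep_hom G act U act P (proj P Q)"
proof -
  have st: "stab G act P" "stab G act Q" using sp by (auto simp: splits_def)
  note ss = stab_subspace[OF st(1)] stab_subspace[OF st(2)]
  note pI = projI[OF sp]
  have 1: "proj P Q (x + y) = proj P Q x + proj P Q y" if "x \<in> U" "y \<in> U" for x y
  proof (rule proj_eqI[OF sp])
    show "proj P Q x + proj P Q y \<in> P" using pI that subsp(2)[OF ss(1)] by simp
    have "(x - proj P Q x) + (y - proj P Q y) \<in> Q" using pI that subsp(2)[OF ss(2)] by simp
    then show "x + y - (proj P Q x + proj P Q y) \<in> Q" by (simp add: algebra_simps)
  qed
  have 2: "proj P Q (fscale c x) = fscale c (proj P Q x)" if "x \<in> U" for c x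
  proof (rule proj_eqI[OF sp])
    show "fscale c (proj P Q x) \<in> P" using pI that subsp(4)[OF ss(1)] by simp
    have "fscale c (x - proj P Q x) \<in> Q" using pI that subsp(4)[OF ss(2)] by simp
    then show "fscale c x - fscale c (proj P Q x) \<in> Q" by (simp add: fvs.scale_right_diff_distrib)
  qed
  have 3: "proj P Q (act A x) = act A (proj P Q x)" if "x \<in> U" "A \<in> G" for A x
  proof (rule proj_eqI[OF sp])
    show "act A (proj P Q x) \<in> P" using pI that stab_act[OF st(1)] by simp
    have "act A (x - proj P Q x) \<in> Q" using pI that stab_act[OF st(2)] by simp
    then show "act A x - act A (proj P Q x) \<in> Q" using lin_act_diff[OF la that(2)] by simp
  qed
  show ?thesis unfolding rep_hom_def lin_on_def using 1 2 3 pI by blast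
qed

text \<open>Two complements of the same subrepresentation are isomorphic.\<close>

lemma dec_complement:
  assumes la: "lin_act G act" and sp: "splits G act U S R" and sp': "splits G act U S R'" and d: "dec G act R' n"
  shows "dec G act R n"
proof -
  note sp2 = splits_sym[OF sp] and sp2' = splits_sym[OF sp']
  note sub = splits_subset[OF sp] splits_subset[OF sp']
  have h: "rep_hom G act R' act R (proj R S)"
    using rep_hom_subset[OF proj_hom[OF la sp2] sub(4), of R] projI(1)[OF sp2] sub(4) by blast
  have lin: "lin_on R' (proj R S)" using h by (simp add: rep_hom_def)
  have ssR': "fvs.subspace R'" using sp' by (simp add: splits_def stab_def)
  have ssS: "fvs.subspace S" using sp' by (simp add: splits_def stab_def)
  have "inj_on (proj R S) R'"
  proof (rule inj_onI)
    fix x y assume xy: "x \<in> R'" "y \<in> R'" "proj R S x = proj R S y"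
    then have "proj R S (x - y) = 0" using lin_on_diff[OF lin ssR', of x y] by simp
    moreover have d: "x - y \<in> R'" using xy subsp(3)[OF ssR'] by simp
    ultimately have "x - y \<in> S" using proj_zero_iff[OF sp2, of "x - y"] sub by blast
    then have "x - y = 0" using d splits_Int[OF sp'] by blast
    then show "x = y" by simp
  qed
  moreover have "proj R S ` R' = R"
  proof
    show "proj R S ` R' \<subseteq> R" using projI(1)[OF sp2] sub by blast
    show "R \<subseteq> proj R S ` R'"
    proof
      fix r assume r: "r \<in> R"
      then have rU: "r \<in> U" using sub by blast
      have a: "r - proj R' S r \<in> S" "proj R' S r \<in> R'" using projI[OF sp2' rU] by auto
      have "proj R S (proj R' S r) = r"
      proof (rule proj_eqI[OF sp2 r])
        show "proj R' S r - r \<in> S" using subsp(5)[OF ssS a(1)] by simp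
      qed
      then show "r \<in> proj R S ` R'" using a(2) by (metis imageI)
    qed
  qed
  ultimately have "rep_iso G act R' act R (proj R S)" using h by (simp add: rep_iso_def bij_betw_def)
  then show ?thesis by (rule dec_iso[OF d])
qed

lemma splits_decomp:
  assumes "splits G act U P Q" "u \<in> U" obtains x y where "u = x + y" "x \<in> P" "y \<in> Q"
  using assms unfolding splits_def by blast

section \<open>Chain conditions in finite dimension and Fitting's lemma\<close>

lemma card_independent_bound:
  assumes "finite B" "T \<subseteq> fvs.span B" "C \<subseteq> T" "fvs.independent C"
  shows "finite C \<and> card C \<le> card B"
  using fvs.independent_span_bound[of B C] assms by blast

text \<open>The dimension of a subspace of a finitely generated space. Outside finite dimension the
  maximum may be unspecified, so the lemmas below assume a finite spanning set.\<close>

definition rank_of :: "('b \<Rightarrow> 'a::field) set \<Rightarrow> nat" where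
  "rank_of S = Max (card ` {C. C \<subseteq> S \<and> fvs.independent C})"

lemma rank_of_less:
  fixes S T :: "('b \<Rightarrow> 'a::field) set"
  assumes B: "finite B" "T \<subseteq> fvs.span B" and S: "fvs.subspace S" "S \<subset> T"
  shows "rank_of S < rank_of T"
proof -
  let ?I = "\<lambda>S :: ('b \<Rightarrow> 'a) set. card ` {C. C \<subseteq> S \<and> fvs.independent C}"
  have SB: "S \<subseteq> fvs.span B" using assms by blast
  have fin: "finite (?I X)" if "X \<subseteq> fvs.span B" for X
    by (rule finite_subset[of _ "{..card B}"]) (use card_independent_bound[OF B(1) that] in auto)
  have ne: "?I X \<noteq> {}" for X using fvs.independent_empty by blast
  obtain C where C: "C \<subseteq> S" "fvs.independent C" "card C = rank_of S"
    using Max_in[OF fin[OF SB] ne] unfolding rank_of_def by force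
  obtain x where x: "x \<in> T" "x \<notin> S" using S by blast
  have "fvs.span C \<subseteq> S" using C(1) S(1) by (rule fvs.span_minimal)
  then have ind: "fvs.independent (insert x C)" using x C(2) by (auto simp: fvs.independent_insert)
  have "finite C" using card_independent_bound[OF B(1) SB C(1,2)] by simp
  moreover have "x \<notin> C" using x C by blast
  ultimately have "card (insert x C) = Suc (rank_of S)" using C by simp
  moreover have "insert x C \<subseteq> T" using x C S by blast
  ultimately have "Suc (rank_of S) \<in> ?I T" using ind by (metis (mono_tags, lifting) imageI mem_Collect_eq)
  then have "Suc (rank_of S) \<le> rank_of T" unfolding rank_of_def using Max_ge[OF fin[OF B(2)]] by blast
  then show ?thesis by simp
qed

lemma rank_of_le:
  fixes T :: "('b \<Rightarrow> 'a::field) set"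
  assumes B: "finite B" "T \<subseteq> fvs.span B"
  shows "rank_of T \<le> card B"
proof -
  let ?I = "\<lambda>S :: ('b \<Rightarrow> 'a) set. card ` {C. C \<subseteq> S \<and> fvs.independent C}"
  have fin: "finite (?I T)"
    by (rule finite_subset[of _ "{..card B}"]) (use card_independent_bound[OF B] in auto)
  have ne: "?I T \<noteq> {}" using fvs.independent_empty by blast
  obtain C where "C \<subseteq> T" "fvs.independent C" "card C = rank_of T"
    using Max_in[OF fin ne] unfolding rank_of_def by force
  then show ?thesis using card_independent_bound[OF B] by metis
qed

lemma decseq_subspace_stationary:
  fixes S :: "nat \<Rightarrow> ('b \<Rightarrow> 'a::field) set"
  assumes B: "finite B" "S 0 \<subseteq> fvs.span B" and S: "\<And>i. fvs.subspace (S i)" and dec: "\<And>i j. i \<le> j \<Longrightarrow> S j \<subseteq> S i"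
  shows "\<exists>i. \<forall>j\<ge>i. S j = S i"
proof -
  define i where "i = (ARG_MIN (\<lambda>i. rank_of (S i)) i. True)"
  have i: "rank_of (S i) \<le> rank_of (S j)" for j
    unfolding i_def by (rule arg_min_nat_le) simp
  have "S j = S i" if "j \<ge> i" for j
  proof (rule ccontr)
    assume "S j \<noteq> S i"
    then have "S j \<subset> S i" using dec[OF that] by blast
    moreover have "S i \<subseteq> fvs.span B" by (rule order_trans[OF dec[OF le0] B(2)])
    ultimately show False using rank_of_less[OF B(1) _ S[of j]] i[of j] by (meson leD)
  qed
  then show ?thesis by blast
qed

lemma incseq_subspace_stationary:
  fixes S :: "nat \<Rightarrow> ('b \<Rightarrow> 'a::field) set"
  assumes B: "finite B" "\<And>i. S i \<subseteq> fvs.span B" and S: "\<And>i. fvs.subspace (S i)" and inc: "\<And>i j. i \<le> j \<Longrightarrow> S i \<subseteq> S j"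
  shows "\<exists>i. \<forall>j\<ge>i. S j = S i"
proof -
  define i where "i = (ARG_MIN (\<lambda>i. card B - rank_of (S i)) i. True)"
  have i0: "card B - rank_of (S i) \<le> card B - rank_of (S j)" for j
    unfolding i_def by (rule arg_min_nat_le) simp
  have i: "rank_of (S j) \<le> rank_of (S i)" for j using i0[of j] rank_of_le[OF B(1) B(2), of i] rank_of_le[OF B(1) B(2), of j] by linarith
  have "S j = S i" if "j \<ge> i" for j
    using rank_of_less[OF B(1) B(2), of "S i" j] i[of j] S[of i] inc[OF that] by (metis leD psubsetI)
  then show ?thesis by blast
qed

lemma rep_hom_pow:
  assumes "rep_hom G act S act S f"
  shows "rep_hom G act S act S (f ^^ i)"
proof (induction i)
  case 0
  then show ?case by (simp add: rep_hom_def lin_on_def)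
next
  case (Suc i)
  from rep_hom_comp[OF Suc assms] show ?case by (simp add: o_def)
qed

lemma rep_hom_in: "rep_hom G act S act' T f \<Longrightarrow> x \<in> S \<Longrightarrow> f x \<in> T"
  by (simp add: rep_hom_def)

lemma rep_hom_lin: "rep_hom G act S act' T f \<Longrightarrow> lin_on S f"
  by (simp add: rep_hom_def)

lemma rep_hom_act: "rep_hom G act S act' T f \<Longrightarrow> A \<in> G \<Longrightarrow> x \<in> S \<Longrightarrow> f (act A x) = act' A (f x)"
  by (simp add: rep_hom_def)

lemma subspace_kernel:
  assumes l: "lin_on S f" and ss: "fvs.subspace S"
  shows "fvs.subspace {x\<in>S. f x = 0}"
proof (rule fvs.subspaceI)
  show "0 \<in> {x\<in>S. f x = 0}" using lin_on_zero[OF l] subsp(1)[OF ss] by blast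
next
  fix x y assume "x \<in> {x\<in>S. f x = 0}" "y \<in> {x\<in>S. f x = 0}"
  then show "x + y \<in> {x\<in>S. f x = 0}" using subsp(2)[OF ss] lin_on_add[OF l, of x y] by simp
next
  fix c x assume "x \<in> {x\<in>S. f x = 0}"
  then show "fscale c x \<in> {x\<in>S. f x = 0}" using subsp(4)[OF ss] lin_on_scale[OF l, of x c] by simp
qed

lemma stab_kernel:
  assumes la: "lin_act G act'" and h: "rep_hom G act S act' T f" and st: "stab G act S"
  shows "stab G act {x\<in>S. f x = 0}"
  unfolding stab_def using subspace_kernel[OF rep_hom_lin[OF h] stab_subspace[OF st]]
    stab_act[OF st] rep_hom_act[OF h] lin_act_zero[OF la] by (metis (mono_tags, lifting) mem_Collect_eq)

text \<open>Kernels of powers of \<open>f\<close> increase and images decrease; where both chains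
  are stationary, comparing the powers i and i + i gives zero intersection and full sum.\<close>

lemma fitting:
  assumes la: "lin_act G act" and st: "stab G act S" and B: "finite B" "S \<subseteq> fvs.span B"
    and h: "rep_hom G act S act S f"
  shows "\<exists>i>0. splits G act S {x\<in>S. (f ^^ i) x = 0} ((f ^^ i) ` S)"
proof -
  note hp = rep_hom_pow[OF h]
  note ss = stab_subspace[OF st]
  let ?K = "\<lambda>i. {x\<in>S. (f ^^ i) x = 0}" and ?I = "\<lambda>i. (f ^^ i) ` S"
  have p0: "(f ^^ i) 0 = 0" for i
    using lin_on_zero[OF rep_hom_lin[OF hp]] subsp(1)[OF ss] by blast
  have padd: "(f ^^ (j + i)) x = (f ^^ j) ((f ^^ i) x)" for i j x by (simp add: funpow_add)
  have K: "stab G act (?K i)" for i by (rule stab_kernel[OF la hp st])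
  have I: "stab G act (?I i)" for i by (rule stab_image[OF hp st])
  have "\<exists>i. \<forall>j\<ge>i. ?K j = ?K i"
  proof (rule incseq_subspace_stationary[OF B(1)])
    show "?K i \<subseteq> fvs.span B" for i using B(2) by blast
    show "fvs.subspace (?K i)" for i by (rule stab_subspace[OF K])
    show "?K i \<subseteq> ?K j" if "i \<le> j" for i j
      using padd[of "j - i" i] p0[of "j - i"] that by auto
  qed
  then obtain i1 where i1: "\<And>j. j \<ge> i1 \<Longrightarrow> ?K j = ?K i1" by blast
  have "\<exists>i. \<forall>j\<ge>i. ?I j = ?I i"
  proof (rule decseq_subspace_stationary[OF B(1)])
    show "?I 0 \<subseteq> fvs.span B" using B(2) by simp
    show "fvs.subspace (?I i)" for i by (rule stab_subspace[OF I])
    show "?I j \<subseteq> ?I i" if "i \<le> j" for i j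
      using padd[of i "j - i"] rep_hom_in[OF hp] that by auto
  qed
  then obtain i2 where i2: "\<And>j. j \<ge> i2 \<Longrightarrow> ?I j = ?I i2" by blast
  \<comment> \<open>\<open>Suc\<close> makes the exponent positive: \<open>indec_fitting\<close>
    peels off one application of \<open>f\<close> from a power.\<close>
  define i where "i = Suc (i1 + i2)"
  have KK: "?K (i + i) = ?K i" using i1[of i] i1[of "i + i"] by (simp add: i_def)
  have II: "?I (i + i) = ?I i" using i2[of i] i2[of "i + i"] by (simp add: i_def)
  have l: "lin_on S (f ^^ i)" by (rule rep_hom_lin[OF hp])
  have "?K i \<inter> ?I i = {0}"
  proof
    show "{0} \<subseteq> ?K i \<inter> ?I i" using stab_0[OF K] stab_0[OF I] by blast
    show "?K i \<inter> ?I i \<subseteq> {0}"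
    proof
      fix y assume y: "y \<in> ?K i \<inter> ?I i"
      then obtain x where x: "x \<in> S" "y = (f ^^ i) x" by blast
      then have "(f ^^ (i + i)) x = 0" using y padd by simp
      then have "x \<in> ?K i" using KK x by blast
      then show "y \<in> {0}" using x by simp
    qed
  qed
  moreover have "S = {x + y |x y. x \<in> ?K i \<and> y \<in> ?I i}"
  proof
    show "S \<subseteq> {x + y |x y. x \<in> ?K i \<and> y \<in> ?I i}"
    proof
      fix x assume x: "x \<in> S"
      then have "(f ^^ i) x \<in> ?I (i + i)" using II by blast
      then obtain z where z: "z \<in> S" "(f ^^ i) x = (f ^^ i) ((f ^^ i) z)" using padd by auto
      have zi: "(f ^^ i) z \<in> S" using rep_hom_in[OF hp z(1)] .
      have "(f ^^ i) (x - (f ^^ i) z) = 0" using lin_on_diff[OF l ss x zi] z by simp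
      then have "x - (f ^^ i) z \<in> ?K i" using subsp(3)[OF ss x zi] by simp
      moreover have "x = (x - (f ^^ i) z) + (f ^^ i) z" by simp
      ultimately show "x \<in> {x + y |x y. x \<in> ?K i \<and> y \<in> ?I i}" using z(1) by blast
    qed
    show "{x + y |x y. x \<in> ?K i \<and> y \<in> ?I i} \<subseteq> S"
      using subsp(2)[OF ss] rep_hom_in[OF hp] by blast
  qed
  ultimately have "splits G act S (?K i) (?I i)" using K I unfolding splits_def by blast
  moreover have "i > 0" by (simp add: i_def)
  ultimately show ?thesis by blast
qed

text \<open>One of the two Fitting summands is zero: if it is the kernel, the map is bijective; if
  it is the image, the map is nilpotent.\<close>

lemma indec_fitting:
  assumes la: "lin_act G act" and ind: "indec G act S" and B: "finite B" "S \<subseteq> fvs.span B"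
    and h: "rep_hom G act S act S f"
  shows "bij_betw f S S \<or> (\<exists>i. \<forall>x\<in>S. (f ^^ i) x = 0)"
proof -
  have st: "stab G act S" using ind by (simp add: indec_def)
  note ss = stab_subspace[OF st]
  obtain i where i: "i > 0" "splits G act S {x\<in>S. (f ^^ i) x = 0} ((f ^^ i) ` S)"
    using fitting[OF la st B h] by blast
  then have "{x\<in>S. (f ^^ i) x = 0} = {0} \<or> (f ^^ i) ` S = {0}" using ind unfolding indec_def by blast
  then show ?thesis
  proof
    assume k: "{x\<in>S. (f ^^ i) x = 0} = {0}"
    obtain i' where i': "i = Suc i'" using i(1) gr0_implies_Suc by blast
    have l: "lin_on S f" by (rule rep_hom_lin[OF h])
    have p0: "(f ^^ j) 0 = 0" for j
      using lin_on_zero[OF rep_hom_lin[OF rep_hom_pow[OF h]]] subsp(1)[OF ss] by blast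
    have "inj_on f S"
    proof (rule inj_onI)
      fix x y assume xy: "x \<in> S" "y \<in> S" "f x = f y"
      then have "f (x - y) = 0" using lin_on_diff[OF l ss xy(1,2)] by simp
      then have "(f ^^ i) (x - y) = 0" using i' p0 by (simp add: funpow_swap1)
      then have "x - y = 0" using k subsp(3)[OF ss xy(1,2)] by blast
      then show "x = y" by simp
    qed
    moreover have "f ` S = S"
    proof
      show "f ` S \<subseteq> S" using rep_hom_in[OF h] by blast
      show "S \<subseteq> f ` S"
      proof
        fix x assume "x \<in> S"
        then obtain u v where uv: "x = u + v" "u \<in> {x\<in>S. (f ^^ i) x = 0}" "v \<in> (f ^^ i) ` S"
          by (rule splits_decomp[OF i(2)])
        then have "u = 0" using k by blast
        then have "x = v" using uv by simp
        then obtain z where "z \<in> S" "x = f ((f ^^ i') z)" using uv i' by auto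
        then show "x \<in> f ` S" using rep_hom_in[OF rep_hom_pow[OF h]] by blast
      qed
    qed
    ultimately show ?thesis by (simp add: bij_betw_def)
  next
    assume "(f ^^ i) ` S = {0}"
    then show ?thesis by blast
  qed
qed

text \<open>Otherwise both maps are nilpotent. The last nonzero vector in the \<open>f\<close>-orbit
  of some s is killed by \<open>f\<close>, hence fixed by \<open>g\<close>, which contradicts
  nilpotency of \<open>g\<close>.\<close>

lemma indec_local:
  assumes la: "lin_act G act" and ind: "indec G act S" and B: "finite B" "S \<subseteq> fvs.span B"
    and h: "rep_hom G act S act S f" "rep_hom G act S act S g" and fg: "\<forall>x\<in>S. f x + g x = x"
  shows "bij_betw f S S \<or> bij_betw g S S"
proof (rule ccontr)
  assume n: "\<not> ?thesis"
  obtain i where i: "\<forall>x\<in>S. (f ^^ i) x = 0" using n indec_fitting[OF la ind B h(1)] by blast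
  obtain j where j: "\<forall>x\<in>S. (g ^^ j) x = 0" using n indec_fitting[OF la ind B h(2)] by blast
  have st: "stab G act S" using ind by (simp add: indec_def)
  note ss = stab_subspace[OF st]
  obtain s where s: "s \<in> S" "s \<noteq> 0" using ind stab_0[OF st] unfolding indec_def by blast
  let ?x = "\<lambda>k. (f ^^ k) s"
  have k: "\<exists>k. ?x k \<noteq> 0 \<and> f (?x k) = 0"
  proof (rule ccontr)
    assume a: "\<nexists>k. ?x k \<noteq> 0 \<and> f (?x k) = 0"
    have "?x k \<noteq> 0" for k
    proof (induction k)
      case 0
      then show ?case using s(2) by (metis funpow_0)
    next
      case (Suc k)
      then show ?case using a by (metis funpow.simps(2) o_apply)
    qed
    then show False using i s by blast
  qed
  then obtain k where k: "?x k \<noteq> 0" "f (?x k) = 0" by blast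
  have xS: "?x k \<in> S" using rep_hom_in[OF rep_hom_pow[OF h(1)] s(1)] .
  have gx: "g (?x k) = ?x k" using fg xS k(2) by (metis add_0)
  have "(g ^^ l) (?x k) = ?x k" for l
  proof (induction l)
    case (Suc l)
    then show ?case using gx by (metis funpow.simps(2) o_apply)
  qed simp
  then show False using j xS k(1) by metis
qed

text \<open>The map \<open>p\<close> followed by the projection to \<open>S\<close> is invertible,
  so \<open>p\<close> is a split embedding, with the kernel of the projection on \<open>X\<close>,
  that is \<open>X \<inter> R\<close>, as complement. The exchange argument applies this to both
  parts of a second splitting.\<close>

lemma splits_image_complement:
  assumes la: "lin_act G act" and sp: "splits G act U S R" and st: "stab G act X" and XU: "X \<subseteq> U"
    and h: "rep_hom G act S act X p" and b: "bij_betw (\<lambda>x. proj S R (p x)) S S"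
  shows "splits G act X (p ` S) (X \<inter> R) \<and> inj_on p S"
proof
  have sts: "stab G act S" "stab G act R" using sp by (auto simp: splits_def)
  note ss = stab_subspace[OF st] stab_subspace[OF sts(1)] stab_subspace[OF sts(2)]
  note ph = proj_hom[OF la sp]
  have lp: "lin_on U (proj S R)" by (rule rep_hom_lin[OF ph])
  have injb: "inj_on (\<lambda>x. proj S R (p x)) S" using b by (simp add: bij_betw_def)
  then show inj: "inj_on p S" unfolding inj_on_def by metis
  have st1: "stab G act (p ` S)" by (rule stab_image[OF h sts(1)])
  have st2: "stab G act (X \<inter> R)" using st sts(2) unfolding stab_def by (blast intro: fvs.subspace_inter)
  have p0: "p 0 = 0" using lin_on_zero[OF rep_hom_lin[OF h]] stab_0[OF sts(1)] by blast
  have pr0: "proj S R 0 = 0" using lin_on_zero[OF lp] stab_0[OF st] XU by blast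
  have "p ` S \<inter> (X \<inter> R) \<subseteq> {0}"
  proof
    fix y assume "y \<in> p ` S \<inter> (X \<inter> R)"
    then obtain s where s: "s \<in> S" "y = p s" "y \<in> R" by blast
    then have "proj S R (p s) = proj S R (p 0)" using proj_right[OF sp] p0 pr0 by metis
    then have "s = 0" using injb s(1) stab_0[OF sts(1)] unfolding inj_on_def by metis
    then show "y \<in> {0}" using s p0 by simp
  qed
  moreover have "0 \<in> p ` S \<inter> (X \<inter> R)" using stab_0[OF st1] stab_0[OF st2] by blast
  moreover have "X = {x + y |x y. x \<in> p ` S \<and> y \<in> X \<inter> R}"
  proof
    show "{x + y |x y. x \<in> p ` S \<and> y \<in> X \<inter> R} \<subseteq> X" using subsp(2)[OF ss(1)] rep_hom_in[OF h] by blast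
    show "X \<subseteq> {x + y |x y. x \<in> p ` S \<and> y \<in> X \<inter> R}"
    proof
      fix x assume x: "x \<in> X"
      then have xU: "x \<in> U" using XU by blast
      have "proj S R x \<in> S" using rep_hom_in[OF ph xU] .
      then obtain s where s: "s \<in> S" "proj S R x = proj S R (p s)" using b unfolding bij_betw_def by blast
      have psX: "p s \<in> X" using rep_hom_in[OF h s(1)] .
      have ssU: "fvs.subspace U" using stab_subspace[OF splits_stab[OF la sp]] .
      have psU: "p s \<in> U" using psX XU by blast
      have "proj S R (x - p s) = 0" using lin_on_diff[OF lp ssU xU psU] s by simp
      then have "x - p s \<in> R" using proj_zero_iff[OF sp subsp(3)[OF ssU xU psU]] by simp
      moreover have "x - p s \<in> X" using subsp(3)[OF ss(1) x psX] .
      moreover have "x = p s + (x - p s)" by simp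
      ultimately show "x \<in> {x + y |x y. x \<in> p ` S \<and> y \<in> X \<inter> R}" using s(1) by blast
    qed
  qed
  ultimately show "splits G act X (p ` S) (X \<inter> R)" using st1 st2 unfolding splits_def by blast
qed

text \<open>Azumaya's exchange argument: the identity of \<open>S\<close> is the sum of the
  composites through \<open>T\<close> and through \<open>Q\<close>, and by
  \<open>indec_local\<close> one of them is bijective.\<close>

lemma dec_exchange:
  assumes la: "lin_act G act" and B: "finite B"
  shows "dec G act U m \<Longrightarrow> U \<subseteq> fvs.span B \<Longrightarrow> splits G act U S R \<Longrightarrow> indec G act S \<Longrightarrow>
    \<exists>m'. m = Suc m' \<and> dec G act R m'"
proof (induction arbitrary: S R rule: dec.induct)
  case zero
  have "S \<subseteq> {0}" by (rule splits_subset(1)[OF zero(2)])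
  then have "S = {0}" using splits_0[OF zero(2)] by blast
  then show ?case using zero(3) by (simp add: indec_def)
next
  case (step U T Q n)
  note sp = \<open>splits G act U S R\<close> and spT = \<open>splits G act U T Q\<close>
  note spQ = splits_sym[OF spT]
  note sub = splits_subset[OF sp] splits_subset[OF spT]
  note indS = \<open>indec G act S\<close> and indT = \<open>indec G act T\<close>
  note UB = \<open>U \<subseteq> fvs.span B\<close>
  have sts: "stab G act S" "stab G act R" "stab G act T" "stab G act Q"
    using sp spT by (auto simp: splits_def)
  have SB: "S \<subseteq> fvs.span B" using sub UB by blast
  have stU: "stab G act U" by (rule splits_stab[OF la sp])
  note ssU = stab_subspace[OF stU]
  let ?pS = "proj S R" and ?pT = "proj T Q" and ?pQ = "proj Q T"
  note hS = proj_hom[OF la sp] and hT = proj_hom[OF la spT] and hQ = proj_hom[OF la spQ]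
  have hT': "rep_hom G act S act T ?pT" using rep_hom_subset[OF hT sub(1), of T] rep_hom_in[OF hT] sub(1) by blast
  have hQ': "rep_hom G act S act Q ?pQ" using rep_hom_subset[OF hQ sub(1), of Q] rep_hom_in[OF hQ] sub(1) by blast
  have ha: "rep_hom G act S act S (\<lambda>x. ?pS (?pT x))"
    by (rule rep_hom_comp[OF rep_hom_mono[OF hT' sub(3)] hS])
  have hb: "rep_hom G act S act S (\<lambda>x. ?pS (?pQ x))"
    by (rule rep_hom_comp[OF rep_hom_mono[OF hQ' sub(4)] hS])
  have tq: "?pT x + ?pQ x = x" if "x \<in> U" for x
  proof -
    have "?pQ x = x - ?pT x"
      by (rule proj_eqI[OF spQ]) (use projI[OF spT that] in simp_all)
    then show ?thesis by simp
  qed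
  have sum: "?pS (?pT x) + ?pS (?pQ x) = x" if "x \<in> S" for x
  proof -
    have xU: "x \<in> U" using that sub by blast
    have "?pT x \<in> U" "?pQ x \<in> U" using rep_hom_in[OF hT xU] rep_hom_in[OF hQ xU] sub by blast+
    then have "?pS (?pT x) + ?pS (?pQ x) = ?pS (?pT x + ?pQ x)" using lin_on_add[OF rep_hom_lin[OF hS]] by metis
    then show ?thesis using tq[OF xU] proj_left[OF sp that] by metis
  qed
  consider (a) "bij_betw (\<lambda>x. ?pS (?pT x)) S S" | (b) "bij_betw (\<lambda>x. ?pS (?pQ x)) S S"
    using indec_local[OF la indS B SB ha hb] sum by blast
  then show ?case
  proof cases
    \<comment> \<open>Indecomposability of \<open>T\<close> forces \<open>T\<close> to be the image
      of \<open>S\<close>; so \<open>S\<close> also complements \<open>Q\<close> in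
      \<open>U\<close>, and the complements \<open>R\<close> and \<open>Q\<close> of
      \<open>S\<close> have equally many summands.\<close>
    case a
    from splits_image_complement[OF la sp sts(3) sub(3) hT' a]
    have 1: "splits G act T (?pT ` S) (T \<inter> R)" and inj: "inj_on ?pT S" by auto
    have pT0: "?pT 0 = 0" by (rule proj_right[OF spT]) (rule stab_0[OF sts(4)])
    have "?pT ` S \<noteq> {0}"
    proof
      assume z: "?pT ` S = {0}"
      have "x = 0" if "x \<in> S" for x
        using inj_onD[OF inj _ that stab_0[OF sts(1)]] z that pT0 by (metis image_eqI singletonD)
      then show False using indS stab_0[OF sts(1)] unfolding indec_def by blast
    qed
    then have TR: "T \<inter> R = {0}" using indT 1 unfolding indec_def by blast
    have TS: "t \<in> ?pT ` S" if tT: "t \<in> T" for t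
    proof -
      obtain u v where "t = u + v" "u \<in> ?pT ` S" "v \<in> T \<inter> R"
        by (rule splits_decomp[OF 1 tT])
      then show ?thesis using TR by simp
    qed
    have "S \<inter> Q \<subseteq> {0}"
    proof
      fix s assume s: "s \<in> S \<inter> Q"
      then have "?pT s = ?pT 0" using proj_right[OF spT] pT0 by simp
      then have "s = 0" using inj_onD[OF inj _ _ stab_0[OF sts(1)]] s by blast
      then show "s \<in> {0}" by (rule ssubst) (rule singletonI)
    qed
    moreover have "0 \<in> S \<inter> Q" using stab_0[OF sts(1)] stab_0[OF sts(4)] by blast
    moreover have "U = {x + y |x y. x \<in> S \<and> y \<in> Q}"
    proof
      show "{x + y |x y. x \<in> S \<and> y \<in> Q} \<subseteq> U" using sub subsp(2)[OF ssU] by blast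
      show "U \<subseteq> {x + y |x y. x \<in> S \<and> y \<in> Q}"
      proof
        fix u assume u: "u \<in> U"
        then obtain s where s: "s \<in> S" "?pT u = ?pT s" using TS rep_hom_in[OF hT u] by blast
        have sU: "s \<in> U" using s sub by blast
        have "?pT (u - s) = 0" using lin_on_diff[OF rep_hom_lin[OF hT] ssU u sU] s by simp
        then have "u - s \<in> Q" using proj_zero_iff[OF spT subsp(3)[OF ssU u sU]] by simp
        moreover have "u = s + (u - s)" by simp
        ultimately show "u \<in> {x + y |x y. x \<in> S \<and> y \<in> Q}" using s(1) by blast
      qed
    qed
    ultimately have "splits G act U S Q" using sts unfolding splits_def by blast
    then have "dec G act R n" using dec_complement[OF la sp] step(3) by blast
    then show ?thesis by blast
  next
    \<comment> \<open>Now \<open>S\<close> embeds as a summand of \<open>Q\<close>. The induction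
      hypothesis removes it from \<open>Q\<close>, and adding \<open>T\<close> back gives a
      complement \<open>?W\<close> of \<open>S\<close> with as many summands as
      \<open>Q\<close>.\<close>
    case b
    from splits_image_complement[OF la sp sts(4) sub(4) hQ' b]
    have 1: "splits G act Q (?pQ ` S) (Q \<inter> R)" and inj: "inj_on ?pQ S" by auto
    have h'': "rep_hom G act S act (?pQ ` S) ?pQ"
      by (rule rep_hom_subset[OF hQ']) simp_all
    have "rep_iso G act S act (?pQ ` S) ?pQ"
      unfolding rep_iso_def bij_betw_def using inj h'' by simp
    then have "indec G act (?pQ ` S)" by (rule indec_image[OF indS])
    moreover have "Q \<subseteq> fvs.span B" using sub UB by blast
    ultimately obtain n' where n': "n = Suc n'" "dec G act (Q \<inter> R) n'" using step(4) 1 by blast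
    let ?W = "{x + y |x y. x \<in> T \<and> y \<in> Q \<inter> R}"
    have stQR: "stab G act (Q \<inter> R)" using 1 by (simp add: splits_def)
    have "T \<inter> (Q \<inter> R) = {0}" using spT stab_0[OF stQR] stab_0[OF sts(3)] unfolding splits_def by blast
    then have spW: "splits G act ?W T (Q \<inter> R)" using sts(3) stQR unfolding splits_def by blast
    have dW: "dec G act ?W (Suc n')" by (rule dec.step[OF spW indT n'(2)])
    have stW: "stab G act ?W" by (rule splits_stab[OF la spW])
    have WU: "?W \<subseteq> U" using sub subsp(2)[OF ssU] by blast
    have pQ0: "?pQ 0 = 0" by (rule proj_right[OF spQ]) (rule stab_0[OF sts(3)])
    have pS0: "?pS 0 = 0" by (rule proj_right[OF sp]) (rule stab_0[OF sts(2)])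
    have "S \<inter> ?W \<subseteq> {0}"
    proof
      fix s assume s: "s \<in> S \<inter> ?W"
      then obtain t r where tr: "s = t + r" "t \<in> T" "r \<in> Q" "r \<in> R" by blast
      have "?pQ s = r" by (rule proj_eqI[OF spQ]) (use tr in simp_all)
      then have "?pS (?pQ s) = ?pS (?pQ 0)" using proj_right[OF sp tr(4)] pQ0 pS0 by simp
      then show "s \<in> {0}" using inj_onD[OF bij_betw_imp_inj_on[OF b] _ _ stab_0[OF sts(1)], of s] s by blast
    qed
    moreover have "0 \<in> S \<inter> ?W" using stab_0[OF sts(1)] stab_0[OF stW] by blast
    moreover have "U = {x + y |x y. x \<in> S \<and> y \<in> ?W}"
    proof
      show "{x + y |x y. x \<in> S \<and> y \<in> ?W} \<subseteq> U" using sub WU subsp(2)[OF ssU] by blast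
      show "U \<subseteq> {x + y |x y. x \<in> S \<and> y \<in> ?W}"
      proof
        fix u assume u: "u \<in> U"
        have "?pQ u \<in> Q" using rep_hom_in[OF hQ u] .
        then obtain s r where s: "s \<in> S" "?pQ u = ?pQ s + r" "r \<in> Q \<inter> R"
          by (metis splits_decomp[OF 1] imageE)
        have sU: "s \<in> U" using s sub by blast
        have "u - s = (?pT u - ?pT s) + r"
        proof -
          have "u = ?pT u + ?pQ u" "s = ?pT s + ?pQ s" using tq[OF u] tq[OF sU] by simp_all
          then have "u - s = (?pT u + (?pQ s + r)) - (?pT s + ?pQ s)" using s(2) by metis
          also have "\<dots> = (?pT u - ?pT s) + r" by simp
          finally show ?thesis .
        qed
        moreover have "?pT u - ?pT s \<in> T"
          using subsp(3)[OF stab_subspace[OF sts(3)]] rep_hom_in[OF hT u] rep_hom_in[OF hT sU] by blast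
        ultimately have "u - s \<in> ?W" using s(3) by blast
        moreover have "u = s + (u - s)" by simp
        ultimately show "u \<in> {x + y |x y. x \<in> S \<and> y \<in> ?W}" using s(1) by blast
      qed
    qed
    ultimately have "splits G act U S ?W" using sts stW unfolding splits_def by blast
    then have "dec G act R (Suc n')" using dec_complement[OF la sp] dW by blast
    then show ?thesis using n'(1) by blast
  qed
qed

theorem dec_unique:
  assumes la: "lin_act G act" and B: "finite B"
  shows "dec G act U n \<Longrightarrow> U \<subseteq> fvs.span B \<Longrightarrow> dec G act U m \<Longrightarrow> n = m"
proof (induction arbitrary: m rule: dec.induct)
  case zero
  from zero(2) show ?case
  proof cases
    case (step S R n)
    have "S \<subseteq> {0}" by (rule splits_subset(1)[OF step(2)])
    then have "S = {0}" using splits_0[OF step(2)] by blast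
    then show ?thesis using step(3) by (simp add: indec_def)
  qed simp
next
  case (step U S R n)
  obtain m' where m': "m = Suc m'" "dec G act R m'"
    using dec_exchange[OF la B step(6) step(5) step(1,2)] by blast
  have "R \<subseteq> fvs.span B" using splits_subset[OF step(1)] step(5) by blast
  then show ?case using step(4) m' by blast
qed

section \<open>Tensor products of the natural representation and its twist\<close>

text \<open>
  Letters index basis vectors of the natural representation, of its Frobenius twist, and of
  two copies of the trivial representation.
\<close>

datatype letter = VL 2 | FL 2 | TL bool

lemma UNIV_letter: "UNIV = {VL 1, VL 2, FL 1, FL 2, TL False, TL True}"
proof -
  have "x \<in> {VL 1, VL 2, FL 1, FL 2, TL False, TL True}" for x
    using exhaust_2 by (cases x) auto
  then show ?thesis by blast
qed

instance letter :: finite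
  by standard (simp add: UNIV_letter)

definition lcoef :: "'a::field ^ 2 ^ 2 \<Rightarrow> letter \<Rightarrow> letter \<Rightarrow> 'a" where
  "lcoef A x y = (case x of
      VL p \<Rightarrow> (case y of VL q \<Rightarrow> A $ p $ q | _ \<Rightarrow> 0)
    | FL p \<Rightarrow> (case y of FL q \<Rightarrow> (A $ p $ q)\<^sup>2 | _ \<Rightarrow> 0)
    | TL b \<Rightarrow> (case y of TL c \<Rightarrow> of_bool (b = c) | _ \<Rightarrow> 0))"

fun wcoef :: "'a::field ^ 2 ^ 2 \<Rightarrow> letter list \<Rightarrow> letter list \<Rightarrow> 'a" where
  "wcoef A [] [] = 1"
| "wcoef A (x # w) (y # v) = lcoef A x y * wcoef A w v"
| "wcoef A _ _ = 0"

text \<open>A single action on all functions of words: every mixed tensor product of V, its twist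
  and trivial factors occurs inside it as the functions supported on some
  \<open>lword Cs\<close>.\<close>

definition wact :: "'a::field ^ 2 ^ 2 \<Rightarrow> (letter list \<Rightarrow> 'a) \<Rightarrow> (letter list \<Rightarrow> 'a)" where
  "wact A t = (\<lambda>w. \<Sum>v | length v = length w. wcoef A w v * t v)"

text \<open>The component of a tensor along the leading basis vector \<open>x\<close>; arguments
  about tensors recurse on the first factor through it.\<close>

definition slice :: "letter \<Rightarrow> (letter list \<Rightarrow> 'a) \<Rightarrow> (letter list \<Rightarrow> 'a)" where
  "slice x t = (\<lambda>w. t (x # w))"

definition supp :: "'b set \<Rightarrow> ('b \<Rightarrow> 'a::field) set" where
  "supp W = {t. \<forall>w. w \<notin> W \<longrightarrow> t w = 0}"

lemma wact_Nil [simp]: "wact A t [] = t []"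
proof -
  have "{v::letter list. v = []} = {[]}" by auto
  then show ?thesis by (simp add: wact_def)
qed

lemma wact_Cons: "wact A t (x # w) = (\<Sum>y\<in>UNIV. lcoef A x y * wact A (slice y t) w)"
proof -
  have eq: "{v::letter list. length v = length (x # w)} = (\<lambda>(j, v). j # v) ` (UNIV \<times> {v. length v = length w})"
    by (auto simp: image_iff length_Suc_conv)
  have inj: "inj_on (\<lambda>(j, v). j # v) (UNIV \<times> {v::letter list. length v = length w})"
    by (auto simp: inj_on_def)
  have "wact A t (x # w) = (\<Sum>(j, v)\<in>UNIV \<times> {v. length v = length w}. lcoef A x j * (wcoef A w v * t (j # v)))"
    unfolding wact_def eq by (subst sum.reindex[OF inj]) (auto intro!: sum.cong simp: mult.assoc)
  also have "\<dots> = (\<Sum>y\<in>UNIV. lcoef A x y * wact A (slice y t) w)"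
    by (simp add: sum.cartesian_product[symmetric] wact_def slice_def sum_distrib_left)
  finally show ?thesis .
qed

lemma wact_VL: "wact A t (VL p # w) = A $ p $ 1 * wact A (slice (VL 1) t) w + A $ p $ 2 * wact A (slice (VL 2) t) w"
  by (simp add: wact_Cons UNIV_letter lcoef_def)

lemma wact_FL: "wact A t (FL p # w) = (A $ p $ 1)\<^sup>2 * wact A (slice (FL 1) t) w + (A $ p $ 2)\<^sup>2 * wact A (slice (FL 2) t) w"
  by (simp add: wact_Cons UNIV_letter lcoef_def)

lemma wact_TL: "wact A t (TL b # w) = wact A (slice (TL b) t) w"
  by (cases b) (simp_all add: wact_Cons UNIV_letter lcoef_def)

lemma wact_add: "wact A (t + u) = wact A t + wact A u"
  by (auto simp: wact_def fun_eq_iff algebra_simps sum.distrib)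

lemma wact_scale: "wact A (fscale c t) = fscale c (wact A t)"
  by (auto simp: wact_def fscale_def fun_eq_iff algebra_simps sum_distrib_left)

lemma lin_act_wact: "lin_act G wact"
  by (simp add: lin_act_def lin_on_def wact_add wact_scale)

lemma wact_zero [simp]: "wact A 0 = 0"
  by (simp add: wact_def fun_eq_iff)

lemma slice_add [simp]: "slice x (t + u) = slice x t + slice x u"
  and slice_scale [simp]: "slice x (fscale c t) = fscale c (slice x t)"
  and slice_zero [simp]: "slice x 0 = 0"
  by (simp_all add: slice_def fscale_def fun_eq_iff)

lemma supp_subspace: "fvs.subspace (supp W)"
  by (auto simp: fvs.subspace_def supp_def fscale_def)

text \<open>The letter sets that occur as tensor factors later. All that matters is that each spans
  a subrepresentation, which is \<open>closed_letters_lcoef\<close>.\<close>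

definition closed_letters :: "letter set \<Rightarrow> bool" where
  "closed_letters C \<longleftrightarrow> C \<in> {range VL, range FL \<union> range TL, range VL \<union> range TL, {TL False}, {TL True}}"

lemma closed_letters_lcoef:
  "closed_letters C \<Longrightarrow> x \<notin> C \<Longrightarrow> y \<in> C \<Longrightarrow> lcoef A x y = 0"
  by (cases x; cases y) (auto simp: closed_letters_def lcoef_def)

text \<open>Basis words of the tensor product whose factors are spanned by the letter sets in
  \<open>Cs\<close>.\<close>

definition lword :: "letter set list \<Rightarrow> letter list set" where
  "lword Cs = {w. list_all2 (\<lambda>x C. x \<in> C) w Cs}"

lemma lword_Nil [simp]: "w \<in> lword [] \<longleftrightarrow> w = []"
  and lword_Cons [simp]: "x # w \<in> lword (C # Cs) \<longleftrightarrow> x \<in> C \<and> w \<in> lword Cs"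
  and lword_Nil_Cons [simp]: "[] \<notin> lword (C # Cs)"
  by (auto simp: lword_def)

lemma lword_length: "w \<in> lword Cs \<Longrightarrow> length w = length Cs"
  by (auto simp: lword_def list_all2_lengthD)

lemma finite_lword: "finite (lword Cs)"
  by (rule finite_subset[OF _ finite_words[of "length Cs"]]) (auto simp: lword_length)

lemma supp_lword_zero: "t \<in> supp W \<Longrightarrow> w \<notin> W \<Longrightarrow> t w = 0"
  by (simp add: supp_def)

lemma supp_Cons_iff:
  "t \<in> supp (lword (C # Cs)) \<longleftrightarrow> t [] = 0 \<and> (\<forall>x. if x \<in> C then slice x t \<in> supp (lword Cs) else slice x t = 0)"
    (is "?l = ?r")
proof
  show "?l \<Longrightarrow> ?r" by (auto simp: supp_def slice_def fun_eq_iff)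
next
  assume r: ?r
  have "t w = 0" if w: "w \<notin> lword (C # Cs)" for w
  proof -
    show "t w = 0"
    proof (cases w)
      case (Cons x v)
      have "slice x t v = 0"
      proof (cases "x \<in> C")
        case True
        then have "slice x t \<in> supp (lword Cs)" "v \<notin> lword Cs" using r w Cons by auto
        then show ?thesis by (rule supp_lword_zero)
      next
        case False
        then have "slice x t = 0" using r by meson
        then show ?thesis by simp
      qed
      then show ?thesis by (simp add: Cons slice_def)
    qed (use r in simp)
  qed
  then show ?l by (simp add: supp_def)
qed

lemma supp_slice: "t \<in> supp (lword (C # Cs)) \<Longrightarrow> slice x t \<in> supp (lword Cs)"
  by (auto simp: supp_def slice_def)

lemma wact_supp:
  assumes "\<forall>C\<in>set Cs. closed_letters C" and "t \<in> supp (lword Cs)"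
  shows "wact A t \<in> supp (lword Cs)"
  using assms
proof (induction Cs arbitrary: t)
  case Nil
  show ?case unfolding supp_def
  proof (intro CollectI allI impI)
    fix w :: "letter list" assume "w \<notin> lword []"
    then obtain x v where w: "w = x # v" by (cases w) auto
    have "slice y t = 0" for y using Nil(2) by (auto simp: supp_def slice_def fun_eq_iff)
    then show "wact A t w = 0" unfolding w wact_Cons by simp
  qed
next
  case (Cons C Cs)
  show ?case unfolding supp_def
  proof (intro CollectI allI impI)
    fix w :: "letter list" assume nw: "w \<notin> lword (C # Cs)"
    show "wact A t w = 0"
    proof (cases w)
      case Nil
      then show ?thesis using Cons(3) by (simp add: supp_Cons_iff)
    next
      case w: (Cons x v)
      have "lcoef A x y * wact A (slice y t) v = 0" for y
      proof (cases "y \<in> C")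
        case yC: True
        show ?thesis
        proof (cases "x \<in> C")
          case True
          then have "v \<notin> lword Cs" using nw w by simp
          moreover have "wact A (slice y t) \<in> supp (lword Cs)" using Cons supp_slice[OF Cons(3)] by simp
          ultimately show ?thesis by (simp add: supp_def)
        next
          case False
          then show ?thesis using closed_letters_lcoef[of C x y A] yC Cons(2) by simp
        qed
      next
        case False
        then have "slice y t = 0" using Cons(3) unfolding supp_Cons_iff by meson
        then show ?thesis by simp
      qed
      then show ?thesis unfolding w wact_Cons by (meson sum.neutral)
    qed
  qed
qed

lemma stab_lword: "\<forall>C\<in>set Cs. closed_letters C \<Longrightarrow> stab G wact (supp (lword Cs))"
  unfolding stab_def using supp_subspace wact_supp by blast

text \<open>Renaming basis vectors by \<psi> is an isomorphism once both actions have the same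
  matrix \<open>k\<close>. It serves the Frobenius twist and the passage from words over
  \<open>VL\<close> to \<open>tensor_power\<close>.\<close>

lemma rep_iso_reindex:
  fixes act :: "'g \<Rightarrow> ('b \<Rightarrow> 'a::field) \<Rightarrow> ('b \<Rightarrow> 'a)" and act' :: "'g \<Rightarrow> ('c \<Rightarrow> 'a) \<Rightarrow> ('c \<Rightarrow> 'a)"
  assumes b: "bij_betw \<psi> W' W"
    and act: "\<And>A t w. A \<in> G \<Longrightarrow> t \<in> supp W \<Longrightarrow> w \<in> W \<Longrightarrow> act A t w = (\<Sum>v\<in>W. k A w v * t v)"
    and act': "\<And>A t w. A \<in> G \<Longrightarrow> t \<in> supp W' \<Longrightarrow> act' A t w = (if w \<in> W' then \<Sum>v\<in>W'. k A (\<psi> w) (\<psi> v) * t v else 0)"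
  shows "rep_iso G act (supp W) act' (supp W') (\<lambda>t w. if w \<in> W' then t (\<psi> w) else 0)"
proof -
  let ?T = "\<lambda>t w. if w \<in> W' then t (\<psi> w) else 0 :: 'a"
  let ?S = "\<lambda>t w. if w \<in> W then t (inv_into W' \<psi> w) else 0 :: 'a"
  have \<psi>: "\<psi> w \<in> W" if "w \<in> W'" for w using b that by (auto simp: bij_betw_def)
  have \<psi>': "inv_into W' \<psi> w \<in> W'" "\<psi> (inv_into W' \<psi> w) = w" if "w \<in> W" for w
    using b that by (auto simp: bij_betw_def inv_into_into f_inv_into_f)
  have \<psi>'': "inv_into W' \<psi> (\<psi> w) = w" if "w \<in> W'" for w
    using b that by (auto simp: bij_betw_def)
  have TU: "?T t \<in> supp W'" for t by (simp add: supp_def)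
  have "lin_on (supp W) ?T"
    unfolding lin_on_def by (auto simp: fun_eq_iff fscale_def)
  moreover have "?T (act A t) = act' A (?T t)" if "A \<in> G" "t \<in> supp W" for A t
  proof
    fix w
    show "?T (act A t) w = act' A (?T t) w"
    proof (cases "w \<in> W'")
      case True
      have "?T (act A t) w = (\<Sum>v\<in>W. k A (\<psi> w) v * t v)" using True act[OF that \<psi>[OF True]] by simp
      also have "\<dots> = (\<Sum>v\<in>W'. k A (\<psi> w) (\<psi> v) * t (\<psi> v))"
        by (rule sum.reindex_bij_betw[OF b, symmetric])
      also have "\<dots> = act' A (?T t) w" using True act'[OF that(1) TU] by simp
      finally show ?thesis .
    next
      case False
      then show ?thesis using act'[OF that(1) TU] by simp
    qed
  qed
  moreover have "bij_betw ?T (supp W) (supp W')"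
  proof (rule bij_betw_byWitness[where f' = ?S])
    show "\<forall>t\<in>supp W. ?S (?T t) = t" using \<psi>' by (auto simp: fun_eq_iff supp_def)
    show "\<forall>t\<in>supp W'. ?T (?S t) = t" using \<psi> \<psi>'' by (auto simp: fun_eq_iff supp_def)
    show "?T ` supp W \<subseteq> supp W'" using TU by blast
    show "?S ` supp W' \<subseteq> supp W" by (auto simp: supp_def)
  qed
  ultimately show ?thesis using TU by (simp add: rep_iso_def rep_hom_def)
qed

lemma wact_lword:
  assumes t: "t \<in> supp (lword Cs)" and w: "length w = length Cs"
  shows "wact A t w = (\<Sum>v\<in>lword Cs. wcoef A w v * t v)"
proof -
  have "(\<Sum>v\<in>lword Cs. wcoef A w v * t v) = wact A t w"
    unfolding wact_def
    by (rule sum.mono_neutral_left) (use t w finite_words in \<open>auto simp: supp_def lword_length\<close>)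
  then show ?thesis by simp
qed

text \<open>Tensoring with the identity of the space spanned by \<open>C\<close> on the left:
  \<open>ext\<close> applies a map to each slice along a letter of \<open>C\<close>.\<close>

lemma rep_iso_Cons:
  fixes T :: "(letter list \<Rightarrow> 'a::field) \<Rightarrow> letter list \<Rightarrow> 'a"
  assumes iso: "rep_iso G wact (supp (lword Cs)) wact (supp (lword Ds)) T" and C: "closed_letters C"
    and st: "\<forall>C\<in>set Cs. closed_letters C"
  shows "\<exists>T'. rep_iso G wact (supp (lword (C # Cs)) :: (letter list \<Rightarrow> 'a::field) set) wact (supp (lword (C # Ds))) T'"
proof -
  define ext :: "((letter list \<Rightarrow> 'a) \<Rightarrow> letter list \<Rightarrow> 'a) \<Rightarrow> (letter list \<Rightarrow> 'a) \<Rightarrow> letter list \<Rightarrow> 'a"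
    where "ext = (\<lambda>T t w. case w of [] \<Rightarrow> 0 | x # v \<Rightarrow> if x \<in> C then T (slice x t) v else (0 :: 'a))"
  have h: "rep_hom G wact (supp (lword Cs)) wact (supp (lword Ds)) T" and b: "bij_betw T (supp (lword Cs)) (supp (lword Ds))"
    using iso by (auto simp: rep_iso_def)
  let ?S = "inv_into (supp (lword Cs)) T"
  have bS: "bij_betw ?S (supp (lword Ds)) (supp (lword Cs))" by (rule bij_betw_inv_into[OF b])
  have l: "lin_on (supp (lword Cs)) T" by (rule rep_hom_lin[OF h])
  have sl: "slice x (ext T t) = (if x \<in> C then T (slice x t) else 0)" for x T and t :: "letter list \<Rightarrow> 'a"
    by (auto simp: ext_def slice_def fun_eq_iff)
  have nil: "ext T t [] = 0" for T t by (simp add: ext_def)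
  have memb: "ext T t \<in> supp (lword (C # Ds))" if "t \<in> supp (lword (C # Cs))" "T ` supp (lword Cs) \<subseteq> supp (lword Ds)" for t T Cs Ds
    using that supp_slice[OF that(1)] unfolding supp_Cons_iff sl by (auto simp: nil)
  have eqI: "t = u" if "t [] = u []" "\<And>x. slice x t = slice x u" for t u :: "letter list \<Rightarrow> 'a"
  proof
    fix w show "t w = u w"
    proof (cases w)
      case (Cons x v)
      show ?thesis using fun_cong[OF that(2)[of x], of v] by (simp add: slice_def Cons)
    qed (simp add: that)
  qed
  have sub: "T ` supp (lword Cs) \<subseteq> supp (lword Ds)" "?S ` supp (lword Ds) \<subseteq> supp (lword Cs)"
    using b bS by (auto simp: bij_betw_def)
  have lin: "lin_on (supp (lword (C # Cs))) (ext T)"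
    unfolding lin_on_def
  proof (intro conjI ballI allI)
    fix t u :: "letter list \<Rightarrow> 'a" assume tu: "t \<in> supp (lword (C # Cs))" "u \<in> supp (lword (C # Cs))"
    show "ext T (t + u) = ext T t + ext T u"
      by (rule eqI) (use lin_on_add[OF l supp_slice[OF tu(1)] supp_slice[OF tu(2)]] in \<open>simp_all add: sl nil\<close>)
  next
    fix c :: 'a and t :: "letter list \<Rightarrow> 'a" assume t: "t \<in> supp (lword (C # Cs))"
    show "ext T (fscale c t) = fscale c (ext T t)"
    proof (rule eqI)
      show "ext T (fscale c t) [] = fscale c (ext T t) []" by (simp add: nil fscale_def)
      show "slice x (ext T (fscale c t)) = slice x (fscale c (ext T t))" for x
        using lin_on_scale[OF l supp_slice[OF t], of c x] by (simp add: sl)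
    qed
  qed
  have eqv: "ext T (wact A t) = wact A (ext T t)" if A: "A \<in> G" and t: "t \<in> supp (lword (C # Cs))" for A t
  proof
    fix w show "ext T (wact A t) w = wact A (ext T t) w"
    proof (cases w)
      case Nil
      then show ?thesis by (simp add: nil)
    next
      case (Cons x v)
      have ss: "slice y t \<in> supp (lword Cs)" for y by (rule supp_slice[OF t])
      have z: "slice y t = 0" if "y \<notin> C" for y using t that unfolding supp_Cons_iff by meson
      have T0: "T 0 = 0" using lin_on_zero[OF l ss] .
      have T1: "T (slice y t) = slice y (ext T t)" for y using z T0 by (auto simp: sl)
      have sw: "slice x (wact A t) = (\<Sum>y\<in>UNIV. fscale (lcoef A x y) (wact A (slice y t)))" for x
        by (simp add: slice_def wact_Cons fun_eq_iff sum_tensor_apply fscale_def)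
      have ws: "wact A (slice y t) \<in> supp (lword Cs)" for y by (rule wact_supp[OF st ss])
      have sm: "T (\<Sum>y\<in>Y. fscale (lcoef A x y) (wact A (slice y t))) = (\<Sum>y\<in>Y. fscale (lcoef A x y) (T (wact A (slice y t))))"
        if "finite Y" for Y using that
      proof induction
        case empty
        show ?case unfolding sum.empty by (rule T0)
      next
        case (insert y Y)
        have "(\<Sum>y\<in>Y. fscale (lcoef A x y) (wact A (slice y t))) \<in> supp (lword Cs)"
          by (intro fvs.subspace_sum supp_subspace fvs.subspace_scale ws)
        then have "T (\<Sum>y\<in>insert y Y. fscale (lcoef A x y) (wact A (slice y t)))
            = T (fscale (lcoef A x y) (wact A (slice y t))) + T (\<Sum>y\<in>Y. fscale (lcoef A x y) (wact A (slice y t)))"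
          unfolding sum.insert[OF insert(1,2)]
          by (intro lin_on_add[OF l] fvs.subspace_scale[OF supp_subspace ws])
        also have "\<dots> = (\<Sum>y\<in>insert y Y. fscale (lcoef A x y) (T (wact A (slice y t))))"
          unfolding sum.insert[OF insert(1,2)] insert(3) lin_on_scale[OF l ws] ..
        finally show ?case .
      qed
      show ?thesis
      proof (cases "x \<in> C")
        case True
        have "ext T (wact A t) w = slice x (ext T (wact A t)) v" by (simp add: slice_def Cons)
        also have "\<dots> = T (\<Sum>y\<in>UNIV. fscale (lcoef A x y) (wact A (slice y t))) v"
          using True sl sw by metis
        also have "\<dots> = (\<Sum>y\<in>UNIV. fscale (lcoef A x y) (wact A (slice y (ext T t)))) v"
          unfolding sm[OF finite] rep_hom_act[OF h A ss] T1 ..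
        also have "\<dots> = wact A (ext T t) w"
          by (simp add: sum_tensor_apply fscale_def wact_Cons Cons)
        finally show ?thesis .
      next
        case False
        have "lcoef A x y * wact A (slice y (ext T t)) v = 0" for y
          using closed_letters_lcoef[OF C False, of y A] sl by (cases "y \<in> C") auto
        then have "wact A (ext T t) w = 0" unfolding Cons wact_Cons by (meson sum.neutral)
        then show ?thesis by (simp add: Cons ext_def False)
      qed
    qed
  qed
  have "bij_betw (ext T) (supp (lword (C # Cs))) (supp (lword (C # Ds)))"
  proof (rule bij_betw_byWitness[where f' = "ext ?S"])
    show "\<forall>t\<in>supp (lword (C # Cs)). ext ?S (ext T t) = t"
    proof
      fix t :: "letter list \<Rightarrow> 'a" assume t: "t \<in> supp (lword (C # Cs))"
      have 1: "ext ?S (ext T t) [] = t []" using t by (simp add: nil supp_Cons_iff)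
      have "?S (T (slice x t)) = slice x t" for x using bij_betw_inv_into_left[OF b supp_slice[OF t]] .
      moreover have "slice x t = 0" if "x \<notin> C" for x using t that unfolding supp_Cons_iff by meson
      ultimately have 2: "slice x (ext ?S (ext T t)) = slice x t" for x by (cases "x \<in> C") (simp_all add: sl)
      show "ext ?S (ext T t) = t" by (rule eqI[OF 1 2])
    qed
    show "\<forall>t\<in>supp (lword (C # Ds)). ext T (ext ?S t) = t"
    proof
      fix t :: "letter list \<Rightarrow> 'a" assume t: "t \<in> supp (lword (C # Ds))"
      have 1: "ext T (ext ?S t) [] = t []" using t by (simp add: nil supp_Cons_iff)
      have "T (?S (slice x t)) = slice x t" for x using bij_betw_inv_into_right[OF b supp_slice[OF t]] .
      moreover have "slice x t = 0" if "x \<notin> C" for x using t that unfolding supp_Cons_iff by meson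
      ultimately have 2: "slice x (ext T (ext ?S t)) = slice x t" for x by (cases "x \<in> C") (simp_all add: sl)
      show "ext T (ext ?S t) = t" by (rule eqI[OF 1 2])
    qed
    show "ext T ` supp (lword (C # Cs)) \<subseteq> supp (lword (C # Ds))" using memb sub by blast
    show "ext ?S ` supp (lword (C # Ds)) \<subseteq> supp (lword (C # Cs))" using memb sub by blast
  qed
  then have "rep_iso G wact (supp (lword (C # Cs))) wact (supp (lword (C # Ds))) (ext T)"
    unfolding rep_iso_def rep_hom_def using lin eqv memb sub by blast
  then show ?thesis by blast
qed

abbreviation "VS \<equiv> range VL"
abbreviation "FT \<equiv> range FL \<union> range TL"
abbreviation "VT \<equiv> range VL \<union> range TL"

lemma closed_letters_simps [simp]: "closed_letters VS" "closed_letters FT" "closed_letters VT" "closed_letters {TL b}"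
  by (cases b; simp add: closed_letters_def)+

lemma char2:
  assumes "CHAR('a::field) = 2"
  shows "(2::'a) = 0" "(x::'a) + x = 0" "- x = x" "x - y = x + (y::'a)"
proof -
  have "of_nat 2 = (0::'a)" using assms of_nat_CHAR by metis
  then show 1: "(2::'a) = 0" by simp
  then show 2: "x + x = 0" for x :: 'a by (metis mult_2 mult_zero_left)
  then show "- x = x" by (metis add_eq_0_iff)
  then show "x - y = x + y" by (metis 2 add_eq_0_iff diff_conv_add_uminus)
qed

lemma dec_add:
  assumes la: "lin_act G act"
  shows "dec G act P n \<Longrightarrow> splits G act U P Q \<Longrightarrow> dec G act Q m \<Longrightarrow> dec G act U (n + m)"
proof (induction arbitrary: U rule: dec.induct)
  case zero
  have "U = Q"
  proof
    show "U \<subseteq> Q" using zero(1) unfolding splits_def by auto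
    show "Q \<subseteq> U" by (rule splits_subset(2)[OF zero(1)])
  qed
  then show ?case using zero(2) by simp
next
  case (step P S R n)
  note spU = step(5) and spP = step(1)
  have st: "stab G act S" "stab G act R" "stab G act P" "stab G act Q"
    using spU spP by (auto simp: splits_def)
  note sub = splits_subset[OF spP]
  let ?W = "{x + y |x y. x \<in> R \<and> y \<in> Q}"
  have "R \<inter> Q \<subseteq> P \<inter> Q" using sub by blast
  then have "R \<inter> Q = {0}" using spU stab_0[OF st(2)] stab_0[OF st(4)] unfolding splits_def by blast
  then have spW: "splits G act ?W R Q" using st unfolding splits_def by blast
  have dW: "dec G act ?W (n + m)" by (rule step(4)[OF spW step(6)])
  have stW: "stab G act ?W" by (rule splits_stab[OF la spW])
  have "S \<inter> ?W \<subseteq> {0}"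
  proof
    fix s assume s: "s \<in> S \<inter> ?W"
    then obtain x y where xy: "s = x + y" "x \<in> R" "y \<in> Q" by blast
    have "s - x \<in> P" using s xy sub subsp(3)[OF stab_subspace[OF st(3)]] by blast
    moreover have "s - x = y" using xy by simp
    ultimately have "y = 0" using splits_Int[OF spU] xy by metis
    then have "s = x" using xy by simp
    then have "s = 0" using splits_Int[OF spP, of s] s xy by blast
    then show "s \<in> {0}" by (rule ssubst) (rule singletonI)
  qed
  moreover have "0 \<in> S \<inter> ?W" using stab_0[OF st(1)] stab_0[OF stW] by blast
  moreover have "U = {x + y |x y. x \<in> S \<and> y \<in> ?W}"
  proof
    show "U \<subseteq> {x + y |x y. x \<in> S \<and> y \<in> ?W}"
    proof
      fix u assume "u \<in> U"
      then obtain p q where pq: "u = p + q" "p \<in> P" "q \<in> Q" by (rule splits_decomp[OF spU])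
      obtain s r where sr: "p = s + r" "s \<in> S" "r \<in> R" by (rule splits_decomp[OF spP pq(2)])
      have "u = s + (r + q)" using pq sr by (simp add: add.assoc)
      then show "u \<in> {x + y |x y. x \<in> S \<and> y \<in> ?W}" using pq sr by blast
    qed
    show "{x + y |x y. x \<in> S \<and> y \<in> ?W} \<subseteq> U"
    proof clarify
      fix s r q assume a: "s \<in> S" "r \<in> R" "q \<in> Q"
      have "s + r \<in> P" using a sub subsp(2)[OF stab_subspace[OF st(3)]] by blast
      moreover have "s + (r + q) = (s + r) + q" by (simp add: add.assoc)
      ultimately show "s + (r + q) \<in> U" using spU a unfolding splits_def by blast
    qed
  qed
  ultimately have "splits G act U S ?W" using st stW unfolding splits_def by blast
  from dec.step[OF this step(2) dW] show ?case by simp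
qed

lemma splits_supp:
  fixes act :: "'g \<Rightarrow> ('b \<Rightarrow> 'a::field) \<Rightarrow> ('b \<Rightarrow> 'a)"
  assumes "W1 \<inter> W2 = {}" "stab G act (supp W1)" "stab G act (supp W2)"
  shows "splits G act (supp (W1 \<union> W2)) (supp W1) (supp W2)"
proof -
  have "t w = 0" if "t \<in> supp W1" "t \<in> supp W2" for t :: "'b \<Rightarrow> 'a" and w
    using that assms(1) unfolding supp_def by blast
  then have z: "t = 0" if "t \<in> supp W1" "t \<in> supp W2" for t :: "'b \<Rightarrow> 'a" using that by (auto simp: fun_eq_iff)
  have "supp W1 \<inter> supp W2 \<subseteq> {0 :: 'b \<Rightarrow> 'a}"
  proof
    fix t :: "'b \<Rightarrow> 'a" assume "t \<in> supp W1 \<inter> supp W2"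
    then have "t = 0" by (intro z) simp_all
    then show "t \<in> {0}" by (rule ssubst) (rule singletonI)
  qed
  moreover have "{0} \<subseteq> supp W1 \<inter> supp W2" by (simp add: supp_def)
  ultimately have "supp W1 \<inter> supp W2 = {0 :: 'b \<Rightarrow> 'a}" by (rule equalityI)
  moreover have "(supp (W1 \<union> W2) :: ('b \<Rightarrow> 'a) set) = {x + y |x y. x \<in> supp W1 \<and> y \<in> supp W2}"
  proof
    show "{x + y |x y. x \<in> supp W1 \<and> y \<in> supp W2} \<subseteq> (supp (W1 \<union> W2) :: ('b \<Rightarrow> 'a) set)" by (auto simp: supp_def)
    show "(supp (W1 \<union> W2) :: ('b \<Rightarrow> 'a) set) \<subseteq> {x + y |x y. x \<in> supp W1 \<and> y \<in> supp W2}"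
    proof
      fix t :: "'b \<Rightarrow> 'a" assume t: "t \<in> supp (W1 \<union> W2)"
      let ?x = "\<lambda>w. if w \<in> W1 then t w else 0" and ?y = "\<lambda>w. if w \<in> W1 then 0 else t w"
      have "t = ?x + ?y" "?x \<in> supp W1" "?y \<in> supp W2" using t by (auto simp: supp_def fun_eq_iff)
      then show "t \<in> {x + y |x y. x \<in> supp W1 \<and> y \<in> supp W2}" by blast
    qed
  qed
  ultimately show ?thesis using assms by (simp add: splits_def)
qed

lemma lword_union:
  "lword (Ps @ (C \<union> D) # Cs) = lword (Ps @ C # Cs) \<union> lword (Ps @ D # Cs)"
  by (auto simp: lword_def list_all2_append2 list_all2_Cons2)

lemma lword_disjoint:
  "C \<inter> D = {} \<Longrightarrow> lword (Ps @ C # Cs) \<inter> lword (Ps @ D # Cs) = {}"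
proof (induction Ps)
  case Nil
  then show ?case by (auto simp: lword_def list_all2_Cons2)
next
  case (Cons P Ps)
  have "w \<notin> lword ((P # Ps) @ D # Cs)" if "w \<in> lword ((P # Ps) @ C # Cs)" for w
  proof (cases w)
    case (Cons x v)
    then show ?thesis using that Cons.IH[OF Cons.prems] by auto
  qed (use that in simp)
  then show ?case by blast
qed

lemma rep_iso_prefix:
  fixes T :: "(letter list \<Rightarrow> 'a::field) \<Rightarrow> letter list \<Rightarrow> 'a"
  assumes "rep_iso G wact (supp (lword Cs)) wact (supp (lword Ds)) T"
    and "\<forall>C\<in>set Cs. closed_letters C" "\<forall>C\<in>set Ps. closed_letters C"
  shows "\<exists>T'. rep_iso G wact (supp (lword (Ps @ Cs)) :: (letter list \<Rightarrow> 'a) set) wact (supp (lword (Ps @ Ds))) T'"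
  using assms(3)
proof (induction Ps)
  case Nil
  then show ?case using assms(1) by auto
next
  case (Cons C Ps)
  then obtain T' :: "(letter list \<Rightarrow> 'a) \<Rightarrow> letter list \<Rightarrow> 'a"
    where "rep_iso G wact (supp (lword (Ps @ Cs))) wact (supp (lword (Ps @ Ds))) T'" by auto
  from rep_iso_Cons[OF this, of C] show ?case using Cons(2) assms(2) by auto
qed

lemma word_eqI: "t [] = u [] \<Longrightarrow> (\<And>x. slice x t = slice x u) \<Longrightarrow> t = u"
proof
  fix w assume a: "t [] = u []" "\<And>x. slice x t = slice x u"
  show "t w = u w"
  proof (cases w)
    case (Cons x v)
    show ?thesis using fun_cong[OF a(2)[of x], of v] by (simp add: slice_def Cons)
  qed (simp add: a)
qed

lemma rep_iso_trivial:
  "rep_iso G wact (supp (lword ({TL b} # Cs)) :: (letter list \<Rightarrow> 'a::field) set) wact (supp (lword Cs)) (slice (TL b))"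
proof -
  let ?T = "slice (TL b) :: (letter list \<Rightarrow> 'a) \<Rightarrow> _"
  define S :: "(letter list \<Rightarrow> 'a) \<Rightarrow> letter list \<Rightarrow> 'a"
    where "S = (\<lambda>t w. case w of [] \<Rightarrow> 0 | x # v \<Rightarrow> if x = TL b then t v else 0)"
  have sS: "slice x (S t) = (if x = TL b then t else 0)" and S0: "S t [] = 0" for x t
    by (auto simp: slice_def S_def fun_eq_iff)
  have "bij_betw ?T (supp (lword ({TL b} # Cs))) (supp (lword Cs))"
  proof (rule bij_betw_byWitness[where f' = S])
    show "\<forall>t\<in>supp (lword ({TL b} # Cs)). S (?T t) = t"
    proof
      fix t :: "letter list \<Rightarrow> 'a" assume t: "t \<in> supp (lword ({TL b} # Cs))"
      show "S (?T t) = t"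
      proof (rule word_eqI)
        show "S (?T t) [] = t []" using t by (simp add: S0 supp_Cons_iff)
        show "slice x (S (?T t)) = slice x t" for x
          using t unfolding supp_Cons_iff sS by (cases "x = TL b") auto
      qed
    qed
    show "\<forall>t\<in>supp (lword Cs). ?T (S t) = t" by (simp add: sS)
    show "?T ` supp (lword ({TL b} # Cs)) \<subseteq> supp (lword Cs)" using supp_slice by blast
    have "S t \<in> supp (lword ({TL b} # Cs))" if "t \<in> supp (lword Cs)" for t
      unfolding supp_Cons_iff using that by (simp add: sS S0)
    then show "S ` supp (lword Cs) \<subseteq> supp (lword ({TL b} # Cs))" by blast
  qed
  moreover have "?T (wact A t) = wact A (?T t)" for A t
    by (simp add: fun_eq_iff slice_def[of _ "wact A t"] wact_TL)
  ultimately show ?thesis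
    unfolding rep_iso_def rep_hom_def lin_on_def using supp_slice by auto
qed

text \<open>
  The isomorphism from \<open>V \<otimes> (V\<^sup>F \<oplus> T \<oplus> T)\<close> to \<open>V \<otimes> V \<otimes> V\<close>, in coordinates. It sends
  \<open>x\<^sub>p \<otimes> y\<^sub>p\<close> to \<open>x\<^sub>p \<otimes> x\<^sub>p \<otimes> x\<^sub>p\<close> and \<open>x\<^sub>p \<otimes> y\<^sub>q\<close>, for \<open>p \<noteq> q\<close>, to the sum of
  the three products with one factor \<open>x\<^sub>p\<close> and two factors \<open>x\<^sub>q\<close>; on the trivial summands it inserts the
  invariant \<open>x\<^sub>1 \<otimes> x\<^sub>2 + x\<^sub>2 \<otimes> x\<^sub>1\<close> to the right or to the left of \<open>v \<in> V\<close>.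
\<close>

definition theta :: "(letter list \<Rightarrow> 'a::field) \<Rightarrow> letter list \<Rightarrow> 'a" where
  "theta t w = (case w of VL p # VL q # VL r # v \<Rightarrow>
      if p = q \<and> q = r then t (VL p # FL p # v)
      else if q = r then t (VL p # FL q # v) + t (VL q # TL True # v)
      else if p = r then t (VL q # FL p # v) + t (VL p # TL False # v) + t (VL p # TL True # v)
      else t (VL r # FL p # v) + t (VL p # TL False # v)
    | _ \<Rightarrow> 0)"

definition flip2 :: "2 \<Rightarrow> 2" where "flip2 p = (if p = 1 then 2 else 1)"

text \<open>Obtained by solving the equations of \<open>theta\<close>. Over the three words with one
  \<open>p\<close> and two \<open>q\<close>, the twist coefficient occurs three times and each
  invariant coefficient twice, so the total is the twist coefficient. Adding only two of the three
  cancels the twist and leaves one invariant coefficient.\<close>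

definition theta_inv :: "(letter list \<Rightarrow> 'a::field) \<Rightarrow> letter list \<Rightarrow> 'a" where
  "theta_inv u w = (case w of
      VL p # FL q # v \<Rightarrow> if p = q then u (VL p # VL p # VL p # v)
        else u (VL p # VL q # VL q # v) + u (VL q # VL p # VL q # v) + u (VL q # VL q # VL p # v)
    | VL p # TL b # v \<Rightarrow> u (VL p # VL (flip2 p) # VL p # v) +
        (if b then u (VL p # VL p # VL (flip2 p) # v) else u (VL (flip2 p) # VL p # VL p # v))
    | _ \<Rightarrow> 0)"

lemma slice_theta:
  "slice (VL r) (slice (VL q) (slice (VL p) (theta t))) =
     (if p = q \<and> q = r then slice (FL p) (slice (VL p) t)
      else if q = r then slice (FL q) (slice (VL p) t) + slice (TL True) (slice (VL q) t)
      else if p = r then slice (FL p) (slice (VL q) t) + slice (TL False) (slice (VL p) t) + slice (TL True) (slice (VL p) t)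
      else slice (FL p) (slice (VL r) t) + slice (TL False) (slice (VL p) t))"
  by (auto simp: slice_def theta_def fun_eq_iff)

lemma theta_wact:
  fixes A :: "'a::field ^ 2 ^ 2"
  assumes ch: "CHAR('a) = 2" and A: "det A = 1"
  shows "theta (wact A t) (VL p # VL q # VL r # v) = wact A (theta t) (VL p # VL q # VL r # v)"
proof -
  have d: "A $ 1 $ 1 * A $ 2 $ 2 + A $ 1 $ 2 * A $ 2 $ 1 = 1"
    using A by (simp add: det_2 char2(4)[OF ch])
  have pqr: "p = 1 \<or> p = 2" "q = 1 \<or> q = 2" "r = 1 \<or> r = 2" using exhaust_2 by auto
  \<comment> \<open>The determinant, which is 1, is inserted on trivial letters. Both sides then
    become homogeneous of the same degree in the entries of \<open>A\<close>, and equivariance is a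
    polynomial identity in characteristic 2.\<close>
  have TL: "wact A u (TL b # w) = (A $ 1 $ 1 * A $ 2 $ 2 + A $ 1 $ 2 * A $ 2 $ 1) * wact A (slice (TL b) u) w" for u b w
    by (simp add: d wact_TL)
  have cancel: "x + (x + y) = y" for x y :: 'a by (simp add: add.assoc[symmetric] char2[OF ch])
  note ex = theta_def wact_VL wact_FL TL slice_theta wact_add
  show ?thesis
    using pqr
    by (elim disjE) (simp_all add: ex char2[OF ch] cancel algebra_simps power2_eq_square)
qed


lemma theta_supp: "t \<in> supp (lword (VS # FT # Cs)) \<Longrightarrow> theta t \<in> supp (lword (VS # VS # VS # Cs))"
  by (auto simp: supp_def theta_def split: list.splits letter.splits)

lemma theta_inv_supp: "u \<in> supp (lword (VS # VS # VS # Cs)) \<Longrightarrow> theta_inv u \<in> supp (lword (VS # FT # Cs))"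
  by (auto simp: supp_def theta_inv_def split: list.splits letter.splits)

lemma theta_inv_theta:
  fixes t :: "letter list \<Rightarrow> 'a::field"
  assumes ch: "CHAR('a) = 2" and t: "t \<in> supp (lword (VS # FT # Cs))"
  shows "theta_inv (theta t) = t"
proof
  fix w
  have cancel: "x + (x + y) = y" for x y :: 'a by (simp add: add.assoc[symmetric] char2[OF ch])
  have two: "p = 1 \<or> p = 2" for p :: 2 using exhaust_2 by auto
  have 1: "theta_inv (theta t) (VL p # FL q # v) = t (VL p # FL q # v)" for p q v
    using two[of p] two[of q]
    by (elim disjE) (simp_all add: theta_inv_def theta_def flip2_def char2[OF ch] cancel ac_simps)
  have 2: "theta_inv (theta t) (VL p # TL b # v) = t (VL p # TL b # v)" for p b v
    using two[of p]
    by (elim disjE; cases b) (simp_all add: theta_inv_def theta_def flip2_def char2[OF ch] cancel ac_simps)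
  have 3: "theta_inv (theta t) w = 0 \<and> t w = 0" if "\<nexists>p x v. w = VL p # x # v \<and> x \<in> FT"
  proof
    have "w \<notin> lword (VS # FT # Cs)" using that by (auto simp: lword_def list_all2_Cons2)
    then show "t w = 0" by (rule supp_lword_zero[OF t])
    show "theta_inv (theta t) w = 0" using that by (auto simp: theta_inv_def split: list.splits letter.splits)
  qed
  show "theta_inv (theta t) w = t w"
  proof (cases "\<exists>p x v. w = VL p # x # v \<and> x \<in> FT")
    case True
    then show ?thesis using 1 2 by auto
  next
    case False
    then show ?thesis using 3 by simp
  qed
qed

lemma theta_theta_inv:
  fixes t :: "letter list \<Rightarrow> 'a::field"
  assumes ch: "CHAR('a) = 2" and t: "t \<in> supp (lword (VS # VS # VS # Cs))"
  shows "theta (theta_inv t) = t"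
proof
  fix w
  have cancel: "x + (x + y) = y" for x y :: 'a by (simp add: add.assoc[symmetric] char2[OF ch])
  have two: "p = 1 \<or> p = 2" for p :: 2 using exhaust_2 by auto
  have 1: "theta (theta_inv t) (VL p # VL q # VL r # v) = t (VL p # VL q # VL r # v)" for p q r v
    using two[of p] two[of q] two[of r]
    by (elim disjE) (simp_all add: theta_inv_def theta_def flip2_def char2[OF ch] cancel ac_simps)
  have 3: "theta (theta_inv t) w = 0 \<and> t w = 0" if "\<nexists>p q r v. w = VL p # VL q # VL r # v"
  proof
    have "w \<notin> lword (VS # VS # VS # Cs)" using that by (auto simp: lword_def list_all2_Cons2)
    then show "t w = 0" by (rule supp_lword_zero[OF t])
    show "theta (theta_inv t) w = 0" using that by (auto simp: theta_def split: list.splits letter.splits)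
  qed
  show "theta (theta_inv t) w = t w"
  proof (cases "\<exists>p q r v. w = VL p # VL q # VL r # v")
    case True
    then show ?thesis using 1 by auto
  next
    case False
    then show ?thesis using 3 by simp
  qed
qed

lemma theta_add: "theta (t + u) = theta t + theta u"
  by (auto simp: theta_def fun_eq_iff split: list.splits letter.splits)

lemma theta_scale: "theta (fscale c t) = fscale c (theta t)"
  by (auto simp: theta_def fun_eq_iff fscale_def algebra_simps split: list.splits letter.splits)

lemma rep_iso_theta:
  assumes ch: "CHAR('a::field) = 2" and Cs: "\<forall>C\<in>set Cs. closed_letters C"
  shows "rep_iso (SL2 :: ('a ^ 2 ^ 2) set) wact (supp (lword (VS # FT # Cs))) wact (supp (lword (VS # VS # VS # Cs))) theta"
proof -
  have "bij_betw theta (supp (lword (VS # FT # Cs)) :: (letter list \<Rightarrow> 'a) set) (supp (lword (VS # VS # VS # Cs)))"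
    by (rule bij_betw_byWitness[where f' = theta_inv])
      (simp_all add: image_subset_iff theta_inv_theta[OF ch] theta_theta_inv[OF ch] theta_supp theta_inv_supp)
  moreover have "theta (wact A t) = wact A (theta t)" if "A \<in> SL2" "t \<in> supp (lword (VS # FT # Cs))"
    for A :: "'a ^ 2 ^ 2" and t
  proof
    fix w
    show "theta (wact A t) w = wact A (theta t) w"
    proof (cases "\<exists>p q r v. w = VL p # VL q # VL r # v")
      case True
      then show ?thesis using theta_wact[OF ch] that by (auto simp: SL2_def)
    next
      case False
      have "w \<notin> lword (VS # VS # VS # Cs)" using False by (auto simp: lword_def list_all2_Cons2)
      moreover have "wact A (theta t) \<in> supp (lword (VS # VS # VS # Cs))"
        by (rule wact_supp) (use Cs theta_supp[OF that(2)] in auto)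
      ultimately have "wact A (theta t) w = 0" by (simp add: supp_def)
      moreover have "theta (wact A t) w = 0" using False by (auto simp: theta_def split: list.splits letter.splits)
      ultimately show ?thesis by simp
    qed
  qed
  moreover have "lin_on (supp (lword (VS # FT # Cs)) :: (letter list \<Rightarrow> 'a) set) theta"
    by (simp add: lin_on_def theta_add theta_scale)
  ultimately show ?thesis
    unfolding rep_iso_def rep_hom_def using theta_supp by meson
qed

text \<open>
  Twisting reparametrises the group by the Frobenius map, which is onto because the field is
  algebraically closed; so a representation and its twist have the same decompositions.
\<close>

lemma stab_reparam: "stab G (\<lambda>A. act (f A)) = stab (f ` G) act"
  by (simp add: fun_eq_iff stab_def)

lemma splits_reparam: "splits G (\<lambda>A. act (f A)) = splits (f ` G) act"
  by (simp add: fun_eq_iff splits_def stab_reparam)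

lemma indec_reparam: "indec G (\<lambda>A. act (f A)) = indec (f ` G) act"
  by (simp add: fun_eq_iff indec_def splits_reparam stab_reparam)

lemma dec_reparam: "dec (f ` G) act U n \<Longrightarrow> dec G (\<lambda>A. act (f A)) U n"
proof (induction rule: dec.induct)
  case zero
  show ?case by (rule dec.zero)
next
  case (step U S R n)
  have 1: "splits G (\<lambda>A. act (f A)) U S R" using step(1) splits_reparam[of G act f] by simp
  have 2: "indec G (\<lambda>A. act (f A)) S" using step(2) indec_reparam[of G act f] by simp
  show ?case by (rule dec.step[OF 1 2 step(4)])
qed

definition frob :: "'a::field ^ 2 ^ 2 \<Rightarrow> 'a ^ 2 ^ 2" where
  "frob A = (\<chi> i j. (A $ i $ j)\<^sup>2)"

lemma det_frob:
  fixes A :: "'a::field ^ 2 ^ 2"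
  assumes "CHAR('a) = 2" shows "det (frob A) = (det A)\<^sup>2"
proof -
  have "(x + y)\<^sup>2 = x\<^sup>2 + y\<^sup>2" for x y :: 'a
    by (simp add: power2_sum char2[OF assms])
  then show ?thesis by (simp add: det_2 frob_def char2[OF assms] power_mult_distrib)
qed

text \<open>An entrywise square root of \<open>B\<close> has a determinant d with d^2 = 1; in
  characteristic 2 this reads (d + 1)^2 = 0, so d = 1.\<close>

lemma frob_SL2:
  assumes ch: "CHAR('a::alg_closed_field) = 2"
  shows "frob ` SL2 = (SL2 :: ('a ^ 2 ^ 2) set)"
proof
  show "frob ` SL2 \<subseteq> (SL2 :: ('a ^ 2 ^ 2) set)" by (auto simp: SL2_def det_frob[OF ch])
  show "(SL2 :: ('a ^ 2 ^ 2) set) \<subseteq> frob ` SL2"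
  proof
    fix B :: "'a ^ 2 ^ 2" assume B: "B \<in> SL2"
    have "\<forall>x::'a. \<exists>y. y\<^sup>2 = x" using nth_root_exists[of 2] by auto
    then obtain r where r: "\<And>x::'a. (r x)\<^sup>2 = x" by metis
    define A where "A = (\<chi> i j. r (B $ i $ j))"
    have fA: "frob A = B" by (simp add: frob_def A_def r vec_eq_iff)
    have "(det A)\<^sup>2 = 1" using B det_frob[OF ch, of A] fA by (simp add: SL2_def)
    then have "(det A + 1) * (det A + 1) = 0"
      by (simp add: power2_eq_square algebra_simps char2[OF ch])
    then have "det A + 1 = 0" by simp
    then have "det A = 1" by (metis add_right_cancel char2(2)[OF ch])
    then show "B \<in> frob ` SL2" using fA by (auto simp: SL2_def)
  qed
qed

fun twist :: "letter \<Rightarrow> letter" where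
  "twist (VL p) = FL p" | "twist x = x"

lemma lword_replicate: "lword (replicate n C) = {w. length w = n \<and> set w \<subseteq> C}"
  by (auto simp: lword_def list_all2_conv_all_nth in_set_conv_nth subset_iff)

lemma twist_bij: "bij_betw (map twist) (lword (replicate n VT)) (lword (replicate n FT))"
proof (rule bij_betw_byWitness[where f' = "map (\<lambda>x. case x of FL p \<Rightarrow> VL p | _ \<Rightarrow> x)"])
  let ?f = "\<lambda>x. case x of FL p \<Rightarrow> VL p | _ \<Rightarrow> x"
  have 1: "?f (twist x) = x" "twist x \<in> FT" if "x \<in> VT" for x using that by auto
  have 2: "twist (?f x) = x" "?f x \<in> VT" if "x \<in> FT" for x using that by auto
  have "map ?f (map twist w) = w" if "set w \<subseteq> VT" for w
    unfolding map_map o_def by (rule map_idI, rule 1) (use that in blast)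
  then show "\<forall>w\<in>lword (replicate n VT). map ?f (map twist w) = w" unfolding lword_replicate by blast
  have "map twist (map ?f w) = w" if "set w \<subseteq> FT" for w
    unfolding map_map o_def by (rule map_idI, rule 2) (use that in blast)
  then show "\<forall>w\<in>lword (replicate n FT). map twist (map ?f w) = w" unfolding lword_replicate by blast
  show "map twist ` lword (replicate n VT) \<subseteq> lword (replicate n FT)"
  proof (rule image_subsetI)
    fix w assume "w \<in> lword (replicate n VT)"
    then have w: "length w = n" "set w \<subseteq> VT" by (simp_all only: lword_replicate mem_Collect_eq)
    have "set (map twist w) \<subseteq> FT" unfolding set_map by (rule image_subsetI, rule 1(2)) (use w in blast)
    then show "map twist w \<in> lword (replicate n FT)" using w by (simp only: lword_replicate mem_Collect_eq length_map)
  qed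
  show "map ?f ` lword (replicate n FT) \<subseteq> lword (replicate n VT)"
  proof (rule image_subsetI)
    fix w assume "w \<in> lword (replicate n FT)"
    then have w: "length w = n" "set w \<subseteq> FT" by (simp_all only: lword_replicate mem_Collect_eq)
    have "set (map ?f w) \<subseteq> VT" unfolding set_map by (rule image_subsetI, rule 2(2)) (use w in blast)
    then show "map ?f w \<in> lword (replicate n VT)" using w by (simp only: lword_replicate mem_Collect_eq length_map)
  qed
qed

lemma wcoef_twist:
  "w \<in> lword (replicate n VT) \<Longrightarrow> v \<in> lword (replicate m VT) \<Longrightarrow> wcoef A (map twist w) (map twist v) = wcoef (frob A) w v"
proof (induction A w v arbitrary: n m rule: wcoef.induct)
  case (2 A x w y v)
  obtain n' m' where nm: "n = Suc n'" "m = Suc m'" using 2(2,3) by (cases n; cases m) auto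
  have xy: "x \<in> VT" "y \<in> VT" and wv: "w \<in> lword (replicate n' VT)" "v \<in> lword (replicate m' VT)"
    using 2(2,3) unfolding nm by simp_all
  have "lcoef A (twist x) (twist y) = lcoef (frob A) x y"
    using xy by (auto simp: lcoef_def frob_def)
  then show ?case using 2(1)[OF wv] by simp
qed simp_all

lemma dec_twist:
  fixes U :: "(letter list \<Rightarrow> 'a::alg_closed_field) set"
  assumes ch: "CHAR('a::alg_closed_field) = 2"
    and d: "dec (SL2 :: ('a ^ 2 ^ 2) set) wact (supp (lword (replicate n VT))) N"
  shows "dec (SL2 :: ('a ^ 2 ^ 2) set) wact (supp (lword (replicate n FT))) N"
proof -
  have d2: "dec (SL2 :: ('a ^ 2 ^ 2) set) (\<lambda>A. wact (frob A)) (supp (lword (replicate n VT))) N"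
    by (rule dec_reparam) (simp add: frob_SL2[OF ch] d)
  have cl: "\<forall>C\<in>set (replicate n FT). closed_letters C" "\<forall>C\<in>set (replicate n VT). closed_letters C" by simp_all
  have "rep_iso (SL2 :: ('a ^ 2 ^ 2) set) wact (supp (lword (replicate n FT))) (\<lambda>A. wact (frob A))
      (supp (lword (replicate n VT))) (\<lambda>t w. if w \<in> lword (replicate n VT) then t (map twist w) else 0)"
  proof (rule rep_iso_reindex[OF twist_bij, where k = wcoef])
    show "wact A t w = (\<Sum>v\<in>lword (replicate n FT). wcoef A w v * t v)"
      if "t \<in> supp (lword (replicate n FT))" "w \<in> lword (replicate n FT)" for A :: "'a ^ 2 ^ 2" and t w
      by (rule wact_lword[OF that(1)]) (use lword_length[OF that(2)] in simp)
    show "wact (frob A) t w = (if w \<in> lword (replicate n VT)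
        then \<Sum>v\<in>lword (replicate n VT). wcoef A (map twist w) (map twist v) * t v else 0)"
      if t: "t \<in> supp (lword (replicate n VT))" for A :: "'a ^ 2 ^ 2" and t w
    proof (cases "w \<in> lword (replicate n VT)")
      case True
      have "wact (frob A) t w = (\<Sum>v\<in>lword (replicate n VT). wcoef (frob A) w v * t v)"
        by (rule wact_lword[OF t]) (use lword_length[OF True] in simp)
      also have "\<dots> = (\<Sum>v\<in>lword (replicate n VT). wcoef A (map twist w) (map twist v) * t v)"
        by (intro sum.cong refl) (simp add: wcoef_twist[OF True, of _ n])
      finally show ?thesis using True by simp
    next
      case False
      then show ?thesis using supp_lword_zero[OF wact_supp[OF cl(2) t]] by simp
    qed
  qed
  from dec_iso[OF d2 rep_iso_inv[OF this stab_lword[OF cl(1)]]] show ?thesis .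
qed

section \<open>Tensor powers as spaces of words, and the expansion of mixed tensor products\<close>

lemma wcoef_VL:
  "length w = k \<Longrightarrow> length v = k \<Longrightarrow> wcoef A (map VL w) (map VL v) = (\<Prod>i<k. A $ (w ! i) $ (v ! i))"
proof (induction k arbitrary: w v)
  case (Suc k)
  obtain x w' y v' where wv: "w = x # w'" "v = y # v'" using Suc(2,3) by (cases w; cases v) auto
  then show ?case using Suc by (simp add: lcoef_def prod.lessThan_Suc_shift del: prod.lessThan_Suc)
qed simp

lemma dec_tensor_power:
  fixes G :: "('a::field ^ 2 ^ 2) set"
  assumes d: "dec G wact (supp (lword (replicate k VS))) N"
  shows "dec G (\<lambda>A. tensor_act k (natural_rep A)) (tensor_power k) N"
proof -
  have b: "bij_betw (map VL) {w. length w = k} (lword (replicate k VS))"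
  proof (rule bij_betw_imageI)
    show "inj_on (map VL) {w. length w = k}"
      by (rule inj_on_subset[OF inj_mapI subset_UNIV]) (simp add: inj_def)
    show "map VL ` {w. length w = k} = lword (replicate k VS)"
    proof
      show "map VL ` {w. length w = k} \<subseteq> lword (replicate k VS)" by (auto simp: lword_replicate)
      show "lword (replicate k VS) \<subseteq> map VL ` {w. length w = k}"
      proof
        fix w assume "w \<in> lword (replicate k VS)"
        then have w: "set w \<subseteq> VS" "length w = k" by (auto simp: lword_replicate)
        have "VL (inv VL x) = x" if "x \<in> set w" for x
          by (rule f_inv_into_f, rule subsetD[OF w(1) that])
        then have "map VL (map (inv VL) w) = w" by (simp add: map_idI)
        then show "w \<in> map VL ` {w. length w = k}" using w(2) by (intro image_eqI[of _ _ "map (inv VL) w"]) simp_all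
      qed
    qed
  qed
  have tp: "tensor_power k = supp {w :: 2 list. length w = k}" by (simp add: tensor_power_def supp_def)
  have "rep_iso G wact (supp (lword (replicate k VS))) (\<lambda>A. tensor_act k (natural_rep A))
      (supp {w. length w = k}) (\<lambda>t w. if w \<in> {w. length w = k} then t (map VL w) else 0)"
  proof (rule rep_iso_reindex[OF b, where k = wcoef])
    show "wact A t w = (\<Sum>v\<in>lword (replicate k VS). wcoef A w v * t v)"
      if "t \<in> supp (lword (replicate k VS))" "w \<in> lword (replicate k VS)" for A :: "'a ^ 2 ^ 2" and t w
      by (rule wact_lword[OF that(1)]) (use lword_length[OF that(2)] in simp)
    show "tensor_act k (natural_rep A) t w = (if w \<in> {w. length w = k}
        then \<Sum>v\<in>{w. length w = k}. wcoef A (map VL w) (map VL v) * t v else 0)" for A :: "'a ^ 2 ^ 2" and t w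
      by (simp add: tensor_act_def natural_rep_def wcoef_VL)
  qed
  from dec_iso[OF d this] show ?thesis unfolding tp .
qed

text \<open>Pascal's rule in the form that matches replacing one factor V + T + T by V or by one of
  two trivial factors; the offset \<open>j\<close> counts copies of V already chosen.\<close>

lemma binomial_sum_Suc:
  fixes b :: "nat \<Rightarrow> nat"
  shows "(\<Sum>i\<le>Suc m. (Suc m choose i) * 2 ^ (Suc m - i) * b (j + i)) =
    (\<Sum>i\<le>m. (m choose i) * 2 ^ (m - i) * b (Suc j + i)) + 2 * (\<Sum>i\<le>m. (m choose i) * 2 ^ (m - i) * b (j + i))"
proof -
  have "(\<Sum>i\<le>Suc m. (Suc m choose i) * 2 ^ (Suc m - i) * b (j + i)) =
      2 ^ Suc m * b j + (\<Sum>i\<le>m. ((m choose i) + (m choose Suc i)) * 2 ^ (m - i) * b (Suc (j + i)))"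
    by (simp add: sum.atMost_Suc_shift del: sum.atMost_Suc)
  also have "\<dots> = (\<Sum>i\<le>m. (m choose i) * 2 ^ (m - i) * b (Suc j + i)) +
      (2 ^ Suc m * b j + (\<Sum>i\<le>m. (m choose Suc i) * 2 ^ (m - i) * b (Suc (j + i))))"
    by (simp add: sum.distrib algebra_simps)
  also have "2 ^ Suc m * b j + (\<Sum>i\<le>m. (m choose Suc i) * 2 ^ (m - i) * b (Suc (j + i))) =
      (\<Sum>i\<le>Suc m. (m choose i) * 2 ^ (Suc m - i) * b (j + i))"
    by (simp add: sum.atMost_Suc_shift del: sum.atMost_Suc)
  also have "\<dots> = 2 * (\<Sum>i\<le>m. (m choose i) * 2 ^ (m - i) * b (j + i))"
    unfolding sum_distrib_left by (simp add: Suc_diff_le algebra_simps)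
  finally show ?thesis .
qed

text \<open>One factor \<open>VT\<close> is expanded at a time: its part V joins the leading block,
  and each of its two trivial parts disappears.\<close>

lemma dec_mixed:
  fixes b :: "nat \<Rightarrow> nat"
  assumes "\<And>i. i \<le> j + m \<Longrightarrow> dec G wact (supp (lword (replicate i VS)) :: (letter list \<Rightarrow> 'a::field) set) (b i)"
  shows "dec G wact (supp (lword (replicate j VS @ replicate m VT)) :: (letter list \<Rightarrow> 'a) set)
    (\<Sum>i\<le>m. (m choose i) * 2 ^ (m - i) * b (j + i))"
  using assms
proof (induction m arbitrary: j)
  case 0
  then show ?case by simp
next
  case (Suc m)
  let ?N = "\<lambda>j. \<Sum>i\<le>m. (m choose i) * 2 ^ (m - i) * b (j + i)"
  let ?S = "\<lambda>Cs. supp (lword Cs) :: (letter list \<Rightarrow> 'a) set"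
  let ?V = "\<lambda>C. replicate j VS @ C # replicate m VT"
  note la = lin_act_wact[where G = G]
  have d1: "dec G wact (?S (?V VS)) (?N (Suc j))"
    using Suc(1)[of "Suc j"] Suc(2) by (simp add: replicate_app_Cons_same)
  have d2: "dec G wact (?S (?V {TL c})) (?N j)" for c
  proof -
    have iso: "rep_iso G wact (?S ({TL c} # replicate m VT)) wact (?S (replicate m VT)) (slice (TL c))"
      by (rule rep_iso_trivial)
    obtain T where T: "rep_iso G wact (?S (?V {TL c})) wact (?S (replicate j VS @ replicate m VT)) T"
      using rep_iso_prefix[OF iso, of "replicate j VS"] by auto
    have "stab G wact (?S (?V {TL c}))" by (rule stab_lword) auto
    moreover have "dec G wact (?S (replicate j VS @ replicate m VT)) (?N j)" using Suc(1)[of j] Suc(2) by simp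
    ultimately show ?thesis using dec_iso rep_iso_inv[OF T] by blast
  qed
  have stab: "stab G wact (?S (?V VS))" "stab G wact (?S (?V {TL c}))" for c
    by (rule stab_lword; auto)+
  have TL: "range TL = {TL False} \<union> {TL True}" by (auto simp: UNIV_bool)
  have s2: "splits G wact (?S (?V (range TL))) (?S (?V {TL False})) (?S (?V {TL True}))"
    unfolding lword_union[of "replicate j VS" "{TL False}" "{TL True}" "replicate m VT", folded TL]
    by (rule splits_supp[OF lword_disjoint stab(2) stab(2)]) simp
  have s1: "splits G wact (?S (?V VT)) (?S (?V VS)) (?S (?V (range TL)))"
    unfolding lword_union by (rule splits_supp[OF lword_disjoint stab(1) splits_stab[OF la s2]]) auto
  from dec_add[OF la d1 s1 dec_add[OF la d2 s2 d2]]
  show ?case unfolding binomial_sum_Suc by (simp add: mult_2)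
qed

text \<open>The last V of the leading block absorbs the first \<open>FT\<close> through
  \<open>theta\<close>; each such step trades one \<open>FT\<close> for two copies of V.\<close>

lemma dec_theta:
  assumes ch: "CHAR('a::field) = 2"
  shows "dec (SL2 :: ('a ^ 2 ^ 2) set) wact (supp (lword (replicate (Suc a) VS @ replicate n FT))) N \<Longrightarrow>
    dec (SL2 :: ('a ^ 2 ^ 2) set) wact (supp (lword (replicate (Suc a + 2 * n) VS))) N"
proof (induction n arbitrary: a)
  case (Suc n)
  have iso: "rep_iso (SL2 :: ('a ^ 2 ^ 2) set) wact (supp (lword (VS # FT # replicate n FT))) wact (supp (lword (VS # VS # VS # replicate n FT))) theta"
    by (rule rep_iso_theta[OF ch]) simp
  obtain T where T: "rep_iso (SL2 :: ('a ^ 2 ^ 2) set) wact (supp (lword (replicate a VS @ VS # FT # replicate n FT))) wact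
      (supp (lword (replicate a VS @ VS # VS # VS # replicate n FT))) T"
    using rep_iso_prefix[OF iso, of "replicate a VS"] by auto
  have e: "replicate (Suc a) VS @ replicate (Suc n) FT = replicate a VS @ VS # FT # replicate n FT"
    "replicate (Suc (Suc (Suc a))) VS @ replicate n FT = replicate a VS @ VS # VS # VS # replicate n FT"
    by (simp_all add: replicate_app_Cons_same)
  from dec_iso[OF Suc(2)[unfolded e] T]
  have "dec (SL2 :: ('a ^ 2 ^ 2) set) wact (supp (lword (replicate (Suc (Suc (Suc a))) VS @ replicate n FT))) N"
    unfolding e .
  from Suc(1)[OF this] show ?case by (simp del: replicate_Suc)
qed simp

section \<open>Indecomposability through idempotent endomorphisms\<close>

lemma splitsI:
  assumes "stab G act P" "stab G act Q" "P \<inter> Q \<subseteq> {0}" "U = {x + y |x y. x \<in> P \<and> y \<in> Q}"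
  shows "splits G act U P Q"
proof -
  have "{0} \<subseteq> P \<inter> Q" using stab_0[OF assms(1)] stab_0[OF assms(2)] by blast
  then show ?thesis unfolding splits_def using assms by (intro conjI equalityI[of "P \<inter> Q"])
qed

text \<open>A splitting yields an idempotent endomorphism, its projection. This form, with its
  converse \<open>indec_idempotent\<close>, carries indecomposability from \<open>S\<close> to V
  tensor \<open>S\<close>, since an idempotent there induces one on \<open>S\<close>.\<close>

lemma indecI:
  assumes la: "lin_act G act" and st: "stab G act U" and ne: "U \<noteq> {0}"
    and X: "\<And>X. rep_hom G act U act U X \<Longrightarrow> \<forall>t\<in>U. X (X t) = X t \<Longrightarrow> (\<forall>t\<in>U. X t = 0) \<or> (\<forall>t\<in>U. X t = t)"
  shows "indec G act U"
  unfolding indec_def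
proof (intro conjI allI impI st ne)
  fix P Q assume sp: "splits G act U P Q"
  note sub = splits_subset[OF sp]
  have h: "rep_hom G act U act U (proj P Q)" by (rule rep_hom_mono[OF proj_hom[OF la sp] sub(1)])
  have "\<forall>t\<in>U. proj P Q (proj P Q t) = proj P Q t" by (intro ballI proj_left[OF sp] projI(1)[OF sp])
  from X[OF h this] show "P = {0} \<or> Q = {0}"
  proof
    assume a: "\<forall>t\<in>U. proj P Q t = 0"
    have "p = 0" if "p \<in> P" for p
    proof -
      have "proj P Q p = 0" by (rule bspec[OF a subsetD[OF sub(1) that]])
      then show ?thesis unfolding proj_left[OF sp that] .
    qed
    then have "P \<subseteq> {0}" by (intro subsetI singleton_iff[THEN iffD2])
    then show ?thesis using splits_0(1)[OF sp] by (intro disjI1 equalityI) simp_all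
  next
    assume a: "\<forall>t\<in>U. proj P Q t = t"
    have "q = 0" if "q \<in> Q" for q
    proof -
      have "proj P Q q = q" by (rule bspec[OF a subsetD[OF sub(2) that]])
      then show ?thesis unfolding proj_right[OF sp that] by (rule sym)
    qed
    then have "Q \<subseteq> {0}" by (intro subsetI singleton_iff[THEN iffD2])
    then show ?thesis using splits_0(2)[OF sp] by (intro disjI2 equalityI) simp_all
  qed
qed

lemma indec_idempotent:
  assumes la: "lin_act G act" and ind: "indec G act S" and h: "rep_hom G act S act S X"
    and id: "\<forall>t\<in>S. X (X t) = X t"
  shows "(\<forall>t\<in>S. X t = 0) \<or> (\<forall>t\<in>S. X t = t)"
proof -
  have st: "stab G act S" using ind by (simp add: indec_def)
  note ss = stab_subspace[OF st]
  have l: "lin_on S X" by (rule rep_hom_lin[OF h])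
  let ?K = "{x\<in>S. X x = 0}"
  have K: "stab G act ?K" by (rule stab_kernel[OF la h st])
  have I: "stab G act (X ` S)" by (rule stab_image[OF h st])
  have "X ` S \<inter> ?K \<subseteq> {0}"
  proof
    fix y assume y: "y \<in> X ` S \<inter> ?K"
    then obtain x where x: "x \<in> S" "y = X x" by blast
    have "y = X y" using id x by metis
    also have "\<dots> = 0" using y by blast
    finally show "y \<in> {0}" by (rule ssubst) (rule singletonI)
  qed
  moreover have "S = {x + y |x y. x \<in> X ` S \<and> y \<in> ?K}"
  proof
    show "{x + y |x y. x \<in> X ` S \<and> y \<in> ?K} \<subseteq> S" using subsp(2)[OF ss] rep_hom_in[OF h] by blast
    show "S \<subseteq> {x + y |x y. x \<in> X ` S \<and> y \<in> ?K}"
    proof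
      fix x assume x: "x \<in> S"
      have Xx: "X x \<in> S" by (rule rep_hom_in[OF h x])
      have "X (x - X x) = X x - X (X x)" by (rule lin_on_diff[OF l ss x Xx])
      also have "\<dots> = 0" using id x by simp
      finally have "x - X x \<in> ?K" using subsp(3)[OF ss x Xx] by blast
      moreover have "x = X x + (x - X x)" by simp
      ultimately show "x \<in> {x + y |x y. x \<in> X ` S \<and> y \<in> ?K}" using x by blast
    qed
  qed
  ultimately have "splits G act S (X ` S) ?K" by (rule splitsI[OF I K])
  then have "X ` S = {0} \<or> ?K = {0}" using ind unfolding indec_def by blast
  then show ?thesis
  proof
    assume "X ` S = {0}"
    then show ?thesis by blast
  next
    assume a: "?K = {0}"
    have "X t = t" if t: "t \<in> S" for t
    proof -
      have Xt: "X t \<in> S" by (rule rep_hom_in[OF h t])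
      have "X (t - X t) = X t - X (X t)" by (rule lin_on_diff[OF l ss t Xt])
      also have "\<dots> = 0" using id t by simp
      finally have "t - X t \<in> ?K" using subsp(3)[OF ss t Xt] by blast
      then have "t - X t = 0" using a by blast
      then show ?thesis by simp
    qed
    then show ?thesis by blast
  qed
qed

section \<open>The infinitesimal action, obtained by interpolation from the group action\<close>

lemma rep_hom_lincomb:
  assumes h: "rep_hom G act S act S X" and st: "stab G act S" and t: "t \<in> S"
    and F: "finite F" and g: "\<forall>a\<in>F. g a \<in> G"
  shows "(\<Sum>a\<in>F. fscale (c a) (act (g a) t)) \<in> S \<and>
    X (\<Sum>a\<in>F. fscale (c a) (act (g a) t)) = (\<Sum>a\<in>F. fscale (c a) (act (g a) (X t)))"
  using F g
proof (induction F rule: finite_induct)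
  case empty
  have "X 0 = 0" by (rule lin_on_zero[OF rep_hom_lin[OF h] t])
  then show ?case using stab_0[OF st] unfolding sum.empty by blast
next
  case (insert a F)
  note ss = stab_subspace[OF st]
  let ?u = "\<Sum>a\<in>F. fscale (c a) (act (g a) t)"
  have u: "?u \<in> S" "X ?u = (\<Sum>a\<in>F. fscale (c a) (act (g a) (X t)))" using insert by blast+
  have ga: "g a \<in> G" using insert by blast
  have at: "act (g a) t \<in> S" by (rule stab_act[OF st ga t])
  have fat: "fscale (c a) (act (g a) t) \<in> S" by (rule subsp(4)[OF ss at])
  have "X (fscale (c a) (act (g a) t) + ?u) = X (fscale (c a) (act (g a) t)) + X ?u"
    by (rule lin_on_add[OF rep_hom_lin[OF h] fat u(1)])
  also have "X (fscale (c a) (act (g a) t)) = fscale (c a) (act (g a) (X t))"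
    unfolding lin_on_scale[OF rep_hom_lin[OF h] at] rep_hom_act[OF h ga t] ..
  finally show ?case unfolding sum.insert[OF insert(1,2)] using u subsp(2)[OF ss fat u(1)] by metis
qed

text \<open>A substitute for differentiation: extracting a coefficient is a finite combination of
  values, by Lagrange interpolation at N + 1 points of the infinite field. Applied to group
  elements, it gives operators with which homomorphisms commute by
  \<open>rep_hom_lincomb\<close>.\<close>

lemma lagrange_coefficient:
  assumes inf: "infinite (UNIV :: 'a::field set)"
  shows "\<exists>X c. finite X \<and> (\<forall>p::'a poly. degree p \<le> N \<longrightarrow> (\<Sum>a\<in>X. c a * poly p a) = coeff p k)"
proof -
  obtain X :: "'a set" where X: "finite X" "card X = Suc N"
    using infinite_arbitrarily_large[OF inf] by blast
  define l where "l a = smult (inverse (\<Prod>b\<in>X - {a}. a - b)) (\<Prod>b\<in>X - {a}. [:- b, 1:])" for a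
  have deg: "degree (l a) \<le> N" if "a \<in> X" for a
  proof -
    have "degree (\<Prod>b\<in>X - {a}. [:- b, 1:]) \<le> (\<Sum>b\<in>X - {a}. degree [:- b, 1:])"
      using degree_prod_sum_le[of "X - {a}" "\<lambda>b. [:- b, 1:]"] X(1) by (simp add: o_def)
    also have "\<dots> = N" using X that by simp
    finally show ?thesis unfolding l_def by (rule order_trans[OF degree_smult_le])
  qed
  have val: "poly (l a) b = (if a = b then 1 else 0)" if "a \<in> X" "b \<in> X" for a b
  proof (cases "a = b")
    case True
    have "(\<Prod>b\<in>X - {a}. a - b) \<noteq> 0" using X(1) by simp
    then show ?thesis using True by (simp add: l_def poly_prod)
  next
    case False
    have "(\<Prod>c\<in>X - {a}. b - c) = 0" by (rule prod_zero) (use X(1) that False in auto)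
    then show ?thesis using False by (simp add: l_def poly_prod)
  qed
  have "(\<Sum>a\<in>X. coeff (l a) k * poly p a) = coeff p k" if p: "degree p \<le> N" for p
  proof -
    let ?q = "p - (\<Sum>a\<in>X. smult (poly p a) (l a))"
    have "degree (\<Sum>a\<in>X. smult (poly p a) (l a)) \<le> N"
      by (rule degree_sum_le[OF X(1)]) (rule order_trans[OF degree_smult_le deg])
    then have dq: "degree ?q \<le> N" using p by (simp add: degree_diff_le)
    have "?q = 0"
    proof (rule ccontr)
      assume q0: "?q \<noteq> 0"
      have "poly ?q b = 0" if "b \<in> X" for b
      proof -
        have "(\<Sum>a\<in>X. poly p a * poly (l a) b) = (\<Sum>a\<in>X. if a = b then poly p b else 0)"
          using that by (intro sum.cong) (auto simp: val)
        then show ?thesis using X(1) that by (simp add: poly_sum)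
      qed
      then have "X \<subseteq> {x. poly ?q x = 0}" by blast
      then have "card X \<le> card {x. poly ?q x = 0}" by (rule card_mono[OF poly_roots_finite[OF q0]])
      also have "\<dots> \<le> degree ?q" by (rule card_poly_roots_bound[OF q0])
      finally show False using dq X by simp
    qed
    then have "coeff p k = coeff (\<Sum>a\<in>X. smult (poly p a) (l a)) k" by simp
    then show ?thesis by (simp add: coeff_sum mult.commute)
  qed
  then show ?thesis using X(1) by (intro exI[of _ X] exI[of _ "\<lambda>a. coeff (l a) k"]) simp
qed

text \<open>The matrix 1 + a M; for M = \<open>E12\<close> and \<open>E21\<close> these are the two
  root subgroups.\<close>

definition elem :: "'a::field ^ 2 ^ 2 \<Rightarrow> 'a \<Rightarrow> 'a ^ 2 ^ 2" where
  "elem M a = (\<chi> i j. (if i = j then 1 else 0) + a * M $ i $ j)"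

text \<open>In characteristic 2 the square of delta + a m is delta + a^2 m^2, so each twisted letter
  contributes an affine function of a^2. Hence there is no term linear in a: the Lie algebra acts by
  zero on twisted words.\<close>

lemma wcoef_elem:
  fixes M :: "'a::field ^ 2 ^ 2"
  assumes ch: "CHAR('a) = 2"
  shows "w \<in> lword (replicate n FT) \<Longrightarrow> v \<in> lword (replicate n FT) \<Longrightarrow>
    \<exists>P. degree P \<le> n \<and> coeff P 0 = (if w = v then 1 else 0) \<and> (\<forall>a. wcoef (elem M a) w v = poly P (a\<^sup>2))"
proof (induction n arbitrary: w v)
  case 0
  then show ?case by (intro exI[of _ 1]) simp
next
  case (Suc n)
  obtain x w' y v' where wv: "w = x # w'" "v = y # v'" using Suc(2,3) by (cases w; cases v) auto
  have xy: "x \<in> FT" "y \<in> FT" and wv': "w' \<in> lword (replicate n FT)" "v' \<in> lword (replicate n FT)"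
    using Suc(2,3) unfolding wv by simp_all
  obtain P where P: "degree P \<le> n" "coeff P 0 = (if w' = v' then 1 else 0)" "\<And>a. wcoef (elem M a) w' v' = poly P (a\<^sup>2)"
    using Suc(1)[OF wv'] by blast
  have "\<exists>L. degree L \<le> 1 \<and> coeff L 0 = (if x = y then 1 else 0) \<and> (\<forall>a. lcoef (elem M a) x y = poly L (a\<^sup>2))"
  proof (cases x)
    case (VL p)
    then show ?thesis using xy by auto
  next
    case x: (FL p)
    show ?thesis
    proof (cases y)
      case (FL q)
      show ?thesis
        by (rule exI[of _ "[:if p = q then 1 else 0, (M $ p $ q)\<^sup>2:]"])
          (use x FL in \<open>simp add: lcoef_def elem_def power2_eq_square algebra_simps char2[OF ch]\<close>)
    qed (use x xy in \<open>auto simp: lcoef_def intro!: exI[of _ 0]\<close>)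
  next
    case x: (TL b)
    show ?thesis
    proof (cases y)
      case (TL c)
      show ?thesis
        by (rule exI[of _ "[:if b = c then 1 else 0:]"]) (use x TL in \<open>simp add: lcoef_def\<close>)
    qed (use x xy in \<open>auto simp: lcoef_def intro!: exI[of _ 0]\<close>)
  qed
  then obtain L where L: "degree L \<le> 1" "coeff L 0 = (if x = y then 1 else 0)" "\<And>a. lcoef (elem M a) x y = poly L (a\<^sup>2)"
    by blast
  have "degree (L * P) \<le> Suc n" using degree_mult_le[of L P] L(1) P(1) by linarith
  moreover have "coeff (L * P) 0 = (if w = v then 1 else 0)" unfolding coeff_mult_0 L P wv by simp
  moreover have "wcoef (elem M a) w v = poly (L * P) (a\<^sup>2)" for a by (simp add: wv L P)
  ultimately show ?case by blast
qed

text \<open>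
  On words over \<^term>\<open>FT\<close> the action of \<^term>\<open>elem M a\<close> is a polynomial in \<open>a\<^sup>2\<close> with constant
  term the identity; the combination extracts the coefficient of \<open>a\<close>.
\<close>

lemma elem_interpolation:
  assumes ch: "CHAR('a::field) = 2" and inf: "infinite (UNIV :: 'a set)"
  shows "\<exists>X (c :: 'a \<Rightarrow> 'a). finite X \<and> (\<forall>M. \<forall>s \<in> supp (lword (replicate n FT)). \<forall>w.
      (\<Sum>a\<in>X. c a * wact (elem M a) s w) = 0 \<and>
      (\<Sum>a\<in>X. c a * (a * wact (elem M a) s w)) = s w \<and>
      (\<Sum>a\<in>X. c a * (a\<^sup>2 * wact (elem M a) s w)) = 0)"
proof -
  \<comment> \<open>Degree at most 2 n from a polynomial of degree n in a^2, plus 2 for the extra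
    factor a^2 in the third combination.\<close>
  obtain X c where X: "finite X" "\<And>p::'a poly. degree p \<le> 2 * n + 2 \<Longrightarrow> (\<Sum>a\<in>X. c a * poly p a) = coeff p 1"
    using lagrange_coefficient[OF inf] by metis
  have wc: "(\<Sum>a\<in>X. c a * wcoef (elem M a) w v) = 0 \<and> (\<Sum>a\<in>X. c a * (a * wcoef (elem M a) w v)) = (if w = v then 1 else 0)
      \<and> (\<Sum>a\<in>X. c a * (a\<^sup>2 * wcoef (elem M a) w v)) = 0"
    if wv: "w \<in> lword (replicate n FT)" "v \<in> lword (replicate n FT)" for w v M
  proof -
    obtain P where P: "degree P \<le> n" "coeff P 0 = (if w = v then 1 else 0)" "\<And>a. wcoef (elem M a) w v = poly P (a\<^sup>2)"
      using wcoef_elem[OF ch wv] by blast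
    define R where "R = pcompose P [:0, 0, 1:]"
    have R: "poly R a = wcoef (elem M a) w v" for a by (simp add: R_def poly_pcompose P(3) power2_eq_square)
    have dR: "degree R \<le> 2 * n" using P(1) by (simp add: R_def degree_pcompose)
    have d1: "degree (pCons 0 R) \<le> 2 * n + 2" "degree (pCons 0 (pCons 0 R)) \<le> 2 * n + 2"
      using degree_pCons_le[of 0 R] degree_pCons_le[of 0 "pCons 0 R"] dR by linarith+
    have c: "coeff R 1 = 0 \<and> coeff R 0 = coeff P 0" unfolding R_def
      by (cases P) (simp add: pcompose_pCons)
    from X(2)[of R] X(2)[OF d1(1)] X(2)[OF d1(2)] show ?thesis
      using dR c P(2) by (simp add: R power2_eq_square mult.assoc)
  qed
  have "(\<Sum>a\<in>X. c a * wact (elem M a) s w) = 0 \<and>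
      (\<Sum>a\<in>X. c a * (a * wact (elem M a) s w)) = s w \<and>
      (\<Sum>a\<in>X. c a * (a\<^sup>2 * wact (elem M a) s w)) = 0" if s: "s \<in> supp (lword (replicate n FT))" for M s w
  proof (cases "w \<in> lword (replicate n FT)")
    case w: True
    let ?W = "lword (replicate n FT)"
    have wa: "wact A s w = (\<Sum>v\<in>?W. wcoef A w v * s v)" for A
      by (rule wact_lword[OF s]) (use lword_length[OF w] in simp)
    have sw: "(\<Sum>a\<in>X. c a * (f a * wact (elem M a) s w)) = (\<Sum>v\<in>?W. (\<Sum>a\<in>X. c a * (f a * wcoef (elem M a) w v)) * s v)" for f
    proof -
      have "(\<Sum>a\<in>X. c a * (f a * wact (elem M a) s w)) = (\<Sum>a\<in>X. \<Sum>v\<in>?W. c a * (f a * wcoef (elem M a) w v) * s v)"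
        by (simp add: wa sum_distrib_left mult.assoc)
      then show ?thesis by (subst (asm) sum.swap) (simp add: sum_distrib_right)
    qed
    have "(\<Sum>a\<in>X. c a * wact (elem M a) s w) = 0" using sw[of "\<lambda>_. 1"] wc[OF w] by simp
    moreover have "(\<Sum>a\<in>X. c a * (a\<^sup>2 * wact (elem M a) s w)) = 0" using sw[of "\<lambda>a. a\<^sup>2"] wc[OF w] by simp
    moreover have "(\<Sum>a\<in>X. c a * (a * wact (elem M a) s w)) = (\<Sum>v\<in>?W. if v = w then s v else 0)"
      unfolding sw by (intro sum.cong) (use wc[OF w] in auto)
    ultimately show ?thesis using w finite_lword by simp
  next
    case False
    have "wact A s w = 0" for A
      by (rule supp_lword_zero[OF wact_supp[OF _ s] False]) simp
    moreover have "s w = 0" by (rule supp_lword_zero[OF s False])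
    ultimately show ?thesis by simp
  qed
  then show ?thesis using X(1) by blast
qed

section \<open>Indecomposability of \<open>V \<otimes> S\<close> and \<open>V \<otimes> V \<otimes> S\<close>\<close>

text \<open>V tensor \<open>S\<close>: the two slices along V are the components in
  \<open>S\<close>.\<close>

definition tens :: "(letter list \<Rightarrow> 'a::field) set \<Rightarrow> (letter list \<Rightarrow> 'a) set" where
  "tens S = {t. t [] = 0 \<and> (\<forall>p. slice (VL p) t \<in> S) \<and> (\<forall>x. x \<notin> VS \<longrightarrow> slice x t = 0)}"

definition emb :: "2 \<Rightarrow> (letter list \<Rightarrow> 'a::field) \<Rightarrow> letter list \<Rightarrow> 'a" where
  "emb p s = (\<lambda>w. case w of [] \<Rightarrow> 0 | x # v \<Rightarrow> if x = VL p then s v else 0)"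

lemma slice_emb: "slice x (emb p s) = (if x = VL p then s else 0)"
  and emb_Nil [simp]: "emb p s [] = 0"
  by (auto simp: slice_def emb_def fun_eq_iff)

lemma slice_emb_VL [simp]: "slice (VL q) (emb p s) = (if q = p then s else 0)"
  by (simp add: slice_emb)

lemma emb_in_tens: "s \<in> S \<Longrightarrow> 0 \<in> S \<Longrightarrow> emb p s \<in> tens S"
  by (auto simp: tens_def slice_emb(1))

lemma emb_add: "emb p (s + t) = emb p s + emb p t"
  and emb_scale: "emb p (fscale c s) = fscale c (emb p s)"
  by (auto simp: emb_def fun_eq_iff fscale_def split: list.splits)

lemma tens_eqI: "t \<in> tens S \<Longrightarrow> u \<in> tens S' \<Longrightarrow> slice (VL 1) t = slice (VL 1) u \<Longrightarrow>
    slice (VL 2) t = slice (VL 2) u \<Longrightarrow> t = u"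
proof (rule word_eqI)
  assume a: "t \<in> tens S" "u \<in> tens S'" "slice (VL 1) t = slice (VL 1) u" "slice (VL 2) t = slice (VL 2) u"
  show "t [] = u []" using a by (simp add: tens_def)
  fix x show "slice x t = slice x u"
  proof (cases x)
    case (VL p)
    then show ?thesis using exhaust_2[of p] a(3,4) by metis
  next
    case (FL p)
    then have "x \<notin> VS" by auto
    then have "slice x t = 0" "slice x u = 0" using a(1,2) unfolding tens_def by blast+
    then show ?thesis by metis
  next
    case (TL p)
    then have "x \<notin> VS" by auto
    then have "slice x t = 0" "slice x u = 0" using a(1,2) unfolding tens_def by blast+
    then show ?thesis by metis
  qed
qed

lemma tens_slice: "t \<in> tens S \<Longrightarrow> slice (VL p) t \<in> S"
  by (simp add: tens_def)

lemma tens_supp: "tens (supp (lword Cs)) = supp (lword (VS # Cs))"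
  by (auto simp: tens_def supp_Cons_iff)

lemma tens_mono: "S \<subseteq> T \<Longrightarrow> tens S \<subseteq> tens T"
  unfolding tens_def by blast

lemma slice_wact_VL: "slice (VL p) (wact A t) =
    fscale (A $ p $ 1) (wact A (slice (VL 1) t)) + fscale (A $ p $ 2) (wact A (slice (VL 2) t))"
  by (simp add: fun_eq_iff slice_def[of _ "wact A t"] wact_VL fscale_def)

lemma stab_tens:
  assumes "stab G wact S" shows "stab G wact (tens S)"
proof -
  note ss = stab_subspace[OF assms]
  have "fvs.subspace (tens S)"
  proof (rule fvs.subspaceI)
    show "0 \<in> tens S" using subsp(1)[OF ss] by (simp add: tens_def)
    show "x + y \<in> tens S" if "x \<in> tens S" "y \<in> tens S" for x y
      using that subsp(2)[OF ss] by (simp add: tens_def)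
    show "fscale c x \<in> tens S" if "x \<in> tens S" for c x
      using that subsp(4)[OF ss] by (simp add: tens_def fscale_def[of c x])
        (simp add: fscale_def slice_def fun_eq_iff)
  qed
  moreover have "wact A t \<in> tens S" if A: "A \<in> G" and t: "t \<in> tens S" for A t
  proof -
    have "slice (VL p) (wact A t) \<in> S" for p
      unfolding slice_wact_VL by (intro subsp(2)[OF ss] subsp(4)[OF ss] stab_act[OF assms A] tens_slice[OF t])
    moreover have "slice x (wact A t) = 0" if "x \<notin> VS" for x
    proof (cases x)
      case (FL p)
      have z: "slice (FL q) t = 0" for q using t by (auto simp: tens_def)
      show ?thesis unfolding FL by (rule ext) (simp add: slice_def[of _ "wact A t"] wact_FL z)
    next
      case (TL b)
      have z: "slice (TL q) t = 0" for q using t by (auto simp: tens_def)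
      show ?thesis unfolding TL by (rule ext) (simp add: slice_def[of _ "wact A t"] wact_TL z)
    qed (use that in auto)
    ultimately show ?thesis using t by (simp add: tens_def)
  qed
  ultimately show ?thesis by (simp add: stab_def)
qed

lemma splits_tens:
  assumes sp: "splits G wact U P Q"
  shows "splits G wact (tens U) (tens P) (tens Q)"
proof -
  have st: "stab G wact P" "stab G wact Q" using sp by (auto simp: splits_def)
  note st' = stab_tens[OF st(1)] stab_tens[OF st(2)]
  note sub = splits_subset[OF sp]
  have stU: "stab G wact (tens U)" by (rule stab_tens[OF splits_stab[OF lin_act_wact sp]])
  have "tens P \<inter> tens Q \<subseteq> {0}"
  proof
    fix t assume t: "t \<in> tens P \<inter> tens Q"
    have "slice (VL p) t = 0" for p
      by (rule splits_Int[OF sp]) (use t in \<open>simp_all add: tens_slice\<close>)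
    then have "t = 0" using t stab_0[OF st'(1)] by (intro tens_eqI[of t P 0 P]) simp_all
    then show "t \<in> {0}" by (rule ssubst) (rule singletonI)
  qed
  moreover have "tens U = {x + y |x y. x \<in> tens P \<and> y \<in> tens Q}"
  proof
    show "{x + y |x y. x \<in> tens P \<and> y \<in> tens Q} \<subseteq> tens U"
      using tens_mono[OF sub(1)] tens_mono[OF sub(2)] subsp(2)[OF stab_subspace[OF stU]] by blast
    show "tens U \<subseteq> {x + y |x y. x \<in> tens P \<and> y \<in> tens Q}"
    proof
      fix t assume t: "t \<in> tens U"
      obtain x1 y1 where 1: "slice (VL 1) t = x1 + y1" "x1 \<in> P" "y1 \<in> Q" by (rule splits_decomp[OF sp tens_slice[OF t]])
      obtain x2 y2 where 2: "slice (VL 2) t = x2 + y2" "x2 \<in> P" "y2 \<in> Q" by (rule splits_decomp[OF sp tens_slice[OF t]])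
      let ?x = "emb 1 x1 + emb 2 x2" and ?y = "emb 1 y1 + emb 2 y2"
      have x: "?x \<in> tens P" by (intro subsp(2)[OF stab_subspace[OF st'(1)]] emb_in_tens 1 2 stab_0[OF st(1)])
      have y: "?y \<in> tens Q" by (intro subsp(2)[OF stab_subspace[OF st'(2)]] emb_in_tens 1 2 stab_0[OF st(2)])
      have xy: "?x + ?y \<in> tens U"
        by (rule subsp(2)[OF stab_subspace[OF stU] subsetD[OF tens_mono[OF sub(1)] x] subsetD[OF tens_mono[OF sub(2)] y]])
      have "t = ?x + ?y"
        by (rule tens_eqI[OF t xy]) (simp_all add: 1 2)
      then show "t \<in> {x + y |x y. x \<in> tens P \<and> y \<in> tens Q}" using x y by blast
    qed
  qed
  ultimately show ?thesis by (rule splitsI[OF st'])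
qed

lemma tens_0: "tens {0} = {0 :: letter list \<Rightarrow> 'a::field}"
proof
  have 0: "0 \<in> tens {0 :: letter list \<Rightarrow> 'a}" by (simp add: tens_def)
  then show "{0} \<subseteq> tens {0 :: letter list \<Rightarrow> 'a}" by blast
  show "tens {0} \<subseteq> {0 :: letter list \<Rightarrow> 'a}"
  proof
    fix t :: "letter list \<Rightarrow> 'a" assume t: "t \<in> tens {0}"
    have "slice (VL p) t = 0" for p using tens_slice[OF t, of p] by (rule singletonD)
    then have "t = 0" by (intro tens_eqI[OF t 0]) simp_all
    then show "t \<in> {0}" by (rule ssubst) (rule singletonI)
  qed
qed

definition E12 :: "'a::field ^ 2 ^ 2" where "E12 = (\<chi> i j. if i = 1 \<and> j = 2 then 1 else 0)"
definition E21 :: "'a::field ^ 2 ^ 2" where "E21 = (\<chi> i j. if i = 2 \<and> j = 1 then 1 else 0)"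

lemma elem_SL2: "elem E12 a \<in> SL2" "elem E21 a \<in> SL2"
  by (simp_all add: SL2_def det_2 elem_def E12_def E21_def)

text \<open>\<open>M\<close> as an element of the Lie algebra acting on V tensor \<open>S\<close>:
  only the leading factor is moved, because the action on the twisted factor \<open>S\<close> is
  zero.\<close>

definition lower1 :: "'a::field ^ 2 ^ 2 \<Rightarrow> (letter list \<Rightarrow> 'a) \<Rightarrow> letter list \<Rightarrow> 'a" where
  "lower1 M t = emb 1 (fscale (M $ 1 $ 1) (slice (VL 1) t) + fscale (M $ 1 $ 2) (slice (VL 2) t))
    + emb 2 (fscale (M $ 2 $ 1) (slice (VL 1) t) + fscale (M $ 2 $ 2) (slice (VL 2) t))"

lemma slice_lower1: "slice (VL p) (lower1 M t) = fscale (M $ p $ 1) (slice (VL 1) t) + fscale (M $ p $ 2) (slice (VL 2) t)"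
  using exhaust_2[of p] by (elim disjE) (simp_all add: lower1_def)

text \<open>The action of \<^term>\<open>M\<close>, as an element of the Lie algebra, on the two leading tensor factors.\<close>

definition lower2 :: "'a::field ^ 2 ^ 2 \<Rightarrow> (letter list \<Rightarrow> 'a) \<Rightarrow> letter list \<Rightarrow> 'a" where
  "lower2 M t = lower1 M t + emb 1 (lower1 M (slice (VL 1) t)) + emb 2 (lower1 M (slice (VL 2) t))"

lemma slice_lower2: "slice (VL r) (slice (VL p) (lower2 M t)) =
    fscale (M $ p $ 1) (slice (VL r) (slice (VL 1) t)) + fscale (M $ p $ 2) (slice (VL r) (slice (VL 2) t)) +
    (fscale (M $ r $ 1) (slice (VL 1) (slice (VL p) t)) + fscale (M $ r $ 2) (slice (VL 2) (slice (VL p) t)))"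
  using exhaust_2[of p] by (elim disjE) (simp_all add: lower2_def slice_lower1)

lemma tens_lower1: "stab G wact S \<Longrightarrow> t \<in> tens S \<Longrightarrow> lower1 M t \<in> tens S"
proof -
  assume st: "stab G wact S" and t: "t \<in> tens S"
  note ss = stab_subspace[OF st] stab_subspace[OF stab_tens[OF st]]
  show ?thesis unfolding lower1_def
    by (intro subsp(2)[OF ss(2)] subsp(2)[OF ss(1)] subsp(4)[OF ss(1)] emb_in_tens tens_slice[OF t] subsp(1)[OF ss(1)])
qed

lemma tens_lower2: "stab G wact S \<Longrightarrow> t \<in> tens (tens S) \<Longrightarrow> lower2 M t \<in> tens (tens S)"
proof -
  assume st: "stab G wact S" and t: "t \<in> tens (tens S)"
  note st' = stab_tens[OF st] stab_tens[OF stab_tens[OF st]]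
  note ss = stab_subspace[OF st'(1)] stab_subspace[OF st'(2)]
  show ?thesis unfolding lower2_def
    by (intro subsp(2)[OF ss(2)] tens_lower1[OF st'(1) t] emb_in_tens tens_lower1[OF st] tens_slice[OF t] subsp(1)[OF ss(1)])
qed

lemma lincomb1:
  fixes c :: "'a::field \<Rightarrow> 'a"
  assumes "(\<Sum>a\<in>X. c a * W a) = 0" "(\<Sum>a\<in>X. c a * (a * W a)) = s"
  shows "(\<Sum>a\<in>X. c a * ((u + a * n) * W a)) = n * s"
proof -
  have "(\<Sum>a\<in>X. c a * ((u + a * n) * W a)) = u * (\<Sum>a\<in>X. c a * W a) + n * (\<Sum>a\<in>X. c a * (a * W a))"
    by (simp add: sum_distrib_left sum.distrib[symmetric] algebra_simps)
  then show ?thesis using assms by simp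
qed

text \<open>The hypotheses say that the combination reads off the coefficient of a, so the Leibniz
  rule for two factors appears.\<close>

lemma lincomb2:
  fixes c :: "'a::field \<Rightarrow> 'a"
  assumes "(\<Sum>a\<in>X. c a * W a) = 0" "(\<Sum>a\<in>X. c a * (a * W a)) = s" "(\<Sum>a\<in>X. c a * (a\<^sup>2 * W a)) = 0"
  shows "(\<Sum>a\<in>X. c a * ((u + a * n) * ((u' + a * n') * W a))) = (n * u' + u * n') * s"
proof -
  have "(\<Sum>a\<in>X. c a * ((u + a * n) * ((u' + a * n') * W a))) =
      u * u' * (\<Sum>a\<in>X. c a * W a) + (n * u' + u * n') * (\<Sum>a\<in>X. c a * (a * W a)) + n * n' * (\<Sum>a\<in>X. c a * (a\<^sup>2 * W a))"
    by (simp add: sum_distrib_left sum.distrib[symmetric] algebra_simps power2_eq_square)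
  then show ?thesis using assms by simp
qed

lemma elem_interpolation1:
  fixes c :: "'a::field \<Rightarrow> 'a"
  assumes X: "\<And>s w. s \<in> supp W \<Longrightarrow> (\<Sum>a\<in>X. c a * wact (elem M a) s w) = 0"
      "\<And>s w. s \<in> supp W \<Longrightarrow> (\<Sum>a\<in>X. c a * (a * wact (elem M a) s w)) = s w"
    and W: "W = lword Cs" and t: "t \<in> tens (supp W)" and cl: "\<forall>C\<in>set Cs. closed_letters C"
  shows "(\<Sum>a\<in>X. fscale (c a) (wact (elem M a) t)) = lower1 M t"
proof -
  have st: "stab UNIV wact (supp W)" unfolding W by (rule stab_lword[OF cl])
  note st' = stab_tens[OF st]
  note ss = stab_subspace[OF st']
  have 1: "(\<Sum>a\<in>X. fscale (c a) (wact (elem M a) t)) \<in> tens (supp W)"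
    by (intro fvs.subspace_sum[OF ss] subsp(4)[OF ss] stab_act[OF st' _ t]) simp
  have 2: "lower1 M t \<in> tens (supp W)" by (rule tens_lower1[OF st t])
  have 3: "slice (VL p) (\<Sum>a\<in>X. fscale (c a) (wact (elem M a) t)) = slice (VL p) (lower1 M t)" for p
  proof
    fix w
    have "slice (VL p) (\<Sum>a\<in>X. fscale (c a) (wact (elem M a) t)) w = (\<Sum>a\<in>X. c a * wact (elem M a) t (VL p # w))"
      by (simp add: slice_def sum_tensor_apply fscale_def)
    also have "\<dots> = (\<Sum>a\<in>X. c a * (((if p = 1 then 1 else 0) + a * M $ p $ 1) * wact (elem M a) (slice (VL 1) t) w)
        + c a * (((if p = 2 then 1 else 0) + a * M $ p $ 2) * wact (elem M a) (slice (VL 2) t) w))"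
      by (simp add: wact_VL elem_def distrib_left)
    also have "\<dots> = M $ p $ 1 * slice (VL 1) t w + M $ p $ 2 * slice (VL 2) t w"
      unfolding sum.distrib
      using lincomb1[OF X[OF tens_slice[OF t]]] by metis
    finally show "slice (VL p) (\<Sum>a\<in>X. fscale (c a) (wact (elem M a) t)) w = slice (VL p) (lower1 M t) w"
      by (simp add: slice_lower1 fscale_def)
  qed
  show ?thesis by (rule tens_eqI[OF 1 2 3 3])
qed

lemma elem_interpolation2:
  fixes c :: "'a::field \<Rightarrow> 'a"
  assumes X: "\<And>s w. s \<in> supp W \<Longrightarrow> (\<Sum>a\<in>X. c a * wact (elem M a) s w) = 0"
      "\<And>s w. s \<in> supp W \<Longrightarrow> (\<Sum>a\<in>X. c a * (a * wact (elem M a) s w)) = s w"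
      "\<And>s w. s \<in> supp W \<Longrightarrow> (\<Sum>a\<in>X. c a * (a\<^sup>2 * wact (elem M a) s w)) = 0"
    and W: "W = lword Cs" and t: "t \<in> tens (tens (supp W))" and cl: "\<forall>C\<in>set Cs. closed_letters C"
  shows "(\<Sum>a\<in>X. fscale (c a) (wact (elem M a) t)) = lower2 M t"
proof -
  have st: "stab UNIV wact (supp W)" unfolding W by (rule stab_lword[OF cl])
  note st' = stab_tens[OF stab_tens[OF st]]
  note ss = stab_subspace[OF st']
  have 1: "(\<Sum>a\<in>X. fscale (c a) (wact (elem M a) t)) \<in> tens (tens (supp W))"
    by (intro fvs.subspace_sum[OF ss] subsp(4)[OF ss] stab_act[OF st' _ t]) simp
  have 2: "lower2 M t \<in> tens (tens (supp W))" by (rule tens_lower2[OF st t])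
  have 3: "slice (VL r) (slice (VL p) (\<Sum>a\<in>X. fscale (c a) (wact (elem M a) t))) = slice (VL r) (slice (VL p) (lower2 M t))" for p r
  proof
    fix w
    let ?e = "\<lambda>p q. if p = q then 1 else (0::'a)"
    let ?s = "\<lambda>q s. slice (VL s) (slice (VL q) t)"
    let ?W = "\<lambda>q s a. wact (elem M a) (?s q s) w"
    let ?f = "\<lambda>q s a. c a * ((?e p q + a * M $ p $ q) * ((?e r s + a * M $ r $ s) * ?W q s a))"
    have sS: "?s q s \<in> supp W" for q s by (rule tens_slice[OF tens_slice[OF t]])
    have f: "(\<Sum>a\<in>X. ?f q s a) = (M $ p $ q * ?e r s + ?e p q * M $ r $ s) * ?s q s w" for q s
      by (rule lincomb2[OF X[OF sS]])
    have "slice (VL r) (slice (VL p) (\<Sum>a\<in>X. fscale (c a) (wact (elem M a) t))) w = (\<Sum>a\<in>X. c a * wact (elem M a) t (VL p # VL r # w))"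
      by (simp add: slice_def sum_tensor_apply fscale_def)
    also have "\<dots> = (\<Sum>a\<in>X. ((?f 1 1 a + ?f 1 2 a) + (?f 2 1 a + ?f 2 2 a)))"
      by (simp add: wact_VL elem_def distrib_left)
    also have "\<dots> = slice (VL r) (slice (VL p) (lower2 M t)) w"
      unfolding sum.distrib f slice_lower2
      using exhaust_2[of p] exhaust_2[of r] by (elim disjE) (simp_all add: fscale_def algebra_simps)
    finally show "slice (VL r) (slice (VL p) (\<Sum>a\<in>X. fscale (c a) (wact (elem M a) t))) w = slice (VL r) (slice (VL p) (lower2 M t)) w" .
  qed
  have 4: "slice (VL p) (\<Sum>a\<in>X. fscale (c a) (wact (elem M a) t)) = slice (VL p) (lower2 M t)" for p
    by (rule tens_eqI[OF tens_slice[OF 1] tens_slice[OF 2] 3 3])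
  show ?thesis by (rule tens_eqI[OF 1 2 4 4])
qed

locale indecomposable_factor =
  fixes S :: "(letter list \<Rightarrow> 'a::alg_closed_field) set" and n :: nat
  assumes ch: "CHAR('a) = 2" and inf: "infinite (UNIV :: 'a set)"
    and S: "S \<subseteq> supp (lword (replicate n FT))" and ind: "indec (SL2 :: ('a ^ 2 ^ 2) set) wact S"
begin

lemma st: "stab (SL2 :: ('a ^ 2 ^ 2) set) wact S" using ind by (simp add: indec_def)

lemmas st1 = stab_tens[OF st]
lemmas st2 = stab_tens[OF st1]
lemmas ss = stab_subspace[OF st] stab_subspace[OF st1] stab_subspace[OF st2]

lemma hom_lower1:
  assumes h: "rep_hom (SL2 :: ('a ^ 2 ^ 2) set) wact (tens S) wact (tens S) X" and M: "M \<in> {E12, E21}" and t: "t \<in> tens S"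
  shows "X (lower1 M t) = lower1 M (X t)"
proof -
  let ?W = "lword (replicate n FT)"
  obtain F and c :: "'a \<Rightarrow> 'a" where F: "finite F" and c: "\<And>s w. s \<in> supp ?W \<Longrightarrow> (\<Sum>a\<in>F. c a * wact (elem M a) s w) = 0"
      "\<And>s w. s \<in> supp ?W \<Longrightarrow> (\<Sum>a\<in>F. c a * (a * wact (elem M a) s w)) = s w"
    using elem_interpolation[OF ch inf, of n] that by meson
  have g: "\<forall>a\<in>F. elem M a \<in> SL2" using M elem_SL2 by blast
  have sub: "tens S \<subseteq> tens (supp ?W)" by (rule tens_mono[OF S])
  have e: "(\<Sum>a\<in>F. fscale (c a) (wact (elem M a) u)) = lower1 M u" if "u \<in> tens S" for u
    by (rule elem_interpolation1[OF c refl subsetD[OF sub that]]) simp_all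
  from rep_hom_lincomb[OF h st1 t F g, of c] show ?thesis
    unfolding e[OF t] e[OF rep_hom_in[OF h t]] by (rule conjunct2)
qed

lemma hom_lower2:
  assumes h: "rep_hom (SL2 :: ('a ^ 2 ^ 2) set) wact (tens (tens S)) wact (tens (tens S)) X" and M: "M \<in> {E12, E21}" and t: "t \<in> tens (tens S)"
  shows "X (lower2 M t) = lower2 M (X t)"
proof -
  let ?W = "lword (replicate n FT)"
  obtain F and c :: "'a \<Rightarrow> 'a" where F: "finite F" and c: "\<And>s w. s \<in> supp ?W \<Longrightarrow> (\<Sum>a\<in>F. c a * wact (elem M a) s w) = 0"
      "\<And>s w. s \<in> supp ?W \<Longrightarrow> (\<Sum>a\<in>F. c a * (a * wact (elem M a) s w)) = s w"
      "\<And>s w. s \<in> supp ?W \<Longrightarrow> (\<Sum>a\<in>F. c a * (a\<^sup>2 * wact (elem M a) s w)) = 0"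
    using elem_interpolation[OF ch inf, of n] that by meson
  have g: "\<forall>a\<in>F. elem M a \<in> SL2" using M elem_SL2 by blast
  have sub: "tens (tens S) \<subseteq> tens (tens (supp ?W))" by (rule tens_mono[OF tens_mono[OF S]])
  have e: "(\<Sum>a\<in>F. fscale (c a) (wact (elem M a) u)) = lower2 M u" if "u \<in> tens (tens S)" for u
    by (rule elem_interpolation2[OF c refl subsetD[OF sub that]]) simp_all
  from rep_hom_lincomb[OF h st2 t F g, of c] show ?thesis
    unfolding e[OF t] e[OF rep_hom_in[OF h t]] by (rule conjunct2)
qed

lemma emb_tens: "s \<in> S \<Longrightarrow> emb p s \<in> tens S"
  by (rule emb_in_tens[OF _ stab_0[OF st]])

lemma wact_emb: "s \<in> S \<Longrightarrow> A \<in> SL2 \<Longrightarrow> wact A (emb p s) = emb 1 (fscale (A $ 1 $ p) (wact A s)) + emb 2 (fscale (A $ 2 $ p) (wact A s))"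
proof -
  assume s: "s \<in> S" and A: "A \<in> SL2"
  have "emb 1 (fscale (A $ 1 $ p) (wact A s)) + emb 2 (fscale (A $ 2 $ p) (wact A s)) \<in> tens S"
    by (intro subsp(2)[OF ss(2)] emb_tens subsp(4)[OF ss(1)] stab_act[OF st A s])
  from tens_eqI[OF stab_act[OF st1 A emb_tens[OF s]] this] show ?thesis
    using exhaust_2[of p] by (elim disjE) (simp_all add: slice_wact_VL)
qed

lemma nonzero: obtains s where "s \<in> S" "s \<noteq> 0"
proof -
  have "\<not> S \<subseteq> {0}" using ind stab_0[OF st] unfolding indec_def by blast
  then obtain s where s: "s \<in> S" "s \<notin> {0}" unfolding subset_iff by fast
  show ?thesis by (rule that[OF s(1)]) (use s(2) in \<open>simp only: singleton_iff not_False_eq_True\<close>)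
qed

text \<open>An endomorphism commutes with the raising and lowering operators on V, which generate
  all endomorphisms of V. So it is the identity of V tensored with an endomorphism \<open>X0\<close>
  of \<open>S\<close>, idempotent if \<open>X\<close> is.\<close>

lemma indec_tens: "indec (SL2 :: ('a ^ 2 ^ 2) set) wact (tens S)"
proof (rule indecI[OF lin_act_wact st1])
  obtain s where s: "s \<in> S" "s \<noteq> 0" by (rule nonzero)
  show "tens S \<noteq> {0}"
  proof
    assume "tens S = {0}"
    then have "emb 1 s = 0" using emb_tens[OF s(1), of 1] by (metis singletonD)
    then have "slice (VL 1) (emb 1 s) = slice (VL 1) 0" by metis
    then show False using s(2) unfolding slice_emb_VL slice_zero by simp
  qed
  fix X assume h: "rep_hom SL2 wact (tens S) wact (tens S) X" and id: "\<forall>t\<in>tens S. X (X t) = X t"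
  have l: "lin_on (tens S) X" by (rule rep_hom_lin[OF h])
  define X0 where "X0 s = slice (VL 1) (X (emb 1 s))" for s
  have X0S: "X0 s \<in> S" if "s \<in> S" for s
    unfolding X0_def by (rule tens_slice[OF rep_hom_in[OF h emb_tens[OF that]]])
  \<comment> \<open>The first basis vector spans the kernel of \<open>E12\<close> on V, so
    \<open>X\<close> preserves its tensor product with \<open>S\<close>.\<close>
  have X1: "X (emb 1 s) = emb 1 (X0 s)" if s: "s \<in> S" for s
  proof -
    have XS: "X (emb 1 s) \<in> tens S" by (rule rep_hom_in[OF h emb_tens[OF s]])
    have "lower1 E12 (emb 1 s) = 0" by (simp add: lower1_def E12_def) (simp add: emb_def fun_eq_iff split: list.splits)
    then have "lower1 E12 (X (emb 1 s)) = X 0"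
      using hom_lower1[OF h _ emb_tens[OF s], of E12 1] by simp
    also have "X 0 = 0" by (rule lin_on_zero[OF l emb_tens[OF s]])
    finally have "slice (VL 1) (lower1 E12 (X (emb 1 s))) = 0" by simp
    then have "slice (VL 2) (X (emb 1 s)) = 0" unfolding slice_lower1 by (simp add: E12_def)
    then show ?thesis by (intro tens_eqI[OF XS emb_tens[OF X0S[OF s]]]) (simp_all add: X0_def)
  qed
  have low: "lower1 E21 (emb 1 s) = emb 2 s" if s: "s \<in> S" for s
    by (rule tens_eqI[OF tens_lower1[OF st emb_tens[OF s]] emb_tens[OF s]]) (simp_all add: slice_lower1 E21_def)
  \<comment> \<open>\<open>E21\<close> carries the first basis vector to the second, which
    transports the formula for \<open>X\<close>.\<close>
  have X2: "X (emb 2 s) = emb 2 (X0 s)" if s: "s \<in> S" for s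
    using hom_lower1[OF h _ emb_tens[OF s], of E21 1] unfolding low[OF s] X1[OF s] low[OF X0S[OF s]] by simp
  have X12: "X (emb p s) = emb p (X0 s)" if s: "s \<in> S" for p s
    using X1[OF s] X2[OF s] exhaust_2[of p] by metis
  have emb_inj: "emb p s = emb p s' \<Longrightarrow> s = s'" for p and s s' :: "letter list \<Rightarrow> 'a"
    using slice_emb_VL[of p p s] slice_emb_VL[of p p s'] by metis
  have lin0: "lin_on S X0"
    unfolding lin_on_def
  proof (intro conjI ballI allI)
    fix x y assume xy: "x \<in> S" "y \<in> S"
    show "X0 (x + y) = X0 x + X0 y"
      unfolding X0_def emb_add lin_on_add[OF l emb_tens[OF xy(1)] emb_tens[OF xy(2)]] by simp
  next
    fix c x assume x: "x \<in> S"
    show "X0 (fscale c x) = fscale c (X0 x)"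
      unfolding X0_def emb_scale lin_on_scale[OF l emb_tens[OF x]] by simp
  qed
  have act0: "X0 (wact A s) = wact A (X0 s)" if A: "A \<in> SL2" and s: "s \<in> S" for A s
  proof -
    have As: "wact A s \<in> S" by (rule stab_act[OF st A s])
    have fs: "fscale c (wact A s) \<in> S" for c by (rule subsp(4)[OF ss(1) As])
    have "X (wact A (emb 1 s)) = wact A (X (emb 1 s))" by (rule rep_hom_act[OF h A emb_tens[OF s]])
    then have "X (emb 1 (fscale (A $ 1 $ 1) (wact A s)) + emb 2 (fscale (A $ 2 $ 1) (wact A s))) =
        emb 1 (fscale (A $ 1 $ 1) (wact A (X0 s))) + emb 2 (fscale (A $ 2 $ 1) (wact A (X0 s)))"
      unfolding X1[OF s] wact_emb[OF s A] wact_emb[OF X0S[OF s] A] .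
    then have e: "emb 1 (fscale (A $ 1 $ 1) (X0 (wact A s))) + emb 2 (fscale (A $ 2 $ 1) (X0 (wact A s))) =
        emb 1 (fscale (A $ 1 $ 1) (wact A (X0 s))) + emb 2 (fscale (A $ 2 $ 1) (wact A (X0 s)))"
      unfolding lin_on_add[OF l emb_tens[OF fs] emb_tens[OF fs]] X12[OF fs] lin_on_scale[OF lin0 As] .
    have e1: "fscale (A $ 1 $ 1) (X0 (wact A s)) = fscale (A $ 1 $ 1) (wact A (X0 s))"
      using arg_cong[OF e, of "slice (VL 1)"] by simp
    have e2: "fscale (A $ 2 $ 1) (X0 (wact A s)) = fscale (A $ 2 $ 1) (wact A (X0 s))"
      using arg_cong[OF e, of "slice (VL 2)"] by simp
    \<comment> \<open>The first column of an invertible matrix has a nonzero entry, so one of the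
      two scaled equations can be cancelled.\<close>
    have "A $ 1 $ 1 \<noteq> 0 \<or> A $ 2 $ 1 \<noteq> 0" using A by (auto simp: SL2_def det_2)
    then show ?thesis using e1 e2 fvs.scale_left_imp_eq by metis
  qed
  have h0: "rep_hom SL2 wact S wact S X0" unfolding rep_hom_def using lin0 X0S act0 by simp
  have id0: "\<forall>s\<in>S. X0 (X0 s) = X0 s"
  proof
    fix s assume s: "s \<in> S"
    have "X (X (emb 1 s)) = X (emb 1 s)" by (rule bspec[OF id emb_tens[OF s]])
    then show "X0 (X0 s) = X0 s" unfolding X1[OF s] X1[OF X0S[OF s]] by (rule emb_inj)
  qed
  have dcmp: "t = emb 1 (slice (VL 1) t) + emb 2 (slice (VL 2) t)" if t: "t \<in> tens S" for t
    by (rule tens_eqI[OF t subsp(2)[OF ss(2) emb_tens[OF tens_slice[OF t]] emb_tens[OF tens_slice[OF t]]]]) simp_all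
  have Xt: "X t = emb 1 (X0 (slice (VL 1) t)) + emb 2 (X0 (slice (VL 2) t))" if t: "t \<in> tens S" for t
    using lin_on_add[OF l emb_tens[OF tens_slice[OF t]] emb_tens[OF tens_slice[OF t]], of 1 1 2 2]
      X12[OF tens_slice[OF t]] dcmp[OF t] by metis
  from indec_idempotent[OF lin_act_wact ind h0 id0]
  show "(\<forall>t\<in>tens S. X t = 0) \<or> (\<forall>t\<in>tens S. X t = t)"
  proof
    assume z: "\<forall>t\<in>S. X0 t = 0"
    have "X t = 0" if t: "t \<in> tens S" for t
    proof (rule tens_eqI[OF rep_hom_in[OF h t] subsp(1)[OF ss(2)]])
      show "slice (VL 1) (X t) = slice (VL 1) 0" "slice (VL 2) (X t) = slice (VL 2) 0"
        unfolding Xt[OF t] using bspec[OF z tens_slice[OF t]] by simp_all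
    qed
    then show ?thesis by blast
  next
    assume z: "\<forall>t\<in>S. X0 t = t"
    have "X t = t" if t: "t \<in> tens S" for t
    proof (rule tens_eqI[OF rep_hom_in[OF h t] t])
      show "slice (VL 1) (X t) = slice (VL 1) t" "slice (VL 2) (X t) = slice (VL 2) t"
        unfolding Xt[OF t] using bspec[OF z tens_slice[OF t]] by simp_all
    qed
    then show ?thesis by blast
  qed
qed

end

lemma tens2_eqI:
  assumes "t \<in> tens (tens S)" "u \<in> tens (tens S')"
    and "\<And>p q. slice (VL q) (slice (VL p) t) = slice (VL q) (slice (VL p) u)"
  shows "t = u"
proof -
  have "slice (VL p) t = slice (VL p) u" for p
    by (rule tens_eqI[OF tens_slice[OF assms(1)] tens_slice[OF assms(2)] assms(3) assms(3)])
  then show ?thesis by (intro tens_eqI[OF assms(1,2)])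
qed

text \<open>In characteristic 2 this is contraction with the invariant alternating form on \<open>V\<close>.\<close>

definition eps :: "(letter list \<Rightarrow> 'a::field) \<Rightarrow> letter list \<Rightarrow> 'a" where
  "eps t = slice (VL 2) (slice (VL 1) t) + slice (VL 1) (slice (VL 2) t)"

lemma eps_add: "eps (t + u) = eps t + eps u"
  by (simp add: eps_def ac_simps)

lemma eps_scale: "eps (fscale c t) = fscale c (eps t)"
  by (simp add: eps_def fvs.scale_right_distrib)

lemma fun_char2:
  assumes "CHAR('a::field) = 2"
  shows "(x :: 'b \<Rightarrow> 'a) + x = 0" "x - y = x + (y :: 'b \<Rightarrow> 'a)" "x + (x + y) = y"
proof -
  show 1: "x + x = 0" for x :: "'b \<Rightarrow> 'a" by (simp add: fun_eq_iff char2[OF assms])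
  show "x - y = x + y" for x y :: "'b \<Rightarrow> 'a" by (simp add: fun_eq_iff char2[OF assms])
  show "x + (x + y) = y" by (simp add: add.assoc[symmetric] 1)
qed

lemma fscale_apply: "fscale c t w = c * t w"
  by (simp add: fscale_def)

lemma eps_wact:
  fixes A :: "'a::field ^ 2 ^ 2"
  assumes ch: "CHAR('a) = 2" and A: "A \<in> SL2"
  shows "eps (wact A t) = wact A (eps t)"
proof
  fix w
  have d: "A $ 1 $ 1 * A $ 2 $ 2 + A $ 1 $ 2 * A $ 2 $ 1 = 1"
    using A by (simp add: SL2_def det_2 char2(4)[OF ch])
  have cancel: "x + (x + y) = y" for x y :: 'a by (simp add: add.assoc[symmetric] char2[OF ch])
  have "wact A (eps t) w = (A $ 1 $ 1 * A $ 2 $ 2 + A $ 1 $ 2 * A $ 2 $ 1) * wact A (eps t) w" using d by simp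
  also have "\<dots> = eps (wact A t) w"
    by (simp add: eps_def slice_wact_VL wact_add wact_scale fscale_apply algebra_simps cancel char2(1,2)[OF ch])
  finally show "eps (wact A t) w = wact A (eps t) w" by simp
qed

lemma slice_lower2_E12:
  "slice (VL 1) (slice (VL 1) (lower2 E12 t)) = eps t"
  "slice (VL 2) (slice (VL 1) (lower2 E12 t)) = slice (VL 2) (slice (VL 2) t)"
  "slice (VL 1) (slice (VL 2) (lower2 E12 t)) = slice (VL 2) (slice (VL 2) t)"
  "slice (VL 2) (slice (VL 2) (lower2 E12 t)) = 0"
  by (simp_all add: slice_lower2 E12_def eps_def ac_simps)

lemma slice_lower2_E21:
  "slice (VL 1) (slice (VL 1) (lower2 E21 t)) = 0"
  "slice (VL 2) (slice (VL 1) (lower2 E21 t)) = slice (VL 1) (slice (VL 1) t)"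
  "slice (VL 1) (slice (VL 2) (lower2 E21 t)) = slice (VL 1) (slice (VL 1) t)"
  "slice (VL 2) (slice (VL 2) (lower2 E21 t)) = eps t"
  by (simp_all add: slice_lower2 E21_def eps_def ac_simps)

lemma rep_hom_id_minus:
  assumes la: "lin_act G act" and st: "stab G act S" and h: "rep_hom G act S act S X"
  shows "rep_hom G act S act S (\<lambda>t. t - X t)"
proof -
  note ss = stab_subspace[OF st]
  have l: "lin_on S X" by (rule rep_hom_lin[OF h])
  have 1: "x + y - X (x + y) = (x - X x) + (y - X y)" if "x \<in> S" "y \<in> S" for x y
    unfolding lin_on_add[OF l that] by simp
  have 2: "fscale c x - X (fscale c x) = fscale c (x - X x)" if "x \<in> S" for c x
    unfolding lin_on_scale[OF l that] by (simp add: fvs.scale_right_diff_distrib)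
  have 3: "act A x - X (act A x) = act A (x - X x)" if "A \<in> G" "x \<in> S" for A x
    unfolding rep_hom_act[OF h that] lin_act_diff[OF la that(1)] ..
  have 4: "x - X x \<in> S" if "x \<in> S" for x by (rule subsp(3)[OF ss that rep_hom_in[OF h that]])
  show ?thesis unfolding rep_hom_def lin_on_def by (intro conjI ballI allI 1 2 3 4)
qed

section \<open>V tensor V tensor S, generated from one copy of S, and its quotient by the
  alternating form\<close>

context indecomposable_factor begin

abbreviation "TT \<equiv> tens (tens S)"

abbreviation g :: "(letter list \<Rightarrow> 'a) \<Rightarrow> letter list \<Rightarrow> 'a" where "g s \<equiv> emb 1 (emb 2 s)"
abbreviation e :: "(letter list \<Rightarrow> 'a) \<Rightarrow> letter list \<Rightarrow> 'a" where "e \<equiv> lower2 E12"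
abbreviation f :: "(letter list \<Rightarrow> 'a) \<Rightarrow> letter list \<Rightarrow> 'a" where "f \<equiv> lower2 E21"

lemma g_TT: "s \<in> S \<Longrightarrow> g s \<in> TT"
  by (intro emb_in_tens emb_tens stab_0[OF st1])

lemma ef_TT: "t \<in> TT \<Longrightarrow> e t \<in> TT" "t \<in> TT \<Longrightarrow> f t \<in> TT"
  by (rule tens_lower2[OF st], assumption)+

lemma eps_g: "eps (g s) = s"
  by (simp add: eps_def)

lemma eps_S: "t \<in> TT \<Longrightarrow> eps t \<in> S"
  unfolding eps_def by (intro subsp(2)[OF ss(1)] tens_slice)

lemma eps_ef: "eps (e t) = 0" "eps (f t) = 0"
  by (simp_all add: eps_def slice_lower2_E12 slice_lower2_E21 fun_char2[OF ch])

text \<open>Write x_p for the basis of V, and \<open>g s\<close> for x_1 x_2 s. Then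
  \<open>e\<close> gives x_1 x_1 s, \<open>f\<close> gives x_2 x_2 s, and \<open>e\<close> after
  \<open>f\<close> gives (x_1 x_2 + x_2 x_1) s. So \<open>g\<close> generates everything under
  \<open>e\<close> and \<open>f\<close>, and an endomorphism commuting with them is determined by
  its values on the tensors \<open>g s\<close>.\<close>

lemma TT_decomp:
  assumes t: "t \<in> TT"
  shows "t = (g (eps t) + e (g (slice (VL 1) (slice (VL 1) t)))) +
    (f (g (slice (VL 2) (slice (VL 2) t))) + e (f (g (slice (VL 1) (slice (VL 2) t)))))" (is "t = ?u")
proof -
  have sl: "slice (VL q) (slice (VL p) t) \<in> S" for p q by (intro tens_slice t)
  have u: "?u \<in> TT" by (intro subsp(2)[OF ss(3)] ef_TT g_TT sl eps_S t)
  have "slice (VL q) (slice (VL p) t) = slice (VL q) (slice (VL p) ?u)" for p q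
    using exhaust_2[of p] exhaust_2[of q]
    by (elim disjE) (simp_all add: slice_lower2_E12 slice_lower2_E21 eps_g eps_ef eps_def[of t] ac_simps fun_char2[OF ch])
  then show ?thesis by (rule tens2_eqI[OF t u])
qed

text \<open>\<open>e (f t)\<close> is the invariant tensor x_1 x_2 + x_2 x_1 times
  \<open>eps t\<close>, so it sees only the quotient by \<open>eps\<close>.\<close>

lemma ef_zero: "t \<in> TT \<Longrightarrow> eps t = 0 \<Longrightarrow> e (f t) = 0"
proof -
  assume t: "t \<in> TT" and z: "eps t = 0"
  have "slice (VL q) (slice (VL p) (e (f t))) = slice (VL q) (slice (VL p) 0)" for p q
    using exhaust_2[of p] exhaust_2[of q]
    by (elim disjE) (simp_all add: slice_lower2_E12 slice_lower2_E21 eps_ef z)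
  then show ?thesis by (rule tens2_eqI[OF ef_TT(1)[OF ef_TT(2)[OF t]] subsp(1)[OF ss(3)]])
qed

context
  fixes X
  assumes h: "rep_hom (SL2 :: ('a ^ 2 ^ 2) set) wact TT wact TT X" and id: "\<forall>t\<in>TT. X (X t) = X t"
begin

lemma X_lin: "lin_on TT X" by (rule rep_hom_lin[OF h])

lemma X_TT: "t \<in> TT \<Longrightarrow> X t \<in> TT" by (rule rep_hom_in[OF h])

lemma X_ef: "t \<in> TT \<Longrightarrow> X (e t) = e (X t)" "t \<in> TT \<Longrightarrow> X (f t) = f (X t)"
  by (rule hom_lower2[OF h], simp, assumption)+

lemma X_decomp:
  assumes t: "t \<in> TT"
  shows "X t = (X (g (eps t)) + e (X (g (slice (VL 1) (slice (VL 1) t))))) +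
    (f (X (g (slice (VL 2) (slice (VL 2) t)))) + e (f (X (g (slice (VL 1) (slice (VL 2) t))))))"
proof -
  have sl: "slice (VL q) (slice (VL p) t) \<in> S" for p q by (intro tens_slice t)
  note m = g_TT[OF eps_S[OF t]] g_TT[OF sl] ef_TT subsp(2)[OF ss(3)]
  have "X t = X ((g (eps t) + e (g (slice (VL 1) (slice (VL 1) t)))) +
    (f (g (slice (VL 2) (slice (VL 2) t))) + e (f (g (slice (VL 1) (slice (VL 2) t))))))"
    by (rule arg_cong[OF TT_decomp[OF t]])
  also have "\<dots> = X (g (eps t) + e (g (slice (VL 1) (slice (VL 1) t)))) +
    X (f (g (slice (VL 2) (slice (VL 2) t))) + e (f (g (slice (VL 1) (slice (VL 2) t)))))"
    by (rule lin_on_add[OF X_lin]; intro m)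
  also have "X (g (eps t) + e (g (slice (VL 1) (slice (VL 1) t)))) = X (g (eps t)) + X (e (g (slice (VL 1) (slice (VL 1) t))))"
    by (rule lin_on_add[OF X_lin]; intro m)
  also have "X (f (g (slice (VL 2) (slice (VL 2) t))) + e (f (g (slice (VL 1) (slice (VL 2) t))))) =
      X (f (g (slice (VL 2) (slice (VL 2) t)))) + X (e (f (g (slice (VL 1) (slice (VL 2) t)))))"
    by (rule lin_on_add[OF X_lin]; intro m)
  finally show ?thesis unfolding X_ef[OF g_TT[OF sl]] X_ef(1)[OF ef_TT(2)[OF g_TT[OF sl]]] .
qed

text \<open>\<open>eps\<close> kills the images of \<open>e\<close> and \<open>f\<close>; in
  \<open>X_decomp\<close> only the generator term survives, so \<open>X\<close> descends to the
  quotient.\<close>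

lemma eps_X: "t \<in> TT \<Longrightarrow> eps (X t) = eps (X (g (eps t)))"
  by (subst X_decomp, assumption) (simp add: eps_add eps_ef)

text \<open>An idempotent that vanishes on the quotient is zero. A fixed vector u has
  \<open>eps u = 0\<close> and takes the form \<open>e a + f b\<close>, where \<open>eps\<close>
  vanishes on a and b; this forces its 11 and 22 components to be zero. Feeding this back into
  \<open>X_decomp\<close> gives u = 0.\<close>

lemma idempotent_eq_0:
  assumes z: "\<And>t. t \<in> TT \<Longrightarrow> eps (X t) = 0" and t: "t \<in> TT"
  shows "X t = 0"
proof -
  have X0: "X 0 = 0" by (rule lin_on_zero[OF X_lin t])
  have g0: "g 0 = 0" by (simp add: emb_def fun_eq_iff split: list.splits)
  define u where "u = X t"
  have u: "u \<in> TT" unfolding u_def by (rule X_TT[OF t])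
  have Xu: "X u = u" unfolding u_def by (rule bspec[OF id t])
  have sl: "slice (VL q) (slice (VL p) u) \<in> S" for p q by (intro tens_slice u)
  have zu: "eps u = 0" unfolding u_def by (rule z[OF t])
  let ?a = "X (g (slice (VL 1) (slice (VL 1) u)))" and ?b = "X (g (slice (VL 2) (slice (VL 2) u)))"
    and ?c = "X (g (slice (VL 1) (slice (VL 2) u)))"
  have ec: "e (f ?c) = 0" by (rule ef_zero[OF X_TT[OF g_TT[OF sl]] z[OF g_TT[OF sl]]])
  have u1: "u = e ?a + f ?b"
    using X_decomp[OF u] unfolding Xu zu g0 X0 ec by simp
  have "slice (VL 1) (slice (VL 1) u) = slice (VL 1) (slice (VL 1) (e ?a + f ?b))"
    by (rule arg_cong[OF u1])
  also have "\<dots> = 0" by (simp add: slice_lower2_E12 slice_lower2_E21 z[OF g_TT[OF sl]])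
  finally have s11: "slice (VL 1) (slice (VL 1) u) = 0" .
  have "slice (VL 2) (slice (VL 2) u) = slice (VL 2) (slice (VL 2) (e ?a + f ?b))"
    by (rule arg_cong[OF u1])
  also have "\<dots> = 0" by (simp add: slice_lower2_E12 slice_lower2_E21 z[OF g_TT[OF sl]])
  finally have s22: "slice (VL 2) (slice (VL 2) u) = 0" .
  have e0: "e 0 = 0" and f0: "f 0 = 0"
    by (rule tens2_eqI[OF ef_TT(1)[OF subsp(1)[OF ss(3)]] subsp(1)[OF ss(3)]], simp add: slice_lower2)
      (rule tens2_eqI[OF ef_TT(2)[OF subsp(1)[OF ss(3)]] subsp(1)[OF ss(3)]], simp add: slice_lower2)
  have "u = 0"
    using X_decomp[OF u] unfolding Xu zu g0 X0 ec s11 s22 e0 f0 by simp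
  then show ?thesis by (simp only: u_def)
qed

end

text \<open>An idempotent \<open>X\<close> induces on the quotient \<open>S\<close> an idempotent
  \<open>X0\<close>, which is 0 or 1. In the first case \<open>idempotent_eq_0\<close> applies to
  \<open>X\<close>, in the second to 1 - \<open>X\<close>.\<close>

lemma indec_tens_tens: "indec (SL2 :: ('a ^ 2 ^ 2) set) wact TT"
proof (rule indecI[OF lin_act_wact st2])
  obtain s where s: "s \<in> S" "s \<noteq> 0" by (rule nonzero)
  show "TT \<noteq> {0}"
  proof
    assume "TT = {0}"
    then have "g s = 0" using g_TT[OF s(1)] by (metis singletonD)
    then have "eps (g s) = eps 0" by (rule arg_cong)
    then show False using s(2) unfolding eps_g by (simp add: eps_def)
  qed
  fix X assume h: "rep_hom (SL2 :: ('a ^ 2 ^ 2) set) wact TT wact TT X" and id: "\<forall>t\<in>TT. X (X t) = X t"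
  have l: "lin_on TT X" by (rule rep_hom_lin[OF h])
  define X0 where "X0 s = eps (X (g s))" for s
  have epsX: "eps (X t) = X0 (eps t)" if "t \<in> TT" for t
    unfolding X0_def by (rule eps_X[OF h id that])
  have X0S: "X0 s \<in> S" if "s \<in> S" for s
    unfolding X0_def by (rule eps_S[OF rep_hom_in[OF h g_TT[OF that]]])
  have lin0: "lin_on S X0"
    unfolding lin_on_def
  proof (intro conjI ballI allI)
    fix x y assume xy: "x \<in> S" "y \<in> S"
    show "X0 (x + y) = X0 x + X0 y"
      unfolding X0_def emb_add lin_on_add[OF l g_TT[OF xy(1)] g_TT[OF xy(2)]] eps_add ..
  next
    fix c x assume x: "x \<in> S"
    show "X0 (fscale c x) = fscale c (X0 x)"
      unfolding X0_def emb_scale lin_on_scale[OF l g_TT[OF x]] eps_scale ..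
  qed
  have act0: "X0 (wact A s) = wact A (X0 s)" if A: "A \<in> SL2" and s: "s \<in> S" for A s
  proof -
    have "X0 (wact A s) = X0 (eps (wact A (g s)))" unfolding eps_wact[OF ch A] eps_g ..
    also have "\<dots> = eps (X (wact A (g s)))" by (rule epsX[OF stab_act[OF st2 A g_TT[OF s]], symmetric])
    also have "\<dots> = wact A (X0 s)"
      unfolding rep_hom_act[OF h A g_TT[OF s]] eps_wact[OF ch A] X0_def ..
    finally show ?thesis .
  qed
  have h0: "rep_hom SL2 wact S wact S X0" unfolding rep_hom_def using lin0 X0S act0 by simp
  have id0: "\<forall>s\<in>S. X0 (X0 s) = X0 s"
  proof
    fix s assume s: "s \<in> S"
    have "X0 (X0 s) = eps (X (X (g s)))" unfolding epsX[OF rep_hom_in[OF h g_TT[OF s]]] X0_def ..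
    also have "\<dots> = X0 s" unfolding bspec[OF id g_TT[OF s]] X0_def ..
    finally show "X0 (X0 s) = X0 s" .
  qed
  from indec_idempotent[OF lin_act_wact ind h0 id0]
  show "(\<forall>t\<in>TT. X t = 0) \<or> (\<forall>t\<in>TT. X t = t)"
  proof
    assume z: "\<forall>s\<in>S. X0 s = 0"
    have zz: "eps (X t) = 0" if "t \<in> TT" for t
      unfolding epsX[OF that] by (rule bspec[OF z eps_S[OF that]])
    show ?thesis by (intro disjI1 ballI idempotent_eq_0[OF h id zz])
  next
    assume z: "\<forall>s\<in>S. X0 s = s"
    let ?Y = "\<lambda>t. t - X t"
    have hY: "rep_hom SL2 wact TT wact TT ?Y" by (rule rep_hom_id_minus[OF lin_act_wact st2 h])
    have idY: "\<forall>t\<in>TT. ?Y (?Y t) = ?Y t"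
    proof
      fix t assume t: "t \<in> TT"
      have "X (t - X t) = X t - X (X t)" by (rule lin_on_diff[OF l ss(3) t rep_hom_in[OF h t]])
      then show "?Y (?Y t) = ?Y t" unfolding bspec[OF id t] by simp
    qed
    have zz: "eps (?Y t) = 0" if t: "t \<in> TT" for t
    proof -
      have "eps (X t) = eps t" unfolding epsX[OF t] by (rule bspec[OF z eps_S[OF t]])
      then show ?thesis unfolding fun_char2(2)[OF ch] eps_add by (simp only: fun_char2[OF ch])
    qed
    have "X t = t" if "t \<in> TT" for t using idempotent_eq_0[OF hY idY zz that] by simp
    then show ?thesis by blast
  qed
qed

end

lemma dec_tens:
  fixes U :: "(letter list \<Rightarrow> 'a::alg_closed_field) set"
  assumes ch: "CHAR('a) = 2" and inf: "infinite (UNIV :: 'a set)"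
  shows "dec (SL2 :: ('a ^ 2 ^ 2) set) wact U N \<Longrightarrow> U \<subseteq> supp (lword (replicate n FT)) \<Longrightarrow>
    dec (SL2 :: ('a ^ 2 ^ 2) set) wact (tens U) N \<and> dec (SL2 :: ('a ^ 2 ^ 2) set) wact (tens (tens U)) N"
proof (induction rule: dec.induct)
  case zero
  show ?case unfolding tens_0 by (intro conjI dec.zero)
next
  case (step U S R N)
  note sub = splits_subset[OF step(1)]
  interpret indecomposable_factor S n
    by standard (use ch inf step(2,5) sub in blast)+
  have R: "R \<subseteq> supp (lword (replicate n FT))" by (rule order_trans[OF sub(2) step(5)])
  note IH = step(4)[OF R]
  show ?case
    by (intro conjI dec.step[OF splits_tens[OF step(1)] indec_tens conjunct1[OF IH]]
        dec.step[OF splits_tens[OF splits_tens[OF step(1)]] indec_tens_tens conjunct2[OF IH]])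
qed

section \<open>The recursion for the number of summands\<close>

lemma direct_sum_0: "direct_sum U 0 S \<longleftrightarrow> U = {0}"
  by (auto simp: direct_sum_def bij_betw_def)

lemma add_eq_imp_diff_eq: "p + a = q + b \<Longrightarrow> a - b = q - p" for a b p q :: "'g::ab_group_add"
  by (simp add: algebra_simps)

text \<open>Turns bijectivity of the summation map into a recursive splitting that detaches the last
  component, the shape of \<open>dec.step\<close>.\<close>

lemma direct_sum_Suc:
  fixes S :: "nat \<Rightarrow> ('b \<Rightarrow> 'a::field) set"
  assumes ss: "\<And>i. i \<le> n \<Longrightarrow> fvs.subspace (S i)"
  shows "direct_sum U (Suc n) S \<longleftrightarrow>
    (\<exists>R. direct_sum R n S \<and> S n \<inter> R \<subseteq> {0} \<and> U = {x + y |x y. x \<in> S n \<and> y \<in> R})"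
proof -
  let ?P = "\<lambda>n. \<Pi>\<^sub>E i\<in>{..<n}. S i"
  let ?f = "\<lambda>n x. \<Sum>i<n. x i :: 'b \<Rightarrow> 'a"
  have up: "x(n := v) \<in> ?P (Suc n)" "?f (Suc n) (x(n := v)) = ?f n x + v" if "x \<in> ?P n" "v \<in> S n" for x v
  proof -
    show "x(n := v) \<in> ?P (Suc n)" using that by (auto simp: PiE_def extensional_def Pi_def less_Suc_eq)
    have "?f n (x(n := v)) = ?f n x" by (intro sum.cong) auto
    then show "?f (Suc n) (x(n := v)) = ?f n x + v" by simp
  qed
  have down: "x(n := undefined) \<in> ?P n" "x n \<in> S n" "?f (Suc n) x = ?f n (x(n := undefined)) + x n" if "x \<in> ?P (Suc n)" for x
  proof -
    show "x(n := undefined) \<in> ?P n" "x n \<in> S n" using that by (auto simp: PiE_def extensional_def Pi_def)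
    have "?f n (x(n := undefined)) = ?f n x" by (intro sum.cong) auto
    then show "?f (Suc n) x = ?f n (x(n := undefined)) + x n" by simp
  qed
  have sub: "fvs.subspace (?f n ` ?P n)"
  proof (rule fvs.subspaceI)
    show "0 \<in> ?f n ` ?P n"
      by (rule image_eqI[of _ _ "\<lambda>i\<in>{..<n}. 0"]) (simp_all add: fvs.subspace_0[OF ss] sum.neutral)
  next
    fix u v assume "u \<in> ?f n ` ?P n" "v \<in> ?f n ` ?P n"
    then obtain x y where xy: "x \<in> ?P n" "u = ?f n x" "y \<in> ?P n" "v = ?f n y" by blast
    show "u + v \<in> ?f n ` ?P n"
    proof (rule image_eqI)
      show "(\<lambda>i\<in>{..<n}. x i + y i) \<in> ?P n" using xy fvs.subspace_add[OF ss] by (auto simp: PiE_def Pi_def)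
      have "?f n (\<lambda>i\<in>{..<n}. x i + y i) = (\<Sum>i<n. x i + y i)" by (intro sum.cong) auto
      then show "u + v = ?f n (\<lambda>i\<in>{..<n}. x i + y i)" unfolding xy by (simp add: sum.distrib)
    qed
  next
    fix c u assume "u \<in> ?f n ` ?P n"
    then obtain x where x: "x \<in> ?P n" "u = ?f n x" by blast
    show "fscale c u \<in> ?f n ` ?P n"
    proof (rule image_eqI)
      show "(\<lambda>i\<in>{..<n}. fscale c (x i)) \<in> ?P n" using x fvs.subspace_scale[OF ss] by (auto simp: PiE_def Pi_def)
      have "?f n (\<lambda>i\<in>{..<n}. fscale c (x i)) = (\<Sum>i<n. fscale c (x i))" by (intro sum.cong) auto
      then show "fscale c u = ?f n (\<lambda>i\<in>{..<n}. fscale c (x i))" unfolding x by (simp add: fvs.scale_sum_right)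
    qed
  qed
  have Sn: "fvs.subspace (S n)" by (rule ss) simp
  show ?thesis
  proof
    assume "direct_sum U (Suc n) S"
    then have inj: "inj_on (?f (Suc n)) (?P (Suc n))" and U: "U = ?f (Suc n) ` ?P (Suc n)"
      by (auto simp: direct_sum_def bij_betw_def)
    let ?R = "?f n ` ?P n"
    have inj2: "x = y \<and> v = w" if xy: "x \<in> ?P n" "y \<in> ?P n" and vw: "v \<in> S n" "w \<in> S n" and e: "?f n x + v = ?f n y + w" for x y v w
    proof -
      have "x(n := v) = y(n := w)"
        by (rule inj_onD[OF inj _ up(1)[OF xy(1) vw(1)] up(1)[OF xy(2) vw(2)]])
          (simp only: up(2)[OF xy(1) vw(1)] up(2)[OF xy(2) vw(2)] e)
      then have 1: "v = w" and 2: "\<And>i. i \<noteq> n \<Longrightarrow> x i = y i" by (metis fun_upd_same, metis fun_upd_other)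
      have "x n = undefined" "y n = undefined" using xy by (auto simp: PiE_def extensional_def)
      then have "x = y" using 2 by (metis ext)
      then show ?thesis using 1 by blast
    qed
    have S0: "0 \<in> S n" using Sn by (rule fvs.subspace_0)
    have "inj_on (?f n) (?P n)"
      by (rule inj_onI) (use inj2[OF _ _ S0 S0] in simp)
    then have "direct_sum ?R n S" by (simp add: direct_sum_def bij_betw_def)
    moreover have "S n \<inter> ?R \<subseteq> {0}"
    proof
      fix v assume "v \<in> S n \<inter> ?R"
      then obtain x where x: "v \<in> S n" "x \<in> ?P n" "v = ?f n x" by blast
      obtain z where z: "z \<in> ?P n" "0 = ?f n z" using fvs.subspace_0[OF sub] by blast
      have "?f n x + 0 = ?f n z + v" using x(3) z(2) by simp
      from inj2[OF x(2) z(1) S0 x(1) this] show "v \<in> {0}" by blast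
    qed
    moreover have "U = {x + y |x y. x \<in> S n \<and> y \<in> ?R}"
    proof
      show "U \<subseteq> {x + y |x y. x \<in> S n \<and> y \<in> ?R}"
      proof
        fix u assume "u \<in> U"
        then obtain x where x: "x \<in> ?P (Suc n)" "u = ?f (Suc n) x" unfolding U by blast
        have "u = x n + ?f n (x(n := undefined))" unfolding x(2) down(3)[OF x(1)] by (rule add.commute)
        then show "u \<in> {x + y |x y. x \<in> S n \<and> y \<in> ?R}" using down(1,2)[OF x(1)] by blast
      qed
      show "{x + y |x y. x \<in> S n \<and> y \<in> ?R} \<subseteq> U"
      proof
        fix u assume "u \<in> {x + y |x y. x \<in> S n \<and> y \<in> ?R}"
        then obtain v x where v: "u = v + ?f n x" "v \<in> S n" "x \<in> ?P n" by blast
        have "u = ?f (Suc n) (x(n := v))" unfolding up(2)[OF v(3,2)] v(1) by (rule add.commute)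
        then show "u \<in> U" unfolding U by (rule image_eqI[OF _ up(1)[OF v(3,2)]])
      qed
    qed
    ultimately show "\<exists>R. direct_sum R n S \<and> S n \<inter> R \<subseteq> {0} \<and> U = {x + y |x y. x \<in> S n \<and> y \<in> R}" by blast
  next
    assume "\<exists>R. direct_sum R n S \<and> S n \<inter> R \<subseteq> {0} \<and> U = {x + y |x y. x \<in> S n \<and> y \<in> R}"
    then obtain R where R: "direct_sum R n S" "S n \<inter> R \<subseteq> {0}" "U = {x + y |x y. x \<in> S n \<and> y \<in> R}" by blast
    have inj: "inj_on (?f n) (?P n)" and Rf: "R = ?f n ` ?P n" using R(1) by (auto simp: direct_sum_def bij_betw_def)
    have Rs: "fvs.subspace R" unfolding Rf by (rule sub)
    have "inj_on (?f (Suc n)) (?P (Suc n))"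
    proof (rule inj_onI)
      fix x y assume xy: "x \<in> ?P (Suc n)" "y \<in> ?P (Suc n)" and e: "?f (Suc n) x = ?f (Suc n) y"
      let ?x = "x(n := undefined)" and ?y = "y(n := undefined)"
      have e': "?f n ?x + x n = ?f n ?y + y n" using e unfolding down(3)[OF xy(1)] down(3)[OF xy(2)] .
      have "x n - y n \<in> S n" by (intro fvs.subspace_diff Sn down(2) xy)
      moreover have "?f n ?y - ?f n ?x \<in> R"
        by (rule fvs.subspace_diff[OF Rs]; unfold Rf; intro imageI down(1) xy)
      moreover have "x n - y n = ?f n ?y - ?f n ?x"
        by (rule add_eq_imp_diff_eq[OF e'])
      ultimately have "x n - y n \<in> S n \<inter> R" by simp
      then have "x n - y n \<in> {0}" by (rule subsetD[OF R(2)])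
      then have "x n - y n = 0" by (rule singletonD)
      then have n: "x n = y n" by (rule right_minus_eq[THEN iffD1])
      have "?f n ?x = ?f n ?y" using e' unfolding n by (rule add_right_imp_eq)
      then have "?x = ?y" by (rule inj_onD[OF inj _ down(1)[OF xy(1)] down(1)[OF xy(2)]])
      then have "\<And>i. i \<noteq> n \<Longrightarrow> x i = y i" by (metis fun_upd_other)
      then show "x = y" using n by (metis ext)
    qed
    moreover have "?f (Suc n) ` ?P (Suc n) = U"
    proof
      show "?f (Suc n) ` ?P (Suc n) \<subseteq> U"
      proof (rule image_subsetI)
        fix x assume x: "x \<in> ?P (Suc n)"
        have "?f (Suc n) x = x n + ?f n (x(n := undefined))" unfolding down(3)[OF x] by (rule add.commute)
        then show "?f (Suc n) x \<in> U" unfolding R(3) Rf using down(1,2)[OF x] by blast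
      qed
      show "U \<subseteq> ?f (Suc n) ` ?P (Suc n)"
      proof
        fix u assume "u \<in> U"
        then obtain v x where v: "u = v + ?f n x" "v \<in> S n" "x \<in> ?P n" unfolding R(3) Rf by blast
        have "u = ?f (Suc n) (x(n := v))" unfolding up(2)[OF v(3,2)] v(1) by (rule add.commute)
        then show "u \<in> ?f (Suc n) ` ?P (Suc n)" by (rule image_eqI[OF _ up(1)[OF v(3,2)]])
      qed
    qed
    ultimately show "direct_sum U (Suc n) S" by (simp add: direct_sum_def bij_betw_def)
  qed
qed

lemma direct_sum_cong: "(\<And>i. i < n \<Longrightarrow> S i = S' i) \<Longrightarrow> direct_sum U n S \<longleftrightarrow> direct_sum U n S'"
  unfolding direct_sum_def by (metis PiE_cong lessThan_iff)

text \<open>The summand with the last index is detached first, so \<open>Q\<close> takes index 0 and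
  \<open>P\<close> index 1.\<close>

lemma splits_iff_direct_sum:
  assumes "stab G act P" "stab G act Q"
  shows "splits G act U P Q \<longleftrightarrow> direct_sum U 2 (\<lambda>i. if i = 0 then Q else P)"
proof -
  let ?S = "\<lambda>i::nat. if i = 0 then Q else P"
  have ss: "fvs.subspace (?S i)" for i using assms by (simp add: stab_def)
  have 1: "direct_sum R (Suc 0) ?S \<longleftrightarrow> R = Q" for R
  proof -
    have "{x + y |x y. x \<in> Q \<and> y \<in> {0 :: 'b \<Rightarrow> 'c}} = Q" by auto
    then show ?thesis
      using direct_sum_Suc[of 0 ?S R, OF ss] direct_sum_0[of _ ?S] by simp
  qed
  have eq: "direct_sum U 2 ?S \<longleftrightarrow> P \<inter> Q \<subseteq> {0} \<and> U = {x + y |x y. x \<in> P \<and> y \<in> Q}"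
    unfolding numeral_2_eq_2 using direct_sum_Suc[of "Suc 0" ?S U, OF ss] 1 by simp
  show ?thesis
  proof
    assume "splits G act U P Q"
    then have "P \<inter> Q \<subseteq> {0}" "U = {x + y |x y. x \<in> P \<and> y \<in> Q}"
      unfolding splits_def by (elim conjE, simp only: order_refl)+
    then show "direct_sum U 2 ?S" unfolding eq by (rule conjI)
  next
    assume "direct_sum U 2 ?S"
    then have "P \<inter> Q \<subseteq> {0} \<and> U = {x + y |x y. x \<in> P \<and> y \<in> Q}" by (rule eq[THEN iffD1])
    then show "splits G act U P Q" by (elim conjE) (rule splitsI[OF assms])
  qed
qed

lemma dec_iff_direct_sum:
  assumes la: "lin_act G act"
  shows "dec G act U n \<longleftrightarrow> (\<exists>S. direct_sum U n S \<and> (\<forall>i<n. indec G act (S i)))"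
proof
  show "dec G act U n \<Longrightarrow> \<exists>S. direct_sum U n S \<and> (\<forall>i<n. indec G act (S i))"
  proof (induction rule: dec.induct)
    case zero
    then show ?case by (simp add: direct_sum_0)
  next
    case (step U P R n)
    then obtain S where S: "direct_sum R n S" "\<forall>i<n. indec G act (S i)" by blast
    let ?S = "S(n := P)"
    have i: "\<forall>i<Suc n. indec G act (?S i)" using S(2) step(2) by (simp add: less_Suc_eq)
    then have ss: "fvs.subspace (?S i)" if "i \<le> n" for i using that by (auto simp: indec_def stab_def less_Suc_eq_le)
    have "direct_sum R n ?S" using S(1) direct_sum_cong[of n S ?S R] by simp
    moreover have "?S n = P" by simp
    moreover have "P \<inter> R \<subseteq> {0}" "U = {x + y |x y. x \<in> P \<and> y \<in> R}"
      using step(1) unfolding splits_def by (elim conjE, simp only: order_refl)+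
    ultimately have "direct_sum U (Suc n) ?S"
      by (intro direct_sum_Suc[of n ?S U, OF ss, THEN iffD2] exI[of _ R] conjI) (simp_all only: order_refl)
    then show ?case using i by blast
  qed
  assume "\<exists>S. direct_sum U n S \<and> (\<forall>i<n. indec G act (S i))"
  then obtain S where "direct_sum U n S" "\<forall>i<n. indec G act (S i)" by blast
  then show "dec G act U n"
  proof (induction n arbitrary: U)
    case 0
    then have "U = {0}" by (simp only: direct_sum_0)
    then show ?case using dec.zero by (rule ssubst)
  next
    case (Suc n)
    have ss: "fvs.subspace (S i)" if "i \<le> n" for i using that Suc(3) by (auto simp: indec_def stab_def less_Suc_eq_le)
    obtain R where R: "direct_sum R n S" "S n \<inter> R \<subseteq> {0}" "U = {x + y |x y. x \<in> S n \<and> y \<in> R}"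
      using Suc(2) direct_sum_Suc[of n S U, OF ss] by blast
    have d: "dec G act R n" using Suc(1)[OF R(1)] Suc(3) by simp
    have i: "indec G act (S n)" using Suc(3) by simp
    then have "stab G act (S n)" by (simp add: indec_def)
    from splitsI[OF this dec_stab[OF d la] R(2,3)] show ?case by (rule dec.step[OF _ i d])
  qed
qed

text \<open>Finite dimension passes to subspaces, and regularity does too because it is tested on
  functionals of the ambient space; only stability has to be checked.\<close>

lemma algebraic_representation_subrep:
  assumes U: "algebraic_representation G act U" and SU: "S \<subseteq> U"
  shows "algebraic_representation G act S \<longleftrightarrow> stab G act S"
proof
  show "algebraic_representation G act S \<Longrightarrow> stab G act S" by (simp add: algebraic_representation_def stab_def)
  assume st: "stab G act S"
  obtain B where B: "finite B" "U = fvs.span B" using U by (auto simp: algebraic_representation_def)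
  obtain C where C: "C \<subseteq> S" "fvs.independent C" "S \<subseteq> fvs.span C" using fvs.maximal_independent_subset by metis
  have "finite C" using card_independent_bound[OF B(1) _ C(1,2)] SU B(2) by blast
  moreover have "S = fvs.span C" using C(3) fvs.span_minimal[OF C(1) stab_subspace[OF st]] by blast
  ultimately have "\<exists>B. finite B \<and> S = fvs.span B" by blast
  then show "algebraic_representation G act S"
    using U st SU unfolding algebraic_representation_def stab_def
    by (simp add: subset_iff)
qed

lemma indecomposable_subrep:
  assumes U: "algebraic_representation G act U" and SU: "S \<subseteq> U" and la: "lin_act G act"
  shows "indecomposable G act S \<longleftrightarrow> indec G act S"
proof (cases "stab G act S")
  case False
  then show ?thesis using algebraic_representation_subrep[OF U SU] by (simp add: indecomposable_def indec_def)
next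
  case True
  have aS: "algebraic_representation G act S" using algebraic_representation_subrep[OF U SU] True by simp
  have k: "(\<exists>T. direct_sum S 2 T \<and> (\<forall>i<2. algebraic_representation G act (T i) \<and> T i \<noteq> {0})) \<longleftrightarrow>
      (\<exists>P Q. splits G act S P Q \<and> P \<noteq> {0} \<and> Q \<noteq> {0})" (is "?l \<longleftrightarrow> ?r")
  proof
    assume ?l
    then obtain T where T: "direct_sum S 2 T" "\<forall>i<2. algebraic_representation G act (T i) \<and> T i \<noteq> {0}" by blast
    then have st: "stab G act (T 1)" "stab G act (T 0)" by (auto simp: algebraic_representation_def stab_def)
    have "direct_sum S 2 (\<lambda>i. if i = 0 then T 0 else T 1)"
      using T(1) by (rule direct_sum_cong[THEN iffD1, rotated]) (auto simp: less_2_cases_iff)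
    then have "splits G act S (T 1) (T 0)" using splits_iff_direct_sum[OF st] by blast
    then show ?r using T(2) by (metis one_less_numeral_iff pos2 semiring_norm(76))
  next
    assume ?r
    then obtain P Q where PQ: "splits G act S P Q" "P \<noteq> {0}" "Q \<noteq> {0}" by blast
    have st: "stab G act P" "stab G act Q" using PQ(1) by (auto simp: splits_def)
    have "P \<subseteq> U" "Q \<subseteq> U" using splits_subset[OF PQ(1)] SU by blast+
    then have "algebraic_representation G act P" "algebraic_representation G act Q"
      using algebraic_representation_subrep[OF U] st by blast+
    moreover have "direct_sum S 2 (\<lambda>i. if i = 0 then Q else P)" using splits_iff_direct_sum[OF st] PQ(1) by blast
    ultimately show ?l using PQ(2,3) by (intro exI[of _ "\<lambda>i. if i = 0 then Q else P"]) simp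
  qed
  have "\<not> ?r \<longleftrightarrow> (\<forall>P Q. splits G act S P Q \<longrightarrow> P = {0} \<or> Q = {0})" by blast
  then show ?thesis unfolding indecomposable_def indec_def k by (simp only: aS True simp_thms)
qed

lemma direct_sum_component_subset:
  assumes "direct_sum U n S" "\<And>i. i < n \<Longrightarrow> 0 \<in> S i" "i < n"
  shows "S i \<subseteq> U"
proof
  fix v assume v: "v \<in> S i"
  let ?x = "\<lambda>j\<in>{..<n}. if j = i then v else 0"
  have "?x \<in> (\<Pi>\<^sub>E i\<in>{..<n}. S i)" using v assms(2) by auto
  moreover have "(\<Sum>j<n. ?x j) = v"
  proof -
    have "(\<Sum>j<n. ?x j) = (\<Sum>j<n. if j = i then v else 0)" by (intro sum.cong) auto
    then show ?thesis using assms(3) by simp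
  qed
  moreover have "U = (\<lambda>x. \<Sum>i<n. x i) ` (\<Pi>\<^sub>E i\<in>{..<n}. S i)"
    by (rule bij_betw_imp_surj_on[OF assms(1)[unfolded direct_sum_def], symmetric])
  ultimately show "v \<in> U" by (metis (mono_tags, lifting) image_eqI)
qed

theorem num_indecomposable_summands_dec:
  assumes U: "algebraic_representation G act U" and la: "lin_act G act" and d: "dec G act U n"
  shows "num_indecomposable_summands G act U = n"
  unfolding num_indecomposable_summands_def
proof (rule the_equality)
  obtain B where B: "finite B" "U = fvs.span B" using U by (auto simp: algebraic_representation_def)
  have eq: "(\<exists>S. direct_sum U m S \<and> (\<forall>i<m. indecomposable G act (S i))) \<longleftrightarrow> dec G act U m" for m
  proof -
    have sub1: "S i \<subseteq> U" if "direct_sum U m S" "\<forall>i<m. indec G act (S i)" "i < m" for S i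
      by (rule direct_sum_component_subset[OF that(1) _ that(3)]) (use that(2) in \<open>auto simp: indec_def intro: stab_0\<close>)
    have sub2: "S i \<subseteq> U" if "direct_sum U m S" "\<forall>i<m. indecomposable G act (S i)" "i < m" for S i
      by (rule direct_sum_component_subset[OF that(1) _ that(3)])
        (use that(2) in \<open>auto simp: indecomposable_def algebraic_representation_def intro: fvs.subspace_0\<close>)
    show ?thesis unfolding dec_iff_direct_sum[OF la]
      using sub1 sub2 indecomposable_subrep[OF U _ la] by meson
  qed
  show "\<exists>S. direct_sum U n S \<and> (\<forall>i<n. indecomposable G act (S i))" unfolding eq by (rule d)
  show "m = n" if "\<exists>S. direct_sum U m S \<and> (\<forall>i<m. indecomposable G act (S i))" for m
    using dec_unique[OF la B(1), of U m n] that d B(2) unfolding eq by blast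
qed

text \<open>\<open>Suc k\<close> is 2 n + 1 or 2 n + 2 with n = \<open>k div 2\<close>, so the
  equality of the two values is built into the recursion.\<close>

fun summands :: "nat \<Rightarrow> nat" where
  "summands 0 = 1"
| "summands (Suc k) = (\<Sum>j\<le>k div 2. (k div 2 choose j) * 2 ^ (k div 2 - j) * summands j)"

lemma infinite_alg_closed: "infinite (UNIV :: 'a::alg_closed_field set)"
proof
  assume fin: "finite (UNIV :: 'a set)"
  define p :: "'a poly" where "p = (\<Prod>a\<in>UNIV. [:- a, 1:]) + 1"
  have d: "degree (\<Prod>a\<in>(UNIV :: 'a set). [:- a, 1:]) = card (UNIV :: 'a set)"
    by (subst degree_prod_eq_sum_degree) auto
  have "card (UNIV :: 'a set) > 0" using fin by (simp add: card_gt_0_iff)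
  then have "degree p > 0" unfolding p_def using d by (subst degree_add_eq_left) simp_all
  then obtain x where "poly p x = 0" using alg_closed_imp_poly_has_root by blast
  moreover have "poly p x = 1" using fin by (simp add: p_def poly_prod prod_zero)
  ultimately show False by simp
qed

lemma dec_empty_words: "dec G wact (supp (lword []) :: (letter list \<Rightarrow> 'a::field) set) 1"
proof -
  let ?U = "supp (lword []) :: (letter list \<Rightarrow> 'a) set"
  have st: "stab G wact ?U" by (rule stab_lword) simp
  define \<delta> :: "letter list \<Rightarrow> 'a" where "\<delta> = (\<lambda>w. if w = [] then 1 else 0)"
  have U: "t = fscale (t []) \<delta>" if "t \<in> ?U" for t
    using that by (auto simp: supp_def \<delta>_def fscale_def fun_eq_iff)
  have \<delta>: "\<delta> \<in> ?U" by (auto simp: \<delta>_def supp_def)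
  have \<delta>0: "\<delta> \<noteq> 0" by (auto simp: \<delta>_def fun_eq_iff)
  have one: "\<delta> \<in> P" if P: "P \<subseteq> ?U" "fvs.subspace P" "P \<noteq> {0}" for P
  proof -
    obtain p where p: "p \<in> P" "p \<noteq> 0" using P(3) fvs.subspace_0[OF P(2)] by blast
    have e: "p = fscale (p []) \<delta>" using U p(1) P(1) by blast
    have "p [] \<noteq> 0"
    proof
      assume "p [] = 0"
      then have "p = 0" using e by simp
      then show False using p(2) by contradiction
    qed
    then have "fscale (inverse (p [])) (fscale (p []) \<delta>) = \<delta>" by simp
    then show ?thesis using fvs.subspace_scale[OF P(2) p(1), of "inverse (p [])"] e by metis
  qed
  have "indec G wact ?U"
    unfolding indec_def
  proof (intro conjI allI impI st)
    show "?U \<noteq> {0}" using \<delta> \<delta>0 by blast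
    fix P Q assume sp: "splits G wact ?U P Q"
    show "P = {0} \<or> Q = {0}"
    proof (rule ccontr)
      assume "\<not> (P = {0} \<or> Q = {0})"
      then have "\<delta> \<in> P" "\<delta> \<in> Q" using one splits_subset[OF sp] sp unfolding splits_def stab_def by blast+
      then show False using splits_Int[OF sp] \<delta>0 by blast
    qed
  qed
  moreover have "splits G wact ?U ?U {0}"
  proof (rule splitsI[OF st stab_zero[OF lin_act_wact]])
    show "?U = {x + y |x y. x \<in> ?U \<and> y \<in> {0}}" by simp
  qed simp
  ultimately have "dec G wact ?U (Suc 0)" using dec.zero by (intro dec.step)
  then show ?thesis by simp
qed

lemma dec_natural:
  assumes ch: "CHAR('a::alg_closed_field) = 2"
  shows "dec (SL2 :: ('a ^ 2 ^ 2) set) wact (supp (lword (replicate k VS))) (summands k)"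
proof (induction k rule: less_induct)
  case (less k)
  let ?d = "dec (SL2 :: ('a ^ 2 ^ 2) set) wact"
  show ?case
  proof (cases k)
    case 0
    then show ?thesis using dec_empty_words by simp
  next
    case (Suc k')
    define n where "n = k' div 2"
    have "?d (supp (lword (replicate 0 VS @ replicate n VT))) (\<Sum>i\<le>n. (n choose i) * 2 ^ (n - i) * summands (0 + i))"
      by (rule dec_mixed) (rule less, use Suc n_def in linarith)
    then have 1: "?d (supp (lword (replicate n VT))) (summands k)" by (simp add: Suc n_def)
    have 2: "?d (supp (lword (replicate n FT))) (summands k)" by (rule dec_twist[OF ch 1])
    note 3 = dec_tens[OF ch infinite_alg_closed 2 order_refl]
    show ?thesis
    \<comment> \<open>The parity decides whether one or two copies of V stand before the n twisted
      factors, for k = 1 + 2 n or k = 2 + 2 n.\<close>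
    proof (cases "even k'")
      case True
      have "?d (supp (lword (replicate (Suc 0) VS @ replicate n FT))) (summands k)"
        using conjunct1[OF 3] by (simp add: tens_supp)
      from dec_theta[OF ch this] show ?thesis using True by (simp add: Suc n_def)
    next
      case False
      have "?d (supp (lword (replicate (Suc 1) VS @ replicate n FT))) (summands k)"
        using conjunct2[OF 3] by (simp add: tens_supp)
      from dec_theta[OF ch this] show ?thesis using False
        by (simp add: Suc n_def odd_two_times_div_two_nat del: replicate_Suc)
    qed
  qed
qed

theorem tensor_summands_eq:
  assumes ch: "CHAR('a::alg_closed_field) = 2"
  shows "tensor_summands (SL2 :: ('a ^ 2 ^ 2) set) natural_rep k = summands k"
proof -
  let ?act = "\<lambda>A :: 'a ^ 2 ^ 2. tensor_act k (natural_rep A)"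
  have a: "algebraic_representation SL2 ?act (tensor_power k)"
    using algebraic_representation_tensor_power[of SL2 k] by (simp add: natural_rep_def)
  have la: "lin_act SL2 ?act"
    by (auto simp: lin_act_def lin_on_def tensor_act_def fscale_def fun_eq_iff algebra_simps sum.distrib sum_distrib_left)
  show ?thesis
    unfolding tensor_summands_def
    by (rule num_indecomposable_summands_dec[OF a la dec_tensor_power[OF dec_natural[OF ch]]])
qed

section \<open>Spectral formula for the layers\<close>

text \<open>The recursion divided by 4^n: the indices j = 2 m + 1 and j = 2 m + 2 carry the same
  number of summands, namely 4^m \<open>dens m\<close>, and 2^-j is 4^-m / 2 or 4^-m / 4.\<close>

definition kern :: "nat \<Rightarrow> nat \<Rightarrow> real" where
  "kern n m = (real (n choose (2 * m + 1)) / 2 + real (n choose (2 * m + 2)) / 4) / 2 ^ n"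

fun layer :: "nat \<Rightarrow> nat \<Rightarrow> real" where
  "layer 0 n = (1 / 2) ^ n"
| "layer (Suc r) n = (\<Sum>m<n. kern n m * layer r m)"

text \<open>Layer \<open>r\<close> collects the contributions to \<open>dens\<close> in which the recursion is unfolded exactly \<open>r\<close> times.\<close>

definition dens :: "nat \<Rightarrow> real" where
  "dens n = real (summands (2 * n + 1)) / 4 ^ n"

lemma sum_odd_even:
  fixes f :: "nat \<Rightarrow> 'a::comm_monoid_add"
  shows "(\<Sum>j\<le>2 * n. f j) = f 0 + (\<Sum>m<n. f (2 * m + 1) + f (2 * m + 2))"
  by (induction n) (simp_all add: ac_simps)

lemma sum_binomial_extend:
  fixes f :: "nat \<Rightarrow> real"
  shows "(\<Sum>j\<le>n. real (n choose j) * f j) = (\<Sum>j\<le>2 * n. real (n choose j) * f j)"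
  by (rule sum.mono_neutral_left) auto

lemma dens_rec: "dens n = (1 / 2) ^ n + (\<Sum>m<n. kern n m * dens m)"
proof -
  let ?f = "\<lambda>j. real (summands j) / 2 ^ j"
  have odd: "?f (2 * m + 1) = dens m / 2" and even: "?f (2 * m + 2) = dens m / 4" for m
  proof -
    show "?f (2 * m + 1) = dens m / 2" by (simp add: dens_def power_mult)
    have "summands (2 * m + 2) = summands (2 * m + 1)" by simp
    then show "?f (2 * m + 2) = dens m / 4" by (simp add: dens_def power_mult del: summands.simps)
  qed
  have "dens n = (\<Sum>j\<le>n. real (n choose j) * ?f j) / 2 ^ n"
  proof -
    have "real ((n choose j) * 2 ^ (n - j) * summands j) / 4 ^ n = real (n choose j) * ?f j / 2 ^ n" if "j \<le> n" for j
    proof -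
      have "(4::real) ^ n = 2 ^ n * 2 ^ n" by (simp add: power_mult_distrib[symmetric])
      moreover have "(2::real) ^ n = 2 ^ (n - j) * 2 ^ j" using that by (simp add: power_add[symmetric])
      ultimately show ?thesis by (simp add: field_simps)
    qed
    then show ?thesis by (simp add: dens_def sum_divide_distrib)
  qed
  also have "(\<Sum>j\<le>n. real (n choose j) * ?f j) = 1 + (\<Sum>m<n. real (n choose (2 * m + 1)) * ?f (2 * m + 1) + real (n choose (2 * m + 2)) * ?f (2 * m + 2))"
    unfolding sum_binomial_extend sum_odd_even by simp
  also have "\<dots> / 2 ^ n = (1 / 2) ^ n + (\<Sum>m<n. kern n m * dens m)"
  proof -
    have "(real (n choose (2 * m + 1)) * (dens m / 2) + real (n choose (2 * m + 2)) * (dens m / 4)) / 2 ^ n = kern n m * dens m" for m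
      by (simp add: kern_def field_simps)
    then show ?thesis unfolding odd even add_divide_distrib[of 1] sum_divide_distrib by (simp add: power_one_over)
  qed
  finally show ?thesis .
qed

lemma layer_eq_0: "n < r \<Longrightarrow> layer r n = 0"
proof (induction r arbitrary: n)
  case (Suc r)
  then show ?case by (auto intro!: sum.neutral)
qed simp

lemma dens_eq_sum_layer: "dens n = (\<Sum>r\<le>n. layer r n)"
proof (induction n rule: less_induct)
  case (less n)
  have "(\<Sum>m<n. kern n m * dens m) = (\<Sum>m<n. \<Sum>r<n. kern n m * layer r m)"
  proof (intro sum.cong refl)
    fix m assume m: "m \<in> {..<n}"
    have "(\<Sum>r\<le>m. layer r m) = (\<Sum>r<n. layer r m)"
      by (rule sum.mono_neutral_left) (use m layer_eq_0 in auto)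
    then show "kern n m * dens m = (\<Sum>r<n. kern n m * layer r m)" using less m by (simp add: sum_distrib_left)
  qed
  also have "\<dots> = (\<Sum>r<n. layer (Suc r) n)" by (subst sum.swap) simp
  finally have "dens n = layer 0 n + (\<Sum>r<n. layer (Suc r) n)" unfolding dens_rec[of n] by simp
  then show ?case unfolding lessThan_Suc_atMost[symmetric] sum.lessThan_Suc_shift .
qed

lemma binomial_odd_even:
  fixes w :: real
  shows "(\<Sum>m<n. real (n choose (2 * m + 1)) * w ^ (2 * m + 1)) = ((1 + w) ^ n - (1 - w) ^ n) / 2"
    and "(\<Sum>m<n. real (n choose (2 * m + 2)) * w ^ (2 * m + 2)) = ((1 + w) ^ n + (1 - w) ^ n) / 2 - 1"
proof -
  have b: "(1 + x) ^ n = 1 + (\<Sum>m<n. real (n choose (2 * m + 1)) * x ^ (2 * m + 1) + real (n choose (2 * m + 2)) * x ^ (2 * m + 2))"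
    for x :: real
    using binomial_ring[of x 1 n] unfolding add.commute[of 1 x]
    by (simp add: sum_binomial_extend sum_odd_even)
  let ?O = "\<Sum>m<n. real (n choose (2 * m + 1)) * w ^ (2 * m + 1)"
    and ?E = "\<Sum>m<n. real (n choose (2 * m + 2)) * w ^ (2 * m + 2)"
  have "(- w) ^ (2 * m + 1) = - (w ^ (2 * m + 1))" "(- w) ^ (2 * m + 2) = w ^ (2 * m + 2)" for m by simp_all
  then have "(1 - w) ^ n = 1 + (- ?O + ?E)"
    using b[of "- w"] by (simp only: sum.distrib mult_minus_right sum_negf) simp
  moreover have "(1 + w) ^ n = 1 + (?O + ?E)" using b[of w] by (simp only: sum.distrib)
  ultimately show "?O = ((1 + w) ^ n - (1 - w) ^ n) / 2" "?E = ((1 + w) ^ n + (1 - w) ^ n) / 2 - 1"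
    by (simp_all only:) (simp_all add: field_simps)
qed

text \<open>With w a cosine, (1 + w) / 2 is the squared cosine of the half angle, so the kernel
  sends such powers to powers of the same kind; the weights 1 + 2 w and 1 - 2 w become the factors
  of \<open>cprod\<close>.\<close>

lemma kern_power:
  fixes w :: real
  assumes "w \<noteq> 0"
  shows "(\<Sum>m<n. kern n m * (w\<^sup>2) ^ m) = ((1 + w) / 2) ^ n * ((1 + 2 * w) / (8 * w\<^sup>2)) +
    ((1 - w) / 2) ^ n * ((1 - 2 * w) / (8 * w\<^sup>2)) - (1 / 2) ^ n / (4 * w\<^sup>2)"
proof -
  have "kern n m * (w\<^sup>2) ^ m = (real (n choose (2 * m + 1)) * w ^ (2 * m + 1) / (2 * w) +
      real (n choose (2 * m + 2)) * w ^ (2 * m + 2) / (4 * w\<^sup>2)) / 2 ^ n" for m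
  proof -
    have "w ^ (2 * m + 1) = w * (w\<^sup>2) ^ m" "w ^ (2 * m + 2) = w\<^sup>2 * (w\<^sup>2) ^ m"
      unfolding power_mult[symmetric] by (simp_all add: power_add power2_eq_square)
    moreover have "(a / 2 + b / 4) / N * y = (a * (w * y) / (2 * w) + b * (w\<^sup>2 * y) / (4 * w\<^sup>2)) / N" for a b N y :: real
      using assms by (simp add: field_simps)
    ultimately show ?thesis unfolding kern_def by presburger
  qed
  then have "(\<Sum>m<n. kern n m * (w\<^sup>2) ^ m) =
      ((\<Sum>m<n. real (n choose (2 * m + 1)) * w ^ (2 * m + 1)) / (2 * w) +
       (\<Sum>m<n. real (n choose (2 * m + 2)) * w ^ (2 * m + 2)) / (4 * w\<^sup>2)) / 2 ^ n"
    unfolding sum_divide_distrib sum.distrib[symmetric] by (rule sum.cong[OF refl])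
  also have "\<dots> = ((1 + w) / 2) ^ n * ((1 + 2 * w) / (8 * w\<^sup>2)) +
    ((1 - w) / 2) ^ n * ((1 - 2 * w) / (8 * w\<^sup>2)) - (1 / 2) ^ n / (4 * w\<^sup>2)"
    unfolding binomial_odd_even using assms by (simp add: power_divide field_simps power2_eq_square)
  finally show ?thesis .
qed

lemma kern_nonneg: "kern n m \<ge> 0"
  by (simp add: kern_def)

text \<open>The case w = 1 of \<open>kern_power\<close>, for n > 0 so that the power of (1 - w) / 2
  vanishes. The value 3/8 is the loss per layer behind 4^delta = 8/3.\<close>

lemma sum_kern: "(\<Sum>m<n. kern n m) \<le> 3 / 8"
proof (cases n)
  case (Suc k)
  have "(\<Sum>m<n. kern n m) = 3 / 8 - (1 / 2) ^ n / 4"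
    using kern_power[of 1 n] by (simp add: Suc)
  then show ?thesis by simp
qed simp

lemma layer_bounds: "0 \<le> layer r n \<and> layer r n \<le> (3 / 8) ^ r"
proof (induction r arbitrary: n)
  case 0
  then show ?case by (simp add: power_le_one)
next
  case (Suc r)
  have "0 \<le> layer (Suc r) n" by (auto intro!: sum_nonneg mult_nonneg_nonneg kern_nonneg simp: Suc)
  moreover have "layer (Suc r) n \<le> (3 / 8) ^ Suc r"
  proof -
    have "layer (Suc r) n \<le> (\<Sum>m<n. kern n m * (3 / 8) ^ r)"
      by (auto intro!: sum_mono mult_left_mono kern_nonneg simp: Suc)
    also have "\<dots> = (\<Sum>m<n. kern n m) * (3 / 8) ^ r" by (simp add: sum_distrib_right)
    also have "\<dots> \<le> 3 / 8 * (3 / 8) ^ r" by (rule mult_right_mono[OF sum_kern]) simp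
    finally show ?thesis by simp
  qed
  ultimately show ?case by blast
qed

section \<open>Products of cosines and alternating sums over equidistant nodes\<close>

definition cprod :: "nat \<Rightarrow> real \<Rightarrow> real" where
  "cprod r x = (\<Prod>i<r. 1 + 2 * cos (2 ^ i * x))"

lemma cprod_0 [simp]: "cprod 0 x = 1"
  and cprod_Suc: "cprod (Suc r) x = cprod r x * (1 + 2 * cos (2 ^ r * x))"
  by (simp_all add: cprod_def)

lemma cprod_Suc_shift: "cprod (Suc r) x = (1 + 2 * cos x) * cprod r (2 * x)"
  unfolding cprod_def prod.lessThan_Suc_shift by (simp add: ac_simps)

lemma cos_2pi_minus: "cos (2 * pi * real k - x) = cos x"
  using cos_npi_int[of "2 * int k"] sin_npi_int[of "2 * int k"] by (simp add: cos_diff ac_simps)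

lemma cprod_reflect: "cprod r (2 * pi - x) = cprod r x"
proof -
  have "cos (2 ^ i * (2 * pi - x)) = cos (2 ^ i * x)" for i
    using cos_2pi_minus[of "2 ^ i" "2 ^ i * x"] by (simp add: algebra_simps)
  then show ?thesis by (simp add: cprod_def)
qed

text \<open>The terms are the real parts of the powers of q = - exp(i m pi / M), a root of unity of
  order dividing 2 M. The bound on m excludes q = 1, so the geometric sum vanishes.\<close>

lemma alternating_cos_sum:
  fixes m :: int
  assumes "M > 0" "\<bar>m\<bar> < int M"
  shows "(\<Sum>j<2 * M. (- 1) ^ j * cos (of_int m * (pi * real j / real M))) = 0"
proof -
  define q where "q = cis (pi + of_int m * pi / real M)"
  have qj: "q ^ j = (- 1) ^ j * cis (of_int m * (pi * real j / real M))" for j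
  proof -
    have "real j * (pi + of_int m * pi / real M) = real j * pi + of_int m * (pi * real j / real M)"
      by (simp add: field_simps)
    then have "q ^ j = cis (real j * pi + of_int m * (pi * real j / real M))"
      unfolding q_def Complex.DeMoivre by simp
    also have "\<dots> = cis pi ^ j * cis (of_int m * (pi * real j / real M))"
      by (simp only: cis_mult[symmetric] Complex.DeMoivre)
    finally show ?thesis by simp
  qed
  have "q \<noteq> 1"
  proof
    assume "q = 1"
    then have "cos (pi + of_int m * pi / real M) = 1" by (metis cis.sel(1) one_complex.sel(1) q_def)
    then obtain l :: int where "pi + of_int m * pi / real M = of_int l * 2 * pi" using cos_one_2pi_int by metis
    then have "pi * (1 + of_int m / real M) = pi * (of_int l * 2)" by (simp add: algebra_simps)
    then have "1 + of_int m / real M = of_int l * 2" by (simp only: mult_cancel_left pi_neq_zero simp_thms)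
    then have "real_of_int (int M + m) = of_int (2 * l * int M)" using assms(1) by (simp add: field_simps)
    then have e: "int M + m = 2 * l * int M" by (simp only: of_int_eq_iff)
    then have "0 < 2 * l * int M" "2 * l * int M < 2 * int M" using assms(2) by linarith+
    then have "0 < l" "l < 1" using assms(1) by (auto simp: zero_less_mult_iff)
    then show False by simp
  qed
  have "q ^ (2 * M) = 1"
  proof -
    have "q ^ (2 * M) = cis (2 * pi * of_int m)" unfolding qj using assms(1) by (simp add: field_simps)
    also have "\<dots> = 1" by (simp add: complex_eq_iff sin_int_2pin cos_int_2pin)
    finally show ?thesis .
  qed
  then have "(\<Sum>j<2 * M. q ^ j) = 0" using \<open>q \<noteq> 1\<close> by (simp add: geometric_sum)
  then have "Re (\<Sum>j<2 * M. q ^ j) = 0" by simp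
  moreover have "Re (q ^ j) = (- 1) ^ j * cos (of_int m * (pi * real j / real M))" for j
    unfolding qj by (cases "even j") simp_all
  ultimately show ?thesis by (simp add: Re_sum)
qed

text \<open>The summand is a trigonometric polynomial of degree below \<open>M\<close>; \<open>m\<close> shifts frequencies so that the induction works.\<close>

lemma alternating_cprod_sum:
  fixes m :: int
  assumes "\<bar>m\<bar> + 2 ^ q \<le> int M"
  shows "(\<Sum>j<2 * M. (- 1) ^ j * (cos (of_int m * (pi * real j / real M)) * cprod q (pi * real j / real M))) = 0"
  using assms
proof (induction q arbitrary: m)
  case 0
  then show ?case using alternating_cos_sum[of M m] by simp
next
  case (Suc q)
  let ?x = "\<lambda>j. pi * real j / real M"
  have "(- 1) ^ j * (cos (of_int m * ?x j) * cprod (Suc q) (?x j)) =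
      (- 1) ^ j * (cos (of_int m * ?x j) * cprod q (?x j)) +
      ((- 1) ^ j * (cos (of_int (m + 2 ^ q) * ?x j) * cprod q (?x j)) +
      (- 1) ^ j * (cos (of_int (m - 2 ^ q) * ?x j) * cprod q (?x j)))" for j
  proof -
    have "2 * (cos (of_int m * ?x j) * cos (2 ^ q * ?x j)) = cos (of_int (m - 2 ^ q) * ?x j) + cos (of_int (m + 2 ^ q) * ?x j)"
      by (subst cos_times_cos) (simp add: algebra_simps add_divide_distrib diff_divide_distrib)
    then have e: "cos (of_int m * ?x j) * (1 + 2 * cos (2 ^ q * ?x j)) =
        cos (of_int m * ?x j) + (cos (of_int (m + 2 ^ q) * ?x j) + cos (of_int (m - 2 ^ q) * ?x j))"
      by (simp only: distrib_left mult.left_commute[of "cos (of_int m * ?x j)" 2] mult_1_right)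
    have "(- 1) ^ j * (cos (of_int m * ?x j) * cprod (Suc q) (?x j)) =
        (- 1) ^ j * cprod q (?x j) * (cos (of_int m * ?x j) * (1 + 2 * cos (2 ^ q * ?x j)))"
      unfolding cprod_Suc by (simp only: ac_simps)
    then show ?thesis unfolding e by (simp only: distrib_left ac_simps)
  qed
  then have "(\<Sum>j<2 * M. (- 1) ^ j * (cos (of_int m * ?x j) * cprod (Suc q) (?x j))) =
      (\<Sum>j<2 * M. (- 1) ^ j * (cos (of_int m * ?x j) * cprod q (?x j))) +
      ((\<Sum>j<2 * M. (- 1) ^ j * (cos (of_int (m + 2 ^ q) * ?x j) * cprod q (?x j))) +
      (\<Sum>j<2 * M. (- 1) ^ j * (cos (of_int (m - 2 ^ q) * ?x j) * cprod q (?x j))))"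
    by (simp only: sum.distrib)
  also have "\<dots> = 0"
  proof -
    have "\<bar>m\<bar> + 2 ^ q \<le> int M" "\<bar>m + 2 ^ q\<bar> + 2 ^ q \<le> int M" "\<bar>m - 2 ^ q\<bar> + 2 ^ q \<le> int M"
      using Suc(2) zero_less_power[of "2::int" q] by (simp_all only: power_Suc) linarith+
    from this[THEN Suc(1)] show ?thesis by simp
  qed
  finally show ?case .
qed

text \<open>The squared sine raises the frequency of the product to at most 2^r < M, so the
  alternating sum over a full period 2 M vanishes. The reflection j -> 2 M - j pairs the terms, and
  what remains is the node j = M, where x = pi.\<close>

lemma alternating_sin_cprod_sum:
  fixes r :: nat
  defines "M \<equiv> 2 ^ Suc r"
  shows "(\<Sum>j\<in>{1..<M}. (- 1) ^ (j + 1) * (sin (pi * real j / real M / 2))\<^sup>2 * cprod r (pi * real j / real M)) = cprod r pi / 2"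
proof -
  let ?x = "\<lambda>j. pi * real j / real M"
  let ?f = "\<lambda>j. (- 1) ^ j * (sin (?x j / 2))\<^sup>2 * cprod r (?x j)"
  have M: "M > 0" "even M" by (simp_all add: M_def)
  have "?f j = ((- 1) ^ j * (cos (of_int 0 * ?x j) * cprod r (?x j)) - (- 1) ^ j * (cos (of_int 1 * ?x j) * cprod r (?x j))) / 2" for j
  proof -
    have "(sin (?x j / 2))\<^sup>2 = (1 - cos (?x j)) / 2" using cos_double_sin[of "?x j / 2"] by simp
    then show ?thesis by (simp only: of_int_0 of_int_1 mult_zero_left mult_1 cos_zero) (simp add: algebra_simps diff_divide_distrib)
  qed
  then have "(\<Sum>j<2 * M. ?f j) = ((\<Sum>j<2 * M. (- 1) ^ j * (cos (of_int 0 * ?x j) * cprod r (?x j))) -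
      (\<Sum>j<2 * M. (- 1) ^ j * (cos (of_int 1 * ?x j) * cprod r (?x j)))) / 2"
    unfolding sum_subtractf[symmetric] sum_divide_distrib by (rule sum.cong[OF refl])
  also have "\<dots> = 0"
    using alternating_cprod_sum[of 0 r M] alternating_cprod_sum[of 1 r M] by (simp add: M_def)
  finally have z: "(\<Sum>j<2 * M. ?f j) = 0" .
  have split: "{..<2 * M} = insert 0 (insert M ({1..<M} \<union> (\<lambda>j. 2 * M - j) ` {1..<M}))"
  proof -
    have "x \<in> (\<lambda>j. 2 * M - j) ` {1..<M}" if "M < x" "x < 2 * M" for x
      by (rule image_eqI[of _ _ "2 * M - x"]) (use that in auto)
    then have "x \<in> insert 0 (insert M ({1..<M} \<union> (\<lambda>j. 2 * M - j) ` {1..<M}))" if "x < 2 * M" for x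
      using that by (cases x M rule: linorder_cases; cases "x = 0") auto
    then show ?thesis using M(1) by (intro equalityI subsetI) auto
  qed
  have mirror: "?f (2 * M - j) = ?f j" if "j \<in> {1..<M}" for j
  proof -
    have x: "?x (2 * M - j) = 2 * pi - ?x j" using that M(1) by (simp add: of_nat_diff field_simps)
    have "sin ((2 * pi - ?x j) / 2) = sin (?x j / 2)"
      by (simp add: diff_divide_distrib sin_diff)
    moreover have "(- 1 :: real) ^ (2 * M - j) = (- 1) ^ j" using that by (simp add: minus_one_power_iff)
    ultimately show ?thesis unfolding x cprod_reflect by simp
  qed
  have inj: "inj_on (\<lambda>j. 2 * M - j) {1..<M}" by (auto simp: inj_on_def)
  have "(\<Sum>j\<in>(\<lambda>j. 2 * M - j) ` {1..<M}. ?f j) = (\<Sum>j\<in>{1..<M}. ?f j)"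
    unfolding sum.reindex[OF inj] o_def by (intro sum.cong refl) (rule mirror)
  moreover have "{1..<M} \<inter> (\<lambda>j. 2 * M - j) ` {1..<M} = {}" by auto
  ultimately have "(\<Sum>j\<in>{1..<M} \<union> (\<lambda>j. 2 * M - j) ` {1..<M}. ?f j) = 2 * (\<Sum>j\<in>{1..<M}. ?f j)"
    by (subst sum.union_disjoint) auto
  moreover have "M \<notin> {1..<M} \<union> (\<lambda>j. 2 * M - j) ` {1..<M}" by auto
  moreover have "0 \<notin> insert M ({1..<M} \<union> (\<lambda>j. 2 * M - j) ` {1..<M})" using M(1) by auto
  ultimately have "(\<Sum>j<2 * M. ?f j) = ?f 0 + (?f M + 2 * (\<Sum>j\<in>{1..<M}. ?f j))"
    unfolding split by (subst sum.insert; simp)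
  moreover have "?f 0 = 0" by simp
  moreover have "?f M = cprod r pi" using M by simp
  ultimately have "2 * (\<Sum>j\<in>{1..<M}. ?f j) = - cprod r pi" using z by linarith
  moreover have "(\<Sum>j\<in>{1..<M}. (- 1) ^ (j + 1) * (sin (?x j / 2))\<^sup>2 * cprod r (?x j)) = - (\<Sum>j\<in>{1..<M}. ?f j)"
    by (simp add: sum_negf[symmetric])
  ultimately show ?thesis by simp
qed

text \<open>Contribution of the node x = pi j / 2^(r+1) to layer r. The n-th power is that of the
  squared cosine of x / 2.\<close>

definition spec_term :: "nat \<Rightarrow> nat \<Rightarrow> nat \<Rightarrow> real" where
  "spec_term r j n = (- 1) ^ (j + 1) * (sin (pi * real j / 2 ^ Suc r))\<^sup>2 *
    ((1 + cos (pi * real j / 2 ^ Suc r)) / 2) ^ n * cprod r (pi * real j / 2 ^ Suc r)"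

text \<open>
  The points \<open>x / 2\<close> and \<open>\<pi> - x / 2\<close>, for all nodes \<open>x\<close> of level \<open>r\<close>, are the nodes of level
  \<open>r + 1\<close> other than \<open>\<pi> / 2\<close>. The remaining terms with \<open>(1 / 2)\<^sup>n\<close> add up to the contribution of that node.
\<close>

lemma kern_spec_term:
  assumes "j \<in> {1..<2 ^ Suc r}"
  shows "(\<Sum>m<n. kern n m * spec_term r j m) = (spec_term (Suc r) j n + spec_term (Suc r) (2 ^ Suc (Suc r) - j) n) / 2
    - (- 1) ^ (j + 1) * (sin (pi * real j / 2 ^ Suc r / 2))\<^sup>2 * cprod r (pi * real j / 2 ^ Suc r) * (1 / 2) ^ n"
proof -
  define x where "x = pi * real j / 2 ^ Suc r / 2"
  define w where "w = cos x"
  have x2: "pi * real j / 2 ^ Suc r = 2 * x" by (simp add: x_def)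
  have jr: "real j < 2 ^ Suc r" using assms by (metis atLeastLessThan_iff of_nat_less_numeral_power_cancel_iff)
  have j0: "real j > 0" using assms by simp
  have x: "0 < x" "x < pi / 2" using jr j0 by (simp_all add: x_def field_simps)
  have w0: "w > 0" unfolding w_def by (rule cos_gt_zero) (use x in auto)
  have w2: "(1 + cos (2 * x)) / 2 = w\<^sup>2" unfolding w_def cos_double_cos by simp
  have s: "(sin (2 * x))\<^sup>2 = 4 * (sin x)\<^sup>2 * w\<^sup>2" by (simp add: sin_double w_def power_mult_distrib)
  have p1: "pi * real j / 2 ^ Suc (Suc r) = x" by (simp add: x_def)
  have p2: "pi * real (2 ^ Suc (Suc r) - j) / 2 ^ Suc (Suc r) = pi - x"
    using assms by (simp add: of_nat_diff x_def field_simps)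
  have sgn: "(- 1 :: real) ^ (2 ^ Suc (Suc r) - j + 1) = (- 1) ^ (j + 1)"
    using assms by (simp add: minus_one_power_iff)
  have c2: "cprod r (2 * (pi - x)) = cprod r (2 * x)"
    using cprod_reflect[of r "2 * x"] by (simp add: algebra_simps)
  let ?c = "(- 1) ^ (j + 1) * (sin x)\<^sup>2 * cprod r (2 * x)"
  have t1: "spec_term (Suc r) j n = ?c * ((1 + w) / 2) ^ n * (1 + 2 * w)"
    unfolding spec_term_def p1 cprod_Suc_shift w_def by (simp add: ac_simps)
  have t2: "spec_term (Suc r) (2 ^ Suc (Suc r) - j) n = ?c * ((1 - w) / 2) ^ n * (1 - 2 * w)"
    unfolding spec_term_def p2 sgn cprod_Suc_shift c2 w_def by (simp add: ac_simps)
  have t0: "spec_term r j m = 4 * w\<^sup>2 * ?c * (w\<^sup>2) ^ m" for m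
    unfolding spec_term_def x2 s w2 by simp
  have "(\<Sum>m<n. kern n m * spec_term r j m) = 4 * w\<^sup>2 * ?c * (\<Sum>m<n. kern n m * (w\<^sup>2) ^ m)"
    unfolding t0 sum_distrib_left by (intro sum.cong refl) (simp only: ac_simps)
  also have "\<dots> = 4 * w\<^sup>2 * ?c * (((1 + w) / 2) ^ n * ((1 + 2 * w) / (8 * w\<^sup>2)) +
    ((1 - w) / 2) ^ n * ((1 - 2 * w) / (8 * w\<^sup>2)) - (1 / 2) ^ n / (4 * w\<^sup>2))"
    using w0 by (subst kern_power) simp_all
  also have "\<dots> = ?c * (((1 + w) / 2) ^ n * (1 + 2 * w) + ((1 - w) / 2) ^ n * (1 - 2 * w)) / 2 - ?c * (1 / 2) ^ n"
  proof -
    have "4 * w\<^sup>2 * C * (a * (p / (8 * w\<^sup>2)) + b * (q / (8 * w\<^sup>2)) - d / (4 * w\<^sup>2)) = C * (a * p + b * q) / 2 - C * d"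
      for C a b d p q :: real using w0 by (simp add: field_simps)
    then show ?thesis .
  qed
  also have "\<dots> = (spec_term (Suc r) j n + spec_term (Suc r) (2 ^ Suc (Suc r) - j) n) / 2 - ?c * (1 / 2) ^ n"
    unfolding t1 t2 by (simp add: algebra_simps)
  finally show ?thesis unfolding x2 by simp
qed

theorem layer_spectral: "layer r n = (\<Sum>j\<in>{1..<2 ^ Suc r}. spec_term r j n) / 2 ^ r"
proof (induction r arbitrary: n)
  case 0
  have "{1..<2::nat} = {1}" by auto
  then show ?case by (simp add: spec_term_def)
next
  case (Suc r)
  define M :: nat where "M = 2 ^ Suc r"
  have M: "M > 0" "even M" by (simp_all add: M_def)
  let ?t = "\<lambda>j. spec_term (Suc r) j n"
  have "layer (Suc r) n = (\<Sum>m<n. \<Sum>j\<in>{1..<M}. kern n m * spec_term r j m) / 2 ^ r"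
    by (simp add: Suc M_def sum_divide_distrib sum_distrib_left)
  also have "(\<Sum>m<n. \<Sum>j\<in>{1..<M}. kern n m * spec_term r j m) = (\<Sum>j\<in>{1..<M}. \<Sum>m<n. kern n m * spec_term r j m)"
    by (rule sum.swap)
  also have "\<dots> = (\<Sum>j\<in>{1..<M}. (?t j + ?t (2 * M - j)) / 2
      - (- 1) ^ (j + 1) * (sin (pi * real j / real M / 2))\<^sup>2 * cprod r (pi * real j / real M) * (1 / 2) ^ n)"
    by (intro sum.cong refl) (use kern_spec_term[of _ r n] in \<open>simp add: M_def\<close>)
  also have "\<dots> = ((\<Sum>j\<in>{1..<M}. ?t j) + (\<Sum>j\<in>{1..<M}. ?t (2 * M - j))) / 2 - cprod r pi / 2 * (1 / 2) ^ n"
    unfolding sum_subtractf sum_divide_distrib[symmetric] sum_distrib_right[symmetric] sum.distrib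
      alternating_sin_cprod_sum[of r, folded M_def] ..
  also have "cprod r pi / 2 * (1 / 2) ^ n = - ?t M / 2"
    using M by (simp add: spec_term_def cprod_Suc_shift M_def)
  also have "((\<Sum>j\<in>{1..<M}. ?t j) + (\<Sum>j\<in>{1..<M}. ?t (2 * M - j))) / 2 - (- ?t M / 2) =
      ((\<Sum>j\<in>{1..<M}. ?t j) + (\<Sum>j\<in>{1..<M}. ?t (2 * M - j)) + ?t M) / 2" by (simp add: add_divide_distrib)
  also have "(\<Sum>j\<in>{1..<M}. ?t j) + (\<Sum>j\<in>{1..<M}. ?t (2 * M - j)) + ?t M = (\<Sum>j\<in>{1..<2 * M}. ?t j)"
  proof -
    have inj: "inj_on (\<lambda>j. 2 * M - j) {1..<M}" by (auto simp: inj_on_def)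
    have "x \<in> (\<lambda>j. 2 * M - j) ` {1..<M}" if "M < x" "x < 2 * M" for x
      by (rule image_eqI[of _ _ "2 * M - x"]) (use that in auto)
    then have "x \<in> insert M ({1..<M} \<union> (\<lambda>j. 2 * M - j) ` {1..<M})" if "x \<in> {1..<2 * M}" for x
      using that by (cases x M rule: linorder_cases) auto
    then have split: "{1..<2 * M} = insert M ({1..<M} \<union> (\<lambda>j. 2 * M - j) ` {1..<M})"
      using M(1) by (intro equalityI subsetI) auto
    have "(\<Sum>j\<in>{1..<2 * M}. ?t j) = ?t M + ((\<Sum>j\<in>{1..<M}. ?t j) + (\<Sum>j\<in>(\<lambda>j. 2 * M - j) ` {1..<M}. ?t j))"
      unfolding split by (subst sum.insert, simp, force, subst sum.union_disjoint) auto
    then show ?thesis unfolding sum.reindex[OF inj] o_def by simp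
  qed
  finally show ?case by (simp add: M_def)
qed

text \<open>A weak Jordan inequality. Up to pi/3 the mean value theorem applies with cosine at least
  1/2; beyond, the sine is at least sqrt 3 / 2 > 4/5, while u / 2 is at most 4/5.\<close>

lemma sin_ge_half:
  fixes u :: real
  assumes "0 \<le> u" "u \<le> pi / 2"
  shows "u / 2 \<le> sin u"
proof (cases "u \<le> pi / 3")
  case True
  show ?thesis
  proof (cases "u = 0")
    case False
    have "\<exists>z. 0 < z \<and> z < u \<and> sin u - sin 0 = (u - 0) * cos z"
      by (rule MVT2) (use assms False in \<open>auto intro!: derivative_eq_intros\<close>)
    then obtain z where z: "0 < z" "z < u" "sin u = u * cos z" by auto
    have "cos (pi / 3) \<le> cos z" by (rule cos_monotone_0_pi_le) (use z True pi_gt_zero in linarith)+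
    then have "u * (1 / 2) \<le> u * cos z" using assms by (intro mult_left_mono) (simp_all add: cos_60)
    then show ?thesis using z by simp
  qed simp
next
  case False
  have "sin (pi / 3) \<le> sin u" by (rule sin_monotone_2pi_le) (use assms False pi_gt_zero in linarith)+
  moreover have "u / 2 \<le> sqrt 3 / 2"
  proof -
    have "pi \<le> 16 / 5" using pi_approx by simp
    then have "u \<le> 8 / 5" using assms by simp
    also have "(8 / 5 :: real) \<le> sqrt 3" by (rule real_le_rsqrt) (simp add: power2_eq_square)
    finally show ?thesis by simp
  qed
  ultimately show ?thesis by (simp add: sin_60)
qed

section \<open>Scaling limit of the layers\<close>

text \<open>The half angle u = pi j / 2^(r+2) satisfies 4^r u^2 = \<open>gam\<close> j^2, so the
  n-th power of the squared cosine behaves like exp(- \<open>gam\<close> j^2 n / 4^r).\<close>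

definition gam :: real where "gam = pi\<^sup>2 / 16"

lemma gam_pos: "gam > 0" by (simp add: gam_def)

text \<open>\<open>cprod\<close> at the j-th node divided by 3^r, with the factors in reverse order:
  raising r then only appends factors close to 1, and the product converges for fixed j.\<close>

definition psi :: "nat \<Rightarrow> nat \<Rightarrow> real" where
  "psi r j = (\<Prod>l<r. (1 + 2 * cos (pi * real j / 2 ^ (l + 2))) / 3)"

lemma psi_Suc: "psi (Suc r) j = psi r j * ((1 + 2 * cos (pi * real j / 2 ^ (r + 2))) / 3)"
  by (simp add: psi_def)

lemma abs_factor_le: "\<bar>(1 + 2 * cos x) / 3 :: real\<bar> \<le> 1"
proof (rule abs_leI)
  show "(1 + 2 * cos x) / 3 \<le> 1" by simp
  have "0 \<le> 1 + cos x" using cos_ge_minus_one[of x] by linarith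
  then have "0 \<le> 2 * (1 + cos x)" by simp
  then show "- ((1 + 2 * cos x) / 3) \<le> 1" by (simp add: field_simps)
qed

lemma psi_bound: "\<bar>psi r j\<bar> \<le> 1"
proof (induction r)
  case (Suc r)
  show ?case unfolding psi_Suc abs_mult by (rule mult_le_one[OF Suc _ abs_factor_le]) simp
qed (simp add: psi_def)

lemma one_minus_cos_le: "1 - cos x \<le> x\<^sup>2 / 2" for x :: real
proof -
  have "(sin (x / 2))\<^sup>2 \<le> (x / 2)\<^sup>2" using abs_sin_x_le_abs_x[of "x / 2"] by (simp only: abs_le_square_iff)
  then show ?thesis using cos_double_sin[of "x / 2"] by (simp add: power_divide)
qed

lemma psi_diff_bound: "\<bar>psi (Suc r) j - psi r j\<bar> \<le> gam * (real j)\<^sup>2 * (1 / 4) ^ r"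
proof -
  let ?x = "pi * real j / 2 ^ (r + 2)"
  have "psi (Suc r) j - psi r j = psi r j * (- (2 / 3) * (1 - cos ?x))"
    unfolding psi_Suc by (simp add: field_simps)
  then have "\<bar>psi (Suc r) j - psi r j\<bar> = \<bar>psi r j\<bar> * (2 / 3 * (1 - cos ?x))"
    using cos_le_one[of ?x] by (simp add: abs_mult)
  also have "\<dots> \<le> 1 * (2 / 3 * (?x\<^sup>2 / 2))"
    using one_minus_cos_le[of ?x] cos_le_one[of ?x] by (intro mult_mono psi_bound mult_left_mono) simp_all
  also have "\<dots> = (gam * (real j)\<^sup>2 * (1 / 4) ^ r) / 3"
  proof -
    have "((2::real) ^ (r + 2))\<^sup>2 = 16 * 4 ^ r" by (simp add: power_add power2_eq_square power_mult_distrib[symmetric])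
    then show ?thesis by (simp add: gam_def power_divide power_mult_distrib)
  qed
  also have "\<dots> \<le> gam * (real j)\<^sup>2 * (1 / 4) ^ r" using gam_pos by (simp add: divide_le_eq)
  finally show ?thesis .
qed

definition psi_lim :: "nat \<Rightarrow> real" where "psi_lim j = lim (\<lambda>r. psi r j)"

lemma psi_LIMSEQ: "(\<lambda>r. psi r j) \<longlonglongrightarrow> psi_lim j"
proof -
  have "summable (\<lambda>r. gam * (real j)\<^sup>2 * (1 / 4) ^ r)" by (intro summable_mult summable_geometric) simp
  then have "summable (\<lambda>r. psi (Suc r) j - psi r j)"
    by (rule summable_comparison_test'[where N = 0]) (use psi_diff_bound in simp)
  then have "convergent (\<lambda>n. \<Sum>r<n. psi (Suc r) j - psi r j)" by (simp add: summable_iff_convergent)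
  then have "convergent (\<lambda>n. psi n j - psi 0 j)" by (simp only: sum_lessThan_telescope[of "\<lambda>r. psi r j"])
  then have "convergent (\<lambda>n. psi n j)" by (simp only: convergent_diff_const_right_iff)
  then show ?thesis unfolding psi_lim_def by (simp add: convergent_LIMSEQ_iff)
qed

lemma psi_lim_bound: "\<bar>psi_lim j\<bar> \<le> 1"
  by (rule LIMSEQ_le_const2[OF tendsto_rabs[OF psi_LIMSEQ]]) (use psi_bound in auto)

text \<open>Makes the leading coefficient \<open>acoef 1\<close> positive. A product of factors at
  least 1 - d_l is at least 1 minus the sum of the d_l.\<close>

lemma psi_lim_1: "psi_lim 1 \<ge> 1 / 2"
proof -
  let ?x = "\<lambda>l. pi * real 1 / 2 ^ (l + 2)"
  \<comment> \<open>The deficit is 2/3 of 1 - cos, hence at most a third of the squared angle; pi^2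
    <= 10 gives 10/48 = 5/24.\<close>
  have f: "(1 + 2 * cos (?x l)) / 3 \<ge> 1 - (5 / 24) * (1 / 4) ^ l" for l
  proof -
    have "((2::real) ^ (l + 2))\<^sup>2 = 16 * 4 ^ l" by (simp add: power_add power2_eq_square power_mult_distrib[symmetric])
    then have "(?x l)\<^sup>2 = pi\<^sup>2 / 16 * (1 / 4) ^ l" by (simp add: power_divide power_mult_distrib)
    also have "\<dots> \<le> (10 / 16) * (1 / 4) ^ l"
    proof -
      have "pi \<le> 315 / 100" using pi_approx by simp
      then have "pi * pi \<le> 315 / 100 * (315 / 100)" by (intro mult_mono) simp_all
      then have "pi\<^sup>2 \<le> 10" by (simp add: power2_eq_square)
      then show ?thesis by (intro mult_right_mono) simp_all
    qed
    finally show ?thesis using one_minus_cos_le[of "?x l"] by simp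
  qed
  have "psi r 1 \<ge> 1 - (\<Sum>l<r. (5 / 24) * (1 / 4) ^ l) \<and> psi r 1 \<ge> 0 \<and> psi r 1 \<le> 1" for r
  proof (induction r)
    case (Suc r)
    let ?q = "(1 + 2 * cos (?x r)) / 3" and ?d = "(5 / 24) * (1 / 4) ^ r :: real"
    have d: "0 \<le> ?d" "?d \<le> 1" using power_le_one[of "1/4::real" r] by simp_all
    have q: "1 - ?d \<le> ?q" "?q \<le> 1" using f[of r] cos_le_one[of "?x r"] by simp_all
    have "psi (Suc r) 1 = psi r 1 * ?q" by (simp add: psi_Suc)
    moreover have "psi r 1 * ?q \<ge> psi r 1 * (1 - ?d)" using Suc q by (intro mult_left_mono) simp_all
    moreover have "psi r 1 * (1 - ?d) \<ge> psi r 1 - ?d" using Suc d by (simp add: algebra_simps mult_left_le_one_le)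
    moreover have "psi r 1 * ?q \<ge> 0" using Suc q d by (intro mult_nonneg_nonneg) simp_all
    moreover have "psi r 1 * ?q \<le> 1" using Suc q d by (intro mult_le_one) simp_all
    ultimately show ?case using Suc by simp
  qed (simp add: psi_def)
  moreover have "(\<Sum>l<r. (5 / 24) * (1 / 4) ^ l) \<le> (1 / 2 :: real)" for r
  proof -
    have "(\<Sum>l<r. (1 / 4) ^ l) = (1 - (1 / 4) ^ r) / (1 - 1 / 4 :: real)" using sum_gp_strict[of "1 / 4 :: real" r] by simp
    also have "\<dots> \<le> 4 / 3" by simp
    finally show ?thesis unfolding sum_distrib_left[symmetric] by linarith
  qed
  ultimately have "psi r 1 \<ge> 1 / 2" for r by (smt (verit) field_sum_of_halves)
  then show ?thesis by (intro LIMSEQ_le_const[OF psi_LIMSEQ]) auto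
qed

lemma cprod_psi: "cprod r (pi * real j / 2 ^ Suc r) = 3 ^ r * psi r j"
proof -
  have "cprod r (pi * real j / 2 ^ Suc r) = (\<Prod>i<r. 1 + 2 * cos (pi * real j / 2 ^ ((r - Suc i) + 2)))"
    unfolding cprod_def
  proof (intro prod.cong refl)
    fix i assume "i \<in> {..<r}"
    then have "Suc r = i + ((r - Suc i) + 2)" by simp
    then have "(2::real) ^ Suc r = 2 ^ i * 2 ^ ((r - Suc i) + 2)" by (metis power_add)
    then show "1 + 2 * cos (2 ^ i * (pi * real j / 2 ^ Suc r)) = 1 + 2 * cos (pi * real j / 2 ^ ((r - Suc i) + 2))"
      by (simp del: power_Suc)
  qed
  also have "\<dots> = (\<Prod>l<r. 1 + 2 * cos (pi * real j / 2 ^ (l + 2)))"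
    by (rule prod.nat_diff_reindex)
  finally show ?thesis by (simp add: psi_def prod_dividef)
qed

text \<open>The terms of layer r scaled by (8/3)^r, extended by 0 to a series so that Tannery's
  theorem applies. Of (8/3)^r, the division by 2^r in \<open>layer_spectral\<close> and the 3^r
  taken out of \<open>cprod\<close> leave 4^r, which balances the squared sine.\<close>

definition sterm :: "nat \<Rightarrow> nat \<Rightarrow> nat \<Rightarrow> real" where
  "sterm r n j = (if j < 2 ^ Suc r then (- 1) ^ (j + 1) * (4 ^ r * (sin (pi * real j / 2 ^ Suc r))\<^sup>2) *
    ((1 + cos (pi * real j / 2 ^ Suc r)) / 2) ^ n * psi r j else 0)"

lemma scaled_layer: "(8 / 3) ^ r * layer r n = (\<Sum>j. sterm r n j)"
proof -
  have "(\<Sum>j. sterm r n j) = (\<Sum>j\<in>{1..<2 ^ Suc r}. sterm r n j)"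
  proof (rule suminf_finite)
    show "sterm r n j = 0" if "j \<notin> {1..<2 ^ Suc r}" for j
      using that by (cases "j = 0") (auto simp: sterm_def)
  qed simp
  also have "\<dots> = (\<Sum>j\<in>{1..<2 ^ Suc r}. (8 / 3) ^ r / 2 ^ r * spec_term r j n)"
  proof (intro sum.cong refl)
    fix j assume "j \<in> {1..<2 ^ Suc r :: nat}"
    then have j: "j < 2 ^ Suc r" by simp
    have e: "x * (a * b * c * (y * d)) = a * ((x * y) * b) * c * d" for a b c d x y :: real by (simp only: ac_simps)
    have "(8 / 3 :: real) ^ r / 2 ^ r * 3 ^ r = 4 ^ r" by (simp add: power_mult_distrib[symmetric] power_divide[symmetric])
    then show "sterm r n j = (8 / 3) ^ r / 2 ^ r * spec_term r j n"
      unfolding sterm_def spec_term_def cprod_psi e by (simp only: j if_True)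
  qed
  finally show ?thesis unfolding layer_spectral by (simp add: sum_distrib_left sum_divide_distrib)
qed

lemma half_angle: "(1 + cos (2 * u)) / 2 = 1 - (sin u)\<^sup>2" for u :: real
  by (simp add: cos_double_sin)

text \<open>A Gaussian majorant uniform in r. Using sin u >= u/2 instead of the sharp asymptotics
  costs a factor 4 in the exponent, hence \<open>4 ^ Suc r\<close>.\<close>

lemma sterm_bound: "\<bar>sterm r n j\<bar> \<le> 4 * gam * (real j)\<^sup>2 * exp (- gam * (real j)\<^sup>2 * (real n / 4 ^ Suc r))"
proof (cases "j < 2 ^ Suc r")
  case True
  define u where "u = pi * real j / 2 ^ Suc r / 2"
  have x: "pi * real j / 2 ^ Suc r = 2 * u" by (simp add: u_def)
  have jr: "real j < 2 ^ Suc r" using True by (metis of_nat_less_numeral_power_cancel_iff)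
  have u: "0 \<le> u" "u \<le> pi / 2" using jr by (simp_all add: u_def field_simps)
  have four: "((2::real) ^ Suc r)\<^sup>2 = 4 * 4 ^ r" by (simp add: power2_eq_square power_mult_distrib[symmetric])
  have "(sin (2 * u))\<^sup>2 \<le> (2 * u)\<^sup>2" using abs_sin_x_le_abs_x[of "2 * u"] by (simp only: abs_le_square_iff)
  then have "4 ^ r * (sin (2 * u))\<^sup>2 \<le> 4 ^ r * (2 * u)\<^sup>2" by simp
  also have "\<dots> = 4 * gam * (real j)\<^sup>2" unfolding x[symmetric] power_divide four by (simp add: gam_def power_mult_distrib)
  finally have 1: "4 ^ r * (sin (2 * u))\<^sup>2 \<le> 4 * gam * (real j)\<^sup>2" .
  have "(u / 2)\<^sup>2 \<le> (sin u)\<^sup>2" using sin_ge_half[OF u] u by (intro power_mono) simp_all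
  then have "1 - (sin u)\<^sup>2 \<le> exp (- ((u / 2)\<^sup>2))" using exp_ge_add_one_self[of "- ((u / 2)\<^sup>2)"] by linarith
  moreover have "(sin u)\<^sup>2 \<le> 1" by (simp add: abs_square_le_1)
  ultimately have "(1 - (sin u)\<^sup>2) ^ n \<le> exp (- ((u / 2)\<^sup>2)) ^ n" by (intro power_mono) simp_all
  also have "\<dots> = exp (- (real n * (u / 2)\<^sup>2))" by (simp add: exp_of_nat_mult[symmetric])
  also have "real n * (u / 2)\<^sup>2 = gam * (real j)\<^sup>2 * (real n / 4 ^ Suc r)"
    unfolding u_def power_divide four by (simp add: gam_def power_mult_distrib)
  finally have 2: "(1 - (sin u)\<^sup>2) ^ n \<le> exp (- gam * (real j)\<^sup>2 * (real n / 4 ^ Suc r))" by simp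
  have "\<bar>sterm r n j\<bar> = (4 ^ r * (sin (2 * u))\<^sup>2) * (1 - (sin u)\<^sup>2) ^ n * \<bar>psi r j\<bar>"
    using True \<open>(sin u)\<^sup>2 \<le> 1\<close> unfolding sterm_def x half_angle by (simp add: abs_mult power_abs)
  also have "\<dots> \<le> (4 * gam * (real j)\<^sup>2) * exp (- gam * (real j)\<^sup>2 * (real n / 4 ^ Suc r)) * 1"
    using \<open>(sin u)\<^sup>2 \<le> 1\<close> gam_pos by (intro mult_mono[OF mult_mono[OF 1 2] psi_bound]) simp_all
  finally show ?thesis by simp
qed (use gam_pos in \<open>simp add: sterm_def\<close>)

definition acoef :: "nat \<Rightarrow> real" where
  "acoef j = (- 1) ^ (j + 1) * (4 * gam * (real j)\<^sup>2) * psi_lim j"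

lemma acoef_0 [simp]: "acoef 0 = 0" by (simp add: acoef_def)

lemma acoef_bound: "\<bar>acoef j\<bar> \<le> 4 * gam * (real j)\<^sup>2"
  using psi_lim_bound[of j] gam_pos by (simp add: acoef_def abs_mult mult_left_le)

definition profile :: "real \<Rightarrow> real" where
  "profile x = (\<Sum>j. acoef j * exp (- gam * (real j)\<^sup>2 * x))"

text \<open>Quadratic decay is enough for the layers below the main scale: it supplies 16^-l against
  the growth (8/3)^l.\<close>

lemma exp_le_inverse_square: "t > 0 \<Longrightarrow> exp (- t) \<le> 2 / t\<^sup>2" for t :: real
proof -
  assume t: "t > 0"
  have "t\<^sup>2 / 2 \<le> exp t" using exp_lower_Taylor_quadratic[of t] t by simp
  then have "inverse (exp t) \<le> inverse (t\<^sup>2 / 2)" using t by (intro le_imp_inverse_le) simp_all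
  then show ?thesis by (simp add: exp_minus)
qed

definition basel :: real where "basel = (\<Sum>j. 1 / (real j)\<^sup>2)"

lemma summable_inverse_squares_nat: "summable (\<lambda>j. 1 / (real j)\<^sup>2)"
  using inverse_power_summable[of 2, where 'a = real] by (simp add: inverse_eq_divide power_one_over)

lemma gauss_bound:
  assumes "c > 0"
  shows "4 * gam * (real j)\<^sup>2 * exp (- gam * (real j)\<^sup>2 * c) \<le> 8 / (gam * c\<^sup>2) * (1 / (real j)\<^sup>2)"
proof (cases "j = 0")
  case False
  let ?t = "gam * (real j)\<^sup>2 * c"
  have t: "?t > 0" using gam_pos assms False by simp
  have "4 * gam * (real j)\<^sup>2 * exp (- ?t) \<le> 4 * gam * (real j)\<^sup>2 * (2 / ?t\<^sup>2)"
    using exp_le_inverse_square[OF t] gam_pos by (intro mult_left_mono) simp_all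
  also have "\<dots> = 8 / (gam * c\<^sup>2) * (1 / (real j)\<^sup>2)"
    using gam_pos assms False by (simp add: power2_eq_square)
  finally show ?thesis by simp
qed simp

lemma summable_gauss:
  assumes "c > 0" shows "summable (\<lambda>j. 4 * gam * (real j)\<^sup>2 * exp (- gam * (real j)\<^sup>2 * c))"
proof (rule summable_comparison_test'[OF summable_mult[OF summable_inverse_squares_nat, of "8 / (gam * c\<^sup>2)"], where N = 0])
  fix j :: nat
  have "0 \<le> 4 * gam * (real j)\<^sup>2 * exp (- gam * (real j)\<^sup>2 * c)" using gam_pos by simp
  then show "norm (4 * gam * (real j)\<^sup>2 * exp (- gam * (real j)\<^sup>2 * c)) \<le> 8 / (gam * c\<^sup>2) * (1 / (real j)\<^sup>2)"
    using gauss_bound[OF assms, of j] by (simp only: real_norm_def abs_of_nonneg)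
qed

lemma suminf_gauss:
  assumes "c > 0" shows "(\<Sum>j. 4 * gam * (real j)\<^sup>2 * exp (- gam * (real j)\<^sup>2 * c)) \<le> 8 * basel / gam / c\<^sup>2"
proof -
  have "(\<Sum>j. 4 * gam * (real j)\<^sup>2 * exp (- gam * (real j)\<^sup>2 * c)) \<le> (\<Sum>j. 8 / (gam * c\<^sup>2) * (1 / (real j)\<^sup>2))"
    by (intro suminf_le summable_gauss summable_mult summable_inverse_squares_nat gauss_bound assms)
  also have "\<dots> = 8 * basel / gam / c\<^sup>2"
    unfolding suminf_mult[OF summable_inverse_squares_nat] basel_def by simp
  finally show ?thesis .
qed

lemma basel_nonneg: "basel \<ge> 0"
  unfolding basel_def by (intro suminf_nonneg summable_inverse_squares_nat) simp

text \<open>Majorant for layers r well below log_4 n; for the others the constant bound of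
  \<open>scaled_layer_le_1\<close> serves.\<close>

lemma scaled_layer_bound:
  assumes "n > 0"
  shows "(8 / 3) ^ r * layer r n \<le> 8 * basel / gam / (real n / 4 ^ Suc r)\<^sup>2"
proof -
  let ?c = "real n / 4 ^ Suc r"
  have c: "?c > 0" using assms by simp
  have "summable (sterm r n)" by (rule summable_comparison_test'[OF summable_gauss[OF c], where N = 0]) (use sterm_bound in simp)
  then have "(\<Sum>j. sterm r n j) \<le> (\<Sum>j. 4 * gam * (real j)\<^sup>2 * exp (- gam * (real j)\<^sup>2 * ?c))"
    by (intro suminf_le summable_gauss c) (use sterm_bound abs_le_D1 in blast)+
  also have "\<dots> \<le> 8 * basel / gam / ?c\<^sup>2" by (rule suminf_gauss[OF c])
  finally show ?thesis by (simp only: scaled_layer)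
qed

lemma scaled_layer_le_1: "0 \<le> (8 / 3) ^ r * layer r n" "(8 / 3) ^ r * layer r n \<le> 1"
proof -
  have "(8 / 3) ^ r * layer r n \<le> (8 / 3) ^ r * (3 / 8) ^ r" using layer_bounds by (intro mult_left_mono) simp_all
  also have "\<dots> = 1" by (simp add: power_mult_distrib[symmetric])
  finally show "(8 / 3) ^ r * layer r n \<le> 1" .
qed (use layer_bounds in simp)

lemma summable_profile:
  assumes "x > 0" shows "summable (\<lambda>j. acoef j * exp (- gam * (real j)\<^sup>2 * x))"
  by (rule summable_comparison_test'[OF summable_gauss[OF assms], where N = 0])
    (use acoef_bound in \<open>simp add: abs_mult mult_right_mono\<close>)

text \<open>The rescaled argument y need not converge, only stay bounded, so the statement is about
  differences. The tolerance 1 absorbs rounding and the index shift in the application.\<close>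

lemma sterm_tendsto:
  fixes r n :: "nat \<Rightarrow> nat" and y :: "nat \<Rightarrow> real"
  assumes r: "filterlim r at_top sequentially" and close: "\<And>k. \<bar>real (n k) - y k * 4 ^ r k\<bar> \<le> 1"
    and y: "\<And>k. 0 \<le> y k" "\<And>k. y k \<le> b"
  shows "(\<lambda>k. sterm (r k) (n k) j - acoef j * exp (- gam * (real j)\<^sup>2 * y k)) \<longlonglongrightarrow> 0"
proof (cases "j = 0")
  case True
  then show ?thesis by (simp add: sterm_def)
next
  case False
  define u where "u k = pi * real j / 2 ^ (r k + 2)" for k
  define S where "S k = 4 ^ r k * (sin (u k))\<^sup>2" for k
  let ?g = "gam * (real j)\<^sup>2"
  have two: "(\<lambda>k. (1 / 2 :: real) ^ r k) \<longlonglongrightarrow> 0" by (rule filterlim_compose[OF _ r]) (rule LIMSEQ_power_zero, simp)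
  have u_eq: "u k = pi * real j / 4 * (1 / 2) ^ r k" for k by (simp add: u_def power_add power_one_over)
  have u0: "u \<longlonglongrightarrow> 0"
    unfolding u_eq using tendsto_mult_right_zero[OF two] by simp
  have un: "u k \<noteq> 0" for k using False by (simp add: u_def)
  have "filterlim u (at 0) sequentially" using u0 un by (simp add: filterlim_at)
  moreover have "((\<lambda>x::real. sin x / x) \<longlongrightarrow> 1) (at 0)"
    using DERIV_sin[of "0::real"] unfolding DERIV_def by simp
  ultimately have "(\<lambda>k. sin (u k) / u k) \<longlonglongrightarrow> 1"
    by (rule filterlim_compose[rotated])
  then have "(\<lambda>k. ?g * (sin (u k) / u k)\<^sup>2) \<longlonglongrightarrow> ?g * 1\<^sup>2" by (intro tendsto_intros)
  moreover have "?g * (sin (u k) / u k)\<^sup>2 = S k" for k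
  proof -
    have "4 ^ r k * (u k)\<^sup>2 = ?g"
    proof -
      have "((2::real) ^ (r k + 2))\<^sup>2 = 16 * 4 ^ r k" by (simp add: power_add power2_eq_square power_mult_distrib[symmetric])
      then show ?thesis by (simp add: u_def power_divide gam_def power_mult_distrib)
    qed
    then show ?thesis unfolding S_def using un[of k] by (simp add: power_divide field_simps)
  qed
  ultimately have S: "S \<longlonglongrightarrow> ?g" by simp
  have s0: "(\<lambda>k. (sin (u k))\<^sup>2) \<longlonglongrightarrow> 0" using tendsto_power[OF tendsto_sin[OF u0], of 2] by simp
  have q: "\<bar>real (n k) / 4 ^ r k\<bar> \<le> b + 1" for k
  proof -
    have "real (n k) \<le> y k * 4 ^ r k + 1" using close[of k] by linarith
    also have "\<dots> \<le> (b + 1) * 4 ^ r k" using y(2)[of k] by (simp add: distrib_right add_mono mult_right_mono)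
    finally show ?thesis by (simp add: divide_le_eq)
  qed
  \<comment> \<open>The logarithmic error: once sin^2 < 1, (1 - sin^2)^n = exp(- g y) exp(d). It
    tends to 0 by three estimates: the second-order error of the logarithm, \<open>S k\<close>
    tending to g, and the rounding of n.\<close>
  define d where "d k = real (n k) * ln (1 - (sin (u k))\<^sup>2) + ?g * y k" for k
  have d0: "d \<longlonglongrightarrow> 0"
  proof -
    have e1: "(\<lambda>k. real (n k) * (ln (1 - (sin (u k))\<^sup>2) + (sin (u k))\<^sup>2)) \<longlonglongrightarrow> 0"
    proof (rule Lim_null_comparison)
      have "eventually (\<lambda>k. (sin (u k))\<^sup>2 < 1 / 2) sequentially" using s0 by (rule order_tendstoD) simp
      then show "eventually (\<lambda>k. norm (real (n k) * (ln (1 - (sin (u k))\<^sup>2) + (sin (u k))\<^sup>2)) \<le>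
          (b + 1) * (2 * \<bar>S k\<bar> * (sin (u k))\<^sup>2)) sequentially"
      proof eventually_elim
        case (elim k)
        let ?s = "(sin (u k))\<^sup>2"
        have "\<bar>ln (1 + - ?s) - - ?s\<bar> \<le> 2 * (- ?s)\<^sup>2"
          by (rule abs_ln_one_plus_x_minus_x_bound_nonpos) (use elim in simp_all)
        then have "norm (real (n k) * (ln (1 - ?s) + ?s)) \<le> real (n k) * (2 * ?s\<^sup>2)"
          by (simp add: abs_mult mult_left_mono)
        also have "\<dots> = real (n k) / 4 ^ r k * (2 * \<bar>S k\<bar> * ?s)"
          by (simp add: S_def abs_mult power2_eq_square)
        also have "\<dots> \<le> (b + 1) * (2 * \<bar>S k\<bar> * ?s)" using q[of k] by (intro mult_right_mono) simp_all
        finally show ?case .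
      qed
      have "(\<lambda>k. (b + 1) * (2 * \<bar>S k\<bar> * (sin (u k))\<^sup>2)) \<longlonglongrightarrow> (b + 1) * (2 * \<bar>?g\<bar> * 0)"
        by (intro tendsto_intros S s0)
      then show "(\<lambda>k. (b + 1) * (2 * \<bar>S k\<bar> * (sin (u k))\<^sup>2)) \<longlonglongrightarrow> 0" by simp
    qed
    have "(\<lambda>k. ?g - S k) \<longlonglongrightarrow> ?g - ?g" by (intro tendsto_intros S)
    then have gS: "(\<lambda>k. (b + 1) * \<bar>?g - S k\<bar>) \<longlonglongrightarrow> 0"
      by (intro tendsto_mult_right_zero tendsto_rabs_zero) simp
    have "(\<lambda>k. real (n k) / 4 ^ r k * (?g - S k)) \<longlonglongrightarrow> 0"
    proof (rule Lim_null_comparison[OF _ gS], intro always_eventually allI)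
      show "norm (real (n k) / 4 ^ r k * (?g - S k)) \<le> (b + 1) * \<bar>?g - S k\<bar>" for k
        using q[of k] unfolding real_norm_def abs_mult by (intro mult_right_mono) simp_all
    qed
    then have e2: "(\<lambda>k. ?g * (real (n k) / 4 ^ r k) - real (n k) * (sin (u k))\<^sup>2) \<longlonglongrightarrow> 0"
      by (simp add: S_def algebra_simps)
    have e3: "(\<lambda>k. ?g * (y k - real (n k) / 4 ^ r k)) \<longlonglongrightarrow> 0"
    proof (rule Lim_null_comparison)
      have "\<bar>y k - real (n k) / 4 ^ r k\<bar> \<le> (1 / 4) ^ r k" for k
      proof -
        have "\<bar>y k - real (n k) / 4 ^ r k\<bar> = \<bar>real (n k) - y k * 4 ^ r k\<bar> / 4 ^ r k"
        proof -
          have "y k - real (n k) / 4 ^ r k = - (real (n k) - y k * 4 ^ r k) / 4 ^ r k" by (simp add: field_simps)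
          then show ?thesis by (simp only: abs_divide abs_minus_cancel power_abs abs_numeral)
        qed
        also have "\<dots> \<le> 1 / 4 ^ r k" using close[of k] by (intro divide_right_mono) simp_all
        finally show ?thesis by (simp add: power_one_over)
      qed
      then show "eventually (\<lambda>k. norm (?g * (y k - real (n k) / 4 ^ r k)) \<le> ?g * (1 / 4) ^ r k) sequentially"
        using gam_pos by (intro always_eventually allI) (simp add: abs_mult mult_left_mono)
      have "(\<lambda>k. (1 / 4 :: real) ^ r k) \<longlonglongrightarrow> 0" by (rule filterlim_compose[OF _ r]) (rule LIMSEQ_power_zero, simp)
      from tendsto_mult_right_zero[OF this] show "(\<lambda>k. ?g * (1 / 4) ^ r k) \<longlonglongrightarrow> 0" .
    qed
    have "(\<lambda>k. real (n k) * (ln (1 - (sin (u k))\<^sup>2) + (sin (u k))\<^sup>2) +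
        (?g * (real (n k) / 4 ^ r k) - real (n k) * (sin (u k))\<^sup>2) + ?g * (y k - real (n k) / 4 ^ r k)) \<longlonglongrightarrow> 0 + 0 + 0"
      by (intro tendsto_add e1 e2 e3)
    then show ?thesis by (simp add: d_def[abs_def] algebra_simps)
  qed
  have ex: "(\<lambda>k. exp (- ?g * y k) * (exp (d k) - 1)) \<longlonglongrightarrow> 0"
  proof (rule Lim_null_comparison)
    show "eventually (\<lambda>k. norm (exp (- ?g * y k) * (exp (d k) - 1)) \<le> \<bar>exp (d k) - 1\<bar>) sequentially"
      using y(1) gam_pos by (intro always_eventually allI) (simp add: abs_mult mult_left_le_one_le)
    have "(\<lambda>k. \<bar>exp (d k) - 1\<bar>) \<longlonglongrightarrow> \<bar>exp 0 - 1\<bar>" by (intro tendsto_intros d0)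
    then show "(\<lambda>k. \<bar>exp (d k) - 1\<bar>) \<longlonglongrightarrow> 0" by simp
  qed
  \<comment> \<open>The amplitude, with the squared sine of the double angle written as 4 sin^2 (1 -
    sin^2) so that \<open>S\<close> appears.\<close>
  define a where "a k = (- 1) ^ (j + 1) * (4 * S k * (1 - (sin (u k))\<^sup>2)) * psi (r k) j" for k
  have psi: "(\<lambda>k. psi (r k) j) \<longlonglongrightarrow> psi_lim j" by (rule filterlim_compose[OF psi_LIMSEQ r])
  have "a \<longlonglongrightarrow> (- 1) ^ (j + 1) * (4 * ?g * (1 - 0)) * psi_lim j"
    unfolding a_def[abs_def] by (intro tendsto_intros S s0 psi)
  then have a: "a \<longlonglongrightarrow> acoef j" by (simp add: acoef_def mult.assoc)
  have "eventually (\<lambda>k. (sin (u k))\<^sup>2 < 1) sequentially" using s0 by (rule order_tendstoD) simp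
  moreover have "eventually (\<lambda>k. j < 2 ^ Suc (r k)) sequentially"
  proof -
    have "eventually (\<lambda>k. r k \<ge> j) sequentially" using r by (simp add: filterlim_at_top)
    then show ?thesis
    proof eventually_elim
      case (elim k)
      have "j < 2 ^ j" by (rule less_exp)
      also have "(2::nat) ^ j \<le> 2 ^ Suc (r k)" using elim by (intro power_increasing) simp_all
      finally show ?case .
    qed
  qed
  ultimately have ev: "eventually (\<lambda>k. sterm (r k) (n k) j - acoef j * exp (- ?g * y k) =
      a k * (exp (- ?g * y k) * (exp (d k) - 1)) + (a k - acoef j) * exp (- ?g * y k)) sequentially"
  proof eventually_elim
    case (elim k)
    have x: "pi * real j / 2 ^ Suc (r k) = 2 * u k" by (simp add: u_def)
    have s2: "(sin (2 * u k))\<^sup>2 = 4 * (sin (u k))\<^sup>2 * (1 - (sin (u k))\<^sup>2)"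
      by (simp add: sin_double power_mult_distrib cos_squared_eq)
    have "(1 - (sin (u k))\<^sup>2) ^ n k = exp (real (n k) * ln (1 - (sin (u k))\<^sup>2))"
      using elim by (simp add: exp_of_nat_mult)
    also have "\<dots> = exp (- ?g * y k) * exp (d k)" by (simp add: d_def exp_add[symmetric])
    finally have p: "(1 - (sin (u k))\<^sup>2) ^ n k = exp (- ?g * y k) * exp (d k)" .
    have "sterm (r k) (n k) j = a k * (exp (- ?g * y k) * exp (d k))"
      using elim unfolding sterm_def x half_angle s2 p a_def S_def by (simp add: ac_simps)
    then show ?case by (simp add: algebra_simps)
  qed
  have "(\<lambda>k. a k * (exp (- ?g * y k) * (exp (d k) - 1)) + (a k - acoef j) * exp (- ?g * y k)) \<longlonglongrightarrow> acoef j * 0 + 0"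
  proof (intro tendsto_add tendsto_mult a ex)
    show "(\<lambda>k. (a k - acoef j) * exp (- ?g * y k)) \<longlonglongrightarrow> 0"
    proof (rule Lim_null_comparison)
      show "eventually (\<lambda>k. norm ((a k - acoef j) * exp (- ?g * y k)) \<le> \<bar>a k - acoef j\<bar>) sequentially"
        using y(1) gam_pos by (intro always_eventually allI) (simp add: abs_mult mult_right_le_one_le)
      have "(\<lambda>k. \<bar>a k - acoef j\<bar>) \<longlonglongrightarrow> \<bar>acoef j - acoef j\<bar>" by (intro tendsto_intros a)
      then show "(\<lambda>k. \<bar>a k - acoef j\<bar>) \<longlonglongrightarrow> 0" by simp
    qed
  qed
  then show ?thesis using ev by (simp add: tendsto_cong)
qed

theorem scaled_layer_tendsto:
  fixes r n :: "nat \<Rightarrow> nat" and y :: "nat \<Rightarrow> real"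
  assumes r: "filterlim r at_top sequentially" and close: "\<And>k. \<bar>real (n k) - y k * 4 ^ r k\<bar> \<le> 1"
    and y: "\<And>k. c \<le> y k" "\<And>k. y k \<le> b" and c: "c > 0"
  shows "(\<lambda>k. (8 / 3) ^ r k * layer (r k) (n k) - profile (y k)) \<longlonglongrightarrow> 0"
proof -
  have y0: "0 < y k" for k using y(1)[of k] c by linarith
  let ?a = "\<lambda>j k. sterm (r k) (n k) j - acoef j * exp (- gam * (real j)\<^sup>2 * y k)"
  let ?G = "\<lambda>c j. 4 * gam * (real j)\<^sup>2 * exp (- gam * (real j)\<^sup>2 * c)"
  have mono: "?G x j \<le> ?G c j" if "c \<le> x" for x c j
    using gam_pos mult_left_mono[OF that, of "gam * (real j)\<^sup>2"] by (intro mult_left_mono) simp_all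
  have "(\<lambda>k. (1 / 4 :: real) ^ r k) \<longlonglongrightarrow> 0" by (rule filterlim_compose[OF _ r]) (rule LIMSEQ_power_zero, simp)
  then have "eventually (\<lambda>k. (1 / 4 :: real) ^ r k < c / 2) sequentially" by (rule order_tendstoD(2)) (use c in simp)
  \<comment> \<open>From c, rounding takes at most half and the passage from \<open>4 ^ r k\<close>
    to \<open>4 ^ Suc (r k)\<close> a quarter, which leaves c / 8.\<close>
  then have ev: "eventually (\<lambda>k. c / 8 \<le> real (n k) / 4 ^ Suc (r k)) sequentially"
  proof eventually_elim
    case (elim k)
    have "y k * 4 ^ r k - 1 \<le> real (n k)" using close[of k] by linarith
    then have "(y k * 4 ^ r k - 1) / 4 ^ r k \<le> real (n k) / 4 ^ r k" by (intro divide_right_mono) simp_all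
    then have "y k - (1 / 4) ^ r k \<le> real (n k) / 4 ^ r k" by (simp add: diff_divide_distrib power_one_over)
    then show ?case using elim y(1)[of k] by simp
  qed
  have lim: "(\<lambda>k. \<Sum>j. ?a j k) \<longlonglongrightarrow> (\<Sum>j. 0)"
  proof -
    have "eventually (\<lambda>(j, k). norm (?a j k) \<le> ?G (c / 8) j + ?G c j) (at_top \<times>\<^sub>F sequentially)"
    proof -
      have "eventually (\<lambda>k. \<forall>j. norm (?a j k) \<le> ?G (c / 8) j + ?G c j) sequentially"
        using ev
      proof eventually_elim
        case (elim k)
        show ?case
        proof
          fix j
          have "norm (?a j k) \<le> \<bar>sterm (r k) (n k) j\<bar> + \<bar>acoef j * exp (- gam * (real j)\<^sup>2 * y k)\<bar>"
            unfolding real_norm_def by (rule abs_triangle_ineq4)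
          also have "\<bar>sterm (r k) (n k) j\<bar> \<le> ?G (c / 8) j" by (rule order_trans[OF sterm_bound mono[OF elim]])
          also have "\<bar>acoef j * exp (- gam * (real j)\<^sup>2 * y k)\<bar> \<le> ?G (y k) j"
            using acoef_bound[of j] by (simp add: abs_mult mult_right_mono)
          also have "?G (y k) j \<le> ?G c j" by (rule mono[OF y(1)])
          finally show "norm (?a j k) \<le> ?G (c / 8) j + ?G c j" by simp
        qed
      qed
      from eventually_prodI[OF always_eventually[of "\<lambda>_. True", OF allI[OF TrueI]] this]
      show ?thesis by (rule eventually_mono) auto
    qed
    moreover have "summable (\<lambda>j. ?G (c / 8) j + ?G c j)" using c by (intro summable_add summable_gauss) simp_all
    ultimately show ?thesis
      using tannerys_theorem[where a = ?a and F = sequentially and b = "\<lambda>_. 0" and M = "\<lambda>j. ?G (c / 8) j + ?G c j"]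
        sterm_tendsto[OF r close less_imp_le[OF y0] y(2)] by simp
  qed
  have "eventually (\<lambda>k. (\<Sum>j. ?a j k) = (8 / 3) ^ r k * layer (r k) (n k) - profile (y k)) sequentially"
    using ev
  proof eventually_elim
    case (elim k)
    have "real (n k) / 4 ^ Suc (r k) > 0" using elim c by simp
    then have "summable (sterm (r k) (n k))"
      by (intro summable_comparison_test'[OF summable_gauss, where N = 0]) (use sterm_bound in auto)
    then show ?case unfolding scaled_layer profile_def by (rule suminf_diff[symmetric, OF _ summable_profile[OF y0]])
  qed
  then show ?thesis using lim by (simp add: tendsto_cong)
qed

text \<open>The alternating series does not show these bounds; they are inherited from the scaled
  layers, of which \<open>profile x\<close> is the limit along n = floor(x 4^k).\<close>

lemma profile_bounds:
  assumes x: "x > 0"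
  shows "0 \<le> profile x" "profile x \<le> 1"
proof -
  let ?n = "\<lambda>k. nat \<lfloor>x * 4 ^ k\<rfloor>"
  have "\<bar>real (?n k) - x * 4 ^ k\<bar> \<le> 1" for k using x by (simp add: abs_if) linarith
  from scaled_layer_tendsto[of "\<lambda>k. k" ?n "\<lambda>k. x" x x, OF filterlim_ident this _ _ x]
  have "(\<lambda>k. (8 / 3) ^ k * layer k (?n k) - profile x) \<longlonglongrightarrow> 0" by simp
  then have l: "(\<lambda>k. (8 / 3) ^ k * layer k (?n k)) \<longlonglongrightarrow> profile x" by (simp only: LIM_zero_iff)
  show "0 \<le> profile x" by (rule LIMSEQ_le_const[OF l]) (use scaled_layer_le_1(1) in blast)
  show "profile x \<le> 1" by (rule LIMSEQ_le_const2[OF l]) (use scaled_layer_le_1(2) in blast)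
qed

lemma profile_decay:
  assumes x: "x > 0"
  shows "profile x \<le> 8 * basel / gam / x\<^sup>2"
proof -
  have "profile x \<le> (\<Sum>j. 4 * gam * (real j)\<^sup>2 * exp (- gam * (real j)\<^sup>2 * x))"
    unfolding profile_def
  proof (intro suminf_le summable_profile summable_gauss x)
    show "acoef j * exp (- gam * (real j)\<^sup>2 * x) \<le> 4 * gam * (real j)\<^sup>2 * exp (- gam * (real j)\<^sup>2 * x)" for j
      using acoef_bound[of j] by (intro mult_right_mono) simp_all
  qed
  also have "\<dots> \<le> 8 * basel / gam / x\<^sup>2" by (rule suminf_gauss[OF x])
  finally show ?thesis .
qed

section \<open>Holomorphic extension of the profile\<close>

text \<open>Summation by parts, applied twice: multiplying the series by \<open>(1 - \<zeta>)\<^sup>2\<close> turns the coefficients into second differences.\<close>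

lemma norm_suminf_by_parts:
  fixes G :: "nat \<Rightarrow> complex"
  assumes G: "summable (\<lambda>j. norm (G j))" and G0: "G 0 = 0" and \<zeta>: "norm \<zeta> = 1" "(norm (1 - \<zeta>))\<^sup>2 \<ge> 2"
  shows "norm (\<Sum>j. \<zeta> ^ j * G j) \<le> (norm (G 1) + (\<Sum>j. norm (G (j + 2) - 2 * G (j + 1) + G j))) / 2"
proof -
  let ?D = "\<lambda>j. G (j + 2) - 2 * G (j + 1) + G j"
  let ?f = "\<lambda>j. \<zeta> ^ j * G j"
  have sf: "summable (\<lambda>j. norm (?f j))" using G \<zeta> by (simp add: norm_mult norm_power)
  then have f: "?f sums suminf ?f" by (simp add: summable_norm_cancel summable_sums)
  have f1: "(\<lambda>j. ?f (j + 1)) sums (suminf ?f - ?f 0)"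
    using sums_split_initial_segment[OF f, of 1] by simp
  have f2: "(\<lambda>j. ?f (j + 2)) sums (suminf ?f - (?f 0 + ?f 1))"
    using sums_split_initial_segment[OF f, of 2] by (simp add: numeral_2_eq_2)
  have sD: "summable (\<lambda>j. norm (?D j))"
  proof (rule summable_comparison_test'[where N = 0])
    show "summable (\<lambda>j. norm (G (j + 2)) + 2 * norm (G (j + 1)) + norm (G j))"
      by (intro summable_add summable_mult G summable_ignore_initial_segment[OF G])
    show "norm (norm (?D j)) \<le> norm (G (j + 2)) + 2 * norm (G (j + 1)) + norm (G j)" for j
      using norm_triangle_ineq[of "G (j + 2) - 2 * G (j + 1)" "G j"] norm_triangle_ineq4[of "G (j + 2)" "2 * G (j + 1)"]
      by (simp add: norm_mult)
  qed
  have "(\<lambda>j. ?f (j + 2) - 2 * \<zeta> * ?f (j + 1) + \<zeta>\<^sup>2 * ?f j) sums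
      ((suminf ?f - (?f 0 + ?f 1)) - 2 * \<zeta> * (suminf ?f - ?f 0) + \<zeta>\<^sup>2 * suminf ?f)"
    by (intro sums_add sums_diff sums_mult f f1 f2)
  moreover have "?f (j + 2) - 2 * \<zeta> * ?f (j + 1) + \<zeta>\<^sup>2 * ?f j = \<zeta> ^ (j + 2) * ?D j" for j
    by (simp add: algebra_simps power2_eq_square)
  moreover have "(suminf ?f - (?f 0 + ?f 1)) - 2 * \<zeta> * (suminf ?f - ?f 0) + \<zeta>\<^sup>2 * suminf ?f = (1 - \<zeta>)\<^sup>2 * suminf ?f - \<zeta> * G 1"
    using G0 by (simp add: algebra_simps power2_eq_square)
  ultimately have s: "(\<lambda>j. \<zeta> ^ (j + 2) * ?D j) sums ((1 - \<zeta>)\<^sup>2 * suminf ?f - \<zeta> * G 1)" by (simp only:)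
  have "norm (\<Sum>j. \<zeta> ^ (j + 2) * ?D j) \<le> (\<Sum>j. norm (?D j))"
    using summable_norm[of "\<lambda>j. \<zeta> ^ (j + 2) * ?D j"] sD \<zeta> by (simp add: norm_mult norm_power)
  then have "norm ((1 - \<zeta>)\<^sup>2 * suminf ?f - \<zeta> * G 1) \<le> (\<Sum>j. norm (?D j))" using sums_unique[OF s] by simp
  then have "norm ((1 - \<zeta>)\<^sup>2 * suminf ?f) \<le> norm (G 1) + (\<Sum>j. norm (?D j))"
    using norm_triangle_sub[of "(1 - \<zeta>)\<^sup>2 * suminf ?f" "\<zeta> * G 1"] \<zeta> by (simp add: norm_mult)
  moreover have "2 * norm (suminf ?f) \<le> norm ((1 - \<zeta>)\<^sup>2 * suminf ?f)"
    using \<zeta>(2) by (simp add: norm_mult norm_power mult_right_mono)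
  ultimately show ?thesis by simp
qed

definition variation :: "(nat \<Rightarrow> complex) \<Rightarrow> real" where
  "variation G = (norm (G 1) + (\<Sum>j. norm (G (j + 2) - 2 * G (j + 1) + G j))) / 2"

text \<open>The cosine is the mean of two exponentials, so \<zeta> = - exp(i \<theta>) with \<theta>
  = \<eta> or - \<eta>. Then |1 - \<zeta>|^2 = 2 + 2 cos \<theta> is at least 2 as long as |\<eta>|
  <= pi/2.\<close>

lemma alternating_cos_bound:
  fixes G :: "nat \<Rightarrow> complex"
  assumes G: "summable (\<lambda>j. norm (G j))" and G0: "G 0 = 0" and \<eta>: "\<bar>\<eta>\<bar> \<le> pi / 2"
  shows "norm (\<Sum>j. (- 1) ^ j * G j * of_real (cos (real j * \<eta>))) \<le> variation G"
proof -
  have b: "norm (\<Sum>j. (- cis \<theta>) ^ j * G j) \<le> variation G" and s: "summable (\<lambda>j. (- cis \<theta>) ^ j * G j)"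
    if "\<theta> = \<eta> \<or> \<theta> = - \<eta>" for \<theta>
  proof -
    have "cos \<theta> \<ge> 0" using that \<eta> by (auto intro!: cos_ge_zero)
    moreover have "(norm (1 - - cis \<theta>))\<^sup>2 = 2 + 2 * cos \<theta>"
      unfolding cmod_power2 using sin_cos_squared_add2[of \<theta>] by (simp add: power2_eq_square algebra_simps)
    ultimately have "2 \<le> (norm (1 - - cis \<theta>))\<^sup>2" by simp
    then show "norm (\<Sum>j. (- cis \<theta>) ^ j * G j) \<le> variation G"
      unfolding variation_def by (intro norm_suminf_by_parts G G0) simp_all
    have "summable (\<lambda>j. norm ((- cis \<theta>) ^ j * G j))" using G by (simp add: norm_mult norm_power)
    then show "summable (\<lambda>j. (- cis \<theta>) ^ j * G j)" by (rule summable_norm_cancel)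
  qed
  have "(- 1) ^ j * G j * of_real (cos (real j * \<eta>)) = ((- cis \<eta>) ^ j * G j + (- cis (- \<eta>)) ^ j * G j) / 2" for j
  proof -
    have m: "(- cis \<theta>) ^ j = (- 1) ^ j * cis (real j * \<theta>)" for \<theta>
      unfolding Complex.DeMoivre[symmetric] by (rule power_minus)
    have "cis (real j * \<eta>) + cis (real j * - \<eta>) = 2 * of_real (cos (real j * \<eta>))"
      by (simp add: complex_eq_iff)
    then have "of_real (cos (real j * \<eta>)) = (cis (real j * \<eta>) + cis (real j * - \<eta>)) / 2" by simp
    then show ?thesis unfolding m by (simp add: algebra_simps add_divide_distrib)
  qed
  moreover have "(\<lambda>j. ((- cis \<eta>) ^ j * G j + (- cis (- \<eta>)) ^ j * G j) / 2) sums
      (((\<Sum>j. (- cis \<eta>) ^ j * G j) + (\<Sum>j. (- cis (- \<eta>)) ^ j * G j)) / 2)"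
    by (intro sums_divide sums_add summable_sums s) simp_all
  ultimately have "(\<lambda>j. (- 1) ^ j * G j * of_real (cos (real j * \<eta>))) sums
      (((\<Sum>j. (- cis \<eta>) ^ j * G j) + (\<Sum>j. (- cis (- \<eta>)) ^ j * G j)) / 2)" by (simp only:)
  note eq = sums_unique[OF this, symmetric]
  show ?thesis unfolding eq
    using b[of \<eta>] b[of "- \<eta>"] norm_triangle_ineq[of "\<Sum>j. (- cis \<eta>) ^ j * G j" "\<Sum>j. (- cis (- \<eta>)) ^ j * G j"]
    by (simp add: norm_divide)
qed

text \<open>
  Each factor \<open>(1 + 2 cos (j \<theta>)) / 3\<close> of \<open>psi\<close> averages the frequency \<open>\<eta>\<close> over \<open>\<eta>\<close> and \<open>\<eta> \<plusminus> \<theta>\<close>,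
  and the total shift stays within \<open>\<pi> / 2\<close>.
\<close>

lemma alternating_psi_bound:
  fixes G :: "nat \<Rightarrow> complex"
  assumes G: "summable (\<lambda>j. norm (G j))" and G0: "G 0 = 0"
  shows "\<bar>\<eta>\<bar> \<le> pi / 2 ^ (r + 1) \<Longrightarrow> norm (\<Sum>j. (- 1) ^ j * G j * of_real (cos (real j * \<eta>) * psi r j)) \<le> variation G"
proof (induction r arbitrary: \<eta>)
  case 0
  then show ?case using alternating_cos_bound[OF G G0, of \<eta>] by (simp add: psi_def)
next
  case (Suc r)
  define \<alpha> where "\<alpha> = pi / 2 ^ (r + 2)"
  let ?V = "\<lambda>\<eta>. \<Sum>j. (- 1) ^ j * G j * of_real (cos (real j * \<eta>) * psi r j)"
  have a: "\<bar>\<eta>\<bar> \<le> \<alpha>" using Suc(2) by (simp add: \<alpha>_def)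
  have a2: "pi / 2 ^ (r + 1) = 2 * \<alpha>" by (simp add: \<alpha>_def)
  have a0: "\<alpha> > 0" by (simp add: \<alpha>_def)
  have s: "summable (\<lambda>j. (- 1) ^ j * G j * of_real (cos (real j * \<theta>) * psi r j))" for \<theta>
  proof (rule summable_norm_cancel, rule summable_comparison_test'[OF G, where N = 0])
    fix j
    have "\<bar>cos (real j * \<theta>) * psi r j\<bar> \<le> 1"
      unfolding abs_mult by (rule mult_le_one) (simp_all add: psi_bound)
    then show "norm (norm ((- 1) ^ j * G j * of_real (cos (real j * \<theta>) * psi r j))) \<le> norm (G j)"
      by (simp add: norm_mult norm_power mult_left_le del: of_real_mult)
  qed
  have "cos (real j * \<eta>) * psi (Suc r) j = (cos (real j * \<eta>) * psi r j + cos (real j * (\<eta> + \<alpha>)) * psi r j + cos (real j * (\<eta> - \<alpha>)) * psi r j) / 3" for j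
  proof -
    have "psi (Suc r) j = psi r j * ((1 + 2 * cos (real j * \<alpha>)) / 3)"
      by (simp add: psi_Suc \<alpha>_def mult.commute)
    moreover have "cos (real j * (\<eta> + \<alpha>)) + cos (real j * (\<eta> - \<alpha>)) = 2 * cos (real j * \<eta>) * cos (real j * \<alpha>)"
      by (simp add: distrib_left right_diff_distrib cos_add cos_diff)
    moreover have "c * (p * ((1 + 2 * d) / 3)) = (c * p + (2 * c * d) * p) / 3" for c d p :: real by (simp add: field_simps)
    ultimately have "cos (real j * \<eta>) * psi (Suc r) j = (cos (real j * \<eta>) * psi r j +
        (cos (real j * (\<eta> + \<alpha>)) + cos (real j * (\<eta> - \<alpha>))) * psi r j) / 3" by (simp only:)
    then show ?thesis by (simp only: distrib_right add.assoc)
  qed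
  then have e: "(- 1) ^ j * G j * of_real (cos (real j * \<eta>) * psi (Suc r) j) =
      ((- 1) ^ j * G j * of_real (cos (real j * \<eta>) * psi r j) + (- 1) ^ j * G j * of_real (cos (real j * (\<eta> + \<alpha>)) * psi r j) +
        (- 1) ^ j * G j * of_real (cos (real j * (\<eta> - \<alpha>)) * psi r j)) / 3" for j
    by (simp only: of_real_divide of_real_add of_real_numeral times_divide_eq_right distrib_left)
  have "(\<lambda>j. (- 1) ^ j * G j * of_real (cos (real j * \<eta>) * psi (Suc r) j)) sums ((?V \<eta> + ?V (\<eta> + \<alpha>) + ?V (\<eta> - \<alpha>)) / 3)"
    unfolding e by (intro sums_divide sums_add summable_sums s)
  note eq = sums_unique[OF this, symmetric]
  have "norm (\<Sum>j. (- 1) ^ j * G j * of_real (cos (real j * \<eta>) * psi (Suc r) j)) \<le> (norm (?V \<eta>) + norm (?V (\<eta> + \<alpha>)) + norm (?V (\<eta> - \<alpha>))) / 3"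
    unfolding eq using norm_triangle_ineq[of "?V \<eta> + ?V (\<eta> + \<alpha>)" "?V (\<eta> - \<alpha>)"] norm_triangle_ineq[of "?V \<eta>" "?V (\<eta> + \<alpha>)"]
    by (simp add: norm_divide del: of_real_mult)
  also have "\<dots> \<le> (variation G + variation G + variation G) / 3"
    using a a0 by (intro divide_right_mono add_mono Suc(1)) (simp_all only: a2; linarith)+
  finally show ?case by simp
qed

lemma alternating_psi_lim_bound:
  fixes G :: "nat \<Rightarrow> complex"
  assumes G: "summable (\<lambda>j. norm (G j))" and G0: "G 0 = 0"
  shows "norm (\<Sum>j. (- 1) ^ j * G j * of_real (psi_lim j)) \<le> variation G"
proof -
  have "((\<lambda>r. \<Sum>j. (- 1) ^ j * G j * of_real (psi r j)) \<longlonglongrightarrow> (\<Sum>j. (- 1) ^ j * G j * of_real (psi_lim j)))"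
  proof -
    have "norm ((- 1) ^ j * G j * of_real (psi r j)) \<le> norm (G j)" for j r
      using psi_bound[of r j] by (simp add: norm_mult norm_power mult_left_le)
    then have "eventually (\<lambda>(j, r). norm ((- 1) ^ j * G j * of_real (psi r j)) \<le> norm (G j)) (at_top \<times>\<^sub>F sequentially)"
      by (intro always_eventually) auto
    moreover have "(\<lambda>r. (- 1) ^ j * G j * of_real (psi r j)) \<longlonglongrightarrow> (- 1) ^ j * G j * of_real (psi_lim j)" for j
      by (intro tendsto_intros psi_LIMSEQ)
    ultimately show ?thesis
      using tannerys_theorem[where a = "\<lambda>j r. (- 1) ^ j * G j * of_real (psi r j)" and F = sequentially
          and b = "\<lambda>j. (- 1) ^ j * G j * of_real (psi_lim j)" and M = "\<lambda>j. norm (G j)"] G by simp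
  qed
  then show ?thesis
  proof (rule LIMSEQ_le_const2[OF tendsto_norm], intro exI allI impI)
    show "norm (\<Sum>j. (- 1) ^ j * G j * of_real (psi r j)) \<le> variation G" for r
      using alternating_psi_bound[OF G G0, of 0 r] by simp
  qed
qed

text \<open>A cone around the positive axis on which |z| and Re z are comparable, and which is
  stable under the scalings z / 4^i.\<close>

definition sector :: "complex set" where "sector = {z. \<bar>Im z\<bar> < Re z}"

lemma open_sector: "open sector"
proof -
  have "sector = {z. \<bar>Im z\<bar> < Re z}" by (simp add: sector_def)
  also have "open \<dots>" by (intro open_Collect_less continuous_intros)
  finally show ?thesis .
qed

lemma sector_Re: "z \<in> sector \<Longrightarrow> Re z > 0"
  by (simp add: sector_def)

lemma sector_norm: "z \<in> sector \<Longrightarrow> norm z \<le> 2 * Re z"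
  using cmod_le[of z] by (simp add: sector_def)

lemma sector_scale: "z \<in> sector \<Longrightarrow> c > 0 \<Longrightarrow> of_real c * z \<in> sector"
  by (simp add: sector_def abs_mult)

text \<open>With v = j and w = \<open>gam\<close> z these are the terms of the profile without sign,
  constant and \<open>psi_lim\<close>. A continuous variable v allows second differences to be
  estimated by the second derivative \<open>gauss2''\<close>.\<close>

definition gauss2 :: "complex \<Rightarrow> complex \<Rightarrow> complex" where "gauss2 w v = v\<^sup>2 * exp (- w * v\<^sup>2)"
definition gauss2' :: "complex \<Rightarrow> complex \<Rightarrow> complex" where "gauss2' w v = (2 * v - 2 * w * v ^ 3) * exp (- w * v\<^sup>2)"
definition gauss2'' :: "complex \<Rightarrow> complex \<Rightarrow> complex" where
  "gauss2'' w v = (2 - 10 * w * v\<^sup>2 + 4 * w\<^sup>2 * v ^ 4) * exp (- w * v\<^sup>2)"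

lemma gauss2_deriv: "(gauss2 w has_field_derivative gauss2' w v) (at v within A)"
  unfolding gauss2_def[abs_def] gauss2'_def
  by (auto intro!: derivative_eq_intros simp: algebra_simps power2_eq_square power3_eq_cube)

lemma gauss2'_deriv: "(gauss2' w has_field_derivative gauss2'' w v) (at v within A)"
  unfolding gauss2'_def[abs_def] gauss2''_def
  by (auto intro!: derivative_eq_intros simp: algebra_simps power2_eq_square power3_eq_cube power4_eq_xxxx)

lemma gauss2''_bound:
  assumes w: "w \<in> sector"
  shows "norm (gauss2'' w (of_real v)) \<le> 128 * exp (- (Re w * v\<^sup>2 / 2))"
proof -
  let ?t = "Re w * v\<^sup>2"
  have t: "?t \<ge> 0" using sector_Re[OF w] by simp
  have wv: "norm w * v\<^sup>2 \<le> 2 * ?t" using sector_norm[OF w] mult_right_mono[of "norm w" "2 * Re w" "v\<^sup>2"] by simp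
  have wv2: "(norm w * v\<^sup>2)\<^sup>2 \<le> (2 * ?t)\<^sup>2" by (rule power_mono[OF wv]) simp
  have "norm (2 - 10 * w * (of_real v)\<^sup>2 + 4 * w\<^sup>2 * (of_real v) ^ 4) \<le> 2 + 10 * (norm w * v\<^sup>2) + 4 * (norm w * v\<^sup>2)\<^sup>2"
  proof -
    have n1: "norm (10 * w * (of_real v)\<^sup>2) = 10 * (norm w * v\<^sup>2)" by (simp add: norm_mult norm_power)
    have "(v\<^sup>2)\<^sup>2 = v ^ 4" by (simp only: power_mult[symmetric]) simp
    then have n2: "norm (4 * w\<^sup>2 * (of_real v) ^ 4) = 4 * (norm w * v\<^sup>2)\<^sup>2" by (simp add: norm_mult norm_power power_mult_distrib)
    have "norm (2 - 10 * w * (of_real v)\<^sup>2 + 4 * w\<^sup>2 * (of_real v) ^ 4) \<le>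
        norm (2 :: complex) + norm (10 * w * (of_real v)\<^sup>2) + norm (4 * w\<^sup>2 * (of_real v) ^ 4)"
      by (intro order_trans[OF norm_triangle_ineq] add_mono norm_triangle_ineq4 order_refl)
    also have "\<dots> = 2 + 10 * (norm w * v\<^sup>2) + 4 * (norm w * v\<^sup>2)\<^sup>2"
      unfolding n1 n2 by simp
    finally show ?thesis .
  qed
  also have "\<dots> \<le> 2 + 10 * (2 * ?t) + 4 * (2 * ?t)\<^sup>2" using wv wv2 by linarith
  \<comment> \<open>Half of the exponent is spent on the polynomial factor; matching the term 16 t^2
    with the quadratic Taylor term of exp(t/2) fixes the constant 128.\<close>
  also have "\<dots> \<le> 128 * (1 + ?t / 2 + (?t / 2)\<^sup>2 / 2)" using t by (simp add: power2_eq_square algebra_simps)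
  also have "\<dots> \<le> 128 * exp (?t / 2)" using exp_lower_Taylor_quadratic[of "?t / 2"] t by simp
  finally have 1: "norm (2 - 10 * w * (of_real v)\<^sup>2 + 4 * w\<^sup>2 * (of_real v) ^ 4) \<le> 128 * exp (?t / 2)" .
  have "Re (- w * (of_real v)\<^sup>2) = - ?t" by (simp add: of_real_power[symmetric] del: of_real_power)
  then have "norm (gauss2'' w (of_real v)) = norm (2 - 10 * w * (of_real v)\<^sup>2 + 4 * w\<^sup>2 * (of_real v) ^ 4) * exp (- ?t)"
    unfolding gauss2''_def norm_mult norm_exp_eq_Re by simp
  also have "\<dots> \<le> 128 * exp (?t / 2) * exp (- ?t)" by (rule mult_right_mono[OF 1]) simp
  also have "\<dots> = 128 * exp (- (?t / 2))" by (simp add: mult.assoc exp_add[symmetric])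
  finally show ?thesis by simp
qed

text \<open>The mean value inequality twice, first for the derivative and then for the unit
  difference; the derivative bound decreases in v, so its value at the left end \<open>x\<close>
  serves throughout.\<close>

lemma gauss2_second_difference:
  assumes w: "w \<in> sector" and x: "x \<ge> 0"
  shows "norm (gauss2 w (of_real (x + 2)) - 2 * gauss2 w (of_real (x + 1)) + gauss2 w (of_real x)) \<le> 128 * exp (- (Re w * x\<^sup>2 / 2))"
proof -
  let ?K = "128 * exp (- (Re w * x\<^sup>2 / 2))"
  let ?seg = "\<lambda>a b. closed_segment (of_real a) (of_real b :: complex)"
  have seg: "\<exists>v. v \<ge> a \<and> z = of_real v" if "z \<in> ?seg a b" "a \<le> b" for z a b
    using that by (auto simp: closed_segment_of_real closed_segment_eq_real_ivl)
  have K: "norm (gauss2'' w (of_real v)) \<le> ?K" if "v \<ge> x" for v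
  proof (rule order_trans[OF gauss2''_bound[OF w]])
    have "x\<^sup>2 \<le> v\<^sup>2" using that x by (intro power_mono)
    then have "Re w * x\<^sup>2 \<le> Re w * v\<^sup>2" using sector_Re[OF w] by (intro mult_left_mono) simp_all
    then show "128 * exp (- (Re w * v\<^sup>2 / 2)) \<le> ?K" by simp
  qed
  have 1: "norm (gauss2' w (of_real v + 1) - gauss2' w (of_real v)) \<le> ?K" if v: "v \<ge> x" for v
  proof -
    have "norm (gauss2' w (of_real (v + 1)) - gauss2' w (of_real v)) \<le> ?K * norm (of_real (v + 1) - of_real v :: complex)"
    proof (rule field_differentiable_bound[where S = "?seg v (v + 1)" and f' = "gauss2'' w"])
      show "norm (gauss2'' w z) \<le> ?K" if "z \<in> ?seg v (v + 1)" for z using seg[OF that] K v by force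
    qed (auto intro: gauss2'_deriv)
    then show ?thesis by simp
  qed
  let ?d = "\<lambda>z. gauss2 w (z + 1) - gauss2 w z"
  have dd: "(?d has_field_derivative (gauss2' w (z + 1) - gauss2' w z)) (at z within A)" for z A
  proof -
    have "((\<lambda>z. gauss2 w (z + 1)) has_field_derivative (gauss2' w (z + 1) * (1 + 0))) (at z within A)"
      by (rule DERIV_chain2[OF gauss2_deriv]) (intro derivative_intros)
    then show ?thesis by (intro derivative_intros gauss2_deriv) simp
  qed
  have "norm (?d (of_real (x + 1)) - ?d (of_real x)) \<le> ?K * norm (of_real (x + 1) - of_real x :: complex)"
  proof (rule field_differentiable_bound[where S = "?seg x (x + 1)" and f' = "\<lambda>z. gauss2' w (z + 1) - gauss2' w z"])
    show "norm (gauss2' w (z + 1) - gauss2' w z) \<le> ?K" if "z \<in> ?seg x (x + 1)" for z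
      using seg[OF that] 1 by force
  qed (auto intro: dd)
  moreover have "?d (of_real (x + 1)) - ?d (of_real x) = gauss2 w (of_real (x + 2)) - 2 * gauss2 w (of_real (x + 1)) + gauss2 w (of_real x)"
    by (simp add: algebra_simps)
  moreover have "norm (of_real (x + 1) - of_real x :: complex) = 1" by simp
  ultimately show ?thesis by (simp only: mult_1_right)
qed

text \<open>The exponent 2/3 meets two demands: with t of order j^2 it must exceed 1/2 for the sum
  over j to converge, and it must stay below log_4(8/3), see \<open>powr_4_23\<close>.\<close>

lemma exp_minus_le_powr: "t > 0 \<Longrightarrow> exp (- t) \<le> t powr (- (2 / 3))" for t :: real
proof -
  assume t: "t > 0"
  have "t powr (2 / 3) \<le> exp t"
  proof (cases "t \<le> 1")
    case True
    then have "t powr (2 / 3) \<le> 1" using t by (simp add: powr_le1)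
    also have "1 \<le> exp t" using t by simp
    finally show ?thesis .
  next
    case False
    then have "t powr (2 / 3) \<le> t powr 1" by (intro powr_mono) simp_all
    also have "t powr 1 = t" using t by simp
    also have "t \<le> exp t" using exp_ge_add_one_self[of t] by linarith
    finally show ?thesis .
  qed
  then have "inverse (exp t) \<le> inverse (t powr (2 / 3))" using t by (intro le_imp_inverse_le) simp_all
  then show ?thesis by (simp add: exp_minus powr_minus)
qed

definition zeta43 :: real where "zeta43 = (\<Sum>j. real j powr (- (4 / 3)))"

lemma summable_zeta43: "summable (\<lambda>j. real j powr (- (4 / 3)))"
  by (simp add: summable_real_powr_iff)

lemma variation_gauss2:
  assumes w: "w \<in> sector"
  shows "variation (\<lambda>j. gauss2 w (of_nat j)) \<le> 129 + 64 * (zeta43 * (Re w / 2) powr (- (2 / 3)))"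
proof -
  let ?G = "\<lambda>j. gauss2 w (of_nat j)"
  let ?D = "\<lambda>j. norm (?G (j + 2) - 2 * ?G (j + 1) + ?G j)"
  have D: "?D j \<le> 128 * exp (- (Re w * (real j)\<^sup>2 / 2))" for j
    using gauss2_second_difference[OF w, of "real j"] by (simp add: add.commute)
  \<comment> \<open>At j = 0 the power is 0 by convention, so the bound 128 for that term is added
    separately.\<close>
  let ?B = "\<lambda>j. (if j = 0 then 128 else 0) + 128 * (Re w / 2) powr (- (2 / 3)) * real j powr (- (4 / 3))"
  have DB: "?D j \<le> ?B j" for j
  proof (cases "j = 0")
    case True
    then show ?thesis using D[of 0] by simp
  next
    case False
    have "exp (- (Re w / 2 * (real j)\<^sup>2)) \<le> (Re w / 2 * (real j)\<^sup>2) powr (- (2 / 3))"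
      by (rule exp_minus_le_powr) (use sector_Re[OF w] False in simp)
    also have "\<dots> = (Re w / 2) powr (- (2 / 3)) * ((real j)\<^sup>2) powr (- (2 / 3))"
      by (rule powr_mult)
    also have "((real j)\<^sup>2) powr (- (2 / 3)) = real j powr (- (4 / 3))"
    proof -
      have "(real j)\<^sup>2 = real j powr 2" using False by simp
      then show ?thesis by (simp only: powr_powr) simp
    qed
    finally have "exp (- (Re w * (real j)\<^sup>2 / 2)) \<le> (Re w / 2) powr (- (2 / 3)) * real j powr (- (4 / 3))" by simp
    then show ?thesis using D[of j] False by simp
  qed
  have s0: "(\<lambda>j::nat. if j = 0 then 128 else 0 :: real) sums 128" using sums_single[of 0 "\<lambda>_. 128::real"] by simp
  have s: "?B sums (128 + 128 * (Re w / 2) powr (- (2 / 3)) * zeta43)"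
    unfolding zeta43_def by (intro sums_add s0 sums_mult summable_sums summable_zeta43)
  have "(\<Sum>j. ?D j) \<le> 128 + 128 * (Re w / 2) powr (- (2 / 3)) * zeta43"
    unfolding sums_unique[OF s]
    by (intro suminf_le DB sums_summable[OF s] summable_comparison_test'[OF sums_summable[OF s], where N = 0])
      (simp only: real_norm_def abs_norm_cancel DB)
  then have "(\<Sum>j. ?D j) \<le> 128 + 128 * (zeta43 * (Re w / 2) powr (- (2 / 3)))" by (simp only: ac_simps)
  moreover have "norm (?G 1) \<le> 1"
    using sector_Re[OF w] by (simp add: gauss2_def norm_exp_eq_Re)
  moreover have "(a + s) / 2 \<le> 129 + 64 * q" if "s \<le> 128 + 128 * q" "a \<le> 1" for a s q :: real
    using add_mono[OF that] by (simp add: field_simps)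
  ultimately show ?thesis unfolding variation_def by blast
qed

definition cprofile :: "complex \<Rightarrow> complex" where
  "cprofile z = (\<Sum>j. of_real (acoef j) * exp (- of_real (gam * (real j)\<^sup>2) * z))"

lemma norm_cprofile_term:
  "norm (of_real (acoef j) * exp (- of_real (gam * (real j)\<^sup>2) * z)) \<le> 4 * gam * (real j)\<^sup>2 * exp (- gam * (real j)\<^sup>2 * Re z)"
  using acoef_bound[of j] by (simp add: norm_mult norm_exp_eq_Re mult_right_mono)

lemma summable_norm_cprofile:
  "Re z > 0 \<Longrightarrow> summable (\<lambda>j. norm (of_real (acoef j) * exp (- of_real (gam * (real j)\<^sup>2) * z)))"
  by (rule summable_comparison_test'[OF summable_gauss, of "Re z" 0]) (use norm_cprofile_term in auto)

lemma cprofile_of_real: "x > 0 \<Longrightarrow> cprofile (of_real x) = of_real (profile x)"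
  unfolding cprofile_def profile_def
  by (subst suminf_of_real[OF summable_profile]) (simp_all add: exp_of_real[symmetric])

lemma cprofile_decay:
  assumes "Re z > 0"
  shows "norm (cprofile z) \<le> 8 * basel / gam / (Re z)\<^sup>2"
proof -
  have "norm (cprofile z) \<le> (\<Sum>j. norm (of_real (acoef j) * exp (- of_real (gam * (real j)\<^sup>2) * z)))"
    unfolding cprofile_def by (rule summable_norm[OF summable_norm_cprofile[OF assms]])
  also have "\<dots> \<le> (\<Sum>j. 4 * gam * (real j)\<^sup>2 * exp (- gam * (real j)\<^sup>2 * Re z))"
    by (intro suminf_le norm_cprofile_term summable_norm_cprofile summable_gauss assms)
  also have "\<dots> \<le> 8 * basel / gam / (Re z)\<^sup>2" by (rule suminf_gauss[OF assms])
  finally show ?thesis .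
qed

text \<open>
  The termwise bound is of order \<open>(Re z)\<^bsup>-3/2\<^esup>\<close>, with which \<open>(3 / 8)\<^sup>i h(z / 4\<^sup>i)\<close> would not be
  summable; the alternating signs have to be used.
\<close>

lemma cprofile_near_0:
  assumes z: "z \<in> sector"
  shows "norm (cprofile z) \<le> 4 * gam * (129 + 64 * (zeta43 * (gam * Re z / 2) powr (- (2 / 3))))"
proof -
  define w where "w = of_real gam * z"
  have w: "w \<in> sector" unfolding w_def by (rule sector_scale[OF z gam_pos])
  let ?G = "\<lambda>j. gauss2 w (of_nat j)"
  have sG: "summable (\<lambda>j. norm (?G j))"
  proof -
    have "norm (?G j) = 1 / (4 * gam) * (4 * gam * (real j)\<^sup>2 * exp (- gam * (real j)\<^sup>2 * Re z))" for j
    proof -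
      have "Re (- w * (of_nat j)\<^sup>2) = - gam * (real j)\<^sup>2 * Re z"
        by (simp add: w_def of_nat_power[symmetric] del: of_nat_power)
      then show ?thesis using gam_pos unfolding gauss2_def norm_mult norm_exp_eq_Re by (simp add: norm_power)
    qed
    then show ?thesis using summable_mult[OF summable_gauss[OF sector_Re[OF z]], of "1 / (4 * gam)"] by simp
  qed
  have "of_real (acoef j) * exp (- of_real (gam * (real j)\<^sup>2) * z) = - 4 * of_real gam * ((- 1) ^ j * ?G j * of_real (psi_lim j))" for j
    by (simp add: acoef_def gauss2_def w_def ac_simps)
  then have "cprofile z = (\<Sum>j. - 4 * of_real gam * ((- 1) ^ j * ?G j * of_real (psi_lim j)))"
    unfolding cprofile_def by simp
  also have "\<dots> = - 4 * of_real gam * (\<Sum>j. (- 1) ^ j * ?G j * of_real (psi_lim j))"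
  proof (rule suminf_mult)
    show "summable (\<lambda>j. (- 1) ^ j * ?G j * of_real (psi_lim j))"
      by (rule summable_norm_cancel, rule summable_comparison_test'[OF sG, where N = 0])
        (use psi_lim_bound in \<open>simp add: norm_mult norm_power mult_left_le\<close>)
  qed
  finally have "norm (cprofile z) = 4 * gam * norm (\<Sum>j. (- 1) ^ j * ?G j * of_real (psi_lim j))"
    using gam_pos by (simp add: norm_mult)
  also have "\<dots> \<le> 4 * gam * (129 + 64 * (zeta43 * (Re w / 2) powr (- (2 / 3))))"
    using gam_pos by (intro mult_left_mono order_trans[OF alternating_psi_lim_bound[OF sG] variation_gauss2[OF w]])
      (simp_all add: gauss2_def)
  finally show ?thesis by (simp add: w_def)
qed

text \<open>Majorants on half planes a <= Re z suffice, because a small disc around a point x stays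
  in Re z >= Re x / 2.\<close>

lemma holomorphic_suminf:
  fixes f :: "nat \<Rightarrow> complex \<Rightarrow> complex"
  assumes S: "open S" and f: "\<And>n. f n holomorphic_on S"
    and bound: "\<And>a. a > 0 \<Longrightarrow> \<exists>M. summable M \<and> (\<forall>n. \<forall>z\<in>S. a \<le> Re z \<longrightarrow> norm (f n z) \<le> M n)"
    and pos: "\<And>z. z \<in> S \<Longrightarrow> Re z > 0"
  shows "(\<lambda>z. \<Sum>n. f n z) holomorphic_on S"
proof (rule holomorphic_uniform_sequence[OF S, where f = "\<lambda>n z. \<Sum>i<n. f i z"])
  show "(\<lambda>z. \<Sum>i<n. f i z) holomorphic_on S" for n by (intro holomorphic_intros f)
  fix x assume x: "x \<in> S"
  obtain e where e: "e > 0" "cball x e \<subseteq> S" using S x open_contains_cball by blast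
  define d where "d = min e (Re x / 2)"
  have d: "d > 0" "cball x d \<subseteq> S" using e pos[OF x] by (auto simp: d_def)
  obtain M where M: "summable M" "\<forall>n. \<forall>z\<in>S. Re x / 2 \<le> Re z \<longrightarrow> norm (f n z) \<le> M n"
    using bound[of "Re x / 2"] pos[OF x] by auto
  have "Re x / 2 \<le> Re z" if "z \<in> cball x d" for z
  proof -
    have "\<bar>Re (x - z)\<bar> \<le> norm (x - z)" by (rule abs_Re_le_cmod)
    also have "\<dots> \<le> Re x / 2" using that by (simp add: d_def dist_norm)
    finally show ?thesis using abs_ge_self[of "Re (x - z)"] unfolding minus_complex.sel by linarith
  qed
  then have "uniform_limit (cball x d) (\<lambda>n z. \<Sum>i<n. f i z) (\<lambda>z. \<Sum>n. f n z) sequentially"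
    using M d(2) by (intro Weierstrass_m_test[where M = M]) auto
  then show "\<exists>d>0. cball x d \<subseteq> S \<and> uniform_limit (cball x d) (\<lambda>n z. \<Sum>i<n. f i z) (\<lambda>z. \<Sum>n. f n z) sequentially"
    using d by blast
qed

lemma cprofile_holomorphic: "cprofile holomorphic_on sector"
  unfolding cprofile_def[abs_def]
proof (rule holomorphic_suminf[OF open_sector])
  show "(\<lambda>z. of_real (acoef n) * exp (- of_real (gam * (real n)\<^sup>2) * z)) holomorphic_on sector" for n
    by (intro holomorphic_intros)
  fix a :: real assume a: "a > 0"
  have "norm (of_real (acoef n) * exp (- of_real (gam * (real n)\<^sup>2) * z)) \<le> 4 * gam * (real n)\<^sup>2 * exp (- gam * (real n)\<^sup>2 * a)"
    if "a \<le> Re z" for n z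
  proof (rule order_trans[OF norm_cprofile_term])
    show "4 * gam * (real n)\<^sup>2 * exp (- gam * (real n)\<^sup>2 * Re z) \<le> 4 * gam * (real n)\<^sup>2 * exp (- gam * (real n)\<^sup>2 * a)"
      using gam_pos mult_left_mono[OF that, of "gam * (real n)\<^sup>2"] by (intro mult_left_mono) simp_all
  qed
  then show "\<exists>M. summable M \<and> (\<forall>n. \<forall>z\<in>sector. a \<le> Re z \<longrightarrow>
      norm (of_real (acoef n) * exp (- of_real (gam * (real n)\<^sup>2) * z)) \<le> M n)"
    using summable_gauss[OF a] by blast
qed (rule sector_Re)

section \<open>The oscillating factor\<close>

text \<open>The sum of (3/8)^i h(x / 4^i) over all integers i, split into i >= 0 and i = - (l +
  1).\<close>

definition osc :: "real \<Rightarrow> real" where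
  "osc x = (\<Sum>i. (3 / 8) ^ i * profile ((1 / 4) ^ i * x)) + (\<Sum>l. (8 / 3) ^ Suc l * profile (4 ^ Suc l * x))"

definition cosc :: "complex \<Rightarrow> complex" where
  "cosc z = (\<Sum>i. of_real ((3 / 8) ^ i) * cprofile (of_real ((1 / 4) ^ i) * z)) +
    (\<Sum>l. of_real ((8 / 3) ^ Suc l) * cprofile (of_real (4 ^ Suc l) * z))"

text \<open>Cubed, the claim is 16 < 512/27. It makes the bound (Re z)^(-2/3) near 0 summable
  against (3/8)^i.\<close>

lemma powr_4_23: "(3 / 8) * 4 powr (2 / 3 :: real) < 1"
proof -
  have "((4::real) powr (2 / 3)) ^ 3 = 4 powr (2 / 3 * 3)" by (simp add: powr_powr powr_realpow[symmetric] del: powr_realpow)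
  also have "\<dots> < (8 / 3) ^ 3" by (simp add: power3_eq_cube)
  finally have "(4::real) powr (2 / 3) < 8 / 3" by (rule power_less_imp_less_base) simp
  then show ?thesis by simp
qed

lemma scaled_cprofile_holomorphic: "c > 0 \<Longrightarrow> (\<lambda>z. of_real b * cprofile (of_real c * z)) holomorphic_on sector"
  by (intro holomorphic_intros holomorphic_on_compose_gen[OF _ cprofile_holomorphic, unfolded o_def])
    (use sector_scale in auto)

lemma cosc_holomorphic: "cosc holomorphic_on sector"
  unfolding cosc_def[abs_def]
proof (rule holomorphic_on_add)
  show "(\<lambda>z. \<Sum>i. of_real ((3 / 8) ^ i) * cprofile (of_real ((1 / 4) ^ i) * z)) holomorphic_on sector"
  proof (rule holomorphic_suminf[OF open_sector])
    show "(\<lambda>z. of_real ((3 / 8) ^ i) * cprofile (of_real ((1 / 4) ^ i) * z)) holomorphic_on sector" for i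
      by (rule scaled_cprofile_holomorphic) simp
    fix a :: real assume a: "a > 0"
    \<comment> \<open>The bound \<open>cprofile_near_0\<close> at real part at least a / 4^i,
      separated into its constant part and its power part.\<close>
    let ?M = "\<lambda>i. 4 * gam * 129 * (3 / 8) ^ i + 4 * gam * 64 * zeta43 * (gam * a / 2) powr (- (2 / 3)) * ((3 / 8) * 4 powr (2 / 3)) ^ i"
    have "summable ?M"
      by (intro summable_add summable_mult summable_geometric) (use powr_4_23 in simp_all)
    moreover have "norm (of_real ((3 / 8) ^ i) * cprofile (of_real ((1 / 4) ^ i) * z)) \<le> ?M i" if z: "z \<in> sector" "a \<le> Re z" for i z
    proof -
      have zs: "of_real ((1 / 4) ^ i) * z \<in> sector" by (rule sector_scale[OF z(1)]) simp
      let ?R = "gam * Re (of_real ((1 / 4) ^ i) * z) / 2"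
      have R: "gam * a / 2 * (1 / 4) ^ i \<le> ?R"
        using z(2) gam_pos by (simp add: mult_left_mono mult_right_mono)
      have "?R powr (- (2 / 3)) \<le> (gam * a / 2 * (1 / 4) ^ i) powr (- (2 / 3))"
        by (rule powr_mono2'[OF _ _ R]) (use a gam_pos in simp_all)
      also have "\<dots> = (gam * a / 2) powr (- (2 / 3)) * ((1 / 4) ^ i) powr (- (2 / 3))"
        by (rule powr_mult)
      also have "((1 / 4 :: real) ^ i) powr (- (2 / 3)) = (4 powr (2 / 3)) ^ i"
      proof -
        have "((1 / 4 :: real) ^ i) powr (- (2 / 3)) = ((1 / 4) powr (- (2 / 3))) ^ i"
          by (simp add: powr_power[symmetric] powr_realpow[symmetric] powr_powr mult.commute)
        then show ?thesis by (simp add: powr_minus_divide powr_divide)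
      qed
      finally have P: "?R powr (- (2 / 3)) \<le> (gam * a / 2) powr (- (2 / 3)) * (4 powr (2 / 3)) ^ i" .
      have z43: "zeta43 \<ge> 0" unfolding zeta43_def by (intro suminf_nonneg summable_zeta43) simp
      have "norm (cprofile (of_real ((1 / 4) ^ i) * z)) \<le> 4 * gam * (129 + 64 * (zeta43 * ?R powr (- (2 / 3))))"
        by (rule cprofile_near_0[OF zs])
      also have "\<dots> \<le> 4 * gam * (129 + 64 * (zeta43 * ((gam * a / 2) powr (- (2 / 3)) * (4 powr (2 / 3)) ^ i)))"
        using P z43 gam_pos by (intro mult_left_mono add_left_mono) simp_all
      finally have B: "norm (cprofile (of_real ((1 / 4) ^ i) * z)) \<le> 4 * gam * (129 + 64 * (zeta43 * ((gam * a / 2) powr (- (2 / 3)) * (4 powr (2 / 3)) ^ i)))" .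
      have "norm (of_real ((3 / 8) ^ i) * cprofile (of_real ((1 / 4) ^ i) * z)) = (3 / 8) ^ i * norm (cprofile (of_real ((1 / 4) ^ i) * z))"
        unfolding norm_mult norm_of_real by simp
      also have "\<dots> \<le> (3 / 8) ^ i * (4 * gam * (129 + 64 * (zeta43 * ((gam * a / 2) powr (- (2 / 3)) * (4 powr (2 / 3)) ^ i))))"
        by (rule mult_left_mono[OF B]) simp
      also have "\<dots> = ?M i" unfolding power_mult_distrib by (simp only: distrib_left ac_simps)
      finally show ?thesis .
    qed
    ultimately show "\<exists>M. summable M \<and> (\<forall>i. \<forall>z\<in>sector. a \<le> Re z \<longrightarrow>
        norm (of_real ((3 / 8) ^ i) * cprofile (of_real ((1 / 4) ^ i) * z)) \<le> M i)"
      by (intro exI[of _ ?M]) simp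
  qed (rule sector_Re)
  show "(\<lambda>z. \<Sum>l. of_real ((8 / 3) ^ Suc l) * cprofile (of_real (4 ^ Suc l) * z)) holomorphic_on sector"
  proof (rule holomorphic_suminf[OF open_sector])
    show "(\<lambda>z. of_real ((8 / 3) ^ Suc l) * cprofile (of_real (4 ^ Suc l) * z)) holomorphic_on sector" for l
      by (rule scaled_cprofile_holomorphic) simp
    fix a :: real assume a: "a > 0"
    \<comment> \<open>The ratio 1/6 is 8/3 divided by the 16 that quadratic decay gains when the
      argument grows fourfold.\<close>
    let ?M = "\<lambda>l. 8 * basel / gam / a\<^sup>2 * (1 / 6) ^ Suc l"
    have "summable ?M" by (intro summable_mult) (simp add: summable_mult summable_geometric)
    moreover have "norm (of_real ((8 / 3) ^ Suc l) * cprofile (of_real (4 ^ Suc l) * z)) \<le> ?M l" if z: "z \<in> sector" "a \<le> Re z" for l z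
    proof -
      have R: "4 ^ Suc l * a \<le> Re (of_real (4 ^ Suc l) * z)" using z(2) by (simp only: Re_complex_of_real Im_complex_of_real times_complex.sel) simp
      have R0: "0 < 4 ^ Suc l * a" using a by simp
      have "norm (cprofile (of_real (4 ^ Suc l) * z)) \<le> 8 * basel / gam / (Re (of_real (4 ^ Suc l) * z))\<^sup>2"
        by (rule cprofile_decay) (use R R0 in linarith)
      also have "\<dots> \<le> 8 * basel / gam / (4 ^ Suc l * a)\<^sup>2"
        using a R R0 less_le_trans[OF R0 R] gam_pos basel_nonneg by (intro divide_left_mono power_mono mult_pos_pos zero_less_power) simp_all
      finally have "(8 / 3) ^ Suc l * norm (cprofile (of_real (4 ^ Suc l) * z)) \<le> (8 / 3) ^ Suc l * (8 * basel / gam / (4 ^ Suc l * a)\<^sup>2)"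
        by (rule mult_left_mono) simp
      also have "\<dots> = ?M l"
      proof -
        have "((4::real) ^ Suc l)\<^sup>2 = 16 ^ Suc l" by (simp only: power2_eq_square power_mult_distrib[symmetric]) simp
        moreover have "(8 / 3 :: real) ^ Suc l / 16 ^ Suc l = (1 / 6) ^ Suc l" by (simp only: power_divide[symmetric]) simp
        moreover have "p * (c / (q * r)) = c / r * (p / q)" for p c q r :: real by (simp add: ac_simps)
        ultimately show ?thesis unfolding power_mult_distrib by (simp only:)
      qed
      finally show ?thesis unfolding norm_mult norm_of_real by simp
    qed
    ultimately show "\<exists>M. summable M \<and> (\<forall>l. \<forall>z\<in>sector. a \<le> Re z \<longrightarrow>
        norm (of_real ((8 / 3) ^ Suc l) * cprofile (of_real (4 ^ Suc l) * z)) \<le> M l)"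
      by (intro exI[of _ ?M]) simp
  qed (rule sector_Re)
qed

lemma scaled_profile_bound:
  assumes "x > 0"
  shows "(8 / 3) ^ Suc l * profile (4 ^ Suc l * x) \<le> 8 * basel / gam / x\<^sup>2 * (1 / 6) ^ Suc l"
proof -
  have "(8 / 3) ^ Suc l * profile (4 ^ Suc l * x) \<le> (8 / 3) ^ Suc l * (8 * basel / gam / (4 ^ Suc l * x)\<^sup>2)"
    using assms by (intro mult_left_mono profile_decay) simp_all
  also have "\<dots> = 8 * basel / gam / x\<^sup>2 * (1 / 6) ^ Suc l"
  proof -
    have "((4::real) ^ Suc l)\<^sup>2 = 16 ^ Suc l" by (simp only: power2_eq_square power_mult_distrib[symmetric]) simp
    moreover have "(8 / 3 :: real) ^ Suc l / 16 ^ Suc l = (1 / 6) ^ Suc l" by (simp only: power_divide[symmetric]) simp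
    moreover have "p * (c / (q * r)) = c / r * (p / q)" for p c q r :: real by (simp add: ac_simps)
    ultimately show ?thesis unfolding power_mult_distrib by (simp only:)
  qed
  finally show ?thesis .
qed

lemma summable_osc:
  assumes x: "x > 0"
  shows "summable (\<lambda>i. (3 / 8) ^ i * profile ((1 / 4) ^ i * x))" "summable (\<lambda>l. (8 / 3) ^ Suc l * profile (4 ^ Suc l * x))"
proof -
  show "summable (\<lambda>i. (3 / 8) ^ i * profile ((1 / 4) ^ i * x))"
  proof (rule summable_comparison_test'[where N = 0])
    show "summable (\<lambda>i. (3 / 8 :: real) ^ i)" by (rule summable_geometric) simp
    show "norm ((3 / 8) ^ i * profile ((1 / 4) ^ i * x)) \<le> (3 / 8) ^ i" for i
      using profile_bounds[of "(1 / 4) ^ i * x"] x by (simp add: abs_mult mult_left_le)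
  qed
  show "summable (\<lambda>l. (8 / 3) ^ Suc l * profile (4 ^ Suc l * x))"
  proof (rule summable_comparison_test'[where N = 0])
    show "summable (\<lambda>l. 8 * basel / gam / x\<^sup>2 * (1 / 6) ^ Suc l)" by (intro summable_mult) (simp add: summable_mult summable_geometric)
    fix l
    have "0 \<le> (8 / 3) ^ Suc l * profile (4 ^ Suc l * x)"
      using profile_bounds(1)[of "4 ^ Suc l * x"] x by (intro mult_nonneg_nonneg) simp_all
    then show "norm ((8 / 3) ^ Suc l * profile (4 ^ Suc l * x)) \<le> 8 * basel / gam / x\<^sup>2 * (1 / 6) ^ Suc l"
      using scaled_profile_bound[OF x, of l] by (simp only: real_norm_def abs_of_nonneg)
  qed
qed

lemma cosc_of_real:
  assumes x: "x > 0" shows "cosc (of_real x) = of_real (osc x)"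
proof -
  have 1: "of_real ((3 / 8) ^ i) * cprofile (of_real ((1 / 4) ^ i) * of_real x) = of_real ((3 / 8) ^ i * profile ((1 / 4) ^ i * x))" for i
    unfolding of_real_mult[symmetric] by (subst cprofile_of_real) (use x in simp_all)
  have 2: "of_real ((8 / 3) ^ Suc l) * cprofile (of_real (4 ^ Suc l) * of_real x) = of_real ((8 / 3) ^ Suc l * profile (4 ^ Suc l * x))" for l
    unfolding of_real_mult[symmetric] by (subst cprofile_of_real) (use x in simp_all)
  show ?thesis unfolding cosc_def osc_def 1 2 of_real_add
    by (simp only: suminf_of_real[OF summable_osc(1)[OF x]] suminf_of_real[OF summable_osc(2)[OF x]])
qed

text \<open>Passing from x to 4 x shifts the index of the two-sided sum by one; the term
  \<open>profile (4 * x)\<close> changes from one half-series to the other.\<close>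

lemma osc_4:
  assumes x: "x > 0" shows "osc (4 * x) = 3 / 8 * osc x"
proof -
  let ?A = "\<lambda>x i. (3 / 8) ^ i * profile ((1 / 4) ^ i * x)" and ?B = "\<lambda>x l. (8 / 3) ^ Suc l * profile (4 ^ Suc l * x)"
  have x4: "4 * x > 0" using x by simp
  have A: "suminf (?A (4 * x)) = profile (4 * x) + 3 / 8 * suminf (?A x)"
  proof -
    have "(\<Sum>i. ?A (4 * x) (Suc i)) = suminf (?A (4 * x)) - ?A (4 * x) 0"
      by (rule suminf_split_head[OF summable_osc(1)[OF x4]])
    moreover have "?A (4 * x) (Suc i) = 3 / 8 * ?A x i" for i by simp
    then have "(\<Sum>i. ?A (4 * x) (Suc i)) = 3 / 8 * suminf (?A x)"
      by (simp only: suminf_mult[OF summable_osc(1)[OF x]])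
    ultimately show ?thesis by simp
  qed
  have B: "suminf (?B (4 * x)) = 3 / 8 * (suminf (?B x) - 8 / 3 * profile (4 * x))"
  proof -
    have s: "(\<Sum>l. ?B x (Suc l)) = suminf (?B x) - ?B x 0"
      by (rule suminf_split_head[OF summable_osc(2)[OF x]])
    have "?B (4 * x) l = 3 / 8 * ?B x (Suc l)" for l by (simp add: ac_simps)
    then have "suminf (?B (4 * x)) = 3 / 8 * (\<Sum>l. ?B x (Suc l))"
      using suminf_mult[OF summable_Suc_iff[THEN iffD2, OF summable_osc(2)[OF x]], of "3 / 8"] by (simp only:)
    then show ?thesis unfolding s by simp
  qed
  show ?thesis unfolding osc_def A B by (simp add: algebra_simps)
qed

lemma osc_4_power: "x > 0 \<Longrightarrow> osc (4 ^ s * x) = (3 / 8) ^ s * osc x"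
proof (induction s)
  case (Suc s)
  have "osc (4 ^ Suc s * x) = osc (4 * (4 ^ s * x))" by (simp add: mult.assoc)
  also have "\<dots> = 3 / 8 * osc (4 ^ s * x)" by (rule osc_4) (use Suc(2) in simp)
  finally show ?case using Suc by simp
qed simp

text \<open>After multiplication by exp(\<open>gam\<close> y) every term with j >= 2 tends to 0, and
  the positive \<open>acoef 1\<close> remains. Tannery's theorem passes to the sum.\<close>

lemma profile_pos_at_top: "eventually (\<lambda>y. profile y > 0) at_top"
proof -
  let ?a = "\<lambda>j y. acoef j * exp (- gam * ((real j)\<^sup>2 - 1) * y)"
  let ?b = "\<lambda>j. if j = 1 then acoef 1 else 0"
  let ?M = "\<lambda>j. exp gam * (4 * gam * (real j)\<^sup>2 * exp (- gam * (real j)\<^sup>2 * 1))"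
  have lim: "((\<lambda>y. ?a j y) \<longlongrightarrow> ?b j) at_top" for j
  proof -
    consider "j = 0" | "j = 1" | "j \<ge> 2" by linarith
    then show ?thesis
    proof cases
      case 3
      have "(real j)\<^sup>2 \<ge> 2\<^sup>2" using 3 by (intro power_mono) simp_all
      then have c: "- gam * ((real j)\<^sup>2 - 1) < 0" using gam_pos by simp
      have "filterlim (\<lambda>y. - gam * ((real j)\<^sup>2 - 1) * y) at_bot at_top"
        by (rule filterlim_tendsto_neg_mult_at_bot[OF tendsto_const c filterlim_ident])
      then have "((\<lambda>y. exp (- gam * ((real j)\<^sup>2 - 1) * y)) \<longlongrightarrow> 0) at_top" by (rule filterlim_compose[OF exp_at_bot])
      from tendsto_mult_right_zero[OF this] show ?thesis using 3 by simp
    qed simp_all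
  qed
  have "eventually (\<lambda>y::real. y \<ge> 1) at_top" by (rule eventually_ge_at_top)
  then have "eventually (\<lambda>y. \<forall>j. norm (?a j y) \<le> ?M j) at_top"
  proof eventually_elim
    case (elim y)
    show ?case
    proof
      fix j
      show "norm (?a j y) \<le> ?M j"
      proof (cases "j = 0")
        case False
        have "(real j)\<^sup>2 - 1 \<ge> 0" using False by (simp add: one_le_power)
        then have "gam * ((real j)\<^sup>2 - 1) * 1 \<le> gam * ((real j)\<^sup>2 - 1) * y" using elim gam_pos by (intro mult_left_mono) simp_all
        then have "exp (- gam * ((real j)\<^sup>2 - 1) * y) \<le> exp (gam + - gam * (real j)\<^sup>2 * 1)" by (simp add: algebra_simps)
        then have "\<bar>acoef j\<bar> * exp (- gam * ((real j)\<^sup>2 - 1) * y) \<le> 4 * gam * (real j)\<^sup>2 * exp (gam + - gam * (real j)\<^sup>2 * 1)"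
          using gam_pos by (intro mult_mono acoef_bound) simp_all
        then show ?thesis unfolding exp_add by (simp add: abs_mult ac_simps)
      qed simp
    qed
  qed
  from eventually_prodI[OF always_eventually[of "\<lambda>_. True", OF allI[OF TrueI]] this]
  have "eventually (\<lambda>(j, y). norm (?a j y) \<le> ?M j) (at_top \<times>\<^sub>F at_top)"
    by (rule eventually_mono) auto
  moreover have "summable ?M" by (intro summable_mult summable_gauss) simp
  ultimately have L: "((\<lambda>y. \<Sum>j. ?a j y) \<longlongrightarrow> suminf ?b) at_top"
    using tannerys_theorem[where a = ?a and b = ?b and M = ?M and F = at_top, OF lim] by simp
  have b: "suminf ?b = acoef 1" using sums_unique[OF sums_single[of 1 "\<lambda>_. acoef 1"]] by simp
  have "acoef 1 > 0" using psi_lim_1 gam_pos by (simp add: acoef_def)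
  then have "eventually (\<lambda>y. (\<Sum>j. ?a j y) > 0) at_top" by (rule order_tendstoD(1)[OF L[unfolded b]])
  then show ?thesis using eventually_gt_at_top[of 0]
  proof eventually_elim
    case (elim y)
    have "?a j y = exp (gam * y) * (acoef j * exp (- gam * (real j)\<^sup>2 * y))" for j
    proof -
      have "exp (- gam * ((real j)\<^sup>2 - 1) * y) = exp (gam * y) * exp (- gam * (real j)\<^sup>2 * y)"
        by (simp add: exp_add[symmetric] algebra_simps)
      then show ?thesis by simp
    qed
    then have "(\<Sum>j. ?a j y) = exp (gam * y) * profile y"
      unfolding profile_def using suminf_mult[OF summable_profile[OF elim(2)], of "exp (gam * y)"] by (simp only:)
    then show ?case using elim(1) by (simp add: zero_less_mult_iff)
  qed
qed

text \<open>All terms are nonnegative, and for large l the argument lies where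
  \<open>profile\<close> is positive.\<close>

lemma osc_pos:
  assumes x: "x > 0" shows "osc x > 0"
proof -
  have "filterlim (\<lambda>l. 4 ^ Suc l * x) at_top sequentially"
  proof -
    have "filterlim (\<lambda>l. (4::real) ^ l) at_top sequentially"
      by (rule filterlim_at_infinity_imp_filterlim_at_top[OF filterlim_realpow_sequentially_gt1]) simp_all
    then have "filterlim (\<lambda>l. (4::real) ^ Suc l) at_top sequentially" by (rule filterlim_compose[OF _ filterlim_Suc])
    then show ?thesis using x by (intro filterlim_at_top_mult_tendsto_pos[OF tendsto_const]) simp_all
  qed
  from eventually_compose_filterlim[OF profile_pos_at_top this]
  obtain l where l: "profile (4 ^ Suc l * x) > 0" by (auto simp: eventually_sequentially)
  have "(\<Sum>i. (3 / 8) ^ i * profile ((1 / 4) ^ i * x)) \<ge> 0"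
    by (intro suminf_nonneg summable_osc x mult_nonneg_nonneg profile_bounds) (use x in simp_all)
  moreover have "(\<Sum>l. (8 / 3) ^ Suc l * profile (4 ^ Suc l * x)) > 0"
    by (rule suminf_pos2[where i = l, OF summable_osc(2)[OF x]])
      (use x l in \<open>auto intro!: mult_nonneg_nonneg mult_pos_pos profile_bounds simp del: power_Suc\<close>)
  ultimately show ?thesis by (simp add: osc_def)
qed

lemma continuous_on_osc: "continuous_on {1..4} osc"
proof -
  have sub: "of_real ` {1..4} \<subseteq> sector" by (auto simp: sector_def)
  have "continuous_on {1..4} (\<lambda>x. Re (cosc (of_real x)))"
    by (intro continuous_intros continuous_on_compose2[OF holomorphic_on_imp_continuous_on[OF cosc_holomorphic] _ sub])
  then show ?thesis by (rule continuous_on_eq) (simp add: cosc_of_real)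
qed

lemma osc_lower_bound: "\<exists>m>0. \<forall>x\<in>{1..4}. m \<le> osc x"
proof -
  obtain x where x: "x \<in> {1..4}" "\<forall>y\<in>{1..4}. osc x \<le> osc y"
    using continuous_attains_inf[OF compact_Icc _ continuous_on_osc] by auto
  then show ?thesis using osc_pos[of x] by (intro exI[of _ "osc x"]) auto
qed

text \<open>The sum of layers recentred at r = s, each layer with its own normalisation (8/3)^r; the
  two series correspond term by term to those of \<open>osc\<close>.\<close>

lemma dens_split:
  "(8 / 3) ^ s * dens n = (\<Sum>i. (3 / 8) ^ i * ((8 / 3) ^ (s + i) * layer (s + i) n)) +
    (\<Sum>l. if l < s then (8 / 3) ^ Suc l * ((8 / 3) ^ (s - Suc l) * layer (s - Suc l) n) else 0)"
proof -
  have sm: "summable (\<lambda>r. layer r n)" by (rule summable_finite[of "{..n}"]) (use layer_eq_0 in auto)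
  have "dens n = (\<Sum>r. layer r n)"
    unfolding dens_eq_sum_layer by (rule suminf_finite[symmetric]) (use layer_eq_0 in auto)
  also have "\<dots> = (\<Sum>i. layer (i + s) n) + (\<Sum>r<s. layer r n)"
    using suminf_split_initial_segment[OF sm, of s] by simp
  also have "(\<Sum>r<s. layer r n) = (\<Sum>l<s. layer (s - Suc l) n)" by (rule sum.nat_diff_reindex[symmetric])
  finally have "(8 / 3) ^ s * dens n = (8 / 3) ^ s * (\<Sum>i. layer (i + s) n) + (\<Sum>l<s. (8 / 3) ^ s * layer (s - Suc l) n)"
    by (simp add: distrib_left sum_distrib_left)
  also have "(8 / 3) ^ s * (\<Sum>i. layer (i + s) n) = (\<Sum>i. (8 / 3) ^ s * layer (i + s) n)"
    by (rule suminf_mult[symmetric]) (rule summable_ignore_initial_segment[OF sm])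
  also have "\<dots> = (\<Sum>i. (3 / 8) ^ i * ((8 / 3) ^ (s + i) * layer (s + i) n))"
  proof (rule suminf_cong)
    fix i
    have "(3 / 8 :: real) ^ i * (8 / 3) ^ i = 1" by (simp only: power_mult_distrib[symmetric]) simp
    then have "(3 / 8 :: real) ^ i * ((8 / 3) ^ (s + i) * y) = (8 / 3) ^ s * y" for y
      unfolding power_add by (metis (no_types, opaque_lifting) mult.assoc mult.commute mult_1)
    then show "(8 / 3) ^ s * layer (i + s) n = (3 / 8) ^ i * ((8 / 3) ^ (s + i) * layer (s + i) n)"
      by (simp only: add.commute)
  qed
  also have "(\<Sum>l<s. (8 / 3) ^ s * layer (s - Suc l) n) =
      (\<Sum>l. if l < s then (8 / 3) ^ Suc l * ((8 / 3) ^ (s - Suc l) * layer (s - Suc l) n) else 0)"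
  proof -
    have "(8 / 3 :: real) ^ s = (8 / 3) ^ Suc l * (8 / 3) ^ (s - Suc l)" if "l < s" for l
      unfolding power_add[symmetric] using that by simp
    then have "(\<Sum>l<s. (8 / 3) ^ s * layer (s - Suc l) n) =
        (\<Sum>l<s. if l < s then (8 / 3) ^ Suc l * ((8 / 3) ^ (s - Suc l) * layer (s - Suc l) n) else 0)"
      by (intro sum.cong refl) (simp only: lessThan_iff if_True mult.assoc)
    also have "\<dots> = (\<Sum>l. if l < s then (8 / 3) ^ Suc l * ((8 / 3) ^ (s - Suc l) * layer (s - Suc l) n) else 0)"
      by (rule suminf_finite[symmetric]) auto
    finally show ?thesis .
  qed
  finally show ?thesis .
qed

text \<open>Let s be the integer part of log_4(k + 2), so that y = (k + 2) / 4^s stays in [1, 4].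
  Layer s + i is compared with the profile at y / 4^i, and Tannery's theorem sums the errors on both
  sides. Since y oscillates, only the difference from \<open>osc (y k)\<close> has a limit; a lower
  bound of \<open>osc\<close> on [1, 4] turns it into a quotient.\<close>

theorem dens_asymptotics: "(\<lambda>k. dens (k + 1) / osc (real (k + 2))) \<longlonglongrightarrow> 1"
proof -
  have "\<exists>s. 4 ^ s \<le> k + 2 \<and> k + 2 < 4 ^ (s + 1)" for k :: nat by (rule ex_power_ivl1) simp_all
  then obtain s :: "nat \<Rightarrow> nat" where s: "4 ^ s k \<le> k + 2" "k + 2 < 4 ^ (s k + 1)" for k by metis
  define x where "x k = real (k + 2)" for k
  define y where "y k = x k / 4 ^ s k" for k
  have sx: "4 ^ s k \<le> x k" "x k < 4 ^ (s k + 1)" for k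
    using s[of k] unfolding x_def by (metis of_nat_le_iff of_nat_numeral of_nat_power, metis of_nat_less_iff of_nat_numeral of_nat_power)
  have y: "1 \<le> y k" "y k \<le> 4" for k using sx[of k] by (simp_all add: y_def le_divide_eq divide_le_eq)
  have s_top: "filterlim s at_top sequentially"
    unfolding filterlim_at_top
  proof
    fix C
    show "eventually (\<lambda>k. C \<le> s k) sequentially"
      using eventually_ge_at_top[of "4 ^ C"]
    proof eventually_elim
      case (elim k)
      then have "(4::nat) ^ C < 4 ^ (s k + 1)" using s(2)[of k] by linarith
      then have "C < s k + 1" by (simp only: power_strict_increasing_iff)
      then show ?case by simp
    qed
  qed
  let ?E = "\<lambda>r k. (8 / 3) ^ r * layer r (k + 1)"
  have A: "(\<lambda>k. \<Sum>i. (3 / 8) ^ i * ?E (s k + i) k - (3 / 8) ^ i * profile ((1 / 4) ^ i * y k)) \<longlonglongrightarrow> (\<Sum>i::nat. 0)"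
  proof -
    let ?a = "\<lambda>i k. (3 / 8) ^ i * ?E (s k + i) k - (3 / 8) ^ i * profile ((1 / 4) ^ i * y k)"
    have "(\<lambda>k. ?a i k) \<longlonglongrightarrow> 0" for i
    proof -
      have r: "filterlim (\<lambda>k. s k + i) at_top sequentially"
        using s_top unfolding filterlim_at_top by (auto elim!: eventually_mono intro: trans_le_add1)
      have "(1 / 4) ^ i * y k * 4 ^ (s k + i) = x k" for k by (simp add: y_def power_add power_one_over)
      \<comment> \<open>The layers are taken at k + 1 but compared at k + 2, the argument of the
        final formula; the shift uses up the tolerance 1.\<close>
      then have c: "\<bar>real (k + 1) - (1 / 4) ^ i * y k * 4 ^ (s k + i)\<bar> \<le> 1" for k by (simp add: x_def)
      have "(1 / 4) ^ i \<le> (1 / 4) ^ i * y k" for k using y(1)[of k] by simp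
      moreover have "(1 / 4) ^ i * y k \<le> 4" for k
        using y[of k] power_le_one[of "1 / 4 :: real" i] mult_mono[of "(1 / 4 :: real) ^ i" 1 "y k" 4] by simp
      ultimately have "(\<lambda>k. ?E (s k + i) k - profile ((1 / 4) ^ i * y k)) \<longlonglongrightarrow> 0"
        by (intro scaled_layer_tendsto[OF r c, where c = "(1 / 4) ^ i" and b = 4]) simp_all
      from tendsto_mult_right_zero[OF this, of "(3 / 8) ^ i"] show ?thesis by (simp add: right_diff_distrib)
    qed
    moreover have "norm (?a i k) \<le> (3 / 8) ^ i" for i k
    proof -
      have "\<bar>?E (s k + i) k - profile ((1 / 4) ^ i * y k)\<bar> \<le> 1"
        using scaled_layer_le_1[of "s k + i" "k + 1"] profile_bounds[of "(1 / 4) ^ i * y k"] y(1)[of k] by (simp add: abs_le_iff)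
      then have "(3 / 8) ^ i * \<bar>?E (s k + i) k - profile ((1 / 4) ^ i * y k)\<bar> \<le> (3 / 8) ^ i" by (intro mult_left_le) simp_all
      then show ?thesis unfolding right_diff_distrib[symmetric] by (simp add: abs_mult)
    qed
    then have "eventually (\<lambda>(i, k). norm (?a i k) \<le> (3 / 8) ^ i) (at_top \<times>\<^sub>F sequentially)"
      by (intro always_eventually) auto
    moreover have "summable (\<lambda>i. (3 / 8 :: real) ^ i)" by (rule summable_geometric) simp
    ultimately show ?thesis
      using tannerys_theorem[where a = ?a and F = sequentially and b = "\<lambda>_. 0" and M = "\<lambda>i. (3 / 8) ^ i"] by simp
  qed
  let ?F = "\<lambda>l k. if l < s k then (8 / 3) ^ Suc l * ?E (s k - Suc l) k else 0"
  let ?P = "\<lambda>l k. (8 / 3) ^ Suc l * profile (4 ^ Suc l * y k)"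
  define C where "C = 8 * basel / gam"
  have C0: "C \<ge> 0" using basel_nonneg gam_pos by (simp add: C_def)
  have FP: "0 \<le> ?F l k \<and> ?F l k \<le> (8 / 3) * (4 * C) * (1 / 6) ^ l" "0 \<le> ?P l k \<and> ?P l k \<le> C * (1 / 6) ^ l" for l k
  proof -
    have p: "(1 / 6) ^ Suc l \<le> (1 / 6 :: real) ^ l" by simp
    have "?P l k \<le> C / (y k)\<^sup>2 * (1 / 6) ^ Suc l"
      unfolding C_def by (rule scaled_profile_bound) (use y(1)[of k] in linarith)
    also have "\<dots> \<le> C * (1 / 6) ^ l"
      using y(1)[of k] C0 p one_le_power[of "y k" 2] by (intro mult_mono) (simp_all add: divide_le_eq mult_left_mono mult_le_cancel_left1)
    finally show "0 \<le> ?P l k \<and> ?P l k \<le> C * (1 / 6) ^ l"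
      using profile_bounds(1)[of "4 ^ Suc l * y k"] y(1)[of k] by simp
    show "0 \<le> ?F l k \<and> ?F l k \<le> (8 / 3) * (4 * C) * (1 / 6) ^ l"
    proof (cases "l < s k")
      case True
      let ?q = "real (k + 1) / 4 ^ Suc (s k - Suc l)"
      have e: "(4::real) ^ s k = 4 ^ Suc (s k - Suc l) * 4 ^ l" unfolding power_add[symmetric] using True by simp
      \<comment> \<open>From 4^s <= k + 2 <= 2 (k + 1); the lost factor 2 is squared in the decay
        bound and becomes the 4 in \<open>4 * C\<close>.\<close>
      have "4 ^ s k \<le> 2 * real (k + 1)" using sx(1)[of k] by (simp add: x_def)
      then have q: "4 ^ l / 2 \<le> ?q" unfolding e by (simp add: field_simps del: power_Suc)
      have "?E (s k - Suc l) k \<le> C / ?q\<^sup>2" unfolding C_def by (rule scaled_layer_bound) simp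
      also have "\<dots> \<le> C / (4 ^ l / 2)\<^sup>2"
        using q C0 by (intro divide_left_mono power_mono mult_pos_pos zero_less_power) (simp_all del: power_Suc)
      also have "\<dots> = 4 * C / 16 ^ l"
      proof -
        have "((4::real) ^ l)\<^sup>2 = 16 ^ l" by (simp only: power2_eq_square power_mult_distrib[symmetric]) simp
        then show ?thesis by (simp add: power_divide)
      qed
      finally have "(8 / 3) ^ Suc l * ?E (s k - Suc l) k \<le> (8 / 3) ^ Suc l * (4 * C / 16 ^ l)" by (rule mult_left_mono) simp
      also have "\<dots> = (8 / 3) * (4 * C) * ((8 / 3) ^ l / 16 ^ l)" by simp
      also have "(8 / 3 :: real) ^ l / 16 ^ l = (1 / 6) ^ l" by (simp only: power_divide[symmetric]) simp
      finally show ?thesis using True scaled_layer_le_1(1)[of "s k - Suc l" "k + 1"] by simp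
    qed (use C0 in simp)
  qed
  have B: "(\<lambda>k. \<Sum>l. ?F l k - ?P l k) \<longlonglongrightarrow> (\<Sum>l::nat. 0)"
  proof -
    have "(\<lambda>k. ?F l k - ?P l k) \<longlonglongrightarrow> 0" for l
    proof -
      let ?r = "\<lambda>k. s k - Suc l"
      have r: "filterlim ?r at_top sequentially"
        unfolding filterlim_at_top
      proof
        fix Z
        show "eventually (\<lambda>k. Z \<le> ?r k) sequentially"
          using filterlim_at_top[THEN iffD1, OF s_top, rule_format, of "Z + Suc l"] by (rule eventually_mono) simp
      qed
      have c: "\<bar>real (k + 1) - x k / 4 ^ ?r k * 4 ^ ?r k\<bar> \<le> 1" for k by (simp add: x_def)
      have y1: "1 \<le> x k / 4 ^ ?r k" for k
      proof -
        have "(4::real) ^ ?r k \<le> 4 ^ s k" by (rule power_increasing) simp_all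
        from order_trans[OF this sx(1)] show ?thesis by (simp add: le_divide_eq)
      qed
      have y2: "x k / 4 ^ ?r k \<le> 4 ^ (l + 2)" for k
      proof -
        have "x k \<le> 4 ^ (s k + 1)" using sx(2)[of k] by simp
        also have "\<dots> \<le> 4 ^ (?r k + (l + 2))" by (rule power_increasing) simp_all
        finally show ?thesis by (simp add: divide_le_eq power_add ac_simps)
      qed
      have "(\<lambda>k. ?E (?r k) k - profile (x k / 4 ^ ?r k)) \<longlonglongrightarrow> 0"
        by (rule scaled_layer_tendsto[OF r c y1 y2]) simp
      then have l0: "(\<lambda>k. (8 / 3) ^ Suc l * (?E (?r k) k - profile (x k / 4 ^ ?r k))) \<longlonglongrightarrow> 0"
        by (rule tendsto_mult_right_zero)
      have "eventually (\<lambda>k. Suc l \<le> s k) sequentially"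
        using s_top unfolding filterlim_at_top by blast
      then have "eventually (\<lambda>k. (8 / 3) ^ Suc l * (?E (?r k) k - profile (x k / 4 ^ ?r k)) = ?F l k - ?P l k) sequentially"
      proof eventually_elim
        case (elim k)
        have "(4::real) ^ s k = 4 ^ ?r k * 4 ^ Suc l" unfolding power_add[symmetric] using elim by simp
        then have "4 ^ Suc l * y k = x k / 4 ^ ?r k" by (simp add: y_def del: power_Suc)
        then show ?case using elim by (simp add: right_diff_distrib del: power_Suc)
      qed
      then show ?thesis using l0 by (rule Lim_transform_eventually[rotated])
    qed
    moreover have "norm (?F l k - ?P l k) \<le> ((8 / 3) * (4 * C) + C) * (1 / 6) ^ l" for l k
    proof -
      have "\<bar>?F l k - ?P l k\<bar> \<le> ?F l k + ?P l k" using FP[of l k] by (simp only: abs_le_iff) linarith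
      also have "\<dots> \<le> ((8 / 3) * (4 * C) + C) * (1 / 6) ^ l" unfolding distrib_right by (intro add_mono) (use FP[of l k] in blast)+
      finally show ?thesis by (simp only: real_norm_def)
    qed
    then have "eventually (\<lambda>(l, k). norm (?F l k - ?P l k) \<le> ((8 / 3) * (4 * C) + C) * (1 / 6) ^ l) (at_top \<times>\<^sub>F sequentially)"
      by (intro always_eventually) auto
    moreover have "summable (\<lambda>l. ((8 / 3) * (4 * C) + C) * (1 / 6 :: real) ^ l)" by (intro summable_mult summable_geometric) simp
    ultimately show ?thesis
      using tannerys_theorem[where a = "\<lambda>l k. ?F l k - ?P l k" and F = sequentially and b = "\<lambda>_. 0" and M = "\<lambda>l. ((8 / 3) * (4 * C) + C) * (1 / 6) ^ l"]
      by simp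
  qed
  have eq: "(\<Sum>i. (3 / 8) ^ i * ?E (s k + i) k - (3 / 8) ^ i * profile ((1 / 4) ^ i * y k)) + (\<Sum>l. ?F l k - ?P l k) =
      (8 / 3) ^ s k * dens (k + 1) - osc (y k)" for k
  proof -
    have y0: "y k > 0" using y(1)[of k] by linarith
    have s1: "summable (\<lambda>i. (3 / 8) ^ i * ?E (s k + i) k)"
      by (rule summable_finite[of "{..k + 1}"]) (auto simp: layer_eq_0)
    have s2: "summable (\<lambda>l. ?F l k)" by (rule summable_finite[of "{..<s k}"]) auto
    show ?thesis
      unfolding dens_split osc_def suminf_diff[OF s1 summable_osc(1)[OF y0], symmetric] suminf_diff[OF s2 summable_osc(2)[OF y0], symmetric]
      by simp
  qed
  have D: "(\<lambda>k. (8 / 3) ^ s k * dens (k + 1) - osc (y k)) \<longlonglongrightarrow> 0"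
    using tendsto_add[OF A B] unfolding eq by simp
  obtain m where m: "m > 0" "\<And>x. x \<in> {1..4} \<Longrightarrow> m \<le> osc x" using osc_lower_bound by blast
  have om: "m \<le> osc (y k)" for k using m(2) y[of k] by simp
  have "(\<lambda>k. ((8 / 3) ^ s k * dens (k + 1) - osc (y k)) / osc (y k)) \<longlonglongrightarrow> 0"
  proof (rule Lim_null_comparison)
    show "eventually (\<lambda>k. norm (((8 / 3) ^ s k * dens (k + 1) - osc (y k)) / osc (y k)) \<le> \<bar>(8 / 3) ^ s k * dens (k + 1) - osc (y k)\<bar> / m) sequentially"
      using om m(1) by (intro always_eventually allI) (simp add: abs_divide frac_le order_trans[OF less_imp_le[OF m(1)]] abs_of_pos[OF less_le_trans[OF m(1) om]])
    show "(\<lambda>k. \<bar>(8 / 3) ^ s k * dens (k + 1) - osc (y k)\<bar> / m) \<longlonglongrightarrow> 0"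
      using tendsto_divide[OF tendsto_rabs_zero[OF D] tendsto_const[of m]] m(1) by simp
  qed
  then have "(\<lambda>k. ((8 / 3) ^ s k * dens (k + 1) - osc (y k)) / osc (y k) + 1) \<longlonglongrightarrow> 0 + 1" by (intro tendsto_intros)
  moreover have "((8 / 3) ^ s k * dens (k + 1) - osc (y k)) / osc (y k) + 1 = dens (k + 1) / osc (real (k + 2))" for k
  proof -
    have o0: "osc (y k) \<noteq> 0" using om[of k] m(1) by simp
    have "x k = 4 ^ s k * y k" by (simp add: y_def)
    \<comment> \<open>The scaling law of \<open>osc\<close> absorbs the normalisation (8/3)^s, so
      the choice of s disappears from the result.\<close>
    then have "osc (x k) = (3 / 8) ^ s k * osc (y k)" using osc_4_power[of "y k" "s k"] y(1)[of k] by simp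
    moreover have "(8 / 3 :: real) ^ s k = 1 / (3 / 8) ^ s k" by (simp add: power_divide)
    ultimately show ?thesis using o0 unfolding x_def by (simp add: diff_divide_distrib)
  qed
  ultimately show ?thesis by simp
qed

lemma powr_delta: "4 powr delta_exponent = 8 / 3"
proof -
  have "ln (4::real) = 2 * ln 2" using ln_realpow[of "2::real" 2] by simp
  moreover have "ln (8::real) = 3 * ln 2" using ln_realpow[of "2::real" 3] by simp
  ultimately have "delta_exponent * ln 4 = ln (8 / 3)"
    by (simp add: delta_exponent_def ln_div field_simps)
  then show ?thesis by (simp add: powr_def)
qed

text \<open>The quarter comes from b(2 k) = b(2 (k - 1) + 1) = 4^(k-1) \<open>dens (k - 1)\<close>;
  the power of x cancels the one in the final formula.\<close>

definition omega :: "real \<Rightarrow> real" where "omega x = osc x / 4 * x powr delta_exponent"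

lemma omega_pos: "x > 0 \<Longrightarrow> omega x > 0"
  using osc_pos[of x] by (simp add: omega_def)

lemma omega_periodic: "omega (4 powr (x + 1)) = omega (4 powr x)"
proof -
  have "4 powr (x + 1) = 4 * 4 powr x" by (simp add: powr_add)
  then show ?thesis
    unfolding omega_def by (simp only: osc_4[of "4 powr x"] powr_mult[of 4 "4 powr x" delta_exponent] powr_delta powr_gt_zero)
qed

text \<open>Along the real axis the n-th real derivative is the real part of the n-th complex
  derivative, which exists for every n.\<close>

lemma smooth_on_Re_holomorphic:
  assumes F: "F holomorphic_on S" "open S" and eq: "\<And>x. x > 0 \<Longrightarrow> of_real x \<in> S \<and> f x = Re (F (of_real x))"
  shows "smooth_on {0<..} f"
proof -
  have der: "((\<lambda>x. Re (g (of_real x))) has_real_derivative Re (deriv g (of_real x))) (at x)"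
    if "g holomorphic_on S" "x > 0" for g x
  proof -
    have "(g has_field_derivative deriv g (of_real x)) (at (of_real x))"
      using holomorphic_derivI[OF that(1) F(2)] eq[OF that(2)] by blast
    then have "((\<lambda>x. g (of_real x)) has_vector_derivative deriv g (of_real x)) (at x)"
      by (rule has_vector_derivative_real_field)
    from bounded_linear.has_vector_derivative[OF bounded_linear_Re this]
    show ?thesis by (simp add: has_real_derivative_iff_has_vector_derivative)
  qed
  have hol: "(deriv ^^ n) F holomorphic_on S" for n by (rule holomorphic_higher_deriv[OF F])
  have ev: "eventually (\<lambda>y. y > 0) (nhds x)" if "x > 0" for x :: real
    using eventually_nhds_in_open[of "{0<..}" x] that by simp
  have "\<forall>x>0. (deriv ^^ n) f x = Re ((deriv ^^ n) F (of_real x))" for n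
  proof (induction n)
    case (Suc n)
    show ?case
    proof (intro allI impI)
      fix x :: real assume x: "x > 0"
      have "eventually (\<lambda>y. (deriv ^^ n) f y = Re ((deriv ^^ n) F (of_real y))) (nhds x)"
        using ev[OF x] by (rule eventually_mono) (use Suc in blast)
      then have "deriv ((deriv ^^ n) f) x = deriv (\<lambda>y. Re ((deriv ^^ n) F (of_real y))) x"
        by (rule deriv_cong_ev) simp
      also have "\<dots> = Re (deriv ((deriv ^^ n) F) (of_real x))" by (rule DERIV_imp_deriv[OF der[OF hol x]])
      finally show "(deriv ^^ Suc n) f x = Re ((deriv ^^ Suc n) F (of_real x))" by simp
    qed
  qed (use eq in simp)
  then have e: "(deriv ^^ n) f x = Re ((deriv ^^ n) F (of_real x))" if "x > 0" for n x using that by blast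
  show ?thesis unfolding smooth_on_def
  proof (intro allI ballI)
    fix n and x :: real assume x: "x \<in> {0<..}"
    then have x0: "x > 0" by simp
    have "((deriv ^^ n) f has_real_derivative Re (deriv ((deriv ^^ n) F) (of_real x))) (at x)"
    proof (rule has_field_derivative_transform_within_open[OF der[OF hol x0], of "{0<..}"])
      show "Re ((deriv ^^ n) F (of_real y)) = (deriv ^^ n) f y" if "y \<in> {0<..}" for y using e[of y n] that by simp
    qed (use x in auto)
    then show "(deriv ^^ n) f differentiable at x" by (auto simp: real_differentiable_def)
  qed
qed

lemma smooth_omega: "smooth_on {0<..} omega"
proof (rule smooth_on_Re_holomorphic[OF _ open_sector])
  \<comment> \<open>The sector avoids the negative real axis, so the principal branch of the power
    is holomorphic there.\<close>
  show "(\<lambda>z. cosc z / 4 * z powr of_real delta_exponent) holomorphic_on sector"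
    by (intro holomorphic_intros cosc_holomorphic) (auto simp: sector_def complex_nonpos_Reals_iff)
  fix x :: real assume x: "x > 0"
  have "of_real x powr of_real delta_exponent = (of_real (x powr delta_exponent) :: complex)"
    using x by (simp add: powr_of_real)
  then show "of_real x \<in> sector \<and> omega x = Re (cosc (of_real x) / 4 * of_real x powr of_real delta_exponent)"
    using x by (simp add: sector_def omega_def cosc_of_real)
qed

lemma summands_odd_even: "k \<ge> 1 \<Longrightarrow> summands (2 * k) = summands (2 * k - 1)"
  by (cases k) simp_all

lemma summands_asymptotics:
  "(\<lambda>k. real (summands (2 * k))) \<sim>[sequentially] (\<lambda>k. omega (real k) * real k powr (- delta_exponent) * 4 ^ k)"
proof (rule asymp_equivI')
  \<comment> \<open>With k shifted by 2 the argument k + 1 of \<open>dens\<close> is positive, as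
    \<open>scaled_layer_bound\<close> requires; a shift does not affect the limit.\<close>
  have "real (summands (2 * (k + 2))) / (omega (real (k + 2)) * real (k + 2) powr (- delta_exponent) * 4 ^ (k + 2)) =
      dens (k + 1) / osc (real (k + 2))" for k
  proof -
    have 1: "real (summands (2 * (k + 2))) = 4 ^ (k + 1) * dens (k + 1)"
    proof -
      have "summands (2 * (k + 2)) = summands (2 * (k + 2) - 1)" by (rule summands_odd_even) simp
      also have "2 * (k + 2) - 1 = 2 * (k + 1) + 1" by simp
      finally show ?thesis unfolding dens_def by (simp del: summands.simps)
    qed
    have "real (k + 2) powr delta_exponent * real (k + 2) powr (- delta_exponent) = 1"
      by (simp add: powr_add[symmetric])
    then have 2: "omega (real (k + 2)) * real (k + 2) powr (- delta_exponent) = osc (real (k + 2)) / 4"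
      unfolding omega_def by (simp only: mult.assoc mult_1_right)
    show ?thesis unfolding 1 2 by simp
  qed
  then have "(\<lambda>k. real (summands (2 * (k + 2))) / (omega (real (k + 2)) * real (k + 2) powr (- delta_exponent) * 4 ^ (k + 2))) \<longlonglongrightarrow> 1"
    using dens_asymptotics by (simp only:)
  then show "(\<lambda>k. real (summands (2 * k)) / (omega (real k) * real k powr (- delta_exponent) * 4 ^ k)) \<longlonglongrightarrow> 1"
    by (rule LIMSEQ_offset[of _ 2])
qed

theorem theorem1p1:
  assumes "CHAR('a::alg_closed_field) = 2"
  shows "(\<forall>k\<ge>1. tensor_summands (SL2 :: ('a ^ 2 ^ 2) set) natural_rep (2 * k) =
      tensor_summands (SL2 :: ('a ^ 2 ^ 2) set) natural_rep (2 * k - 1)) \<and>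
    (\<exists>\<omega> :: real \<Rightarrow> real.
       (\<forall>x>0. \<omega> x > 0) \<and> smooth_on {0<..} \<omega> \<and>
       (\<forall>x. \<omega> (4 powr (x + 1)) = \<omega> (4 powr x)) \<and>
       (\<lambda>k. real (tensor_summands (SL2 :: ('a ^ 2 ^ 2) set) natural_rep (2 * k)))
         \<sim>[sequentially] (\<lambda>k. \<omega> (real k) * real k powr (- delta_exponent) * 4 ^ k))"
  unfolding tensor_summands_eq[OF assms]
proof (intro conjI exI[of _ omega] allI impI)
  show "summands (2 * k) = summands (2 * k - 1)" if "k \<ge> 1" for k
    by (rule summands_odd_even[OF that])
qed (fact omega_pos smooth_omega omega_periodic summands_asymptotics)+

end
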